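(* Let $\nu>0$, $T>0$, and let $u \in L^\infty(0,T;H^1(\mathbb{R}^3)) \cap L^2(0,T;H^2(\mathbb{R}^3))$ be a solution of the three-dimensional incompressible Navier-Stokes equations $$\partial_t u + u\cdot\nabla u + \nabla p = \nu\Delta u,\qquad \nabla\cdot u = 0$$ with initial data $u(0,\cdot)=u_0$. For each $t\in[0,T)$ decompose $u(t,\cdot)=u_+(t,\cdot)+u_-(t,\cdot)$, where $$u_\pm = \tfrac12\big(u \pm D^{-1}\nabla\times u\big),$$ and similarly $u_0=u_{0+}+u_{0-}$ with $u_{0\pm}=\tfrac12(u_0\pm D^{-1}\nabla\times u_0)$. Then $$E_c(u_+)(t) = E_c(u_-)(t) + c_0\qquad\text{for all } t\in[0,T),$$ where $$c_0 = \tfrac12\big(\|u_{0+}\|_{\dot H^{1/2}}^2 - \|u_{0-}\|_{\dot H^{1/2}}^2\big)$$ and, for a time-dependent vector field $w$, $$E_c(w)(t) = \tfrac12\|D^{1/2}w(t,\cdot)\|_{L^2}^2 + \nu\int_0^t\|D^{1/2}\nabla w(s,\cdot)\|_{L^2}^2\,ds .$$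
   Context: $D=\sqrt{-\Delta}$ is the Fourier multiplier with symbol $|\xi|$ on $\mathbb{R}^3$, and $D^{s}$ is the multiplier with symbol $|\xi|^s$; $D^{-1}\nabla\times$ is the Fourier multiplier $\widehat{u}(\xi)\mapsto i|\xi|^{-1}\xi\times\widehat u(\xi)$. The homogeneous Sobolev norm is $\|f\|_{\dot H^{1/2}}=\|D^{1/2}f\|_{L^2}$. Here $u$ is an $\mathbb{R}^3$-valued velocity field on $[0,T)\times\mathbb{R}^3$, $p$ the scalar pressure, and $\nu$ the constant viscosity. *)

theory Defs
  imports "HOL-Analysis.Analysis"
begin

section \<open>Square-integrable fields and the Fourier transform\<close>

text \<open>Elements of \<open>L\<^sup>2\<close> are represented by functions; every notion below is invariant under changes
  on null sets.\<close>

definition L2 :: "('a::euclidean_space \<Rightarrow> 'b::euclidean_space) \<Rightarrow> bool" where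
  "L2 f \<longleftrightarrow> f \<in> borel_measurable lebesgue \<and> integrable lebesgue (\<lambda>x. (norm (f x))\<^sup>2)"

definition L2_norm :: "('a::euclidean_space \<Rightarrow> 'b::euclidean_space) \<Rightarrow> real" where
  "L2_norm f = sqrt (LINT x|lebesgue. (norm (f x))\<^sup>2)"

definition fourier_trunc :: "nat \<Rightarrow> (real^3 \<Rightarrow> real^'n::finite) \<Rightarrow> real^3 \<Rightarrow> complex^'n" where
  "fourier_trunc N f \<xi> = (1 / (2 * pi) powr (3/2)) *\<^sub>R
     (LINT x:cball 0 (real N)|lebesgue. cis (- (x \<bullet> \<xi>)) *s (\<chi> k. complex_of_real (f x $ k)))"

text \<open>The unitary Fourier transform on \<open>L\<^sup>2\<close>: the \<open>L\<^sup>2\<close>-limit of the transforms of the truncations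
  of \<open>f\<close> to balls. It exists by Plancherel's theorem and is unique up to null sets. The convergence
  is stated with the extended nonnegative integral, so that no integrability is presupposed.\<close>

definition fourier :: "(real^3 \<Rightarrow> real^'n::finite) \<Rightarrow> real^3 \<Rightarrow> complex^'n" where
  "fourier f = (SOME F. L2 F \<and>
     (\<lambda>N. \<integral>\<^sup>+\<xi>. ennreal ((norm (F \<xi> - fourier_trunc N f \<xi>))\<^sup>2) \<partial>lebesgue) \<longlonglongrightarrow> 0)"

text \<open>The Fourier multiplier with (matrix-valued) symbol \<open>\<sigma>\<close>. All symbols used below satisfy
  \<open>\<sigma> (-\<xi>) (cnj v) = cnj (\<sigma> \<xi> v)\<close>, so they map real fields to real fields; \<open>f\<close> lies in the
  \<open>L\<^sup>2\<close>-domain of the multiplier iff a field \<open>g\<close> as below exists.\<close>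

definition fourier_multiplier ::
    "(real^3 \<Rightarrow> complex^'m \<Rightarrow> complex^'n) \<Rightarrow> (real^3 \<Rightarrow> real^'m::finite) \<Rightarrow> real^3 \<Rightarrow> real^'n::finite" where
  "fourier_multiplier \<sigma> f =
     (SOME g. L2 g \<and> (AE \<xi> in lebesgue. fourier g \<xi> = \<sigma> \<xi> (fourier f \<xi>)))"

definition Dpow :: "real \<Rightarrow> (real^3 \<Rightarrow> real^'n::finite) \<Rightarrow> real^3 \<Rightarrow> real^'n" where
  "Dpow s = fourier_multiplier (\<lambda>\<xi> v. (norm \<xi> powr s) *\<^sub>R v)"

definition partial_x :: "3 \<Rightarrow> (real^3 \<Rightarrow> real^'n::finite) \<Rightarrow> real^3 \<Rightarrow> real^'n" where
  "partial_x j = fourier_multiplier (\<lambda>\<xi> v. (\<i> * complex_of_real (\<xi> $ j)) *s v)"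

text \<open>Since \<open>cross3\<close> is defined for real vectors only, \<open>\<xi> \<times> v\<close> for complex \<open>v\<close> is written in coordinates.\<close>

definition ccross :: "real^3 \<Rightarrow> complex^3 \<Rightarrow> complex^3" where
  "ccross \<xi> v = vector
     [of_real (\<xi> $ 2) * v $ 3 - of_real (\<xi> $ 3) * v $ 2,
      of_real (\<xi> $ 3) * v $ 1 - of_real (\<xi> $ 1) * v $ 3,
      of_real (\<xi> $ 1) * v $ 2 - of_real (\<xi> $ 2) * v $ 1]"

definition Dinv_curl :: "(real^3 \<Rightarrow> real^3) \<Rightarrow> real^3 \<Rightarrow> real^3" where
  "Dinv_curl = fourier_multiplier (\<lambda>\<xi> v. (\<i> * complex_of_real (inverse (norm \<xi>))) *s ccross \<xi> v)"

definition helical_plus :: "(real^3 \<Rightarrow> real^3) \<Rightarrow> real^3 \<Rightarrow> real^3" where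
  "helical_plus v x = (1/2) *\<^sub>R (v x + Dinv_curl v x)"

definition helical_minus :: "(real^3 \<Rightarrow> real^3) \<Rightarrow> real^3 \<Rightarrow> real^3" where
  "helical_minus v x = (1/2) *\<^sub>R (v x - Dinv_curl v x)"

section \<open>Sobolev spaces\<close>

definition sobolev_weight :: "real \<Rightarrow> (real^3 \<Rightarrow> real^'n::finite) \<Rightarrow> real^3 \<Rightarrow> complex^'n" where
  "sobolev_weight s f \<xi> = ((1 + (norm \<xi>)\<^sup>2) powr (s/2)) *\<^sub>R fourier f \<xi>"

definition sobolev :: "real \<Rightarrow> (real^3 \<Rightarrow> real^'n::finite) \<Rightarrow> bool" where
  "sobolev s f \<longleftrightarrow> L2 f \<and> L2 (sobolev_weight s f)"

definition sobolev_norm :: "real \<Rightarrow> (real^3 \<Rightarrow> real^'n::finite) \<Rightarrow> real" where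
  "sobolev_norm s f = L2_norm (sobolev_weight s f)"

definition Hdot_half_norm :: "(real^3 \<Rightarrow> real^'n::finite) \<Rightarrow> real" where
  "Hdot_half_norm f = L2_norm (Dpow (1/2) f)"

text \<open>The Bochner spaces \<open>L\<^sup>\<infinity>(0,T;H\<^sup>s)\<close> and \<open>L\<^sup>2(0,T;H\<^sup>s)\<close>. As \<open>H\<^sup>s\<close> is separable, strong measurability
  is expressed by joint Lebesgue measurability on \<open>(0,T) \<times> \<real>\<^sup>3\<close>.\<close>

definition spacetime_measurable :: "real \<Rightarrow> (real \<Rightarrow> real^3 \<Rightarrow> real^'n::finite) \<Rightarrow> bool" where
  "spacetime_measurable T u \<longleftrightarrow>
     (\<lambda>(t, x). u t x) \<in> borel_measurable (lebesgue_on ({0<..<T} \<times> UNIV))"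

definition Linf_sobolev :: "real \<Rightarrow> real \<Rightarrow> (real \<Rightarrow> real^3 \<Rightarrow> real^'n::finite) \<Rightarrow> bool" where
  "Linf_sobolev T s u \<longleftrightarrow> spacetime_measurable T u \<and>
     (\<exists>C. AE t in lebesgue_on {0<..<T}. sobolev s (u t) \<and> sobolev_norm s (u t) \<le> C)"

definition L2_sobolev :: "real \<Rightarrow> real \<Rightarrow> (real \<Rightarrow> real^3 \<Rightarrow> real^'n::finite) \<Rightarrow> bool" where
  "L2_sobolev T s u \<longleftrightarrow> spacetime_measurable T u \<and>
     (AE t in lebesgue_on {0<..<T}. sobolev s (u t)) \<and>
     integrable (lebesgue_on {0<..<T}) (\<lambda>t. (sobolev_norm s (u t))\<^sup>2)"

section \<open>Test functions on space-time\<close>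

definition dir_deriv ::
    "'a::euclidean_space \<Rightarrow> ('a \<Rightarrow> 'b::euclidean_space) \<Rightarrow> 'a \<Rightarrow> 'b" where
  "dir_deriv b f z = frechet_derivative f (at z) b"

primrec Ck :: "nat \<Rightarrow> ('a::euclidean_space \<Rightarrow> 'b::euclidean_space) \<Rightarrow> bool" where
  "Ck 0 f \<longleftrightarrow> continuous_on UNIV f"
| "Ck (Suc k) f \<longleftrightarrow> (\<forall>z. f differentiable (at z)) \<and> (\<forall>b\<in>Basis. Ck k (dir_deriv b f))"

definition test_function :: "real \<Rightarrow> (real \<times> (real^3) \<Rightarrow> 'b::euclidean_space) \<Rightarrow> bool" where
  "test_function T \<phi> \<longleftrightarrow> (\<forall>k. Ck k \<phi>) \<and>
     (\<exists>K. compact K \<and> K \<subseteq> {0<..<T} \<times> UNIV \<and> (\<forall>z. z \<notin> K \<longrightarrow> \<phi> z = 0))"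

definition d_t :: "(real \<times> (real^3) \<Rightarrow> 'b::euclidean_space) \<Rightarrow> real \<times> (real^3) \<Rightarrow> 'b" where
  "d_t = dir_deriv (1, 0)"

definition d_x :: "3 \<Rightarrow> (real \<times> (real^3) \<Rightarrow> 'b::euclidean_space) \<Rightarrow> real \<times> (real^3) \<Rightarrow> 'b" where
  "d_x j = dir_deriv (0, axis j 1)"

definition grad_x :: "(real \<times> (real^3) \<Rightarrow> real) \<Rightarrow> real \<times> (real^3) \<Rightarrow> real^3" where
  "grad_x \<eta> z = (\<chi> j. d_x j \<eta> z)"

definition div_x :: "(real \<times> (real^3) \<Rightarrow> real^3) \<Rightarrow> real \<times> (real^3) \<Rightarrow> real" where
  "div_x \<phi> z = (\<Sum>j\<in>UNIV. d_x j \<phi> z $ j)"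

definition laplace_x :: "(real \<times> (real^3) \<Rightarrow> 'b::euclidean_space) \<Rightarrow> real \<times> (real^3) \<Rightarrow> 'b" where
  "laplace_x \<phi> z = (\<Sum>j\<in>UNIV. d_x j (d_x j \<phi>) z)"

section \<open>The Navier-Stokes equations\<close>

definition advection :: "(real^3 \<Rightarrow> real^3) \<Rightarrow> real^3 \<Rightarrow> real^3" where
  "advection v x = (\<Sum>j\<in>UNIV. (v x $ j) *\<^sub>R partial_x j v x)"

text \<open>The equations hold in the sense of distributions on \<open>(0,T) \<times> \<real>\<^sup>3\<close>. The integrals are
  iterated because \<open>partial_x j (u t)\<close> is selected separately for each \<open>t\<close>; the inner integral does
  not depend on the selection.\<close>

definition momentum_equation ::
    "real \<Rightarrow> real \<Rightarrow> (real \<Rightarrow> real^3 \<Rightarrow> real^3) \<Rightarrow> (real \<Rightarrow> real^3 \<Rightarrow> real) \<Rightarrow> bool" where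
  "momentum_equation \<nu> T u p \<longleftrightarrow>
     (\<forall>\<phi> :: real \<times> (real^3) \<Rightarrow> real^3. test_function T \<phi> \<longrightarrow>
        (LINT t:{0<..<T}|lebesgue. LINT x|lebesgue.
           - (u t x \<bullet> d_t \<phi> (t, x)) + advection (u t) x \<bullet> \<phi> (t, x) - p t x * div_x \<phi> (t, x))
      = (LINT t:{0<..<T}|lebesgue. LINT x|lebesgue. \<nu> * (u t x \<bullet> laplace_x \<phi> (t, x))))"

definition divergence_free :: "real \<Rightarrow> (real \<Rightarrow> real^3 \<Rightarrow> real^3) \<Rightarrow> bool" where
  "divergence_free T u \<longleftrightarrow>
     (\<forall>\<eta> :: real \<times> (real^3) \<Rightarrow> real. test_function T \<eta> \<longrightarrow>
        (LINT t:{0<..<T}|lebesgue. LINT x|lebesgue. u t x \<bullet> grad_x \<eta> (t, x)) = 0)"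

text \<open>The distributional equations determine \<open>u t\<close> only for almost every \<open>t\<close>. Values at every
  \<open>t\<close>, and the initial condition, refer to the representative that is weakly continuous in \<open>L\<^sup>2\<close>.\<close>

definition weakly_continuous_L2 :: "real \<Rightarrow> (real \<Rightarrow> real^3 \<Rightarrow> real^3) \<Rightarrow> bool" where
  "weakly_continuous_L2 T u \<longleftrightarrow> (\<forall>t\<in>{0..<T}. L2 (u t)) \<and>
     (\<forall>g. L2 g \<longrightarrow> continuous_on {0..<T} (\<lambda>t. LINT x|lebesgue. u t x \<bullet> g x))"

definition pressure_field :: "real \<Rightarrow> (real \<Rightarrow> real^3 \<Rightarrow> real) \<Rightarrow> bool" where
  "pressure_field T p \<longleftrightarrow>
     (\<forall>K. compact K \<and> K \<subseteq> {0<..<T} \<times> UNIV \<longrightarrow> set_integrable lebesgue K (\<lambda>(t, x). p t x))"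

definition navier_stokes_solution ::
    "real \<Rightarrow> real \<Rightarrow> (real \<Rightarrow> real^3 \<Rightarrow> real^3) \<Rightarrow> (real \<Rightarrow> real^3 \<Rightarrow> real) \<Rightarrow> (real^3 \<Rightarrow> real^3) \<Rightarrow> bool" where
  "navier_stokes_solution \<nu> T u p u0 \<longleftrightarrow>
     pressure_field T p \<and> momentum_equation \<nu> T u p \<and> divergence_free T u \<and>
     weakly_continuous_L2 T u \<and> (AE x in lebesgue. u 0 x = u0 x)"

text \<open>\<open>\<nabla>w\<close> has the columns \<open>partial_x j w\<close>, and the \<open>L\<^sup>2\<close> norm of a matrix field is built on the
  Frobenius norm.\<close>

definition E_c :: "real \<Rightarrow> (real \<Rightarrow> real^3 \<Rightarrow> real^3) \<Rightarrow> real \<Rightarrow> real" where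
  "E_c \<nu> w t = 1/2 * (L2_norm (Dpow (1/2) (w t)))\<^sup>2 +
     \<nu> * (LINT s:{0..t}|lebesgue. (\<Sum>j\<in>UNIV. (L2_norm (Dpow (1/2) (partial_x j (w s))))\<^sup>2))"

end

theory Submission
  imports Defs "HOL-Probability.Probability"
begin

text \<open>Let \<open>\<omega>\<close> be the curl of \<open>u\<close> and let \<open>H\<close> be the helicity, the integral of \<open>u \<bullet> \<omega>\<close>. On the
Fourier side the curl is the matrix \<open>curl_symbol \<xi>\<close>, which is self-adjoint and has the eigenvalues
\<open>0, \<bar>\<xi>\<bar>, -\<bar>\<xi>\<bar>\<close>; on divergence-free fields \<open>u\<^sub>+\<close> and \<open>u\<^sub>-\<close> are the projections to the last
two eigenspaces. For every field the polarisation identity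
\<open>\<bar>v + w\<bar>\<^sup>2 - \<bar>v - w\<bar>\<^sup>2 = 4 (v \<bullet> w)\<close> gives
\<open>\<bar>\<xi>\<bar> (\<bar>u\<^sub>+\<bar>\<^sup>2 - \<bar>u\<^sub>-\<bar>\<^sup>2) = u \<bullet> curl_symbol \<xi> u\<close> for the transforms, hence
\<open>E_c(u\<^sub>+)(t) - E_c(u\<^sub>-)(t) = H(t)/2 + \<nu> \<integral> Q\<close>, where \<open>Q\<close> is the helicity dissipation, the integral of
\<open>\<bar>\<xi>\<bar>\<^sup>2 (u \<bullet> curl_symbol \<xi> u)\<close>, and the time integral is over \<open>[0, t]\<close>. The theorem is therefore the
helicity balance \<open>H(t) - H(0) = - 2 \<nu> \<integral> Q\<close> (\<open>helicity_balance\<close>).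

Formally the balance results from testing the momentum equation with \<open>2 \<omega>\<close>: the pressure disappears
because \<open>\<omega>\<close> is solenoidal, and the nonlinear term disappears because \<open>u \<cdot> \<nabla>u\<close> is the sum of
\<open>\<omega> \<times> u\<close>, which is orthogonal to \<open>\<omega>\<close>, and of a gradient (\<open>integral_advection_inner_curl_field\<close>).
Since \<open>u\<close> is only a weak solution, four points need care.

(1) Fields that may be tested with. The momentum equation admits smooth compactly supported fields; with
solenoidal ones the pressure term vanishes pointwise. Curls of cut-off band-limited fields are of
this kind and approximate every band-limited curl together with its Laplacian
(\<open>solenoidal_test_approximation\<close>), so that \<open>u(b) - u(a)\<close> can be paired with the curl of any
low-pass filtered field (\<open>momentum_increment_filtered_curl\<close>).

(2) The test field depends on time. Let \<open>C\<close> be the filtered curl, a symmetric operator. By symmetry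
\<open>\<langle>u(b), C u(b)\<rangle> - \<langle>u(a), C u(a)\<rangle> = \<langle>u(b) - u(a), C u(a)\<rangle> + \<langle>u(b) - u(a), C u(b)\<rangle>\<close>, and both terms are time
integrals over \<open>[a, b]\<close> with frozen test fields. Summed over finer and finer partitions they
converge to twice the integral along the diagonal (\<open>riemann_quadratic_increment\<close>); the integrands
depend continuously on the frozen time because \<open>u\<close> is weakly continuous.

(3) Removal of the filter. Fields in \<open>H\<^sup>2\<close> are bounded, so the nonlinear term is in \<open>L\<^sup>2\<close> with norm
at most a multiple of the squared \<open>H\<^sup>2\<close> norm (\<open>advection_L2\<close>), and that square is integrable in time.
Dominated convergence then applies to all terms.

(4) Every time instead of almost every time, and measurability. Weighted norms of truncated transforms of
\<open>u\<close> are lower semicontinuous in time. Therefore the \<open>H\<^sup>1\<close> bound holds at all times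
(\<open>sobolev1_everywhere\<close>), and the dissipation is measurable in time.

The Fourier transform on \<open>L\<^sup>2\<close> rests on Bessel's inequality, which follows by Gaussian
regularisation (\<open>ft_Bessel\<close>), and on inversion, which holds for continuous functions and extends by
density (\<open>is_ft_inversion\<close>); Plancherel's theorem and surjectivity are consequences.\<close>

section \<open>Square-integrable functions\<close>

abbreviation Lmeas :: "('a::euclidean_space \<Rightarrow> 'b::topological_space) set" where
  "Lmeas \<equiv> borel_measurable lebesgue"

lemma L2_measurable: "L2 f \<Longrightarrow> f \<in> Lmeas"
  by (simp add: L2_def)

lemma L2_integrable_norm_sq: "L2 f \<Longrightarrow> integrable lebesgue (\<lambda>x. (norm (f x))\<^sup>2)"
  by (simp add: L2_def)

lemma L2_norm_nonneg [simp]: "0 \<le> L2_norm f"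
  by (simp add: L2_norm_def)

lemma L2_norm_sq: "(L2_norm f)\<^sup>2 = (LINT x|lebesgue. (norm (f x))\<^sup>2)"
  by (simp add: L2_norm_def)

lemma L2_norm_cong_AE:
  assumes "f \<in> Lmeas" "AE x in lebesgue. f x = g x"
  shows "L2_norm f = L2_norm g"
proof -
  have "g \<in> Lmeas"
    using assms by (rule borel_measurable_AE)
  then show ?thesis
    unfolding L2_norm_def using assms
    by (intro arg_cong[of _ _ sqrt] integral_cong_AE) (auto elim!: eventually_mono)
qed

lemma L2_cong_AE:
  assumes "L2 f" "AE x in lebesgue. f x = g x"
  shows "L2 g"
proof -
  have g: "g \<in> Lmeas"
    using assms L2_measurable by (blast intro: borel_measurable_AE)
  have "integrable lebesgue (\<lambda>x. (norm (f x))\<^sup>2) = integrable lebesgue (\<lambda>x. (norm (g x))\<^sup>2)"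
    using assms g L2_measurable[OF assms(1)]
    by (intro integrable_cong_AE) (auto elim!: eventually_mono)
  then show ?thesis using g assms by (simp add: L2_def)
qed

lemma L2_dominated:
  assumes f: "L2 f" and g: "g \<in> Lmeas"
    and le: "AE x in lebesgue. norm (g x) \<le> c * norm (f x)" and c: "0 \<le> c"
  shows "L2 g" "L2_norm g \<le> c * L2_norm f"
proof -
  have le2: "AE x in lebesgue. (norm (g x))\<^sup>2 \<le> c\<^sup>2 * (norm (f x))\<^sup>2"
    using le by eventually_elim (metis norm_ge_zero power_mono power_mult_distrib)
  have i1: "integrable lebesgue (\<lambda>x. c\<^sup>2 * (norm (f x))\<^sup>2)"
    using f by (simp add: L2_def)
  have i2: "integrable lebesgue (\<lambda>x. (norm (g x))\<^sup>2)"
    by (rule Bochner_Integration.integrable_bound[OF i1]) (use g le2 in \<open>auto elim!: eventually_mono\<close>)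
  show "L2 g" using i2 g by (simp add: L2_def)
  have "(L2_norm g)\<^sup>2 \<le> c\<^sup>2 * (L2_norm f)\<^sup>2"
    unfolding L2_norm_sq using integral_mono_AE[OF i2 i1 le2] by simp
  then have "(L2_norm g)\<^sup>2 \<le> (c * L2_norm f)\<^sup>2" by (simp add: power_mult_distrib)
  then show "L2_norm g \<le> c * L2_norm f"
    by (rule power2_le_imp_le) (use c in simp)
qed

lemma L2_add:
  assumes "L2 f" "L2 g" shows "L2 (\<lambda>x. f x + g x)"
proof -
  have [measurable]: "f \<in> Lmeas" "g \<in> Lmeas"
    using assms by (auto simp: L2_def)
  have "integrable lebesgue (\<lambda>x. (norm (f x + g x))\<^sup>2)"
  proof (rule Bochner_Integration.integrable_bound)
    show "integrable lebesgue (\<lambda>x. 2 * (norm (f x))\<^sup>2 + 2 * (norm (g x))\<^sup>2)"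
      using assms by (simp add: L2_def)
    show "AE x in lebesgue. norm ((norm (f x + g x))\<^sup>2) \<le> norm (2 * (norm (f x))\<^sup>2 + 2 * (norm (g x))\<^sup>2)"
    proof (rule AE_I2)
      fix x
      have "(norm (f x + g x))\<^sup>2 \<le> (norm (f x) + norm (g x))\<^sup>2"
        by (simp add: norm_triangle_ineq power_mono)
      also have "\<dots> \<le> 2 * (norm (f x))\<^sup>2 + 2 * (norm (g x))\<^sup>2"
        using sum_squares_bound[of "norm (f x)" "norm (g x)"] by (simp add: power2_sum)
      finally show "norm ((norm (f x + g x))\<^sup>2) \<le> norm (2 * (norm (f x))\<^sup>2 + 2 * (norm (g x))\<^sup>2)"
        by simp
    qed
  qed measurable
  then show ?thesis by (simp add: L2_def)
qed

lemma L2_scaleR: "L2 f \<Longrightarrow> L2 (\<lambda>x. c *\<^sub>R f x)"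
  by (auto simp: L2_def power_mult_distrib)

lemma L2_minus: "L2 f \<Longrightarrow> L2 (\<lambda>x. - f x)"
  by (auto simp: L2_def)

lemma L2_diff: "L2 f \<Longrightarrow> L2 g \<Longrightarrow> L2 (\<lambda>x. f x - g x)"
  using L2_add[OF _ L2_minus] by simp

lemma L2_zero [simp]: "L2 (\<lambda>x. 0)"
  by (simp add: L2_def)

lemma L2_sum: "(\<And>i. i \<in> I \<Longrightarrow> L2 (f i)) \<Longrightarrow> L2 (\<lambda>x. \<Sum>i\<in>I. f i x)"
  by (induction I rule: infinite_finite_induct) (auto intro: L2_add)

lemma L2_norm_scaleR: "L2_norm (\<lambda>x. c *\<^sub>R f x) = \<bar>c\<bar> * L2_norm f"
  by (simp add: L2_norm_def power_mult_distrib real_sqrt_mult)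

lemma L2_norm_zero [simp]: "L2_norm (\<lambda>x. 0) = 0"
  by (simp add: L2_norm_def)

lemma L2_norm_diff_commute: "L2_norm (\<lambda>x. f x - g x) = L2_norm (\<lambda>x. g x - f x)"
  by (simp add: L2_norm_def norm_minus_commute)

lemma L2_norm_eq_0_iff:
  assumes "L2 f"
  shows "L2_norm f = 0 \<longleftrightarrow> (AE x in lebesgue. f x = 0)"
  unfolding L2_norm_def
  using integral_nonneg_eq_0_iff_AE[OF L2_integrable_norm_sq[OF assms]] by simp

lemma L2_mult_integrable:
  assumes "L2 f" "L2 g"
  shows "integrable lebesgue (\<lambda>x. norm (f x) * norm (g x))"
proof (rule Bochner_Integration.integrable_bound)
  show "integrable lebesgue (\<lambda>x. (norm (f x))\<^sup>2 + (norm (g x))\<^sup>2)"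
    using assms by (simp add: L2_def)
  show "AE x in lebesgue. norm (norm (f x) * norm (g x)) \<le> norm ((norm (f x))\<^sup>2 + (norm (g x))\<^sup>2)"
  proof (rule AE_I2)
    fix x
    have "2 * (norm (f x) * norm (g x)) \<le> (norm (f x))\<^sup>2 + (norm (g x))\<^sup>2"
      using sum_squares_bound[of "norm (f x)" "norm (g x)"] by simp
    moreover have "0 \<le> norm (f x) * norm (g x)" by simp
    moreover have "(norm (f x))\<^sup>2 + (norm (g x))\<^sup>2 \<le> norm ((norm (f x))\<^sup>2 + (norm (g x))\<^sup>2)"
      by simp
    moreover have "norm (norm (f x) * norm (g x)) = norm (f x) * norm (g x)"
      by (simp add: abs_mult)
    ultimately show "norm (norm (f x) * norm (g x)) \<le> norm ((norm (f x))\<^sup>2 + (norm (g x))\<^sup>2)"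
      by linarith
  qed
  show "(\<lambda>x. norm (f x) * norm (g x)) \<in> Lmeas"
    using assms by (auto simp: L2_def)
qed

text \<open>Optimise \<open>2 s \<bar>f\<bar> \<bar>g\<bar> \<le> s\<^sup>2 \<bar>f\<bar>\<^sup>2 + \<bar>g\<bar>\<^sup>2\<close>
  over \<open>s > 0\<close>.\<close>

lemma L2_Cauchy_Schwarz:
  assumes "L2 f" "L2 g"
  shows "(LINT x|lebesgue. norm (f x) * norm (g x)) \<le> L2_norm f * L2_norm g"
proof -
  let ?I = "LINT x|lebesgue. norm (f x) * norm (g x)"
  have ineq: "2 * s * ?I \<le> s\<^sup>2 * (L2_norm f)\<^sup>2 + (L2_norm g)\<^sup>2" if "s > 0" for s
  proof -
    have "(LINT x|lebesgue. 2 * s * (norm (f x) * norm (g x)))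
        \<le> (LINT x|lebesgue. s\<^sup>2 * (norm (f x))\<^sup>2 + (norm (g x))\<^sup>2)"
    proof (rule integral_mono)
      show "2 * s * (norm (f x) * norm (g x)) \<le> s\<^sup>2 * (norm (f x))\<^sup>2 + (norm (g x))\<^sup>2" for x
        using sum_squares_bound[of "s * norm (f x)" "norm (g x)"]
        by (simp add: power_mult_distrib mult_ac)
    qed (use assms L2_mult_integrable[OF assms] in \<open>auto simp: L2_def\<close>)
    also have "\<dots> = s\<^sup>2 * (L2_norm f)\<^sup>2 + (L2_norm g)\<^sup>2"
      using assms by (simp add: L2_norm_sq L2_def)
    finally show ?thesis by simp
  qed
  have "0 \<le> ?I" by simp
  let ?A = "L2_norm f" and ?B = "L2_norm g"
  show ?thesis
  proof (cases "?A = 0 \<or> ?B = 0")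
    case True
    then have "AE x in lebesgue. norm (f x) * norm (g x) = 0"
      using L2_norm_eq_0_iff[OF assms(1)] L2_norm_eq_0_iff[OF assms(2)]
      by (auto elim!: eventually_mono)
    then have "?I = (LINT x|(lebesgue::'a measure). 0)"
      by (intro integral_cong_AE) (use assms in \<open>auto simp: L2_def\<close>)
    then show ?thesis by simp
  next
    case False
    then have pos: "?A > 0" "?B > 0"
      using L2_norm_nonneg[of f] L2_norm_nonneg[of g] by (auto simp: less_le simp del: L2_norm_nonneg)
    have "2 * (?B / ?A) * ?I \<le> (?B / ?A)\<^sup>2 * ?A\<^sup>2 + ?B\<^sup>2"
      using ineq[of "?B / ?A"] pos by simp
    also have "\<dots> = 2 * ?B\<^sup>2"
      using pos by (simp add: power_divide)
    finally have "(?B / ?A) * ?I \<le> ?B * ?B" by (simp add: power2_eq_square)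
    then have "?B * ?I \<le> ?B * (?A * ?B)" using pos by (simp add: field_simps)
    then show ?thesis using pos by simp
  qed
qed

lemma L2_inner_integrable:
  assumes "L2 f" "L2 g"
  shows "integrable lebesgue (\<lambda>x. f x \<bullet> g x)"
  by (rule Bochner_Integration.integrable_bound[OF L2_mult_integrable[OF assms]])
     (use assms in \<open>auto simp: L2_def Cauchy_Schwarz_ineq2\<close>)

lemma L2_inner_bound:
  assumes "L2 f" "L2 g"
  shows "\<bar>LINT x|lebesgue. f x \<bullet> g x\<bar> \<le> L2_norm f * L2_norm g"
proof -
  have "\<bar>LINT x|lebesgue. f x \<bullet> g x\<bar> \<le> (LINT x|lebesgue. \<bar>f x \<bullet> g x\<bar>)"
    by (rule integral_abs_bound)
  also have "\<dots> \<le> (LINT x|lebesgue. norm (f x) * norm (g x))"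
    by (intro integral_mono L2_mult_integrable integrable_abs L2_inner_integrable assms)
       (simp add: Cauchy_Schwarz_ineq2)
  also have "\<dots> \<le> L2_norm f * L2_norm g" by (rule L2_Cauchy_Schwarz[OF assms])
  finally show ?thesis .
qed

lemma L2_norm_triangle:
  assumes "L2 f" "L2 g"
  shows "L2_norm (\<lambda>x. f x + g x) \<le> L2_norm f + L2_norm g"
proof (rule power2_le_imp_le)
  have "(L2_norm (\<lambda>x. f x + g x))\<^sup>2 = (LINT x|lebesgue. (norm (f x))\<^sup>2 + 2 * (f x \<bullet> g x) + (norm (g x))\<^sup>2)"
    unfolding L2_norm_sq
    by (rule Bochner_Integration.integral_cong[OF refl])
       (simp add: power2_norm_eq_inner inner_add_left inner_add_right inner_commute)
  also have "\<dots> = (L2_norm f)\<^sup>2 + 2 * (LINT x|lebesgue. f x \<bullet> g x) + (L2_norm g)\<^sup>2"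
    using assms L2_inner_integrable[OF assms] by (simp add: L2_norm_sq L2_def)
  also have "\<dots> \<le> (L2_norm f + L2_norm g)\<^sup>2"
    using L2_inner_bound[OF assms] by (simp add: power2_sum abs_le_iff)
  finally show "(L2_norm (\<lambda>x. f x + g x))\<^sup>2 \<le> (L2_norm f + L2_norm g)\<^sup>2" .
qed simp

lemma L2_norm_triangle_diff:
  assumes "L2 f" "L2 g" "L2 h"
  shows "L2_norm (\<lambda>x. f x - h x) \<le> L2_norm (\<lambda>x. f x - g x) + L2_norm (\<lambda>x. g x - h x)"
  using L2_norm_triangle[OF L2_diff[OF assms(1,2)] L2_diff[OF assms(2,3)]] by simp

lemma L2_norm_triangle_le:
  assumes "L2 f" "L2 g"
  shows "L2_norm f \<le> L2_norm g + L2_norm (\<lambda>x. f x - g x)"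
  using L2_norm_triangle[OF assms(2) L2_diff[OF assms]] by simp

text \<open>Convergence in \<open>L\<^sup>2\<close>. Membership of all terms is part of the notion because \<open>L2_norm\<close>
  is \<open>0\<close> on functions whose square is not integrable.\<close>

definition L2_lim :: "(nat \<Rightarrow> 'a::euclidean_space \<Rightarrow> 'b::euclidean_space) \<Rightarrow> ('a \<Rightarrow> 'b) \<Rightarrow> bool" where
  "L2_lim s f \<longleftrightarrow> (\<forall>n. L2 (s n)) \<and> L2 f \<and> (\<lambda>n. L2_norm (\<lambda>x. s n x - f x)) \<longlonglongrightarrow> 0"

lemma L2_lim_dominated:
  fixes s :: "nat \<Rightarrow> 'a::euclidean_space \<Rightarrow> 'b::euclidean_space" and w :: "'a \<Rightarrow> 'c::euclidean_space"
  assumes s: "\<And>n. s n \<in> Lmeas"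
    and bd: "\<And>n. AE x in lebesgue. norm (s n x) \<le> norm (w x)" and w: "L2 w"
    and f: "f \<in> Lmeas"
    and lim: "AE x in lebesgue. (\<lambda>n. s n x) \<longlonglongrightarrow> f x"
  shows "L2_lim s f"
proof -
  have sL2: "L2 (s n)" for n
    using L2_dominated(1)[OF w s[of n], of 1] bd[of n] by simp
  have bdall: "AE x in lebesgue. \<forall>n. norm (s n x) \<le> norm (w x)"
    using bd by (simp add: AE_all_countable)
  have bf: "AE x in lebesgue. norm (f x) \<le> norm (w x)"
    using lim bdall by eventually_elim (auto intro: LIMSEQ_le_const2 tendsto_norm)
  have fL2: "L2 f" using L2_dominated(1)[OF w f, of 1] bf by simp
  have "(\<lambda>n. LINT x|lebesgue. (norm (s n x - f x))\<^sup>2) \<longlonglongrightarrow> (LINT x|(lebesgue::'a measure). 0)"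
  proof (rule integral_dominated_convergence)
    show "integrable lebesgue (\<lambda>x. 4 * (norm (w x))\<^sup>2)" using w by (simp add: L2_def)
    show "AE x in lebesgue. (\<lambda>n. (norm (s n x - f x))\<^sup>2) \<longlonglongrightarrow> 0"
      using lim
    proof eventually_elim
      case (elim x)
      have "(\<lambda>n. s n x - f x) \<longlonglongrightarrow> 0" using elim by (simp add: LIM_zero)
      then have "(\<lambda>n. (norm (s n x - f x))\<^sup>2) \<longlonglongrightarrow> (norm (0::'b))\<^sup>2" by (intro tendsto_intros)
      then show ?case by simp
    qed
    show "AE x in lebesgue. norm ((norm (s n x - f x))\<^sup>2) \<le> 4 * (norm (w x))\<^sup>2" for n
      using bdall bf
    proof eventually_elim
      case (elim x)
      have "norm (s n x - f x) \<le> norm (s n x) + norm (f x)" by (rule norm_triangle_ineq4)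
      also have "\<dots> \<le> 2 * norm (w x)" using elim(1)[rule_format, of n] elim(2) by simp
      finally have "(norm (s n x - f x))\<^sup>2 \<le> (2 * norm (w x))\<^sup>2" by (rule power_mono) simp
      then show ?case by (simp add: power_mult_distrib)
    qed
  qed (use s f in \<open>auto\<close>)
  then have "(\<lambda>n. L2_norm (\<lambda>x. s n x - f x)) \<longlonglongrightarrow> 0"
    unfolding L2_norm_def using tendsto_real_sqrt by fastforce
  then show ?thesis using sL2 fL2 by (simp add: L2_lim_def)
qed

lemma L2_lim_inner:
  assumes "L2_lim s f" "L2_lim t g"
  shows "(\<lambda>n. LINT x|lebesgue. s n x \<bullet> t n x) \<longlonglongrightarrow> (LINT x|lebesgue. f x \<bullet> g x)"
proof -
  have L: "L2 (s n)" "L2 (t n)" "L2 f" "L2 g" for n using assms by (auto simp: L2_lim_def)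
  let ?a = "\<lambda>n. L2_norm (\<lambda>x. s n x - f x)" and ?b = "\<lambda>n. L2_norm (\<lambda>x. t n x - g x)"
  have "(\<lambda>n. (LINT x|lebesgue. s n x \<bullet> t n x) - (LINT x|lebesgue. f x \<bullet> g x)) \<longlonglongrightarrow> 0"
  proof (rule Lim_null_comparison)
    show "\<forall>\<^sub>F n in sequentially. norm ((LINT x|lebesgue. s n x \<bullet> t n x) - (LINT x|lebesgue. f x \<bullet> g x))
        \<le> ?a n * (?b n + L2_norm g) + L2_norm f * ?b n"
    proof (rule always_eventually, rule allI)
      fix n
      have "(LINT x|lebesgue. s n x \<bullet> t n x) - (LINT x|lebesgue. f x \<bullet> g x)
          = (LINT x|lebesgue. (s n x - f x) \<bullet> t n x) + (LINT x|lebesgue. f x \<bullet> (t n x - g x))"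
        using L by (simp add: inner_diff L2_inner_integrable)
      also have "norm \<dots> \<le> ?a n * L2_norm (t n) + L2_norm f * ?b n"
        using L2_inner_bound[OF L2_diff[OF L(1)[of n] L(3)] L(2)[of n]]
          L2_inner_bound[OF L(3) L2_diff[OF L(2)[of n] L(4)]] by (auto simp: abs_le_iff)
      also have "\<dots> \<le> ?a n * (?b n + L2_norm g) + L2_norm f * ?b n"
        using L2_norm_triangle_le[OF L(2)[of n] L(4)] by (simp add: mult_left_mono add.commute)
      finally show "norm ((LINT x|lebesgue. s n x \<bullet> t n x) - (LINT x|lebesgue. f x \<bullet> g x))
        \<le> ?a n * (?b n + L2_norm g) + L2_norm f * ?b n" .
    qed
    have "?a \<longlonglongrightarrow> 0" "?b \<longlonglongrightarrow> 0" using assms by (auto simp: L2_lim_def)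
    then have "(\<lambda>n. ?a n * (?b n + L2_norm g) + L2_norm f * ?b n) \<longlonglongrightarrow> 0 * (0 + L2_norm g) + L2_norm f * 0"
      by (intro tendsto_intros)
    then show "(\<lambda>n. ?a n * (?b n + L2_norm g) + L2_norm f * ?b n) \<longlonglongrightarrow> 0" by simp
  qed
  then show ?thesis by (rule LIM_zero_cancel)
qed

lemma L2_lim_const: "L2 f \<Longrightarrow> L2_lim (\<lambda>n. f) f"
  by (simp add: L2_lim_def)

lemma L2_lim_add:
  assumes "L2_lim s f" "L2_lim t g" shows "L2_lim (\<lambda>n x. s n x + t n x) (\<lambda>x. f x + g x)"
proof -
  have L: "L2 (s n)" "L2 (t n)" "L2 f" "L2 g" for n using assms by (auto simp: L2_lim_def)
  have "(\<lambda>n. L2_norm (\<lambda>x. (s n x + t n x) - (f x + g x))) \<longlonglongrightarrow> 0"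
  proof (rule Lim_null_comparison)
    show "\<forall>\<^sub>F n in sequentially. norm (L2_norm (\<lambda>x. (s n x + t n x) - (f x + g x)))
        \<le> L2_norm (\<lambda>x. s n x - f x) + L2_norm (\<lambda>x. t n x - g x)"
      using L2_norm_triangle[OF L2_diff[OF L(1) L(3)] L2_diff[OF L(2) L(4)]]
      by (intro always_eventually allI) (simp add: algebra_simps)
    have "(\<lambda>n. L2_norm (\<lambda>x. s n x - f x) + L2_norm (\<lambda>x. t n x - g x)) \<longlonglongrightarrow> 0 + 0"
      using assms unfolding L2_lim_def by (intro tendsto_add) auto
    then show "(\<lambda>n. L2_norm (\<lambda>x. s n x - f x) + L2_norm (\<lambda>x. t n x - g x)) \<longlonglongrightarrow> 0" by simp
  qed
  then show ?thesis using L by (auto simp: L2_lim_def intro: L2_add)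
qed

lemma L2_lim_bounded_linear:
  fixes A :: "'b::euclidean_space \<Rightarrow> 'c::euclidean_space"
  assumes "L2_lim s f" "bounded_linear A"
  shows "L2_lim (\<lambda>n x. A (s n x)) (\<lambda>x. A (f x))"
proof -
  interpret A: bounded_linear A by fact
  obtain K where K: "K \<ge> 0" "\<And>y. norm (A y) \<le> norm y * K" using A.nonneg_bounded by blast
  have L: "L2 (s n)" "L2 f" for n using assms by (auto simp: L2_lim_def)
  have cont: "continuous_on UNIV A" by (rule A.continuous_on) (rule continuous_on_id)
  have meas: "(\<lambda>x. A (g x)) \<in> Lmeas" if "L2 g" for g :: "'a \<Rightarrow> 'b"
    using borel_measurable_continuous_on[OF cont L2_measurable[OF that]] .
  have A2: "L2 (\<lambda>x. A (g x))" "L2_norm (\<lambda>x. A (g x)) \<le> K * L2_norm g" if "L2 g" for g :: "'a \<Rightarrow> 'b"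
    using L2_dominated[OF that meas[OF that], of K] K by (auto simp: mult.commute)
  have "(\<lambda>n. L2_norm (\<lambda>x. A (s n x) - A (f x))) \<longlonglongrightarrow> 0"
  proof (rule Lim_null_comparison)
    show "\<forall>\<^sub>F n in sequentially. norm (L2_norm (\<lambda>x. A (s n x) - A (f x))) \<le> K * L2_norm (\<lambda>x. s n x - f x)"
      using A2(2)[OF L2_diff[OF L(1) L(2)]] by (simp add: A.diff)
    show "(\<lambda>n. K * L2_norm (\<lambda>x. s n x - f x)) \<longlonglongrightarrow> 0"
      using assms(1) by (auto simp: L2_lim_def intro: tendsto_mult_right_zero)
  qed
  then show ?thesis using A2(1) L by (simp add: L2_lim_def)
qed

lemma L2_bounded_linear:
  fixes A :: "'b::euclidean_space \<Rightarrow> 'c::euclidean_space"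
  assumes "L2 f" "bounded_linear A"
  shows "L2 (\<lambda>x. A (f x))"
  using L2_lim_bounded_linear[OF L2_lim_const[OF assms(1)] assms(2)] by (simp add: L2_lim_def)

lemma L2_lim_unique:
  assumes "L2_lim s f" "L2_lim s g"
  shows "AE x in lebesgue. f x = g x"
proof -
  have L: "L2 (s n)" "L2 f" "L2 g" for n using assms by (auto simp: L2_lim_def)
  have "(\<lambda>n. L2_norm (\<lambda>x. s n x - f x) + L2_norm (\<lambda>x. s n x - g x)) \<longlonglongrightarrow> 0 + 0"
    using assms unfolding L2_lim_def by (intro tendsto_add) auto
  then have "L2_norm (\<lambda>x. f x - g x) \<le> 0 + 0"
    by (rule LIMSEQ_le_const)
       (use L2_norm_triangle_diff[OF L(2) L(1) L(3)] in \<open>auto simp: L2_norm_diff_commute[of f]\<close>)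
  then have "L2_norm (\<lambda>x. f x - g x) = 0" using L2_norm_nonneg[of "\<lambda>x. f x - g x"] by linarith
  then show ?thesis using L2_norm_eq_0_iff[OF L2_diff[OF L(2,3)]] by simp
qed

lemma L2_lim_norm:
  assumes "L2_lim s f" shows "(\<lambda>n. L2_norm (s n)) \<longlonglongrightarrow> L2_norm f"
proof -
  have "(\<lambda>n. sqrt (LINT x|lebesgue. s n x \<bullet> s n x)) \<longlonglongrightarrow> sqrt (LINT x|lebesgue. f x \<bullet> f x)"
    using L2_lim_inner[OF assms assms] by (rule tendsto_real_sqrt)
  then show ?thesis by (simp add: L2_norm_def power2_norm_eq_inner)
qed

lemma L2_nn_integral_norm_sq:
  assumes "L2 f" shows "(\<integral>\<^sup>+x. ennreal ((norm (f x))\<^sup>2) \<partial>lebesgue) = ennreal ((L2_norm f)\<^sup>2)"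
  unfolding L2_norm_sq by (rule nn_integral_eq_integral) (use assms in \<open>auto simp: L2_def\<close>)

lemma L2_Fatou:
  fixes s :: "nat \<Rightarrow> 'a::euclidean_space \<Rightarrow> 'b::euclidean_space"
  assumes s: "\<And>n. L2 (s n)" "\<And>n. L2_norm (s n) \<le> C" and f: "f \<in> Lmeas"
    and lim: "AE x in lebesgue. (\<lambda>n. s n x) \<longlonglongrightarrow> f x"
  shows "L2 f" "L2_norm f \<le> C"
proof -
  have C: "0 \<le> C" using s(2)[of 0] L2_norm_nonneg[of "s 0"] by linarith
  have [measurable]: "s n \<in> Lmeas" for n using s(1) L2_measurable by blast
  note [measurable] = f
  have "(\<integral>\<^sup>+x. ennreal ((norm (f x))\<^sup>2) \<partial>lebesgue) = (\<integral>\<^sup>+x. liminf (\<lambda>n. ennreal ((norm (s n x))\<^sup>2)) \<partial>lebesgue)"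
  proof (rule nn_integral_cong_AE)
    show "AE x in lebesgue. ennreal ((norm (f x))\<^sup>2) = liminf (\<lambda>n. ennreal ((norm (s n x))\<^sup>2))"
      using lim
    proof eventually_elim
      case (elim x)
      have "(\<lambda>n. (norm (s n x))\<^sup>2) \<longlonglongrightarrow> (norm (f x))\<^sup>2" using elim by (intro tendsto_intros)
      then have "(\<lambda>n. ennreal ((norm (s n x))\<^sup>2)) \<longlonglongrightarrow> ennreal ((norm (f x))\<^sup>2)" by (rule tendsto_ennrealI)
      then show ?case by (rule lim_imp_Liminf[OF trivial_limit_sequentially, symmetric])
    qed
  qed
  also have "\<dots> \<le> liminf (\<lambda>n. \<integral>\<^sup>+x. ennreal ((norm (s n x))\<^sup>2) \<partial>lebesgue)" by (rule nn_integral_liminf) measurable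
  also have "\<dots> \<le> ennreal (C\<^sup>2)"
  proof (intro Liminf_le always_eventually allI)
    show "(\<integral>\<^sup>+x. ennreal ((norm (s n x))\<^sup>2) \<partial>lebesgue) \<le> ennreal (C\<^sup>2)" for n
      unfolding L2_nn_integral_norm_sq[OF s(1)] by (intro ennreal_leI power_mono s(2)) simp
  qed simp
  finally have B: "(\<integral>\<^sup>+x. ennreal ((norm (f x))\<^sup>2) \<partial>lebesgue) \<le> ennreal (C\<^sup>2)" .
  have "integrable lebesgue (\<lambda>x. (norm (f x))\<^sup>2)"
  proof (rule integrableI_bounded)
    show "(\<integral>\<^sup>+x. ennreal (norm ((norm (f x))\<^sup>2)) \<partial>lebesgue) < \<infinity>" using B by (auto intro: le_less_trans)
  qed measurable
  then show fL: "L2 f" using f by (simp add: L2_def)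
  have "(L2_norm f)\<^sup>2 \<le> C\<^sup>2"
    using B unfolding L2_nn_integral_norm_sq[OF fL] using ennreal_le_iff zero_le_power2 by blast
  then show "L2_norm f \<le> C" by (rule power2_le_imp_le) (rule C)
qed

text \<open>The Riesz--Fischer theorem. A Cauchy sequence in \<open>L\<^sup>1\<close> has a subsequence that converges almost
  everywhere; multiplication by a positive \<open>L\<^sup>2\<close> function carries this over to \<open>L\<^sup>2\<close> by
  Cauchy--Schwarz, and Fatou's lemma identifies the pointwise limit with the limit in norm.\<close>

lemma L2_cauchy_complete:
  fixes s :: "nat \<Rightarrow> 'a::euclidean_space \<Rightarrow> 'b::euclidean_space"
  assumes L: "\<And>n. L2 (s n)"
    and cauchy: "\<And>e. e > 0 \<Longrightarrow> \<exists>N. \<forall>i\<ge>N. \<forall>j\<ge>N. L2_norm (\<lambda>x. s i x - s j x) < e"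
  shows "\<exists>f. L2_lim s f"
proof -
  have [measurable]: "s n \<in> Lmeas" for n using L L2_measurable by blast
  \<comment> \<open>an everywhere positive weight, so that convergence of the weighted sequence can be divided by it\<close>
  obtain w :: "'a \<Rightarrow> real" where w: "L2 w" "\<And>x. w x > 0"
  proof -
    obtain h :: "'a \<Rightarrow> real" where h0: "h \<in> borel_measurable lborel" "\<And>x. 0 < h x"
        "\<And>x. h x \<le> 1" "integrable lborel h"
      using sigma_finite_measure.obtain_positive_integrable_function[OF sigma_finite_lborel] by blast
    have h: "h \<in> Lmeas" "\<And>x. 0 < h x" "\<And>x. h x \<le> 1" "integrable lebesgue h"
      using h0 by (auto simp: integrable_completion measurable_completion)
    have "integrable lebesgue (\<lambda>x. (norm (h x))\<^sup>2)"
    proof (rule Bochner_Integration.integrable_bound[OF h(4)])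
      have "(norm (h x))\<^sup>2 \<le> norm (h x)" for x
        using h(2,3)[of x] by (simp add: power2_eq_square mult_left_le)
      then show "AE x in lebesgue. norm ((norm (h x))\<^sup>2) \<le> norm (h x)" by simp
    qed (use h in auto)
    then have "L2 h" using h by (simp add: L2_def)
    then show ?thesis using that h by blast
  qed
  have [measurable]: "w \<in> Lmeas" using w L2_measurable by blast
  have int1: "integrable lebesgue (\<lambda>x. w x *\<^sub>R g x)" and bd1: "(LINT x|lebesgue. norm (w x *\<^sub>R g x)) \<le> L2_norm w * L2_norm g"
    if "L2 g" for g :: "'a \<Rightarrow> 'b"
  proof -
    show "integrable lebesgue (\<lambda>x. w x *\<^sub>R g x)"
      by (rule Bochner_Integration.integrable_bound[OF L2_mult_integrable[OF w(1) that]])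
         (use that in \<open>auto simp: L2_def\<close>)
    show "(LINT x|lebesgue. norm (w x *\<^sub>R g x)) \<le> L2_norm w * L2_norm g"
      using L2_Cauchy_Schwarz[OF w(1) that] by simp
  qed
  have "\<exists>N. \<forall>i\<ge>N. \<forall>j\<ge>N. (LINT x|lebesgue. norm (w x *\<^sub>R s i x - w x *\<^sub>R s j x)) < e" if "e > 0" for e
  proof -
    have "e / (L2_norm w + 1) > 0" using that by (simp add: add_nonneg_pos)
    then obtain N where N: "\<And>i j. i \<ge> N \<Longrightarrow> j \<ge> N \<Longrightarrow> L2_norm (\<lambda>x. s i x - s j x) < e / (L2_norm w + 1)"
      using cauchy by blast
    have "(LINT x|lebesgue. norm (w x *\<^sub>R s i x - w x *\<^sub>R s j x)) < e" if "i \<ge> N" "j \<ge> N" for i j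
    proof -
      have "(LINT x|lebesgue. norm (w x *\<^sub>R s i x - w x *\<^sub>R s j x)) \<le> L2_norm w * L2_norm (\<lambda>x. s i x - s j x)"
        using bd1[OF L2_diff[OF L[of i] L[of j]]] by (simp add: scaleR_diff_right)
      also have "\<dots> \<le> (L2_norm w + 1) * L2_norm (\<lambda>x. s i x - s j x)" by (simp add: mult_right_mono)
      also have "\<dots> < e"
      proof -
        have "0 < L2_norm w + 1" by (simp add: add_nonneg_pos)
        then show ?thesis using N[OF that] by (simp add: pos_less_divide_eq mult.commute)
      qed
      finally show ?thesis .
    qed
    then show ?thesis by blast
  qed
  then obtain r where r: "strict_mono r" "AE x in lebesgue. Cauchy (\<lambda>i. w x *\<^sub>R s (r i) x)"
    using cauchy_L1_AE_cauchy_subseq[of lebesgue "\<lambda>n x. w x *\<^sub>R s n x"] int1[OF L] by blast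
  define f where "f x = lim (\<lambda>i. s (r i) x)" for x
  have lim: "AE x in lebesgue. (\<lambda>i. s (r i) x) \<longlonglongrightarrow> f x"
    using r(2)
  proof eventually_elim
    case (elim x)
    then have "convergent (\<lambda>i. w x *\<^sub>R s (r i) x)" by (simp add: Cauchy_convergent_iff)
    then obtain l where "(\<lambda>i. w x *\<^sub>R s (r i) x) \<longlonglongrightarrow> l" by (auto simp: convergent_def)
    then have "(\<lambda>i. (1 / w x) *\<^sub>R (w x *\<^sub>R s (r i) x)) \<longlonglongrightarrow> (1 / w x) *\<^sub>R l" by (intro tendsto_intros)
    then have "(\<lambda>i. s (r i) x) \<longlonglongrightarrow> (1 / w x) *\<^sub>R l" using w(2)[of x] by simp
    then show ?case unfolding f_def by (simp add: limI)
  qed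
  have [measurable]: "f \<in> Lmeas"
    unfolding f_def by (rule borel_measurable_lim_metric) simp
  have close: "L2 (\<lambda>x. s i x - f x) \<and> L2_norm (\<lambda>x. s i x - f x) \<le> e"
    if N: "\<forall>i\<ge>N. \<forall>j\<ge>N. L2_norm (\<lambda>x. s i x - s j x) < e" and i: "i \<ge> N" for i N e
  proof -
    have "L2_norm (\<lambda>x. s i x - s (r (j + N)) x) \<le> e" for j
      using N i order_trans[OF le_add2 seq_suble[OF r(1), of "j + N"]] by (simp add: less_imp_le)
    moreover have "AE x in lebesgue. (\<lambda>j. s i x - s (r (j + N)) x) \<longlonglongrightarrow> s i x - f x"
      using lim by eventually_elim (intro tendsto_diff tendsto_const LIMSEQ_ignore_initial_segment)
    moreover have "(\<lambda>x. s i x - f x) \<in> Lmeas" by simp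
    ultimately show ?thesis
      using L2_Fatou[where s="\<lambda>j x. s i x - s (r (j + N)) x", OF L2_diff[OF L[of i] L]] by blast
  qed
  obtain N where N: "\<forall>i\<ge>N. \<forall>j\<ge>N. L2_norm (\<lambda>x. s i x - s j x) < 1" using cauchy[of 1] by auto
  have "L2 (\<lambda>x. s N x - (s N x - f x))"
    using L2_diff[OF L[of N], of "\<lambda>x. s N x - f x"] close[OF N, of N] by simp
  then have fL: "L2 f" by simp
  have "(\<lambda>n. L2_norm (\<lambda>x. s n x - f x)) \<longlonglongrightarrow> 0"
  proof (rule LIMSEQ_I)
    fix e :: real assume "e > 0"
    then obtain N where N: "\<forall>i\<ge>N. \<forall>j\<ge>N. L2_norm (\<lambda>x. s i x - s j x) < e / 2" using cauchy[of "e / 2"] by auto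
    have "norm (L2_norm (\<lambda>x. s n x - f x) - 0) < e" if "n \<ge> N" for n
      using close[OF N that] \<open>e > 0\<close> by auto
    then show "\<exists>no. \<forall>n\<ge>no. norm (L2_norm (\<lambda>x. s n x - f x) - 0) < e" by blast
  qed
  then have "L2_lim s f" using L fL by (simp add: L2_lim_def)
  then show ?thesis by blast
qed

lemma cball_in_lebesgue: "cball c r \<in> sets lebesgue"
  using lmeasurable_cball[of c r] by (simp add: fmeasurable_def)

lemma L2_lim_truncate:
  fixes f :: "'a::euclidean_space \<Rightarrow> 'b::euclidean_space"
  assumes "L2 f"
  shows "L2_lim (\<lambda>N x. indicator (cball 0 (real N)) x *\<^sub>R f x) f"
proof (rule L2_lim_dominated[OF _ _ assms])
  show "(\<lambda>x. indicator (cball 0 (real n)) x *\<^sub>R f x) \<in> Lmeas" for n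
    using assms borel_measurable_indicator[OF cball_in_lebesgue, of 0 "real n"]
    by (intro borel_measurable_scaleR) (auto simp: L2_def)
  show "AE x in lebesgue. norm (indicator (cball 0 (real n)) x *\<^sub>R f x) \<le> norm (f x)" for n
    by (auto simp: indicator_def)
  show "f \<in> Lmeas" using assms by (simp add: L2_def)
  show "AE x in lebesgue. (\<lambda>n. indicator (cball 0 (real n)) x *\<^sub>R f x) \<longlonglongrightarrow> f x"
  proof (rule AE_I2)
    fix x :: 'a
    obtain n0 where "norm x \<le> real n0" using real_arch_simple by blast
    then have "\<forall>\<^sub>F n in sequentially. indicator (cball 0 (real n)) x *\<^sub>R f x = f x"
      by (auto simp: eventually_sequentially indicator_def intro!: exI[of _ n0])
    then show "(\<lambda>n. indicator (cball 0 (real n)) x *\<^sub>R f x) \<longlonglongrightarrow> f x" by (rule tendsto_eventually)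
  qed
qed

text \<open>Truncate \<open>f\<close> in space and in size, and take continuous functions converging to the truncation almost
  everywhere. These have no common bound; radial clamping and a spatial cutoff, neither of which changes the limit, provide
  one.\<close>

lemma L2_dense_continuous:
  fixes f :: "'a::euclidean_space \<Rightarrow> 'b::euclidean_space"
  assumes f: "L2 f" and e: "e > 0"
  obtains g where "continuous_on UNIV g" "bounded (range g)" "integrable lebesgue g" "L2 g"
    "L2_norm (\<lambda>x. f x - g x) < e"
proof -
  have [measurable]: "f \<in> Lmeas" using f by (simp add: L2_def)
  define S where "S n = {x. norm x \<le> real n \<and> norm (f x) \<le> real n}" for n
  have [measurable]: "S n \<in> sets lebesgue" for n
  proof -
    have "S n = cball 0 (real n) \<inter> {x \<in> space lebesgue. norm (f x) \<le> real n}" by (auto simp: S_def)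
    also have "\<dots> \<in> sets lebesgue"
    proof (rule sets.Int)
      show "cball 0 (real n) \<in> sets (lebesgue::'a measure)"
        by (rule cball_in_lebesgue)
      have "(\<lambda>x. norm (f x)) \<in> Lmeas" by simp
      then show "{x \<in> space lebesgue. norm (f x) \<le> real n} \<in> sets lebesgue"
        unfolding borel_measurable_iff_le by blast
    qed
    finally show ?thesis .
  qed
  have "L2_lim (\<lambda>n x. indicator (S n) x *\<^sub>R f x) f"
  proof (rule L2_lim_dominated[OF _ _ f])
    show "AE x in lebesgue. (\<lambda>n. indicator (S n) x *\<^sub>R f x) \<longlonglongrightarrow> f x"
    proof (rule AE_I2)
      fix x :: 'a
      obtain n0 where "max (norm x) (norm (f x)) \<le> real n0" using real_arch_simple by blast
      then have "\<forall>\<^sub>F n in sequentially. indicator (S n) x *\<^sub>R f x = f x"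
        by (auto simp: eventually_sequentially indicator_def S_def intro!: exI[of _ n0])
      then show "(\<lambda>n. indicator (S n) x *\<^sub>R f x) \<longlonglongrightarrow> f x" by (rule tendsto_eventually)
    qed
  qed (auto simp: indicator_def)
  then have "(\<lambda>n. L2_norm (\<lambda>x. indicator (S n) x *\<^sub>R f x - f x)) \<longlonglongrightarrow> 0" by (simp add: L2_lim_def)
  then have "\<forall>\<^sub>F n in sequentially. L2_norm (\<lambda>x. indicator (S n) x *\<^sub>R f x - f x) < e / 2 \<and> n > 0"
    using e by (intro eventually_conj order_tendstoD(2) eventually_gt_at_top) auto
  then obtain k where k: "L2_norm (\<lambda>x. indicator (S k) x *\<^sub>R f x - f x) < e / 2" "k > 0"
    using eventually_happens by force
  define fk where "fk x = indicator (S k) x *\<^sub>R f x" for x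
  have fkm [measurable]: "fk \<in> Lmeas" unfolding fk_def by measurable
  have fkb: "norm (fk x) \<le> real k" and fk0: "norm x > real k \<Longrightarrow> fk x = 0" for x
    by (auto simp: fk_def S_def indicator_def)
  have "fk measurable_on UNIV" by (rule lebesgue_measurable_imp_measurable_on) auto
  then obtain N g where N: "negligible N" and g: "\<And>n. continuous_on UNIV (g n)"
      and lim: "\<And>x. x \<notin> N \<Longrightarrow> (\<lambda>n. g n x) \<longlonglongrightarrow> fk x"
    by (auto simp: measurable_on_def)
  \<comment> \<open>the retraction of the space onto the ball of radius \<open>k\<close>; it fixes the values of \<open>fk\<close>\<close>
  define clamp where "clamp y = (1 / max 1 (norm y / real k)) *\<^sub>R y" for y :: 'b
  define c where "c x = max 0 (min 1 (real k + 1 - norm x))" for x :: 'a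
  have clamp_c: "continuous_on UNIV clamp"
    unfolding clamp_def using k(2) by (intro continuous_intros) auto
  have clamp_b: "norm (clamp y) \<le> real k" for y
  proof (cases "norm y / real k \<le> 1")
    case True then show ?thesis using k(2) by (simp add: clamp_def max_def field_simps)
  next
    case False then show ?thesis using k(2) by (simp add: clamp_def max_def field_simps)
  qed
  have clamp_id: "clamp y = y" if "norm y \<le> real k" for y
    using that k(2) by (simp add: clamp_def max_def field_simps)
  have c_c: "continuous_on UNIV c" unfolding c_def by (intro continuous_intros)
  have c_b: "0 \<le> c x" "c x \<le> 1" and c1: "norm x \<le> real k \<Longrightarrow> c x = 1" and c0: "norm x \<ge> real k + 1 \<Longrightarrow> c x = 0" for x
    by (auto simp: c_def)
  define h where "h n x = c x *\<^sub>R clamp (g n x)" for n x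
  have h_c: "continuous_on UNIV (h n)" for n
    unfolding h_def
    by (intro continuous_on_scaleR c_c continuous_on_compose2[OF clamp_c g]) auto
  define w :: "'a \<Rightarrow> real" where "w x = real k * indicator (cball 0 (real k + 1)) x" for x
  have h_b: "norm (h n x) \<le> norm (w x)" for n x
  proof (cases "norm x \<ge> real k + 1")
    case True then show ?thesis by (simp add: h_def c0)
  next
    case False
    have "norm (h n x) \<le> 1 * real k"
      unfolding h_def norm_scaleR using c_b[of x] clamp_b[of "g n x"] by (intro mult_mono) auto
    then show ?thesis using False by (simp add: w_def indicator_def)
  qed
  have ind: "integrable lebesgue (indicator (cball 0 (real k + 1)) :: 'a \<Rightarrow> real)"
    using lmeasurable_cball[of "0::'a" "real k + 1"] by (subst integrable_indicator_iff) (auto simp: fmeasurable_def)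
  have w_i: "integrable lebesgue w" unfolding w_def using ind by simp
  have w2: "(norm (w x))\<^sup>2 = real k * w x" for x
    by (simp add: w_def indicator_def power2_eq_square)
  have w_L: "L2 w"
    unfolding L2_def w2 using w_i borel_measurable_integrable by auto
  have h_m: "h n \<in> Lmeas" for n
    by (rule measurable_completion) (use borel_measurable_continuous_onI[OF h_c] in simp)
  have "L2_lim h fk"
  proof (rule L2_lim_dominated[OF h_m _ w_L fkm])
    show "AE x in lebesgue. norm (h n x) \<le> norm (w x)" for n using h_b by simp
    have "AE x in lebesgue. x \<notin> N"
      using N by (simp add: negligible_iff_null_sets AE_not_in)
    then show "AE x in lebesgue. (\<lambda>n. h n x) \<longlonglongrightarrow> fk x"
    proof eventually_elim
      case (elim x)
      have "(\<lambda>n. clamp (g n x)) \<longlonglongrightarrow> clamp (fk x)"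
        using clamp_c lim[OF elim] by (auto simp: continuous_on_eq_continuous_at isCont_def intro: isCont_tendsto_compose)
      then have "(\<lambda>n. h n x) \<longlonglongrightarrow> c x *\<^sub>R clamp (fk x)"
        unfolding h_def by (intro tendsto_intros)
      moreover have "c x *\<^sub>R clamp (fk x) = fk x"
        using clamp_id[OF fkb, of x] fk0[of x] c1[of x] by (cases "norm x > real k") simp_all
      ultimately show ?case by simp
    qed
  qed
  then have "(\<lambda>n. L2_norm (\<lambda>x. h n x - fk x)) \<longlonglongrightarrow> 0" and hL: "\<And>n. L2 (h n)" and fkL: "L2 fk"
    by (auto simp: L2_lim_def)
  then have "\<forall>\<^sub>F n in sequentially. L2_norm (\<lambda>x. h n x - fk x) < e / 2"
    using e by (intro order_tendstoD(2)) auto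
  then obtain n where n: "L2_norm (\<lambda>x. h n x - fk x) < e / 2" using eventually_happens by force
  show thesis
  proof (rule that[of "h n"])
    show "bounded (range (h n))"
    proof (rule boundedI)
      fix y assume "y \<in> range (h n)"
      then obtain x where "y = h n x" by auto
      moreover have "norm (w x) \<le> real k" by (simp add: w_def indicator_def)
      ultimately show "norm y \<le> real k" using h_b[of n x] by simp
    qed
    show "integrable lebesgue (h n)"
      by (rule Bochner_Integration.integrable_bound[OF w_i h_m]) (use h_b in auto)
    show "L2_norm (\<lambda>x. f x - h n x) < e"
      using L2_norm_triangle_diff[OF f fkL hL[of n]] n k(1)
      by (simp add: fk_def[abs_def] L2_norm_diff_commute[of f] L2_norm_diff_commute[of _ "h n"])
  qed (use h_c hL in auto)
qed

text \<open>Fubini's theorem concerns product measures, and the product of two Lebesgue measures is not complete; Borel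
  representatives carry statements about \<open>lebesgue\<close> over to \<open>lborel\<close> and its products.\<close>

lemma lebesgue_borel_representative:
  fixes f :: "'a::euclidean_space \<Rightarrow> 'b::euclidean_space"
  assumes "f \<in> Lmeas"
  obtains g where "g \<in> borel_measurable borel" "AE x in lebesgue. f x = g x"
proof -
  have "\<exists>g'\<in>borel_measurable lborel. AE x in lborel. f x \<bullet> b = g' x" for b
    using assms by (intro completion_ex_borel_measurable_real) auto
  then obtain G where G: "\<And>b. G b \<in> borel_measurable lborel" "\<And>b. AE x in lborel. f x \<bullet> b = G b x"
    by metis
  have [measurable]: "G b \<in> borel_measurable borel" for b using G(1) by simp
  show thesis
  proof
    show "(\<lambda>x. \<Sum>b\<in>Basis. G b x *\<^sub>R b) \<in> borel_measurable borel" by measurable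
    have "AE x in lborel. \<forall>b\<in>Basis. f x \<bullet> b = G b x"
      using G(2) by (intro AE_finite_allI) auto
    then have "AE x in lborel. f x = (\<Sum>b\<in>Basis. G b x *\<^sub>R b)"
      by eventually_elim (metis (no_types, lifting) euclidean_representation sum.cong)
    then show "AE x in lebesgue. f x = (\<Sum>b\<in>Basis. G b x *\<^sub>R b)" by (rule AE_completion)
  qed
qed

section \<open>Euclidean isometries and the Fourier integral\<close>

lemma isometry_lebesgue:
  fixes a :: "'a::euclidean_space"
  assumes c: "c = 1 \<or> c = -1"
  shows lebesgue_distr_isometry: "distr lebesgue lebesgue (\<lambda>x. a + c *\<^sub>R x) = lebesgue"
    and measurable_lebesgue_isometry: "(\<lambda>x. a + c *\<^sub>R x) \<in> lebesgue \<rightarrow>\<^sub>M lebesgue"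
proof -
  have eq: "(\<Sum>j\<in>Basis. (c * (x \<bullet> j)) *\<^sub>R j) = c *\<^sub>R x" for x :: 'a
    by (metis (no_types, lifting) euclidean_representation scaleR_scaleR scaleR_sum_right sum.cong)
  have "c \<noteq> 0" using c by auto
  have "(\<Prod>j\<in>(Basis::'a set). \<bar>c\<bar>) = 1" using c by auto
  then have "(lebesgue :: 'a measure) = density (distr lebesgue lebesgue (\<lambda>x. a + c *\<^sub>R x)) (\<lambda>_. ennreal 1)"
    using lebesgue_affine_euclidean[of "\<lambda>_. c" a] \<open>c \<noteq> 0\<close> eq by simp
  then show "distr lebesgue lebesgue (\<lambda>x. a + c *\<^sub>R x) = lebesgue"
    by (simp add: density_1)
  show "(\<lambda>x. a + c *\<^sub>R x) \<in> lebesgue \<rightarrow>\<^sub>M lebesgue"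
    using lebesgue_affine_measurable[of "\<lambda>_. c" a] \<open>c \<noteq> 0\<close> eq by simp
qed

lemma
  fixes f :: "'a::euclidean_space \<Rightarrow> 'b::euclidean_space"
  assumes c: "c = 1 \<or> c = -1" and f: "f \<in> Lmeas"
  shows borel_measurable_isometry: "(\<lambda>x. f (a + c *\<^sub>R x)) \<in> Lmeas"
    and integrable_isometry: "integrable lebesgue (\<lambda>x. f (a + c *\<^sub>R x)) \<longleftrightarrow> integrable lebesgue f"
    and integral_isometry: "(LINT x|lebesgue. f (a + c *\<^sub>R x)) = (LINT x|lebesgue. f x)"
proof -
  note m = measurable_lebesgue_isometry[OF c, of a]
  show "(\<lambda>x. f (a + c *\<^sub>R x)) \<in> Lmeas"
    using measurable_compose[OF m f] .
  show "integrable lebesgue (\<lambda>x. f (a + c *\<^sub>R x)) \<longleftrightarrow> integrable lebesgue f"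
    using integrable_distr_eq[OF m f] by (simp add: lebesgue_distr_isometry[OF c])
  show "(LINT x|lebesgue. f (a + c *\<^sub>R x)) = (LINT x|lebesgue. f x)"
    using integral_distr[OF m f] by (simp add: lebesgue_distr_isometry[OF c])
qed

lemma AE_isometry:
  fixes a :: "'a::euclidean_space"
  assumes c: "c = 1 \<or> c = -1" and P: "AE x in lebesgue. P x"
  shows "AE x in lebesgue. P (a + c *\<^sub>R x)"
proof -
  have "AE x in distr lebesgue lebesgue (\<lambda>x. a + c *\<^sub>R x). P x"
    unfolding lebesgue_distr_isometry[OF c] by (rule P)
  then show ?thesis by (rule AE_distrD[OF measurable_lebesgue_isometry[OF c]])
qed

lemma
  assumes c: "c = 1 \<or> c = -1" and f: "L2 f"
  shows L2_isometry: "L2 (\<lambda>x. f (a + c *\<^sub>R x))"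
    and L2_norm_isometry: "L2_norm (\<lambda>x. f (a + c *\<^sub>R x)) = L2_norm f"
proof -
  have m: "f \<in> Lmeas" and m2: "(\<lambda>x. (norm (f x))\<^sup>2) \<in> Lmeas"
    using f by (auto simp: L2_def)
  show "L2 (\<lambda>x. f (a + c *\<^sub>R x))"
    using f borel_measurable_isometry[OF c m] integrable_isometry[OF c m2] by (simp add: L2_def)
  show "L2_norm (\<lambda>x. f (a + c *\<^sub>R x)) = L2_norm f"
    using integral_isometry[OF c m2] by (simp add: L2_norm_def)
qed

lemma L2_lim_isometry:
  assumes "c = 1 \<or> c = -1" "L2_lim s f"
  shows "L2_lim (\<lambda>n x. s n (a + c *\<^sub>R x)) (\<lambda>x. f (a + c *\<^sub>R x))"
  using assms(2) L2_isometry[OF assms(1)] L2_norm_isometry[OF assms(1) L2_diff, of _ f a]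
  by (auto simp: L2_lim_def)

lemma L2_lim_mult_bounded:
  fixes m :: "'a::euclidean_space \<Rightarrow> complex"
  assumes m: "m \<in> Lmeas" "\<And>x. norm (m x) \<le> B" and s: "L2_lim s f"
  shows "L2_lim (\<lambda>n x. m x * s n x) (\<lambda>x. m x * f x)"
proof -
  have B: "0 \<le> B" using m(2)[of undefined] norm_ge_zero order_trans by blast
  have *: "L2 (\<lambda>x. m x * g x)" "L2_norm (\<lambda>x. m x * g x) \<le> B * L2_norm g" if "L2 g" for g :: "'a \<Rightarrow> complex"
  proof -
    have "(\<lambda>x. m x * g x) \<in> Lmeas" using m(1) that by (auto simp: L2_def)
    moreover have "AE x in lebesgue. norm (m x * g x) \<le> B * norm (g x)"
      using m(2) by (simp add: norm_mult mult_right_mono)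
    ultimately show "L2 (\<lambda>x. m x * g x)" "L2_norm (\<lambda>x. m x * g x) \<le> B * L2_norm g"
      using L2_dominated[OF that _ _ B] by auto
  qed
  have L: "L2 (s n)" "L2 f" for n using s by (auto simp: L2_lim_def)
  have "(\<lambda>n. L2_norm (\<lambda>x. m x * s n x - m x * f x)) \<longlonglongrightarrow> 0"
  proof (rule Lim_null_comparison)
    show "\<forall>\<^sub>F n in sequentially. norm (L2_norm (\<lambda>x. m x * s n x - m x * f x)) \<le> B * L2_norm (\<lambda>x. s n x - f x)"
      using *(2)[OF L2_diff[OF L]] by (simp add: right_diff_distrib)
    show "(\<lambda>n. B * L2_norm (\<lambda>x. s n x - f x)) \<longlonglongrightarrow> 0"
      using s by (auto simp: L2_lim_def intro: tendsto_mult_right_zero)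
  qed
  then show ?thesis using L * by (simp add: L2_lim_def)
qed

lemma L2_lim_cong_AE:
  assumes "L2_lim s f" "\<And>n. AE x in lebesgue. s n x = t n x" "AE x in lebesgue. f x = g x"
  shows "L2_lim t g"
proof -
  have L: "L2 (s n)" "L2 f" for n using assms(1) by (auto simp: L2_lim_def)
  have "L2_norm (\<lambda>x. s n x - f x) = L2_norm (\<lambda>x. t n x - g x)" for n
    using assms(2)[of n] assms(3) L2_diff[OF L, of n]
    by (intro L2_norm_cong_AE) (auto simp: L2_def)
  then show ?thesis
    using assms L by (auto simp: L2_lim_def intro: L2_cong_AE)
qed

definition ft_const :: real where "ft_const = 1 / (2 * pi) powr (3/2)"

lemma ft_const_pos: "ft_const > 0" by (simp add: ft_const_def)

text \<open>The Fourier integral of a scalar function, which is meaningful for integrable functions only; \<open>is_ft\<close>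
  below extends it to \<open>L\<^sup>2\<close>. The normalisation makes it unitary.\<close>

definition ft :: "(real^3 \<Rightarrow> complex) \<Rightarrow> real^3 \<Rightarrow> complex" where
  "ft f \<xi> = ft_const *\<^sub>R (LINT x|lebesgue. cis (- (x \<bullet> \<xi>)) * f x)"

lemma continuous_cis_inner [continuous_intros]:
  "continuous_on A f \<Longrightarrow> continuous_on A (\<lambda>x. cis (f x))"
  unfolding cis_conv_exp by (intro continuous_intros)

lemma borel_measurable_cis [measurable (raw)]:
  "f \<in> borel_measurable M \<Longrightarrow> (\<lambda>x. cis (f x)) \<in> borel_measurable M"
  by (rule borel_measurable_continuous_on[where f=cis]) (auto intro!: continuous_intros)

lemma cis_inner_measurable [measurable]:
  "(\<lambda>x::'a::euclidean_space. cis (x \<bullet> \<xi>)) \<in> Lmeas"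
  "(\<lambda>x::'a::euclidean_space. cis (\<xi> \<bullet> x)) \<in> Lmeas"
  "(\<lambda>x::'a::euclidean_space. cis (- (x \<bullet> \<xi>))) \<in> Lmeas"
  "(\<lambda>x::'a::euclidean_space. cis (- (\<xi> \<bullet> x))) \<in> Lmeas"
  by (auto intro!: measurable_completion borel_measurable_cis)

lemma integrable_mult_bounded:
  fixes m f :: "'a \<Rightarrow> complex"
  assumes f: "integrable M f" and m: "m \<in> borel_measurable M" "\<And>x. norm (m x) \<le> B"
  shows "integrable M (\<lambda>x. m x * f x)"
proof (rule Bochner_Integration.integrable_bound)
  show "integrable M (\<lambda>x. B * norm (f x))" using f by simp
  show "AE x in M. norm (m x * f x) \<le> norm (B * norm (f x))"
  proof (rule AE_I2)
    fix x
    have B: "0 \<le> B" using m(2)[of x] norm_ge_zero order_trans by blast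
    show "norm (m x * f x) \<le> norm (B * norm (f x))"
      using m(2)[of x] B by (simp add: norm_mult abs_mult mult_right_mono)
  qed
qed (use f m in auto)

lemma ft_integrand_integrable:
  assumes "integrable lebesgue f"
  shows "integrable lebesgue (\<lambda>x. cis (- (x \<bullet> \<xi>)) * f x)" "integrable lebesgue (\<lambda>x. cis (x \<bullet> \<xi>) * f x)"
        "integrable lebesgue (\<lambda>x. cis (- (\<xi> \<bullet> x)) * f x)" "integrable lebesgue (\<lambda>x. cis (\<xi> \<bullet> x) * f x)"
  by (rule integrable_mult_bounded[OF assms, where B=1]; simp)+

lemma ft_bound:
  assumes "integrable lebesgue f"
  shows "norm (ft f \<xi>) \<le> ft_const * (LINT x|lebesgue. norm (f x))"
proof -
  have "norm (LINT x|lebesgue. cis (- (x \<bullet> \<xi>)) * f x) \<le> (LINT x|lebesgue. norm (cis (- (x \<bullet> \<xi>)) * f x))"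
    by (rule integral_norm_bound)
  then show ?thesis using ft_const_pos by (simp add: ft_def norm_mult)
qed

lemma ft_cong_AE:
  assumes "f \<in> Lmeas" "AE x in lebesgue. f x = g x"
  shows "ft f \<xi> = ft g \<xi>"
proof -
  have "g \<in> Lmeas" using assms by (rule borel_measurable_AE)
  then show ?thesis unfolding ft_def using assms
    by (intro arg_cong[where f="\<lambda>z. ft_const *\<^sub>R z"] integral_cong_AE) (auto elim!: eventually_mono)
qed

lemma ft_diff:
  assumes "integrable lebesgue f" "integrable lebesgue g"
  shows "ft (\<lambda>x. f x - g x) \<xi> = ft f \<xi> - ft g \<xi>"
  using assms by (simp add: ft_def right_diff_distrib ft_integrand_integrable scaleR_diff_right)

lemma ft_add:
  assumes "integrable lebesgue f" "integrable lebesgue g"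
  shows "ft (\<lambda>x. f x + g x) \<xi> = ft f \<xi> + ft g \<xi>"
  using assms by (simp add: ft_def distrib_left ft_integrand_integrable scaleR_add_right)

lemma ft_cmult: "ft (\<lambda>x. c * f x) \<xi> = c * ft f \<xi>"
proof -
  have "(LINT x|lebesgue. cis (- (x \<bullet> \<xi>)) * (c * f x)) = (LINT x|lebesgue. c * (cis (- (x \<bullet> \<xi>)) * f x))"
    by (simp add: mult_ac)
  also have "\<dots> = c * (LINT x|lebesgue. cis (- (x \<bullet> \<xi>)) * f x)"
    by (rule integral_mult_right_zero)
  finally show ?thesis by (simp add: ft_def scaleR_conv_of_real mult_ac)
qed

lemma ft_translate:
  assumes "f \<in> Lmeas"
  shows "ft (\<lambda>x. f (a + x)) \<xi> = cis (a \<bullet> \<xi>) * ft f \<xi>"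
proof -
  have "(\<lambda>x. cis (- ((x - a) \<bullet> \<xi>))) \<in> Lmeas"
    by (intro measurable_completion borel_measurable_cis) measurable
  then have "(\<lambda>x. cis (- ((x - a) \<bullet> \<xi>)) * f x) \<in> Lmeas"
    using assms by (rule borel_measurable_times)
  from integral_isometry[OF _ this, of 1 a]
  have "(LINT x|lebesgue. cis (- (x \<bullet> \<xi>)) * f (a + x)) = (LINT x|lebesgue. cis (- ((x - a) \<bullet> \<xi>)) * f x)"
    by simp
  also have "\<dots> = (LINT x|lebesgue. cis (a \<bullet> \<xi>) * (cis (- (x \<bullet> \<xi>)) * f x))"
    by (rule Bochner_Integration.integral_cong[OF refl]) (simp add: inner_diff_left cis_mult flip: mult.assoc)
  also have "\<dots> = cis (a \<bullet> \<xi>) * (LINT x|lebesgue. cis (- (x \<bullet> \<xi>)) * f x)"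
    by (rule integral_mult_right_zero)
  finally show ?thesis by (simp add: ft_def)
qed

lemma ft_reflect:
  assumes "f \<in> Lmeas"
  shows "ft (\<lambda>x. f (- x)) \<xi> = ft f (- \<xi>)"
proof -
  have "(\<lambda>x. cis (x \<bullet> \<xi>) * f x) \<in> Lmeas"
    using assms by measurable
  from integral_isometry[OF _ this, of "-1" 0] show ?thesis by (simp add: ft_def)
qed

lemma ft_cnj:
  assumes "integrable lebesgue f"
  shows "ft (\<lambda>x. cnj (f x)) \<xi> = cnj (ft f (- \<xi>))"
proof -
  have "cnj (LINT x|lebesgue. cis (x \<bullet> \<xi>) * f x) = (LINT x|lebesgue. cnj (cis (x \<bullet> \<xi>) * f x))"
    by (rule integral_bounded_linear[OF bounded_linear_cnj ft_integrand_integrable(2)[OF assms], symmetric])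
  then show ?thesis by (simp add: ft_def cis_cnj)
qed

lemma continuous_on_integral_bounded:
  fixes f :: "'b::euclidean_space \<Rightarrow> 'a \<Rightarrow> 'c::{banach,second_countable_topology}"
  assumes m: "\<And>y. f y \<in> borel_measurable M"
    and c: "\<And>x. continuous_on UNIV (\<lambda>y. f y x)"
    and b: "\<And>y. AE x in M. norm (f y x) \<le> w x" and w: "integrable M w"
  shows "continuous_on UNIV (\<lambda>y. LINT x|M. f y x)"
  unfolding continuous_on_sequentially
proof (intro ballI allI impI, elim conjE)
  fix s :: "nat \<Rightarrow> 'b" and a assume s: "s \<longlonglongrightarrow> a"
  have "(\<lambda>n. LINT x|M. f (s n) x) \<longlonglongrightarrow> (LINT x|M. f a x)"
  proof (rule integral_dominated_convergence[OF m m w _ b])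
    show "AE x in M. (\<lambda>n. f (s n) x) \<longlonglongrightarrow> f a x"
      using c s by (auto simp: continuous_on_sequentially o_def)
  qed
  then show "((\<lambda>y. LINT x|M. f y x) \<circ> s) \<longlonglongrightarrow> (LINT x|M. f a x)" by (simp add: o_def)
qed

lemma ft_continuous:
  assumes "integrable lebesgue f"
  shows "continuous_on UNIV (ft f)"
  unfolding ft_def[abs_def]
proof (intro continuous_intros continuous_on_integral_bounded)
  show "integrable lebesgue (\<lambda>x. norm (f x))" using assms by simp
  show "(\<lambda>x. cis (- (x \<bullet> y)) * f x) \<in> Lmeas" for y
    using ft_integrand_integrable(1)[OF assms] by auto
qed (auto simp: norm_mult intro!: continuous_intros)

lemma ft_measurable: "integrable lebesgue f \<Longrightarrow> ft f \<in> Lmeas"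
  using borel_measurable_continuous_onI[OF ft_continuous] by (simp add: measurable_completion)

text \<open>Fubini for the kernel \<open>cis (- (x \<bullet> \<xi>))\<close>, which is symmetric in \<open>x\<close> and
  \<open>\<xi>\<close>.\<close>

lemma ft_multiplication_formula:
  assumes f: "integrable lebesgue f" and g: "integrable lebesgue g"
  shows "(LINT \<xi>|lebesgue. ft f \<xi> * g \<xi>) = (LINT x|lebesgue. f x * ft g x)"
proof -
  obtain f' where f': "f' \<in> borel_measurable borel" "AE x in lebesgue. f x = f' x"
    by (rule lebesgue_borel_representative[OF borel_measurable_integrable[OF f]])
  obtain g' where g': "g' \<in> borel_measurable borel" "AE x in lebesgue. g x = g' x"
    by (rule lebesgue_borel_representative[OF borel_measurable_integrable[OF g]])
  note [measurable] = f'(1) g'(1)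
  have m: "f' \<in> Lmeas" "g' \<in> Lmeas"
    using f'(1) g'(1) by (simp_all add: measurable_completion)
  have i: "integrable lebesgue f'" "integrable lebesgue g'"
    by (rule integrable_cong_AE_imp[OF f m(1) f'(2)], rule integrable_cong_AE_imp[OF g m(2) g'(2)])
  then have i2: "integrable lborel f'" "integrable lborel g'"
    using f' g' by (auto simp: integrable_completion)
  have ftf: "ft f = ft f'" and ftg: "ft g = ft g'"
    using f g f' g' by (auto intro!: ext ft_cong_AE)
  have [measurable]: "ft f' \<in> borel_measurable borel" "ft g' \<in> borel_measurable borel"
    using i by (auto intro: borel_measurable_continuous_onI ft_continuous)
  have ftb: "ft h \<xi> = ft_const *\<^sub>R (LINT x|lborel. cis (- (x \<bullet> \<xi>)) * h x)" if [measurable]: "h \<in> borel_measurable borel" for h \<xi>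
  proof -
    have "(\<lambda>x. cis (- (x \<bullet> \<xi>)) * h x) \<in> borel_measurable lborel" by measurable
    from integral_completion[OF this] show ?thesis unfolding ft_def by simp
  qed
  have "integrable (lborel \<Otimes>\<^sub>M lborel) (\<lambda>z. f' (fst z) * g' (snd z))"
    by (rule lborel_pair.Fubini_integrable) (use i2 in \<open>auto simp: norm_mult\<close>)
  then have "integrable (lborel \<Otimes>\<^sub>M lborel) (\<lambda>z. cis (- (fst z \<bullet> snd z)) * (f' (fst z) * g' (snd z)))"
    by (intro integrable_mult_bounded[where B=1 and m="\<lambda>z. cis (- (fst z \<bullet> snd z))"]) auto
  then have Fi: "integrable (lborel \<Otimes>\<^sub>M lborel) (\<lambda>(x, \<xi>). cis (- (x \<bullet> \<xi>)) * (f' x * g' \<xi>))"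
    by (simp add: case_prod_beta')
  have "(LINT \<xi>|lebesgue. ft f \<xi> * g \<xi>) = (LINT \<xi>|lebesgue. ft f' \<xi> * g' \<xi>)"
    unfolding ftf using g' g i m
    by (intro integral_cong_AE borel_measurable_times ft_measurable) (auto elim!: eventually_mono)
  also have "\<dots> = (LINT \<xi>|lborel. ft f' \<xi> * g' \<xi>)" by (rule integral_completion) measurable
  also have "\<dots> = ft_const *\<^sub>R (LINT \<xi>|lborel. LINT x|lborel. cis (- (x \<bullet> \<xi>)) * (f' x * g' \<xi>))"
    unfolding ftb[OF f'(1)] by (simp flip: integral_mult_left_zero mult.assoc)
  also have "\<dots> = ft_const *\<^sub>R (LINT x|lborel. LINT \<xi>|lborel. cis (- (x \<bullet> \<xi>)) * (f' x * g' \<xi>))"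
    using lborel_pair.Fubini_integral[OF Fi] by simp
  also have "\<dots> = (LINT x|lborel. f' x * ft g' x)"
    unfolding ftb[OF g'(1)]
    by (simp add: inner_commute mult.left_commute flip: integral_mult_right_zero)
  also have "\<dots> = (LINT x|lebesgue. f' x * ft g' x)" by (rule integral_completion[symmetric]) measurable
  also have "\<dots> = (LINT x|lebesgue. f x * ft g x)"
    unfolding ftg using f' f i m
    by (intro integral_cong_AE borel_measurable_times ft_measurable) (auto elim!: eventually_mono)
  finally show ?thesis .
qed

section \<open>Gaussians and Bessel's inequality\<close>

lemma
  fixes f :: "'a::euclidean_space \<Rightarrow> real \<Rightarrow> complex"
  assumes f: "\<And>b. b \<in> Basis \<Longrightarrow> integrable lborel (f b)"
  shows lborel_integrable_prod_Basis: "integrable lborel (\<lambda>x::'a. \<Prod>b\<in>Basis. f b (x \<bullet> b))"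
    and lborel_integral_prod_Basis:
      "(LINT x|lborel. (\<Prod>b\<in>(Basis::'a set). f b (x \<bullet> b))) = (\<Prod>b\<in>Basis. (LINT t|lborel. f b t))"
proof -
  interpret P: product_sigma_finite "\<lambda>_::'a. lborel :: real measure"
    by (rule product_sigma_finite.intro) (rule sigma_finite_lborel)
  let ?T = "\<lambda>g::'a \<Rightarrow> real. \<Sum>b\<in>Basis. g b *\<^sub>R b"
  have T: "?T \<in> (\<Pi>\<^sub>M b\<in>Basis. lborel) \<rightarrow>\<^sub>M borel" by measurable
  have fm: "f b \<in> borel_measurable borel" if "b \<in> Basis" for b
    using borel_measurable_integrable[OF f[OF that]] by simp
  then have m: "(\<lambda>x::'a. \<Prod>b\<in>Basis. f b (x \<bullet> b)) \<in> borel_measurable borel"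
    by (intro borel_measurable_prod measurable_compose[OF _ fm]) auto
  have eq: "(\<Prod>b\<in>Basis. f b (?T g \<bullet> b)) = (\<Prod>b\<in>Basis. f b (g b))" for g
    by (intro prod.cong refl) simp
  show "integrable lborel (\<lambda>x::'a. \<Prod>b\<in>Basis. f b (x \<bullet> b))"
    by (subst lborel_eq, subst integrable_distr_eq[OF T m], unfold eq, rule P.product_integrable_prod)
       (use f in auto)
  show "(LINT x|lborel. (\<Prod>b\<in>(Basis::'a set). f b (x \<bullet> b))) = (\<Prod>b\<in>Basis. (LINT t|lborel. f b t))"
    by (subst lborel_eq, subst integral_distr[OF T m], unfold eq, rule P.product_integral_prod)
       (use f in auto)
qed

text \<open>The characteristic function of the standard normal distribution, rescaled.\<close>

lemma gaussian_integral_real: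
  fixes e s :: real
  assumes e: "e > 0"
  shows "integrable lborel (\<lambda>t. cis (- (s * t)) * complex_of_real (exp (- (e / 2) * t\<^sup>2)))"
    and "(LINT t|lborel. cis (- (s * t)) * complex_of_real (exp (- (e / 2) * t\<^sup>2)))
      = complex_of_real (sqrt (2 * pi / e) * exp (- (s\<^sup>2 / (2 * e))))"
proof -
  define h where "h t = complex_of_real (std_normal_density t) * cis (- (s / sqrt e) * t)" for t
  have hi: "integrable lborel h"
  proof -
    have "integrable lborel (\<lambda>t. cis (- (s / sqrt e) * t) * complex_of_real (std_normal_density t))"
      by (rule integrable_mult_bounded[where B=1]) (auto intro!: borel_measurable_cis)
    then show ?thesis unfolding h_def by (simp add: mult.commute)
  qed
  have "(LINT t|lborel. h t) = char std_normal_distribution (- (s / sqrt e))"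
    unfolding char_def h_def
    by (subst integral_density) (auto simp: scaleR_conv_of_real cis_conv_exp mult_ac)
  also have "\<dots> = complex_of_real (exp (- ((s / sqrt e)\<^sup>2) / 2))"
    by (simp add: char_std_normal_distribution)
  finally have hI: "(LINT t|lborel. h t) = complex_of_real (exp (- (s\<^sup>2 / (2 * e))))"
    using e by (simp add: power_divide)
  have h_scale: "h (0 + sqrt e * t) = complex_of_real (1 / sqrt (2 * pi)) * (cis (- (s * t)) * complex_of_real (exp (- (e / 2) * t\<^sup>2)))" for t
    using e by (simp add: h_def std_normal_density_def power_mult_distrib mult_ac)
  have "integrable lborel (\<lambda>t. h (0 + sqrt e * t))"
    by (rule lborel_integrable_real_affine[OF hi]) (use e in simp)
  then have "integrable lborel (\<lambda>t. complex_of_real (sqrt (2 * pi)) * h (0 + sqrt e * t))"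
    by (rule integrable_mult_right)
  then show "integrable lborel (\<lambda>t. cis (- (s * t)) * complex_of_real (exp (- (e / 2) * t\<^sup>2)))"
    unfolding h_scale by (simp flip: mult.assoc of_real_mult)
  have "(LINT t|lborel. h t) = \<bar>sqrt e\<bar> *\<^sub>R (LINT t|lborel. h (0 + sqrt e * t))"
    by (rule lborel_integral_real_affine) (use e in simp)
  then have *: "complex_of_real (exp (- (s\<^sup>2 / (2 * e))))
      = complex_of_real (sqrt e / sqrt (2 * pi)) * (LINT t|lborel. cis (- (s * t)) * complex_of_real (exp (- (e / 2) * t\<^sup>2)))"
    unfolding hI h_scale using e by (simp add: scaleR_conv_of_real)
  have "complex_of_real (sqrt (2 * pi / e)) * complex_of_real (sqrt e / sqrt (2 * pi)) = 1"
    using e by (simp add: real_sqrt_divide flip: of_real_mult)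
  then show "(LINT t|lborel. cis (- (s * t)) * complex_of_real (exp (- (e / 2) * t\<^sup>2)))
      = complex_of_real (sqrt (2 * pi / e) * exp (- (s\<^sup>2 / (2 * e))))"
    unfolding of_real_mult * by (simp flip: mult.assoc)
qed

lemma borel_measurable_cnj [measurable (raw)]:
  "f \<in> borel_measurable M \<Longrightarrow> (\<lambda>x. cnj (f x)) \<in> borel_measurable M"
  by (rule borel_measurable_continuous_on[where f=cnj]) (auto intro!: continuous_intros)

definition gaussian :: "real \<Rightarrow> real^3 \<Rightarrow> complex" where
  "gaussian e x = complex_of_real (exp (- (e / 2) * (norm x)\<^sup>2))"

lemma gaussian_continuous: "continuous_on UNIV (gaussian e)"
  unfolding gaussian_def by (intro continuous_intros)

lemma norm_gaussian_le: "0 \<le> e \<Longrightarrow> norm (gaussian e x) \<le> 1"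
  by (simp add: gaussian_def)

lemma norm_power2_Basis: "(norm x)\<^sup>2 = (\<Sum>b\<in>Basis. (x \<bullet> b)\<^sup>2)"
  by (subst power2_norm_eq_inner, subst euclidean_inner) (simp add: power2_eq_square)

lemma cis_sum: "finite I \<Longrightarrow> cis (\<Sum>i\<in>I. f i) = (\<Prod>i\<in>I. cis (f i))"
  by (induction I rule: finite_induct) (auto simp flip: cis_mult)

lemma gaussian_factor:
  "cis (- (x \<bullet> \<xi>)) * gaussian e x
    = (\<Prod>b\<in>Basis. cis (- ((\<xi> \<bullet> b) * (x \<bullet> b))) * complex_of_real (exp (- (e / 2) * (x \<bullet> b)\<^sup>2)))"
proof -
  have "cis (- (x \<bullet> \<xi>)) = (\<Prod>b\<in>Basis. cis (- ((\<xi> \<bullet> b) * (x \<bullet> b))))"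
    by (subst euclidean_inner) (simp add: cis_sum mult.commute flip: sum_negf)
  moreover have "exp (- (e / 2) * (norm x)\<^sup>2) = (\<Prod>b\<in>Basis. exp (- (e / 2) * (x \<bullet> b)\<^sup>2))"
    by (subst norm_power2_Basis) (simp add: exp_sum sum_distrib_left flip: sum_negf)
  ultimately show ?thesis by (simp add: gaussian_def prod.distrib)
qed

lemma gaussian_integrable:
  assumes "e > 0" shows "integrable lebesgue (gaussian e)"
proof -
  have "integrable lborel (\<lambda>x. cis (- (x \<bullet> 0)) * gaussian e x)"
    unfolding gaussian_factor by (rule lborel_integrable_prod_Basis) (rule gaussian_integral_real(1)[OF assms])
  then show ?thesis
    using borel_measurable_continuous_onI[OF gaussian_continuous] by (simp add: integrable_completion)
qed

lemma sqrt_cubed: "x > 0 \<Longrightarrow> sqrt x ^ 3 = x powr (3 / 2)"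
  by (simp add: powr_half_sqrt[symmetric] powr_power)

lemma ft_gaussian:
  assumes e: "e > 0"
  shows "ft (gaussian e) \<xi> = complex_of_real (e powr (- 3 / 2)) * gaussian (1 / e) \<xi>"
proof -
  have m: "(\<lambda>x. cis (- (x \<bullet> \<xi>)) * gaussian e x) \<in> borel_measurable lborel"
    using borel_measurable_continuous_onI[OF gaussian_continuous[of e]] by (simp add: borel_measurable_cis)
  have "(LINT x|lebesgue. cis (- (x \<bullet> \<xi>)) * gaussian e x) = (LINT x|lborel. cis (- (x \<bullet> \<xi>)) * gaussian e x)"
    by (rule integral_completion[OF m])
  also have "\<dots> = (\<Prod>b\<in>(Basis::(real^3) set). complex_of_real (sqrt (2 * pi / e) * exp (- ((\<xi> \<bullet> b)\<^sup>2 / (2 * e)))))"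
    unfolding gaussian_factor
    by (subst lborel_integral_prod_Basis[OF gaussian_integral_real(1)[OF e]])
       (simp only: gaussian_integral_real(2)[OF e])
  also have "\<dots> = complex_of_real (sqrt (2 * pi / e) ^ 3 * exp (\<Sum>b\<in>(Basis::(real^3) set). - ((\<xi> \<bullet> b)\<^sup>2 / (2 * e))))"
    by (simp add: prod.distrib exp_sum)
  also have "(\<Sum>b\<in>(Basis::(real^3) set). - ((\<xi> \<bullet> b)\<^sup>2 / (2 * e))) = - ((1 / e) / 2) * (norm \<xi>)\<^sup>2"
    by (subst norm_power2_Basis) (simp add: sum_distrib_left sum_negf field_simps)
  also have "sqrt (2 * pi / e) ^ 3 = (2 * pi / e) powr (3 / 2)"
    using e by (intro sqrt_cubed) simp
  also have "\<dots> = (2 * pi) powr (3 / 2) * e powr (- 3 / 2)"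
    using e by (simp add: powr_divide powr_minus_divide)
  finally show ?thesis
    unfolding ft_def gaussian_def ft_const_def
    by (simp add: scaleR_conv_of_real)
qed

text \<open>The heat kernel at time \<open>e / 2\<close>: the transform of a Gaussian, normalised to have integral one.\<close>

definition heat_kernel :: "real \<Rightarrow> real^3 \<Rightarrow> real" where
  "heat_kernel e x = ft_const * e powr (- 3 / 2) * exp (- (norm x)\<^sup>2 / (2 * e))"

lemma heat_kernel_nonneg: "0 \<le> heat_kernel e x"
  using ft_const_pos by (simp add: heat_kernel_def)

lemma heat_kernel_measurable [measurable]: "heat_kernel e \<in> borel_measurable borel"
  unfolding heat_kernel_def by measurable

lemma heat_kernel_eq_ft: "e > 0 \<Longrightarrow> complex_of_real (heat_kernel e x) = ft_const *\<^sub>R ft (gaussian e) x"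
  by (simp add: ft_gaussian heat_kernel_def gaussian_def scaleR_conv_of_real field_simps)

lemma heat_kernel_has_integral:
  assumes e: "e > 0"
  shows "integrable lebesgue (heat_kernel e)" "(LINT x|lebesgue. heat_kernel e x) = 1"
proof -
  have eq: "complex_of_real (heat_kernel e x) = complex_of_real (ft_const * e powr (- 3 / 2)) * gaussian (1 / e) x" for x
    by (simp add: heat_kernel_def gaussian_def)
  have "integrable lebesgue (\<lambda>x. complex_of_real (heat_kernel e x))"
    unfolding eq using gaussian_integrable[of "1 / e"] e by (intro integrable_mult_right) auto
  then show i: "integrable lebesgue (heat_kernel e)" by (simp only: complex_of_real_integrable_eq)
  have "complex_of_real (LINT x|lebesgue. heat_kernel e x) = (LINT x|lebesgue. complex_of_real (heat_kernel e x))"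
    by simp
  also have "\<dots> = complex_of_real (ft_const * e powr (- 3 / 2)) * (LINT x|lebesgue. gaussian (1 / e) x)"
    unfolding eq by (rule integral_mult_right_zero)
  also have "\<dots> = complex_of_real (e powr (- 3 / 2)) * ft (gaussian (1 / e)) 0"
    by (simp add: ft_def scaleR_conv_of_real)
  also have "\<dots> = complex_of_real (e powr (- 3 / 2) * (1 / e) powr (- 3 / 2))"
    using e by (simp add: ft_gaussian gaussian_def)
  also have "e powr (- 3 / 2) * (1 / e) powr (- 3 / 2) = 1"
    using e by (simp add: powr_mult[symmetric])
  finally show "(LINT x|lebesgue. heat_kernel e x) = 1" by (simp only: of_real_eq_iff of_real_1 of_real_eq_1_iff)
qed

text \<open>Inversion with Gaussian damping. The multiplication formula moves the transform from \<open>f\<close> to the modulated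
  Gaussian and turns damping into convolution with the heat kernel, up to a reflection.\<close>

lemma ft_gaussian_mult_ft:
  assumes e: "e > 0" and f: "integrable lebesgue f"
  shows "ft (\<lambda>\<xi>. gaussian e \<xi> * ft f \<xi>) x = (LINT y|lebesgue. f y * complex_of_real (heat_kernel e (x + y)))"
proof -
  let ?g = "\<lambda>\<xi>. cis (- (x \<bullet> \<xi>)) * gaussian e \<xi>"
  have gi: "integrable lebesgue ?g"
    using ft_integrand_integrable(3)[OF gaussian_integrable[OF e]] .
  have ftg: "ft ?g y = ft (gaussian e) (x + y)" for y
    unfolding ft_def
    by (simp only: mult.assoc[symmetric] cis_mult) (simp add: inner_add_right inner_commute algebra_simps)
  have "ft (\<lambda>\<xi>. gaussian e \<xi> * ft f \<xi>) x = ft_const *\<^sub>R (LINT \<xi>|lebesgue. ft f \<xi> * ?g \<xi>)"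
    unfolding ft_def[of "\<lambda>\<xi>. gaussian e \<xi> * ft f \<xi>"] by (simp add: inner_commute mult_ac)
  also have "\<dots> = ft_const *\<^sub>R (LINT y|lebesgue. f y * ft (gaussian e) (x + y))"
    by (simp add: ft_multiplication_formula[OF f gi] ftg)
  also have "\<dots> = (LINT y|lebesgue. f y * complex_of_real (heat_kernel e (x + y)))"
    using heat_kernel_eq_ft[OF e] by (simp add: mult.left_commute scaleR_conv_of_real flip: integral_mult_right_zero)
  finally show ?thesis .
qed

lemma nn_integral_heat_kernel:
  assumes e: "e > 0"
  shows "(\<integral>\<^sup>+y. ennreal (heat_kernel e (y - x)) \<partial>lborel) = 1" "(\<integral>\<^sup>+y. ennreal (heat_kernel e (x - y)) \<partial>lborel) = 1"
proof -
  have i: "integrable lborel (heat_kernel e)" "(LINT x|lborel. heat_kernel e x) = 1"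
    using heat_kernel_has_integral[OF e] by (auto simp: integrable_completion integral_completion)
  have "(\<integral>\<^sup>+y. ennreal (heat_kernel e (y - x)) \<partial>lborel)
      = (\<integral>\<^sup>+y. ennreal (heat_kernel e (y - x)) \<partial>distr lborel borel ((+) x))"
    by (simp add: lborel_distr_plus)
  also have "\<dots> = (\<integral>\<^sup>+y. ennreal (heat_kernel e y) \<partial>lborel)"
    by (subst nn_integral_distr) auto
  also have "\<dots> = 1"
    using nn_integral_eq_integral[OF i(1)] i(2) heat_kernel_nonneg by simp
  finally show "(\<integral>\<^sup>+y. ennreal (heat_kernel e (y - x)) \<partial>lborel) = 1" .
  then show "(\<integral>\<^sup>+y. ennreal (heat_kernel e (x - y)) \<partial>lborel) = 1"
    by (simp add: heat_kernel_def norm_minus_commute)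
qed

text \<open>The damped integral of \<open>\<bar>ft f\<bar>\<^sup>2\<close> equals, by the multiplication formula, the double
  integral of \<open>f(x) cnj(f(y)) heat_kernel e (y - x)\<close>. With \<open>\<bar>f(x)\<bar> \<bar>f(y)\<bar> \<le>
  (\<bar>f(x)\<bar>\<^sup>2 + \<bar>f(y)\<bar>\<^sup>2) / 2\<close> and the unit mass of the kernel it is at most
  \<open>\<parallel>f\<parallel>\<^sup>2\<close>, for every \<open>e\<close>; Fatou's lemma removes the damping.\<close>

lemma ft_Bessel:
  assumes f: "integrable lebesgue f" and fL: "L2 f"
  shows "L2 (ft f)" "L2_norm (ft f) \<le> L2_norm f"
proof -
  obtain f' where f': "f' \<in> borel_measurable borel" "AE x in lebesgue. f x = f' x"
    by (rule lebesgue_borel_representative[OF borel_measurable_integrable[OF f]])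
  note [measurable] = f'(1)
  have m: "f' \<in> Lmeas" using f'(1) by (simp add: measurable_completion)
  have fi': "integrable lebesgue f'" by (rule integrable_cong_AE_imp[OF f m f'(2)])
  have fL': "L2 f'" by (rule L2_cong_AE[OF fL f'(2)])
  have fteq: "ft f = ft f'" using f f' by (auto intro!: ext ft_cong_AE)
  have [measurable]: "ft f' \<in> Lmeas" by (rule ft_measurable[OF fi'])
  let ?h = "\<lambda>e \<xi>. gaussian (e / 2) \<xi> * ft f' \<xi>"
  have key: "L2 (?h e) \<and> L2_norm (?h e) \<le> L2_norm f'" if e: "e > 0" for e :: real
  proof -
    let ?A = "\<lambda>x. ennreal ((norm (f' x))\<^sup>2)" and ?K = "\<lambda>x y. ennreal (heat_kernel e (y - x))"
    let ?g = "\<lambda>\<xi>. cnj (ft f' \<xi>) * gaussian e \<xi>"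
    have bd: "norm (ft f' \<xi>) \<le> ft_const * (LINT x|lebesgue. norm (f' x))" for \<xi>
      by (rule ft_bound[OF fi'])
    have gi: "integrable lebesgue ?g"
      by (rule integrable_mult_bounded[OF gaussian_integrable[OF e], where B="ft_const * (LINT x|lebesgue. norm (f' x))"]) (use bd in \<open>auto intro!: borel_measurable_cnj\<close>)
    have gi2: "integrable lebesgue (\<lambda>\<xi>. gaussian e \<xi> * ft f' \<xi>)"
      using integrable_mult_bounded[OF gaussian_integrable[OF e], of "ft f'" "ft_const * (LINT x|lebesgue. norm (f' x))"] bd
      by (simp add: mult.commute)
    have ftg: "ft ?g x = cnj (LINT y|lebesgue. f' y * complex_of_real (heat_kernel e (y - x)))" for x
    proof -
      have "?g = (\<lambda>\<xi>. cnj (gaussian e \<xi> * ft f' \<xi>))" by (auto simp: gaussian_def mult.commute)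
      then have "ft ?g x = cnj (ft (\<lambda>\<xi>. gaussian e \<xi> * ft f' \<xi>) (- x))"
        using ft_cnj[OF gi2] by simp
      then show ?thesis by (simp add: ft_gaussian_mult_ft[OF e fi'] add.commute)
    qed
    have normsq: "complex_of_real ((norm (ft f' \<xi>))\<^sup>2 * exp (- (e / 2) * (norm \<xi>)\<^sup>2)) = ft f' \<xi> * ?g \<xi>" for \<xi>
      unfolding gaussian_def using complex_norm_square[of "ft f' \<xi>"] by simp
    have prodi: "integrable lebesgue (\<lambda>\<xi>. ft f' \<xi> * ?g \<xi>)"
      by (rule integrable_mult_bounded[OF gi, where B="ft_const * (LINT x|lebesgue. norm (f' x))"]) (use bd in auto)
    have ri: "integrable lebesgue (\<lambda>\<xi>. (norm (ft f' \<xi>))\<^sup>2 * exp (- (e / 2) * (norm \<xi>)\<^sup>2))"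
      using prodi unfolding normsq[symmetric] by (simp only: complex_of_real_integrable_eq)
    have "(\<integral>\<^sup>+\<xi>. ennreal ((norm (ft f' \<xi>))\<^sup>2 * exp (- (e / 2) * (norm \<xi>)\<^sup>2)) \<partial>lebesgue)
        = ennreal (LINT \<xi>|lebesgue. (norm (ft f' \<xi>))\<^sup>2 * exp (- (e / 2) * (norm \<xi>)\<^sup>2))"
      by (rule nn_integral_eq_integral[OF ri]) simp
    also have "\<dots> = ennreal (norm (LINT \<xi>|lebesgue. ft f' \<xi> * ?g \<xi>))"
    proof -
      have "(LINT \<xi>|lebesgue. ft f' \<xi> * ?g \<xi>) = complex_of_real (LINT \<xi>|lebesgue. (norm (ft f' \<xi>))\<^sup>2 * exp (- (e / 2) * (norm \<xi>)\<^sup>2))"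
        unfolding normsq[symmetric] by (rule integral_complex_of_real)
      moreover have "0 \<le> (LINT \<xi>|lebesgue. (norm (ft f' \<xi>))\<^sup>2 * exp (- (e / 2) * (norm \<xi>)\<^sup>2))"
        by (rule Bochner_Integration.integral_nonneg) simp
      ultimately show ?thesis by simp
    qed
    also have "(LINT \<xi>|lebesgue. ft f' \<xi> * ?g \<xi>) = (LINT x|lebesgue. f' x * ft ?g x)"
      by (rule ft_multiplication_formula[OF fi' gi])
    also have "ennreal (norm \<dots>) \<le> (\<integral>\<^sup>+x. ennreal (norm (f' x * ft ?g x)) \<partial>lebesgue)"
    proof (rule integral_norm_bound_ennreal)
      have "norm (ft ?g x) \<le> ft_const * (LINT x|lebesgue. norm (?g x))" for x by (rule ft_bound[OF gi])
      then have "integrable lebesgue (\<lambda>x. ft ?g x * f' x)"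
        by (rule integrable_mult_bounded[OF fi' ft_measurable[OF gi]])
      then show "integrable lebesgue (\<lambda>x. f' x * ft ?g x)" by (simp add: mult.commute)
    qed
    also have "\<dots> = (\<integral>\<^sup>+x. ennreal (norm (f' x * ft ?g x)) \<partial>lborel)"
      by (rule nn_integral_completion)
    also have "\<dots> \<le> (\<integral>\<^sup>+x. \<integral>\<^sup>+y. ennreal (norm (f' x) * norm (f' y) * heat_kernel e (y - x)) \<partial>lborel \<partial>lborel)"
    proof (rule nn_integral_mono)
      fix x
      have "ennreal (norm (LINT y|lebesgue. f' y * complex_of_real (heat_kernel e (y - x))))
          \<le> (\<integral>\<^sup>+y. ennreal (norm (f' y * complex_of_real (heat_kernel e (y - x)))) \<partial>lborel)"
        using integral_norm_bound_ennreal[of lebesgue "\<lambda>y. f' y * complex_of_real (heat_kernel e (y - x))"]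
        by (cases "integrable lebesgue (\<lambda>y. f' y * complex_of_real (heat_kernel e (y - x)))")
           (auto simp: not_integrable_integral_eq nn_integral_completion)
      then have "ennreal (norm (f' x)) * ennreal (norm (ft ?g x))
          \<le> ennreal (norm (f' x)) * (\<integral>\<^sup>+y. ennreal (norm (f' y * complex_of_real (heat_kernel e (y - x)))) \<partial>lborel)"
        unfolding ftg complex_mod_cnj by (rule mult_left_mono) simp
      also have "\<dots> = (\<integral>\<^sup>+y. ennreal (norm (f' x)) * ennreal (norm (f' y * complex_of_real (heat_kernel e (y - x)))) \<partial>lborel)"
        by (rule nn_integral_cmult[symmetric]) measurable
      also have "\<dots> = (\<integral>\<^sup>+y. ennreal (norm (f' x) * norm (f' y) * heat_kernel e (y - x)) \<partial>lborel)"
        by (intro nn_integral_cong) (simp add: norm_mult heat_kernel_nonneg mult.assoc flip: ennreal_mult')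
      finally show "ennreal (norm (f' x * ft ?g x)) \<le> (\<integral>\<^sup>+y. ennreal (norm (f' x) * norm (f' y) * heat_kernel e (y - x)) \<partial>lborel)"
        by (simp add: norm_mult ennreal_mult')
    qed
    also have "\<dots> \<le> (\<integral>\<^sup>+x. \<integral>\<^sup>+y. ennreal (1/2) * (?A x * ?K x y)
          + ennreal (1/2) * (?A y * ?K x y) \<partial>lborel \<partial>lborel)"
    proof (intro nn_integral_mono)
      fix x y
      have "norm (f' x) * norm (f' y) * heat_kernel e (y - x)
          \<le> (1/2 * (norm (f' x))\<^sup>2 + 1/2 * (norm (f' y))\<^sup>2) * heat_kernel e (y - x)"
        using sum_squares_bound[of "norm (f' x)" "norm (f' y)"]
        by (intro mult_right_mono heat_kernel_nonneg) simp
      then have "ennreal (norm (f' x) * norm (f' y) * heat_kernel e (y - x))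
          \<le> ennreal (1/2 * ((norm (f' x))\<^sup>2 * heat_kernel e (y - x)) + 1/2 * ((norm (f' y))\<^sup>2 * heat_kernel e (y - x)))"
        by (intro ennreal_leI) (simp add: algebra_simps)
      also have "\<dots> = ennreal (1/2) * (?A x * ?K x y)
          + ennreal (1/2) * (?A y * ?K x y)"
        by (simp only: ennreal_plus ennreal_mult' heat_kernel_nonneg mult_nonneg_nonneg zero_le_power2 zero_le_divide_1_iff zero_le_numeral)
      finally show "ennreal (norm (f' x) * norm (f' y) * heat_kernel e (y - x)) \<le>
         ennreal (1/2) * (?A x * ?K x y)
          + ennreal (1/2) * (?A y * ?K x y)" .
    qed
    also have "\<dots> = ennreal (1/2) * (\<integral>\<^sup>+x. \<integral>\<^sup>+y. ?A x * ?K x y \<partial>lborel \<partial>lborel)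
        + ennreal (1/2) * (\<integral>\<^sup>+x. \<integral>\<^sup>+y. ?A y * ?K x y \<partial>lborel \<partial>lborel)"
      by (simp add: nn_integral_add nn_integral_cmult)
    also have "(\<integral>\<^sup>+x. \<integral>\<^sup>+y. ?A y * ?K x y \<partial>lborel \<partial>lborel)
        = (\<integral>\<^sup>+y. \<integral>\<^sup>+x. ?A y * ?K x y \<partial>lborel \<partial>lborel)"
      by (rule lborel_pair.Fubini') measurable
    also have "\<dots> = (\<integral>\<^sup>+y. ?A y \<partial>lborel)"
      by (simp add: nn_integral_cmult nn_integral_heat_kernel[OF e])
    also have "(\<integral>\<^sup>+x. \<integral>\<^sup>+y. ?A x * ?K x y \<partial>lborel \<partial>lborel)
        = (\<integral>\<^sup>+x. ?A x \<partial>lborel)"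
      by (simp add: nn_integral_cmult nn_integral_heat_kernel[OF e])
    also have "ennreal (1/2) * (\<integral>\<^sup>+x. ?A x \<partial>lborel) + ennreal (1/2) * (\<integral>\<^sup>+x. ?A x \<partial>lborel)
        = (\<integral>\<^sup>+x. ?A x \<partial>lborel)"
    proof -
      have "ennreal (1/2) + ennreal (1/2) = 1" by (subst ennreal_plus[symmetric]) auto
      then show ?thesis by (simp only: distrib_right[symmetric] mult_1_left)
    qed
    finally have B: "(\<integral>\<^sup>+\<xi>. ennreal ((norm (ft f' \<xi>))\<^sup>2 * exp (- (e / 2) * (norm \<xi>)\<^sup>2)) \<partial>lebesgue) \<le> ennreal ((L2_norm f')\<^sup>2)"
      by (simp add: nn_integral_completion flip: L2_nn_integral_norm_sq[OF fL'])
    have sq: "(norm (?h e \<xi>))\<^sup>2 = (norm (ft f' \<xi>))\<^sup>2 * exp (- (e / 2) * (norm \<xi>)\<^sup>2)" for \<xi>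
      by (simp add: gaussian_def norm_mult power_mult_distrib flip: exp_double)
    have "gaussian (e / 2) \<in> Lmeas"
      by (rule measurable_completion) (simp add: borel_measurable_continuous_onI gaussian_continuous)
    then have hL: "L2 (?h e)" unfolding L2_def sq using ri by (intro conjI borel_measurable_times) auto
    have "ennreal ((L2_norm (?h e))\<^sup>2) \<le> ennreal ((L2_norm f')\<^sup>2)" using B unfolding L2_nn_integral_norm_sq[OF hL, symmetric] sq .
    then have "(L2_norm (?h e))\<^sup>2 \<le> (L2_norm f')\<^sup>2" using ennreal_le_iff zero_le_power2 by blast
    then show ?thesis using hL power2_le_imp_le[OF _ L2_norm_nonneg] by blast
  qed
  have lim: "AE \<xi> in lebesgue. (\<lambda>n. ?h (1 / real (Suc n)) \<xi>) \<longlonglongrightarrow> ft f' \<xi>"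
  proof (rule AE_I2)
    fix \<xi>
    have "(\<lambda>n. ?h (1 / real (Suc n)) \<xi>) \<longlonglongrightarrow> complex_of_real (exp (- (0 / 2 / 2) * (norm \<xi>)\<^sup>2)) * ft f' \<xi>"
      unfolding gaussian_def by (intro tendsto_intros LIMSEQ_Suc[OF lim_1_over_n]) auto
    then show "(\<lambda>n. ?h (1 / real (Suc n)) \<xi>) \<longlonglongrightarrow> ft f' \<xi>" by simp
  qed
  have k: "L2 (?h (1 / real (Suc n)))" "L2_norm (?h (1 / real (Suc n))) \<le> L2_norm f'" for n
    using key[of "1 / real (Suc n)"] by (simp_all del: of_nat_Suc)
  note F = L2_Fatou[where s="\<lambda>n. ?h (1 / real (Suc n))", OF k ft_measurable[OF fi'] lim]
  show "L2 (ft f)" unfolding fteq by (rule F(1))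
  note F(2)
  moreover have "L2_norm f = L2_norm f'" by (rule L2_norm_cong_AE[OF borel_measurable_integrable[OF f] f'(2)])
  ultimately show "L2_norm (ft f) \<le> L2_norm f" by (simp add: fteq)
qed

section \<open>Fourier inversion and the Plancherel theorem\<close>

lemma L2_truncation_integrable:
  fixes f :: "'a::euclidean_space \<Rightarrow> 'b::euclidean_space"
  assumes "L2 f"
  shows "integrable lebesgue (\<lambda>x. indicator (cball 0 r) x *\<^sub>R f x)"
proof -
  have ind: "integrable lebesgue (indicator (cball 0 r) :: 'a \<Rightarrow> real)"
    using lmeasurable_cball[of "0::'a" r] by (subst integrable_indicator_iff) (auto simp: fmeasurable_def)
  have "L2 (indicator (cball 0 r) :: 'a \<Rightarrow> real)"
  proof -
    have "(norm (indicator (cball 0 r) x :: real))\<^sup>2 = indicator (cball 0 r) x" for x :: 'a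
      by (simp add: indicator_def)
    then show ?thesis unfolding L2_def using ind borel_measurable_integrable by auto
  qed
  from L2_mult_integrable[OF this assms] show ?thesis
  proof (rule Bochner_Integration.integrable_bound)
    show "(\<lambda>x. indicator (cball 0 r) x *\<^sub>R f x) \<in> Lmeas"
      using assms borel_measurable_integrable[OF ind] by (auto simp: L2_def intro!: borel_measurable_scaleR)
  qed auto
qed

text \<open>In the rescaled variable the kernel is fixed and the argument of \<open>f\<close> converges, as dominated convergence
  needs.\<close>

lemma heat_kernel_scaling:
  assumes e: "e > 0" and f: "continuous_on UNIV f"
  shows "(LINT y|lebesgue. f y * complex_of_real (heat_kernel e (x + y)))
    = (LINT z|lebesgue. f (- x + sqrt e *\<^sub>R z) * complex_of_real (heat_kernel 1 z))"
proof -
  have [measurable]: "f \<in> borel_measurable borel" by (rule borel_measurable_continuous_onI[OF f])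
  have se: "sqrt e \<noteq> 0" using e by simp
  have "(LINT y|lebesgue. f y * complex_of_real (heat_kernel e (x + y)))
      = (LINT y|lborel. f y * complex_of_real (heat_kernel e (x + y)))"
    by (rule integral_completion) measurable
  also have "\<dots> = (LINT y|density (distr lborel borel (\<lambda>z. - x + sqrt e *\<^sub>R z)) (\<lambda>_. ennreal (\<bar>sqrt e\<bar> ^ DIM(real^3))). f y * complex_of_real (heat_kernel e (x + y)))"
    using lborel_affine[OF se, of "- x"] by (simp add: ennreal_power)
  also have "\<dots> = (LINT z|lborel. \<bar>sqrt e\<bar> ^ 3 *\<^sub>R (f (- x + sqrt e *\<^sub>R z) * complex_of_real (heat_kernel e (sqrt e *\<^sub>R z))))"
    by (subst integral_density, measurable, simp, subst integral_distr, measurable)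
  also have "\<dots> = (LINT z|lborel. f (- x + sqrt e *\<^sub>R z) * complex_of_real (heat_kernel 1 z))"
  proof (rule Bochner_Integration.integral_cong[OF refl])
    fix z :: "real^3"
    have "\<bar>sqrt e\<bar> ^ 3 * heat_kernel e (sqrt e *\<^sub>R z) = (sqrt e ^ 3 * e powr (- 3 / 2)) * heat_kernel 1 z"
      using e by (simp add: heat_kernel_def power_mult_distrib)
    also have "sqrt e ^ 3 * e powr (- 3 / 2) = 1"
      using e by (simp add: sqrt_cubed powr_add[symmetric])
    finally have "complex_of_real (\<bar>sqrt e\<bar> ^ 3) * complex_of_real (heat_kernel e (sqrt e *\<^sub>R z)) = complex_of_real (heat_kernel 1 z)"
      by (simp only: of_real_mult[symmetric]) simp
    then show "\<bar>sqrt e\<bar> ^ 3 *\<^sub>R (f (- x + sqrt e *\<^sub>R z) * complex_of_real (heat_kernel e (sqrt e *\<^sub>R z)))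
        = f (- x + sqrt e *\<^sub>R z) * complex_of_real (heat_kernel 1 z)"
      by (simp add: scaleR_conv_of_real mult.left_commute)
  qed
  also have "\<dots> = (LINT z|lebesgue. f (- x + sqrt e *\<^sub>R z) * complex_of_real (heat_kernel 1 z))"
    by (rule integral_completion[symmetric]) measurable
  finally show ?thesis .
qed

lemma ft_gaussian_inversion_tendsto:
  assumes f: "integrable lebesgue f" and c: "continuous_on UNIV f" and b: "bounded (range f)"
  shows "(\<lambda>n. ft (\<lambda>\<xi>. gaussian (1 / real (Suc n)) \<xi> * ft f \<xi>) x) \<longlonglongrightarrow> f (- x)"
proof -
  obtain B where B: "\<And>x. norm (f x) \<le> B" using b by (auto simp: bounded_iff)
  have [measurable]: "f \<in> borel_measurable borel" by (rule borel_measurable_continuous_onI[OF c])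
  have "(\<lambda>n. LINT z|lebesgue. f (- x + sqrt (1 / real (Suc n)) *\<^sub>R z) * complex_of_real (heat_kernel 1 z))
      \<longlonglongrightarrow> (LINT z|lebesgue. f (- x) * complex_of_real (heat_kernel 1 z))"
  proof (rule integral_dominated_convergence)
    show "integrable lebesgue (\<lambda>z. B * heat_kernel 1 z)"
      using heat_kernel_has_integral(1)[of 1] by simp
    show "AE z in lebesgue. (\<lambda>n. f (- x + sqrt (1 / real (Suc n)) *\<^sub>R z) * complex_of_real (heat_kernel 1 z)) \<longlonglongrightarrow> f (- x) * complex_of_real (heat_kernel 1 z)"
    proof (rule AE_I2)
      fix z :: "real^3"
      have "(\<lambda>n. - x + sqrt (1 / real (Suc n)) *\<^sub>R z) \<longlonglongrightarrow> - x + sqrt 0 *\<^sub>R z"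
        by (intro tendsto_intros LIMSEQ_Suc[OF lim_1_over_n])
      then have "(\<lambda>n. - x + sqrt (1 / real (Suc n)) *\<^sub>R z) \<longlonglongrightarrow> - x" by simp
      then have "(\<lambda>n. f (- x + sqrt (1 / real (Suc n)) *\<^sub>R z)) \<longlonglongrightarrow> f (- x)"
        using c by (auto simp: continuous_on_eq_continuous_at intro: isCont_tendsto_compose)
      then show "(\<lambda>n. f (- x + sqrt (1 / real (Suc n)) *\<^sub>R z) * complex_of_real (heat_kernel 1 z)) \<longlonglongrightarrow> f (- x) * complex_of_real (heat_kernel 1 z)"
        by (intro tendsto_intros)
    qed
    show "AE z in lebesgue. norm (f (- x + sqrt (1 / real (Suc n)) *\<^sub>R z) * complex_of_real (heat_kernel 1 z)) \<le> B * heat_kernel 1 z" for n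
      using B by (auto simp: norm_mult heat_kernel_nonneg intro!: mult_right_mono)
    show "(\<lambda>z. f (- x) * complex_of_real (heat_kernel 1 z)) \<in> Lmeas"
      by (rule measurable_completion) measurable
    show "(\<lambda>z. f (- x + sqrt (1 / real (Suc n)) *\<^sub>R z) * complex_of_real (heat_kernel 1 z)) \<in> Lmeas" for n
      by (rule measurable_completion) measurable
  qed
  also have "(LINT z|lebesgue. f (- x) * complex_of_real (heat_kernel 1 z)) = f (- x)"
    using heat_kernel_has_integral[of 1] by simp
  finally show ?thesis
    using ft_gaussian_mult_ft[OF _ f] heat_kernel_scaling[OF _ c] by simp
qed

text \<open>The transform on \<open>L\<^sup>2\<close>, as a relation because \<open>F\<close> is determined up to null sets
  only.\<close>

definition is_ft :: "(real^3 \<Rightarrow> complex) \<Rightarrow> (real^3 \<Rightarrow> complex) \<Rightarrow> bool" where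
  "is_ft f F \<longleftrightarrow> L2 f \<and> L2_lim (\<lambda>N. ft (\<lambda>x. indicator (cball 0 (real N)) x *\<^sub>R f x)) F"

lemma is_ft_L2: "is_ft f F \<Longrightarrow> L2 f" "is_ft f F \<Longrightarrow> L2 F"
  by (auto simp: is_ft_def L2_lim_def)

text \<open>Bessel's inequality makes the transform continuous, so the truncations to balls in the definition may be replaced by
  any integrable approximation.\<close>

lemma L2_lim_ft:
  assumes i: "\<And>n. integrable lebesgue (s n)" and s: "L2_lim s f" and F: "is_ft f F"
  shows "L2_lim (\<lambda>n. ft (s n)) F"
proof -
  let ?f = "\<lambda>N x. indicator (cball 0 (real N)) x *\<^sub>R f x"
  have L: "L2 (s n)" "L2 f" "L2 F" for n using s F by (auto simp: L2_lim_def is_ft_def)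
  have fN: "L2_lim ?f f" by (rule L2_lim_truncate[OF L(2)])
  have fi: "integrable lebesgue (?f n)" for n by (rule L2_truncation_integrable[OF L(2)])
  have fL: "L2 (?f n)" for n using fN by (simp add: L2_lim_def)
  have sL: "L2 (ft (s n))" for n by (rule ft_Bessel(1)[OF i L(1)])
  have ffL: "L2 (ft (?f n))" for n by (rule ft_Bessel(1)[OF fi fL])
  have "(\<lambda>n. L2_norm (\<lambda>x. ft (s n) x - F x)) \<longlonglongrightarrow> 0"
  proof (rule Lim_null_comparison)
    show "\<forall>\<^sub>F n in sequentially. norm (L2_norm (\<lambda>x. ft (s n) x - F x))
        \<le> (L2_norm (\<lambda>x. s n x - f x) + L2_norm (\<lambda>x. ?f n x - f x)) + L2_norm (\<lambda>x. ft (?f n) x - F x)"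
    proof (rule always_eventually, rule allI)
      fix n
      have "L2_norm (\<lambda>x. ft (s n) x - ft (?f n) x) = L2_norm (ft (\<lambda>x. s n x - ?f n x))"
        by (rule arg_cong[where f=L2_norm]) (auto simp: ft_diff[OF i fi])
      also have "\<dots> \<le> L2_norm (\<lambda>x. s n x - ?f n x)"
        by (rule ft_Bessel(2)) (use i fi L2_diff[OF L(1) fL] in auto)
      also have "\<dots> \<le> L2_norm (\<lambda>x. s n x - f x) + L2_norm (\<lambda>x. ?f n x - f x)"
        using L2_norm_triangle_diff[OF L(1) L(2) fL, of n n] by (simp add: L2_norm_diff_commute[of f])
      finally show "norm (L2_norm (\<lambda>x. ft (s n) x - F x))
        \<le> (L2_norm (\<lambda>x. s n x - f x) + L2_norm (\<lambda>x. ?f n x - f x)) + L2_norm (\<lambda>x. ft (?f n) x - F x)"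
        using L2_norm_triangle_diff[OF sL ffL L(3), of n n] by simp
    qed
    have "(\<lambda>n. (L2_norm (\<lambda>x. s n x - f x) + L2_norm (\<lambda>x. ?f n x - f x)) + L2_norm (\<lambda>x. ft (?f n) x - F x)) \<longlonglongrightarrow> (0 + 0) + 0"
      using s fN F unfolding L2_lim_def is_ft_def by (intro tendsto_add) auto
    then show "(\<lambda>n. (L2_norm (\<lambda>x. s n x - f x) + L2_norm (\<lambda>x. ?f n x - f x)) + L2_norm (\<lambda>x. ft (?f n) x - F x)) \<longlonglongrightarrow> 0"
      by simp
  qed
  then show ?thesis using sL L(3) by (simp add: L2_lim_def)
qed

lemma L2_lim_Cauchy:
  assumes "L2_lim s f" "e > 0"
  shows "\<exists>N. \<forall>i\<ge>N. \<forall>j\<ge>N. L2_norm (\<lambda>x. s i x - s j x) < e"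
proof -
  have L: "L2 (s n)" "L2 f" for n using assms by (auto simp: L2_lim_def)
  have "\<forall>\<^sub>F n in sequentially. L2_norm (\<lambda>x. s n x - f x) < e / 2"
    using assms unfolding L2_lim_def by (intro order_tendstoD(2)) auto
  then obtain N where N: "\<And>n. n \<ge> N \<Longrightarrow> L2_norm (\<lambda>x. s n x - f x) < e / 2"
    by (auto simp: eventually_sequentially)
  have "L2_norm (\<lambda>x. s i x - s j x) < e" if "i \<ge> N" "j \<ge> N" for i j
    using L2_norm_triangle_diff[OF L(1) L(2) L(1), of i j] N[OF that(1)] N[OF that(2)]
    by (simp add: L2_norm_diff_commute[of f])
  then show ?thesis by blast
qed

lemma is_ft_exists:
  assumes f: "L2 f" shows "\<exists>F. is_ft f F"
proof -
  let ?f = "\<lambda>N x. indicator (cball 0 (real N)) x *\<^sub>R f x"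
  have fN: "L2_lim ?f f" by (rule L2_lim_truncate[OF f])
  have fi: "integrable lebesgue (?f n)" for n by (rule L2_truncation_integrable[OF f])
  have fL: "L2 (?f n)" for n using fN by (simp add: L2_lim_def)
  have "\<exists>F. L2_lim (\<lambda>n. ft (?f n)) F"
  proof (rule L2_cauchy_complete)
    show "L2 (ft (?f n))" for n by (rule ft_Bessel(1)[OF fi fL])
    fix e :: real assume "e > 0"
    then obtain N where N: "\<forall>i\<ge>N. \<forall>j\<ge>N. L2_norm (\<lambda>x. ?f i x - ?f j x) < e"
      using L2_lim_Cauchy[OF fN] by blast
    have "L2_norm (\<lambda>x. ft (?f i) x - ft (?f j) x) \<le> L2_norm (\<lambda>x. ?f i x - ?f j x)" for i j
    proof -
      have "L2_norm (\<lambda>x. ft (?f i) x - ft (?f j) x) = L2_norm (ft (\<lambda>x. ?f i x - ?f j x))"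
        by (rule arg_cong[where f=L2_norm]) (auto simp: ft_diff[OF fi fi])
      also have "\<dots> \<le> L2_norm (\<lambda>x. ?f i x - ?f j x)"
        by (rule ft_Bessel(2)) (use fi L2_diff[OF fL fL] in auto)
      finally show ?thesis .
    qed
    then show "\<exists>N. \<forall>i\<ge>N. \<forall>j\<ge>N. L2_norm (\<lambda>x. ft (?f i) x - ft (?f j) x) < e"
      using N by (meson le_less_trans)
  qed
  then show ?thesis using f by (auto simp: is_ft_def)
qed

lemma is_ft_unique: "is_ft f F \<Longrightarrow> is_ft f G \<Longrightarrow> AE x in lebesgue. F x = G x"
  unfolding is_ft_def using L2_lim_unique by blast

lemma is_ft_cong_AE:
  assumes "is_ft f F" "AE x in lebesgue. f x = g x" "AE x in lebesgue. F x = G x"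
  shows "is_ft g G"
proof -
  let ?t = "\<lambda>h N x. indicator (cball 0 (real N)) x *\<^sub>R h x"
  have "ft (?t f N) = ft (?t g N)" for N
  proof (rule ext, rule ft_cong_AE)
    show "?t f N \<in> Lmeas"
      using L2_truncation_integrable[of f "real N"] is_ft_L2[OF assms(1)] by auto
    show "AE x in lebesgue. ?t f N x = ?t g N x" using assms(2) by eventually_elim simp
  qed
  moreover have "L2_lim (\<lambda>N. ft (?t f N)) G"
    using assms(1,3) unfolding is_ft_def by (auto intro: L2_lim_cong_AE)
  ultimately show ?thesis
    using L2_cong_AE[OF is_ft_L2(1)[OF assms(1)] assms(2)] by (simp add: is_ft_def)
qed

lemma is_ft_limI:
  assumes "\<And>n. integrable lebesgue (s n)" "L2_lim s f" "L2_lim (\<lambda>n. ft (s n)) F"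
  shows "is_ft f F"
proof -
  obtain G where G: "is_ft f G" using is_ft_exists assms(2) by (auto simp: L2_lim_def)
  have "AE x in lebesgue. G x = F x"
    by (rule L2_lim_unique[OF L2_lim_ft[OF assms(1,2) G] assms(3)])
  then show ?thesis by (rule is_ft_cong_AE[OF G, rotated]) simp
qed

lemma is_ft_integrable:
  assumes "integrable lebesgue f" "L2 f" shows "is_ft f (ft f)"
  by (rule is_ft_limI[of "\<lambda>n. f"]) (use assms in \<open>auto intro!: L2_lim_const ft_Bessel\<close>)

lemma is_ft_bound:
  assumes "is_ft f F" shows "L2_norm F \<le> L2_norm f"
proof -
  let ?f = "\<lambda>N x. indicator (cball 0 (real N)) x *\<^sub>R f x"
  have f: "L2 f" using is_ft_L2 assms by blast
  have fN: "L2_lim ?f f" by (rule L2_lim_truncate[OF f])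
  have "(\<lambda>n. L2_norm (ft (?f n))) \<longlonglongrightarrow> L2_norm F" using assms by (auto simp: is_ft_def intro: L2_lim_norm)
  moreover have "(\<lambda>n. L2_norm (?f n)) \<longlonglongrightarrow> L2_norm f" by (rule L2_lim_norm[OF fN])
  moreover have "L2_norm (ft (?f n)) \<le> L2_norm (?f n)" for n
    by (rule ft_Bessel(2)[OF L2_truncation_integrable[OF f]]) (use fN in \<open>auto simp: L2_lim_def\<close>)
  ultimately show ?thesis by (intro LIMSEQ_le) auto
qed

lemma is_ft_approx:
  assumes "is_ft f F"
  obtains s where "\<And>n. integrable lebesgue (s n)" "L2_lim s f" "L2_lim (\<lambda>n. ft (s n)) F"
proof (rule that[of "\<lambda>N x. indicator (cball 0 (real N)) x *\<^sub>R f x"])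
  have f: "L2 f" using assms by (rule is_ft_L2)
  show "integrable lebesgue (\<lambda>x. indicator (cball 0 (real n)) x *\<^sub>R f x)" for n
    by (rule L2_truncation_integrable[OF f])
  show "L2_lim (\<lambda>N x. indicator (cball 0 (real N)) x *\<^sub>R f x) f" by (rule L2_lim_truncate[OF f])
  show "L2_lim (\<lambda>N. ft (\<lambda>x. indicator (cball 0 (real N)) x *\<^sub>R f x)) F"
    using assms by (simp add: is_ft_def)
qed

lemma is_ft_add:
  assumes "is_ft f F" "is_ft g G" shows "is_ft (\<lambda>x. f x + g x) (\<lambda>x. F x + G x)"
proof -
  obtain s where s: "\<And>n. integrable lebesgue (s n)" "L2_lim s f" "L2_lim (\<lambda>n. ft (s n)) F"
    by (rule is_ft_approx[OF assms(1)]) blast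
  obtain t where t: "\<And>n. integrable lebesgue (t n)" "L2_lim t g" "L2_lim (\<lambda>n. ft (t n)) G"
    by (rule is_ft_approx[OF assms(2)]) blast
  show ?thesis
  proof (rule is_ft_limI)
    show "L2_lim (\<lambda>n x. s n x + t n x) (\<lambda>x. f x + g x)" by (rule L2_lim_add[OF s(2) t(2)])
    have "ft (\<lambda>x. s n x + t n x) = (\<lambda>x. ft (s n) x + ft (t n) x)" for n
      by (rule ext) (rule ft_add[OF s(1) t(1)])
    then show "L2_lim (\<lambda>n. ft (\<lambda>x. s n x + t n x)) (\<lambda>x. F x + G x)"
      using L2_lim_add[OF s(3) t(3)] by simp
  qed (use s t in auto)
qed

lemma is_ft_cmult:
  assumes "is_ft f F" shows "is_ft (\<lambda>x. c * f x) (\<lambda>x. c * F x)"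
proof -
  obtain s where s: "\<And>n. integrable lebesgue (s n)" "L2_lim s f" "L2_lim (\<lambda>n. ft (s n)) F"
    by (rule is_ft_approx[OF assms(1)]) blast
  show ?thesis
    by (rule is_ft_limI[of "\<lambda>n x. c * s n x"])
       (use s L2_lim_bounded_linear[OF _ bounded_linear_mult_right] in \<open>auto simp: ft_cmult[abs_def]\<close>)
qed

lemma is_ft_diff:
  assumes "is_ft f F" "is_ft g G" shows "is_ft (\<lambda>x. f x - g x) (\<lambda>x. F x - G x)"
  using is_ft_add[OF assms(1) is_ft_cmult[OF assms(2), of "-1"]] by simp

lemma is_ft_zero: "is_ft (\<lambda>x. 0) (\<lambda>x. 0)"
  using is_ft_integrable[of "\<lambda>x. 0"] by (simp add: ft_def[abs_def])

lemma is_ft_sum: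
  assumes "\<And>i. i \<in> I \<Longrightarrow> is_ft (f i) (F i)"
  shows "is_ft (\<lambda>x. \<Sum>i\<in>I. f i x) (\<lambda>x. \<Sum>i\<in>I. F i x)"
  using assms by (induction I rule: infinite_finite_induct) (auto intro: is_ft_add is_ft_zero)

lemma is_ft_translate:
  assumes "is_ft f F" shows "is_ft (\<lambda>x. f (a + x)) (\<lambda>\<xi>. cis (a \<bullet> \<xi>) * F \<xi>)"
proof -
  obtain s where s: "\<And>n. integrable lebesgue (s n)" "L2_lim s f" "L2_lim (\<lambda>n. ft (s n)) F"
    by (rule is_ft_approx[OF assms(1)]) blast
  have m: "s n \<in> Lmeas" for n using s(1) by auto
  show ?thesis
  proof (rule is_ft_limI)
    show "L2_lim (\<lambda>n x. s n (a + x)) (\<lambda>x. f (a + x))" using L2_lim_isometry[of 1, OF _ s(2), of a] by simp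
    show "integrable lebesgue (\<lambda>x. s n (a + x))" for n using integrable_isometry[OF _ m[of n], where c=1 and a=a] s(1) by simp
    have "ft (\<lambda>x. s n (a + x)) = (\<lambda>x. cis (a \<bullet> x) * ft (s n) x)" for n
      by (rule ext) (rule ft_translate[OF m])
    moreover have "L2_lim (\<lambda>n x. cis (a \<bullet> x) * ft (s n) x) (\<lambda>\<xi>. cis (a \<bullet> \<xi>) * F \<xi>)"
      by (rule L2_lim_mult_bounded[where B=1]) (use s(3) in auto)
    ultimately show "L2_lim (\<lambda>n. ft (\<lambda>x. s n (a + x))) (\<lambda>\<xi>. cis (a \<bullet> \<xi>) * F \<xi>)" by simp
  qed
qed

lemma is_ft_reflect:
  assumes "is_ft f F" shows "is_ft (\<lambda>x. f (- x)) (\<lambda>\<xi>. F (- \<xi>))"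
proof -
  obtain s where s: "\<And>n. integrable lebesgue (s n)" "L2_lim s f" "L2_lim (\<lambda>n. ft (s n)) F"
    by (rule is_ft_approx[OF assms(1)]) blast
  have m: "s n \<in> Lmeas" for n using s(1) by auto
  show ?thesis
  proof (rule is_ft_limI)
    show "L2_lim (\<lambda>n x. s n (- x)) (\<lambda>x. f (- x))" using L2_lim_isometry[of "-1", OF _ s(2), of 0] by simp
    show "integrable lebesgue (\<lambda>x. s n (- x))" for n using integrable_isometry[OF _ m[of n], where c="-1" and a=0] s(1) by simp
    have "ft (\<lambda>x. s n (- x)) = (\<lambda>\<xi>. ft (s n) (- \<xi>))" for n
      by (rule ext) (rule ft_reflect[OF m])
    then show "L2_lim (\<lambda>n. ft (\<lambda>x. s n (- x))) (\<lambda>\<xi>. F (- \<xi>))"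
      using L2_lim_isometry[of "-1", OF _ s(3), of 0] by simp
  qed
qed

lemma is_ft_cnj:
  assumes "is_ft f F" shows "is_ft (\<lambda>x. cnj (f x)) (\<lambda>\<xi>. cnj (F (- \<xi>)))"
proof -
  obtain s where s: "\<And>n. integrable lebesgue (s n)" "L2_lim s f" "L2_lim (\<lambda>n. ft (s n)) F"
    by (rule is_ft_approx[OF assms(1)]) blast
  show ?thesis
  proof (rule is_ft_limI)
    show "L2_lim (\<lambda>n x. cnj (s n x)) (\<lambda>x. cnj (f x))" by (rule L2_lim_bounded_linear[OF s(2) bounded_linear_cnj])
    show "integrable lebesgue (\<lambda>x. cnj (s n x))" for n
      using integrable_bounded_linear[OF bounded_linear_cnj s(1)] by simp
    have "ft (\<lambda>x. cnj (s n x)) = (\<lambda>\<xi>. cnj (ft (s n) (- \<xi>)))" for n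
      by (rule ext) (rule ft_cnj[OF s(1)])
    moreover have "L2_lim (\<lambda>n \<xi>. ft (s n) (- \<xi>)) (\<lambda>\<xi>. F (- \<xi>))"
      using L2_lim_isometry[of "-1", OF _ s(3), of 0] by simp
    ultimately show "L2_lim (\<lambda>n. ft (\<lambda>x. cnj (s n x))) (\<lambda>\<xi>. cnj (F (- \<xi>)))"
      using L2_lim_bounded_linear[OF _ bounded_linear_cnj] by simp
  qed
qed

lemma is_ft_lim:
  assumes ft: "\<And>n. is_ft (s n) (S n)" and s: "L2_lim s f" and S: "L2_lim S F"
  shows "is_ft f F"
proof -
  obtain G where G: "is_ft f G" using is_ft_exists s by (auto simp: L2_lim_def)
  have le: "L2_norm (\<lambda>x. S n x - G x) \<le> L2_norm (\<lambda>x. s n x - f x)" for n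
    by (rule is_ft_bound[OF is_ft_diff[OF ft G]])
  have "(\<lambda>n. L2_norm (\<lambda>x. S n x - G x)) \<longlonglongrightarrow> 0"
  proof (rule Lim_null_comparison)
    show "\<forall>\<^sub>F n in sequentially. norm (L2_norm (\<lambda>x. S n x - G x)) \<le> L2_norm (\<lambda>x. s n x - f x)"
      using le by simp
    show "(\<lambda>n. L2_norm (\<lambda>x. s n x - f x)) \<longlonglongrightarrow> 0" using s by (simp add: L2_lim_def)
  qed
  then have "L2_lim S G" using S is_ft_L2[OF G] by (auto simp: L2_lim_def)
  then have "AE x in lebesgue. G x = F x" using S L2_lim_unique by blast
  then show ?thesis by (rule is_ft_cong_AE[OF G, rotated]) simp
qed

lemma L2_dense_continuous_seq:
  fixes f :: "'a::euclidean_space \<Rightarrow> 'b::euclidean_space"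
  assumes "L2 f"
  obtains s where "L2_lim s f" "\<And>n. continuous_on UNIV (s n)" "\<And>n. bounded (range (s n))"
    "\<And>n. integrable lebesgue (s n)"
proof -
  have "\<exists>g. continuous_on UNIV g \<and> bounded (range g) \<and> integrable lebesgue g \<and> L2 g \<and>
      L2_norm (\<lambda>x. f x - g x) < 1 / real (Suc n)" for n
  proof -
    have "1 / real (Suc n) > 0" by simp
    then obtain g where "continuous_on UNIV g" "bounded (range g)" "integrable lebesgue g" "L2 g"
        "L2_norm (\<lambda>x. f x - g x) < 1 / real (Suc n)"
      by (rule L2_dense_continuous[OF assms])
    then show ?thesis by blast
  qed
  then obtain s where s: "\<And>n. continuous_on UNIV (s n) \<and> bounded (range (s n)) \<and> integrable lebesgue (s n) \<and> L2 (s n) \<and>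
      L2_norm (\<lambda>x. f x - s n x) < 1 / real (Suc n)"
    by metis
  have "(\<lambda>n. L2_norm (\<lambda>x. s n x - f x)) \<longlonglongrightarrow> 0"
  proof (rule Lim_null_comparison)
    show "\<forall>\<^sub>F n in sequentially. norm (L2_norm (\<lambda>x. s n x - f x)) \<le> 1 / real (Suc n)"
      using s by (auto simp: L2_norm_diff_commute[of _ f] intro!: always_eventually less_imp_le)
    show "(\<lambda>n. 1 / real (Suc n)) \<longlonglongrightarrow> 0" by (rule LIMSEQ_Suc[OF lim_1_over_n])
  qed
  then have "L2_lim s f" using s assms by (auto simp: L2_lim_def)
  then show thesis using that s by blast
qed

text \<open>For \<open>f\<close> continuous, bounded and integrable, the damped inversion integrals converge pointwise to \<open>f
  (- x)\<close> and in \<open>L\<^sup>2\<close> to the transform of \<open>ft f\<close>; on each ball they are bounded, so the two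
  limits agree there. The general case follows by density.\<close>

lemma is_ft_inversion:
  assumes "is_ft f F" shows "is_ft F (\<lambda>x. f (- x))"
proof -
  have good: "is_ft (ft f) (\<lambda>x. f (- x))"
    if f: "integrable lebesgue f" "continuous_on UNIV f" "bounded (range f)" "L2 f" for f
  proof -
    have FL: "L2 (ft f)" by (rule ft_Bessel(1)[OF f(1,4)])
    obtain G where G: "is_ft (ft f) G" using is_ft_exists[OF FL] by blast
    let ?s = "\<lambda>n \<xi>. gaussian (1 / real (Suc n)) \<xi> * ft f \<xi>"
    have si: "integrable lebesgue (?s n)" for n
      using integrable_mult_bounded[OF gaussian_integrable ft_measurable[OF f(1)] ft_bound[OF f(1)], of "1 / real (Suc n)"]
      by (simp add: mult.commute)
    have sL: "L2_lim ?s (ft f)"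
    proof (rule L2_lim_dominated[OF _ _ FL])
      show "AE x in lebesgue. (\<lambda>n. ?s n x) \<longlonglongrightarrow> ft f x"
      proof (rule AE_I2)
        fix x
        have "(\<lambda>n. ?s n x) \<longlonglongrightarrow> complex_of_real (exp (- (0 / 2) * (norm x)\<^sup>2)) * ft f x"
          unfolding gaussian_def by (intro tendsto_intros LIMSEQ_Suc[OF lim_1_over_n]) auto
        then show "(\<lambda>n. ?s n x) \<longlonglongrightarrow> ft f x" by simp
      qed
      show "AE x in lebesgue. norm (?s n x) \<le> norm (ft f x)" for n
        using norm_gaussian_le[of "1 / real (Suc n)"] by (auto simp: norm_mult mult_left_le_one_le)
    qed (use si ft_measurable[OF f(1)] in auto)
    have lim1: "L2_lim (\<lambda>n. ft (?s n)) G" by (rule L2_lim_ft[OF si sL G])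
    have "AE x in lebesgue. G x = f (- x)"
    proof -
      have "AE x in lebesgue. indicator (cball 0 (real k)) x *\<^sub>R G x = indicator (cball 0 (real k)) x *\<^sub>R f (- x)" for k
      proof (rule L2_lim_unique)
        let ?i = "indicator (cball 0 (real k)) :: real^3 \<Rightarrow> real"
        have im: "?i \<in> Lmeas" by (rule borel_measurable_indicator[OF cball_in_lebesgue])
        have im': "(\<lambda>x. complex_of_real (?i x)) \<in> Lmeas" using im by simp
        obtain B where B: "\<And>x. norm (f x) \<le> B" using f(3) by (auto simp: bounded_iff)
        have B0: "0 \<le> B" using B[of 0] norm_ge_zero order_trans by blast
        have bd: "norm (ft (?s n) x) \<le> B" for n x
        proof -
          let ?e = "1 / real (Suc n)"
          have e: "?e > 0" by simp
          have hm: "heat_kernel ?e \<in> Lmeas" by (rule borel_measurable_integrable[OF heat_kernel_has_integral(1)[OF e]])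
          have hi: "integrable lebesgue (\<lambda>y. heat_kernel ?e (x + y))" "(LINT y|lebesgue. heat_kernel ?e (x + y)) = 1"
            using integrable_isometry[OF _ hm, where c=1 and a=x] integral_isometry[OF _ hm, where c=1 and a=x] heat_kernel_has_integral[OF e] by auto
          have "norm (ft (?s n) x) = norm (LINT y|lebesgue. f y * complex_of_real (heat_kernel ?e (x + y)))"
            by (simp only: ft_gaussian_mult_ft[OF e f(1)])
          also have "\<dots> \<le> (LINT y|lebesgue. norm (f y * complex_of_real (heat_kernel ?e (x + y))))"
            by (rule integral_norm_bound)
          also have "\<dots> \<le> (LINT y|lebesgue. B * heat_kernel ?e (x + y))"
          proof (rule Bochner_Integration.integral_mono')
            show "integrable lebesgue (\<lambda>y. B * heat_kernel ?e (x + y))" using hi by simp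
            show "norm (f y * complex_of_real (heat_kernel ?e (x + y))) \<le> B * heat_kernel ?e (x + y)" for y
              using B[of y] by (simp add: norm_mult heat_kernel_nonneg mult_right_mono)
            show "0 \<le> B * heat_kernel ?e (x + y)" for y using B0 by (simp add: heat_kernel_nonneg)
          qed
          also have "\<dots> = B" using hi by simp
          finally show ?thesis .
        qed
        show "L2_lim (\<lambda>n x. ?i x *\<^sub>R ft (?s n) x) (\<lambda>x. ?i x *\<^sub>R G x)"
          using L2_lim_mult_bounded[OF im' _ lim1, of 1] by (simp add: scaleR_conv_of_real indicator_def)
        show "L2_lim (\<lambda>n x. ?i x *\<^sub>R ft (?s n) x) (\<lambda>x. ?i x *\<^sub>R f (- x))"
        proof (rule L2_lim_dominated)
          have "integrable lebesgue ?i"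
            using lmeasurable_cball[of "0::real^3" "real k"] by (subst integrable_indicator_iff) (auto simp: fmeasurable_def)
          moreover have "(norm (B * ?i x))\<^sup>2 = B\<^sup>2 * ?i x" for x by (simp add: indicator_def)
          ultimately show "L2 (\<lambda>x. B * ?i x)" using im by (simp add: L2_def)
          show "AE x in lebesgue. norm (?i x *\<^sub>R ft (?s n) x) \<le> norm (B * ?i x)" for n
            using bd B0 by (auto simp: indicator_def)
          show "AE x in lebesgue. (\<lambda>n. ?i x *\<^sub>R ft (?s n) x) \<longlonglongrightarrow> ?i x *\<^sub>R f (- x)"
            using ft_gaussian_inversion_tendsto[OF f(1-3)] by (intro AE_I2 tendsto_intros)
          show "(\<lambda>x. ?i x *\<^sub>R ft (?s n) x) \<in> Lmeas" for n
            by (intro borel_measurable_scaleR im ft_measurable si)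
          have "(\<lambda>x. f (- x)) \<in> Lmeas"
            using borel_measurable_isometry[of "-1" f 0] f(1) by auto
          then show "(\<lambda>x. ?i x *\<^sub>R f (- x)) \<in> Lmeas"
            by (intro borel_measurable_scaleR im)
        qed
      qed
      then have "AE x in lebesgue. \<forall>k::nat. indicator (cball 0 (real k)) x *\<^sub>R G x = indicator (cball 0 (real k)) x *\<^sub>R f (- x)"
        unfolding AE_all_countable by blast
      then show ?thesis
      proof eventually_elim
        case (elim x)
        obtain k where "norm x \<le> real k" using real_arch_simple by blast
        then show ?case using elim[rule_format, of k] by simp
      qed
    qed
    then show ?thesis by (intro is_ft_cong_AE[OF G]) auto
  qed
  obtain s where s: "L2_lim s f" "\<And>n. continuous_on UNIV (s n)" "\<And>n. bounded (range (s n))"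
    "\<And>n. integrable lebesgue (s n)"
    by (rule L2_dense_continuous_seq[OF is_ft_L2(1)[OF assms]]) blast
  show ?thesis
  proof (rule is_ft_lim)
    show "is_ft (ft (s n)) (\<lambda>x. s n (- x))" for n
      by (rule good) (use s in \<open>auto simp: L2_lim_def\<close>)
    show "L2_lim (\<lambda>n. ft (s n)) F" by (rule L2_lim_ft[OF s(4,1) assms])
    show "L2_lim (\<lambda>n x. s n (- x)) (\<lambda>x. f (- x))" using L2_lim_isometry[of "-1", OF _ s(1), of 0] by simp
  qed
qed

text \<open>Bessel's inequality for \<open>f\<close> and, by inversion, for its transform.\<close>

lemma is_ft_norm:
  assumes "is_ft f F" shows "L2_norm F = L2_norm f"
proof -
  have "L2_norm (\<lambda>x. f (- x)) = L2_norm f"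
    using L2_norm_isometry[of "-1" f 0] is_ft_L2[OF assms] by simp
  then show ?thesis
    using is_ft_bound[OF assms] is_ft_bound[OF is_ft_inversion[OF assms]] by simp
qed

lemma is_ft_inner:
  assumes "is_ft f F" "is_ft g G"
  shows "(LINT x|lebesgue. f x \<bullet> g x) = (LINT x|lebesgue. F x \<bullet> G x)"
proof -
  have pol: "(LINT x|lebesgue. a x \<bullet> b x) = ((L2_norm (\<lambda>x. a x + b x))\<^sup>2 - (L2_norm a)\<^sup>2 - (L2_norm b)\<^sup>2) / 2"
    if "L2 a" "L2 b" for a b :: "real^3 \<Rightarrow> complex"
  proof -
    have "(L2_norm (\<lambda>x. a x + b x))\<^sup>2 = (LINT x|lebesgue. (norm (a x))\<^sup>2 + 2 * (a x \<bullet> b x) + (norm (b x))\<^sup>2)"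
      unfolding L2_norm_sq
      by (rule Bochner_Integration.integral_cong[OF refl])
         (simp add: power2_norm_eq_inner inner_add_left inner_add_right inner_commute)
    also have "\<dots> = (L2_norm a)\<^sup>2 + 2 * (LINT x|lebesgue. a x \<bullet> b x) + (L2_norm b)\<^sup>2"
      using that L2_inner_integrable[OF that] by (simp add: L2_norm_sq L2_def)
    finally show ?thesis by simp
  qed
  show ?thesis
    using assms by (simp add: pol is_ft_L2 is_ft_norm is_ft_norm[OF is_ft_add[OF assms]])
qed

lemma is_ft_surj:
  assumes "L2 F" shows "\<exists>f. is_ft f F"
proof -
  obtain G where "is_ft F G" using is_ft_exists[OF assms] by blast
  then have "is_ft (\<lambda>x. G (- x)) (\<lambda>x. F (- (- x)))" by (intro is_ft_reflect is_ft_inversion)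
  then show ?thesis by auto
qed

lemma is_ft_inj:
  assumes "is_ft f F" "is_ft g F" shows "AE x in lebesgue. f x = g x"
proof -
  have "L2_norm (\<lambda>x. f x - g x) = 0" using is_ft_norm[OF is_ft_diff[OF assms]] by simp
  then show ?thesis using L2_norm_eq_0_iff[OF L2_diff[OF is_ft_L2(1)[OF assms(1)] is_ft_L2(1)[OF assms(2)]]] by simp
qed

lemma is_ft_inverse_formula:
  assumes "is_ft f F" "integrable lebesgue F"
  shows "AE x in lebesgue. f x = ft F (- x)"
proof -
  have "AE x in lebesgue. f (- x) = ft F x"
    by (rule is_ft_unique[OF is_ft_inversion[OF assms(1)] is_ft_integrable[OF assms(2) is_ft_L2(2)[OF assms(1)]]])
  from AE_isometry[of "-1", OF _ this, of 0] show ?thesis by simp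
qed

section \<open>Vector fields and Fourier multipliers\<close>

lemma norm_vec_power2: "(norm (x :: 'b::real_normed_vector ^ 'n::finite))\<^sup>2 = (\<Sum>k\<in>UNIV. (norm (x $ k))\<^sup>2)"
  by (simp add: norm_vec_def L2_set_def sum_nonneg)

lemma L2_nth: "L2 f \<Longrightarrow> L2 (\<lambda>x. f x $ k)"
  for f :: "'a::euclidean_space \<Rightarrow> 'b::euclidean_space ^ 'n::finite"
  by (rule L2_bounded_linear[OF _ bounded_linear_vec_nth])

lemma bounded_linear_axis: "bounded_linear (\<lambda>y :: 'b::real_normed_vector. axis k y :: 'b ^ 'n::finite)"
proof (rule bounded_linear_intro[where K=1])
  fix x :: 'b
  have "(norm (axis k x :: 'b ^ 'n))\<^sup>2 = (\<Sum>i\<in>UNIV. if i = k then (norm x)\<^sup>2 else 0)"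
    unfolding norm_vec_power2 by (rule sum.cong) (auto simp: axis_def)
  then have "(norm (axis k x :: 'b ^ 'n))\<^sup>2 \<le> (norm x)\<^sup>2" by simp
  then show "norm (axis k x :: 'b ^ 'n) \<le> norm x * 1" using power2_le_imp_le by fastforce
qed (auto simp: axis_def vec_eq_iff)

lemma vec_lambda_eq_sum_axis: "(\<chi> k. y k) = (\<Sum>k\<in>UNIV. axis k (y k))"
  by (auto simp: vec_eq_iff axis_def)

lemma L2_vec_lambda:
  fixes f :: "'n::finite \<Rightarrow> 'a::euclidean_space \<Rightarrow> 'b::euclidean_space"
  shows "(\<And>k. L2 (f k)) \<Longrightarrow> L2 (\<lambda>x. \<chi> k. f k x)"
  unfolding vec_lambda_eq_sum_axis by (intro L2_sum L2_bounded_linear[OF _ bounded_linear_axis])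

lemma L2_lim_zero: "L2_lim (\<lambda>n x. 0) (\<lambda>x. 0)"
  by (rule L2_lim_const) simp

lemma L2_lim_sum:
  "(\<And>i. i \<in> I \<Longrightarrow> L2_lim (s i) (f i)) \<Longrightarrow> L2_lim (\<lambda>n x. \<Sum>i\<in>I. s i n x) (\<lambda>x. \<Sum>i\<in>I. f i x)"
  by (induction I rule: infinite_finite_induct) (auto intro: L2_lim_add L2_lim_zero)

lemma L2_lim_vec_lambda:
  fixes f :: "'n::finite \<Rightarrow> 'a::euclidean_space \<Rightarrow> 'b::euclidean_space"
  shows "(\<And>k. L2_lim (s k) (f k)) \<Longrightarrow> L2_lim (\<lambda>n x. \<chi> k. s k n x) (\<lambda>x. \<chi> k. f k x)"
  unfolding vec_lambda_eq_sum_axis by (intro L2_lim_sum L2_lim_bounded_linear[OF _ bounded_linear_axis])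

lemma AE_vec_eq_iff:
  fixes F G :: "'a \<Rightarrow> 'b ^ 'n::finite"
  shows "(AE x in M. F x = G x) \<longleftrightarrow> (\<forall>k. AE x in M. F x $ k = G x $ k)"
proof
  assume "AE x in M. F x = G x"
  then show "\<forall>k. AE x in M. F x $ k = G x $ k" by (auto elim: eventually_mono)
next
  assume "\<forall>k. AE x in M. F x $ k = G x $ k"
  then have "AE x in M. \<forall>k. F x $ k = G x $ k" by (intro eventually_all_finite) auto
  then show "AE x in M. F x = G x" by (simp add: vec_eq_iff)
qed

abbreviation cpx :: "'n \<Rightarrow> ('a \<Rightarrow> real ^ 'n::finite) \<Rightarrow> 'a \<Rightarrow> complex" where
  "cpx k f \<equiv> \<lambda>x. complex_of_real (f x $ k)"

lemma L2_cpx: "L2 f \<Longrightarrow> L2 (cpx k f)"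
  by (rule L2_bounded_linear[OF L2_nth bounded_linear_of_real])

lemma fourier_trunc_nth:
  fixes f :: "real^3 \<Rightarrow> real^'n::finite"
  assumes "L2 f"
  shows "fourier_trunc N f \<xi> $ k = ft (\<lambda>x. indicator (cball 0 (real N)) x *\<^sub>R cpx k f x) \<xi>"
proof -
  let ?i = "indicator (cball 0 (real N)) :: real^3 \<Rightarrow> real"
  let ?h = "\<lambda>x. ?i x *\<^sub>R (cis (- (x \<bullet> \<xi>)) *s (\<chi> k. complex_of_real (f x $ k)))"
  have ck: "integrable lebesgue (\<lambda>x. cis (- (x \<bullet> \<xi>)) * (?i x *\<^sub>R cpx k f x))" for k
    by (rule ft_integrand_integrable(1)[OF L2_truncation_integrable[OF L2_cpx[OF assms]]])
  have heq: "?h = (\<lambda>x. \<Sum>k\<in>UNIV. axis k (cis (- (x \<bullet> \<xi>)) * (?i x *\<^sub>R cpx k f x)))"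
    by (rule ext) (auto simp: vec_eq_iff axis_def)
  have hi: "integrable lebesgue ?h"
    unfolding heq by (intro Bochner_Integration.integrable_sum integrable_bounded_linear[OF bounded_linear_axis ck])
  have "(LINT x|lebesgue. ?h x) $ k = (LINT x|lebesgue. ?h x $ k)"
    by (rule integral_bounded_linear[OF bounded_linear_vec_nth hi, symmetric])
  also have "\<dots> = (LINT x|lebesgue. cis (- (x \<bullet> \<xi>)) * (?i x *\<^sub>R cpx k f x))"
    by (rule Bochner_Integration.integral_cong) auto
  finally show ?thesis
    by (simp add: fourier_trunc_def ft_def ft_const_def set_lebesgue_integral_def)
qed

lemma tendsto_L2_norm_iff_nn_integral:
  assumes "\<And>n. L2 (s n)"
  shows "(\<lambda>n. \<integral>\<^sup>+x. ennreal ((norm (s n x))\<^sup>2) \<partial>lebesgue) \<longlonglongrightarrow> 0 \<longleftrightarrow> (\<lambda>n. L2_norm (s n)) \<longlonglongrightarrow> 0"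
proof
  assume "(\<lambda>n. L2_norm (s n)) \<longlonglongrightarrow> 0"
  then have "(\<lambda>n. (L2_norm (s n))\<^sup>2) \<longlonglongrightarrow> 0\<^sup>2" by (rule tendsto_power)
  then have "(\<lambda>n. ennreal ((L2_norm (s n))\<^sup>2)) \<longlonglongrightarrow> ennreal (0\<^sup>2)" by (rule tendsto_ennrealI)
  then show "(\<lambda>n. \<integral>\<^sup>+x. ennreal ((norm (s n x))\<^sup>2) \<partial>lebesgue) \<longlonglongrightarrow> 0"
    using L2_nn_integral_norm_sq[OF assms] by simp
next
  assume "(\<lambda>n. \<integral>\<^sup>+x. ennreal ((norm (s n x))\<^sup>2) \<partial>lebesgue) \<longlonglongrightarrow> 0"
  then have "(\<lambda>n. ennreal ((L2_norm (s n))\<^sup>2)) \<longlonglongrightarrow> ennreal 0"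
    using L2_nn_integral_norm_sq[OF assms] by simp
  then have "(\<lambda>n. (L2_norm (s n))\<^sup>2) \<longlonglongrightarrow> 0"
    by (subst (asm) tendsto_ennreal_iff) auto
  then have "(\<lambda>n. sqrt ((L2_norm (s n))\<^sup>2)) \<longlonglongrightarrow> sqrt 0" by (rule tendsto_real_sqrt)
  then show "(\<lambda>n. L2_norm (s n)) \<longlonglongrightarrow> 0" by simp
qed

text \<open>This identifies the choice made in \<open>fourier\<close>: the condition under the choice operator is
  \<open>L\<^sup>2\<close> convergence of the truncated transforms, component by component.\<close>

lemma fourier_is_ft:
  fixes f :: "real^3 \<Rightarrow> real^'n::finite"
  assumes f: "L2 f"
  shows fourier_L2: "L2 (fourier f)"
    and is_ft_fourier: "is_ft (cpx k f) (\<lambda>\<xi>. fourier f \<xi> $ k)"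
proof -
  let ?P = "\<lambda>F. L2 F \<and> (\<lambda>N. \<integral>\<^sup>+\<xi>. ennreal ((norm (F \<xi> - fourier_trunc N f \<xi>))\<^sup>2) \<partial>lebesgue) \<longlonglongrightarrow> 0"
  obtain G where G: "\<And>k. is_ft (cpx k f) (G k)"
    using is_ft_exists[OF L2_cpx[OF f]] by metis
  have comp: "(\<lambda>\<xi>. fourier_trunc N f \<xi> $ k) = ft (\<lambda>x. indicator (cball 0 (real N)) x *\<^sub>R cpx k f x)" for N k
    by (rule ext) (rule fourier_trunc_nth[OF f])
  have tr: "fourier_trunc N f = (\<lambda>\<xi>. \<chi> k. fourier_trunc N f \<xi> $ k)" for N by simp
  have "L2_lim (\<lambda>N \<xi>. \<chi> k. fourier_trunc N f \<xi> $ k) (\<lambda>\<xi>. \<chi> k. G k \<xi>)"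
    by (rule L2_lim_vec_lambda) (use G in \<open>simp add: comp is_ft_def\<close>)
  then have limG: "L2_lim (\<lambda>N. fourier_trunc N f) (\<lambda>\<xi>. \<chi> k. G k \<xi>)" by simp
  then have trL: "L2 (fourier_trunc N f)" for N by (simp add: L2_lim_def)
  have iff: "?P F \<longleftrightarrow> L2_lim (\<lambda>N. fourier_trunc N f) F" for F
    using tendsto_L2_norm_iff_nn_integral[of "\<lambda>N \<xi>. F \<xi> - fourier_trunc N f \<xi>"] trL
    by (auto simp: L2_lim_def L2_norm_diff_commute[of F] intro: L2_diff)
  have "?P (\<lambda>\<xi>. \<chi> k. G k \<xi>)" by (rule iff[THEN iffD2, OF limG])
  from someI[of ?P, OF this] have "?P (fourier f)" unfolding fourier_def .
  then have lim: "L2_lim (\<lambda>N. fourier_trunc N f) (fourier f)" by (rule iff[THEN iffD1])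
  then show "L2 (fourier f)" by (simp add: L2_lim_def)
  have "L2_lim (\<lambda>N \<xi>. fourier_trunc N f \<xi> $ k) (\<lambda>\<xi>. fourier f \<xi> $ k)"
    by (rule L2_lim_bounded_linear[OF lim bounded_linear_vec_nth])
  then show "is_ft (cpx k f) (\<lambda>\<xi>. fourier f \<xi> $ k)"
    unfolding is_ft_def comp using L2_cpx[OF f] by blast
qed

lemma fourier_eqI:
  fixes f :: "real^3 \<Rightarrow> real^'n::finite"
  assumes "L2 f" "\<And>k. is_ft (cpx k f) (\<lambda>\<xi>. F \<xi> $ k)"
  shows "AE \<xi> in lebesgue. fourier f \<xi> = F \<xi>"
  unfolding AE_vec_eq_iff using is_ft_unique[OF is_ft_fourier[OF assms(1)] assms(2)] by blast

lemma fourier_cong_AE: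
  fixes f g :: "real^3 \<Rightarrow> real^'n::finite"
  assumes f: "L2 f" and eq: "AE x in lebesgue. f x = g x"
  shows "fourier f = fourier g"
proof -
  have g: "L2 g" by (rule L2_cong_AE[OF f eq])
  have "fourier_trunc N f \<xi> $ k = fourier_trunc N g \<xi> $ k" for N \<xi> k
    unfolding fourier_trunc_nth[OF f] fourier_trunc_nth[OF g]
  proof (rule ft_cong_AE)
    show "(\<lambda>x. indicator (cball 0 (real N)) x *\<^sub>R cpx k f x) \<in> Lmeas"
      by (rule borel_measurable_integrable[OF L2_truncation_integrable[OF L2_cpx[OF f]]])
    show "AE x in lebesgue. indicator (cball 0 (real N)) x *\<^sub>R cpx k f x = indicator (cball 0 (real N)) x *\<^sub>R cpx k g x"
      using eq by eventually_elim simp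
  qed
  then have "fourier_trunc N f = fourier_trunc N g" for N by (auto simp: vec_eq_iff)
  then show ?thesis by (simp add: fourier_def)
qed

lemma fourier_inner:
  fixes f g :: "real^3 \<Rightarrow> real^'n::finite"
  assumes f: "L2 f" and g: "L2 g"
  shows "(LINT x|lebesgue. f x \<bullet> g x) = (LINT \<xi>|lebesgue. fourier f \<xi> \<bullet> fourier g \<xi>)"
proof -
  have "(LINT x|lebesgue. f x \<bullet> g x) = (LINT x|lebesgue. (\<Sum>k\<in>UNIV. cpx k f x \<bullet> cpx k g x))"
    by (simp add: inner_vec_def inner_complex_def)
  also have "\<dots> = (\<Sum>k\<in>UNIV. (LINT x|lebesgue. cpx k f x \<bullet> cpx k g x))"
    by (rule Bochner_Integration.integral_sum) (intro L2_inner_integrable L2_cpx f g)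
  also have "\<dots> = (\<Sum>k\<in>UNIV. (LINT \<xi>|lebesgue. fourier f \<xi> $ k \<bullet> fourier g \<xi> $ k))"
    by (intro sum.cong refl is_ft_inner is_ft_fourier f g)
  also have "\<dots> = (LINT \<xi>|lebesgue. (\<Sum>k\<in>UNIV. fourier f \<xi> $ k \<bullet> fourier g \<xi> $ k))"
    by (rule Bochner_Integration.integral_sum[symmetric]) (intro L2_inner_integrable L2_nth fourier_L2 f g)
  finally show ?thesis by (simp add: inner_vec_def)
qed

lemma fourier_L2_norm:
  fixes f :: "real^3 \<Rightarrow> real^'n::finite"
  assumes f: "L2 f" shows "L2_norm (fourier f) = L2_norm f"
  using fourier_inner[OF f f] by (simp add: L2_norm_def power2_norm_eq_inner)

lemma fourier_add:
  fixes f g :: "real^3 \<Rightarrow> real^'n::finite"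
  assumes "L2 f" "L2 g"
  shows "AE \<xi> in lebesgue. fourier (\<lambda>x. f x + g x) \<xi> = fourier f \<xi> + fourier g \<xi>"
  by (rule fourier_eqI) (use assms is_ft_add[OF is_ft_fourier[OF assms(1)] is_ft_fourier[OF assms(2)]] in \<open>auto intro: L2_add\<close>)

lemma fourier_diff:
  fixes f g :: "real^3 \<Rightarrow> real^'n::finite"
  assumes "L2 f" "L2 g"
  shows "AE \<xi> in lebesgue. fourier (\<lambda>x. f x - g x) \<xi> = fourier f \<xi> - fourier g \<xi>"
  by (rule fourier_eqI) (use assms is_ft_diff[OF is_ft_fourier[OF assms(1)] is_ft_fourier[OF assms(2)]] in \<open>auto intro: L2_diff\<close>)

lemma fourier_scaleR:
  fixes f :: "real^3 \<Rightarrow> real^'n::finite"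
  assumes "L2 f"
  shows "AE \<xi> in lebesgue. fourier (\<lambda>x. c *\<^sub>R f x) \<xi> = c *\<^sub>R fourier f \<xi>"
proof (rule fourier_eqI)
  show "is_ft (cpx k (\<lambda>x. c *\<^sub>R f x)) (\<lambda>\<xi>. (c *\<^sub>R fourier f \<xi>) $ k)" for k
    using is_ft_cmult[OF is_ft_fourier[OF assms, of k], of "complex_of_real c"] by (simp add: scaleR_conv_of_real[where 'a=complex])
qed (use assms L2_scaleR in auto)

lemma fourier_translate:
  fixes f :: "real^3 \<Rightarrow> real^'n::finite"
  assumes "L2 f"
  shows "AE \<xi> in lebesgue. fourier (\<lambda>x. f (a + x)) \<xi> = cis (a \<bullet> \<xi>) *s fourier f \<xi>"
proof (rule fourier_eqI)
  show "L2 (\<lambda>x. f (a + x))" using L2_isometry[of 1 f a] assms by simp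
  show "is_ft (cpx k (\<lambda>x. f (a + x))) (\<lambda>\<xi>. (cis (a \<bullet> \<xi>) *s fourier f \<xi>) $ k)" for k
    using is_ft_translate[OF is_ft_fourier[OF assms, of k], of a] by simp
qed

lemma fourier_inj:
  fixes f g :: "real^3 \<Rightarrow> real^'n::finite"
  assumes "L2 f" "L2 g" "AE \<xi> in lebesgue. fourier f \<xi> = fourier g \<xi>"
  shows "AE x in lebesgue. f x = g x"
proof -
  have "AE \<xi> in lebesgue. fourier (\<lambda>x. f x - g x) \<xi> = 0"
    using fourier_diff[OF assms(1,2)] assms(3) by eventually_elim simp
  then have "L2_norm (fourier (\<lambda>x. f x - g x)) = 0"
    using L2_norm_eq_0_iff[OF fourier_L2[OF L2_diff[OF assms(1,2)]]] by simp
  then show ?thesis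
    using L2_norm_eq_0_iff[OF L2_diff[OF assms(1,2)]] fourier_L2_norm[OF L2_diff[OF assms(1,2)]] by simp
qed

definition vcnj :: "complex^'n \<Rightarrow> complex^'n::finite" where
  "vcnj v = (\<chi> k. cnj (v $ k))"

lemma vcnj_nth [simp]: "vcnj v $ k = cnj (v $ k)"
  by (simp add: vcnj_def)

text \<open>The symmetry that characterises transforms of real fields.\<close>

definition hermitian :: "(real^3 \<Rightarrow> complex^'n::finite) \<Rightarrow> bool" where
  "hermitian h \<longleftrightarrow> (AE \<xi> in lebesgue. h (- \<xi>) = vcnj (h \<xi>))"

lemma AE_reflect:
  fixes P :: "'a::euclidean_space \<Rightarrow> bool"
  assumes "AE x in lebesgue. P x" shows "AE x in lebesgue. P (- x)"
  using AE_isometry[of "-1", OF _ assms, of 0] by simp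

lemma fourier_hermitian:
  fixes f :: "real^3 \<Rightarrow> real^'n::finite"
  assumes "L2 f" shows "hermitian (fourier f)"
proof -
  have "AE \<xi> in lebesgue. fourier f \<xi> = vcnj (fourier f (- \<xi>))"
  proof (rule fourier_eqI[OF assms])
    show "is_ft (cpx k f) (\<lambda>\<xi>. vcnj (fourier f (- \<xi>)) $ k)" for k
      using is_ft_cnj[OF is_ft_fourier[OF assms, of k]] by simp
  qed
  from AE_reflect[OF this] show ?thesis by (simp add: hermitian_def)
qed

text \<open>The inverse transform \<open>G\<close> of a Hermitian function has the same transform as its complex conjugate, so it
  is real.\<close>

lemma fourier_surj:
  fixes h :: "real^3 \<Rightarrow> complex^'n::finite"
  assumes h: "L2 h" and herm: "hermitian h"
  obtains g where "L2 g" "AE \<xi> in lebesgue. fourier g \<xi> = h \<xi>"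
proof -
  have "\<exists>G. is_ft G (\<lambda>\<xi>. h \<xi> $ k)" for k by (rule is_ft_surj[OF L2_nth[OF h]])
  then obtain G where G: "\<And>k. is_ft (G k) (\<lambda>\<xi>. h \<xi> $ k)" by metis
  have real: "AE x in lebesgue. G k x = complex_of_real (Re (G k x))" for k
  proof -
    have "AE \<xi> in lebesgue. cnj (h (- \<xi>) $ k) = h \<xi> $ k"
      using herm unfolding hermitian_def by eventually_elim simp
    then have "is_ft (\<lambda>x. cnj (G k x)) (\<lambda>\<xi>. h \<xi> $ k)"
      by (intro is_ft_cong_AE[OF is_ft_cnj[OF G[of k]]]) auto
    then have "AE x in lebesgue. cnj (G k x) = G k x" using G is_ft_inj by blast
    then show ?thesis by eventually_elim (metis Reals_cnj_iff of_real_Re)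
  qed
  define g where "g x = (\<chi> k. Re (G k x))" for x
  have ftg: "is_ft (cpx k g) (\<lambda>\<xi>. h \<xi> $ k)" for k
    by (rule is_ft_cong_AE[OF G[of k]]) (use real[of k] in \<open>auto simp: g_def\<close>)
  have gL: "L2 g" unfolding g_def
    by (intro L2_vec_lambda L2_bounded_linear[OF _ bounded_linear_Re] is_ft_L2(1)[OF G])
  show thesis using that[OF gL] fourier_eqI[OF gL ftg] by blast
qed

text \<open>The symmetry of the symbol makes the multiplied transform Hermitian, so a real field with this transform exists and
  the choice in \<open>fourier_multiplier\<close> is well founded.\<close>

lemma fourier_multiplier:
  fixes f :: "real^3 \<Rightarrow> real^'m::finite" and \<sigma> :: "real^3 \<Rightarrow> complex^'m \<Rightarrow> complex^'n::finite"
  assumes f: "L2 f" and L: "L2 (\<lambda>\<xi>. \<sigma> \<xi> (fourier f \<xi>))"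
    and sym: "\<And>\<xi> v. \<sigma> (- \<xi>) (vcnj v) = vcnj (\<sigma> \<xi> v)"
  shows L2_fourier_multiplier: "L2 (fourier_multiplier \<sigma> f)"
    and fourier_fourier_multiplier: "AE \<xi> in lebesgue. fourier (fourier_multiplier \<sigma> f) \<xi> = \<sigma> \<xi> (fourier f \<xi>)"
proof -
  have "hermitian (\<lambda>\<xi>. \<sigma> \<xi> (fourier f \<xi>))"
    using fourier_hermitian[OF f] unfolding hermitian_def by eventually_elim (simp add: sym)
  then obtain g where "L2 g \<and> (AE \<xi> in lebesgue. fourier g \<xi> = \<sigma> \<xi> (fourier f \<xi>))"
    using fourier_surj[OF L] by blast
  from someI[of "\<lambda>g. L2 g \<and> (AE \<xi> in lebesgue. fourier g \<xi> = \<sigma> \<xi> (fourier f \<xi>))", OF this]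
  have "L2 (fourier_multiplier \<sigma> f) \<and> (AE \<xi> in lebesgue. fourier (fourier_multiplier \<sigma> f) \<xi> = \<sigma> \<xi> (fourier f \<xi>))"
    unfolding fourier_multiplier_def .
  then show "L2 (fourier_multiplier \<sigma> f)" "AE \<xi> in lebesgue. fourier (fourier_multiplier \<sigma> f) \<xi> = \<sigma> \<xi> (fourier f \<xi>)"
    by auto
qed

lemma fourier_multiplier_cong_AE:
  assumes "L2 f" "AE x in lebesgue. f x = g x"
  shows "fourier_multiplier \<sigma> f = fourier_multiplier \<sigma> g"
  using fourier_cong_AE[OF assms] by (simp add: fourier_multiplier_def)

lemma Dpow:
  fixes f :: "real^3 \<Rightarrow> real^'n::finite"
  assumes f: "L2 f" and L: "L2 (\<lambda>\<xi>. (norm \<xi> powr s) *\<^sub>R fourier f \<xi>)"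
  shows "L2_norm (Dpow s f) = L2_norm (\<lambda>\<xi>. (norm \<xi> powr s) *\<^sub>R fourier f \<xi>)"
proof -
  have sym: "(norm (- \<xi>) powr s) *\<^sub>R vcnj v = vcnj ((norm \<xi> powr s) *\<^sub>R v)" for \<xi> :: "real^3" and v :: "complex^'n"
    by (simp add: vec_eq_iff)
  note m = fourier_multiplier[OF f L sym]
  show ?thesis
    unfolding Dpow_def fourier_L2_norm[OF m(1), symmetric]
    by (rule L2_norm_cong_AE[OF L2_measurable[OF fourier_L2[OF m(1)]] m(2)])
qed

lemma partial_x:
  fixes f :: "real^3 \<Rightarrow> real^'n::finite"
  assumes f: "L2 f" and L: "L2 (\<lambda>\<xi>. (\<i> * of_real (\<xi> $ j)) *s fourier f \<xi>)"
  shows partial_x_L2: "L2 (partial_x j f)"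
    and fourier_partial_x: "AE \<xi> in lebesgue. fourier (partial_x j f) \<xi> = (\<i> * of_real (\<xi> $ j)) *s fourier f \<xi>"
proof -
  have sym: "(\<i> * of_real ((- \<xi>) $ j)) *s vcnj v = vcnj ((\<i> * of_real (\<xi> $ j)) *s v)" for \<xi> :: "real^3" and v :: "complex^'n"
    by (simp add: vec_eq_iff)
  note m = fourier_multiplier[OF f L sym]
  show "L2 (partial_x j f)" "AE \<xi> in lebesgue. fourier (partial_x j f) \<xi> = (\<i> * of_real (\<xi> $ j)) *s fourier f \<xi>"
    using m by (auto simp: partial_x_def)
qed

text \<open>The Fourier symbol of the curl; it is Hermitian because the cross product with \<open>\<xi>\<close> is antisymmetric
  and \<open>\<i>\<close> compensates the sign.\<close>

definition curl_symbol :: "real^3 \<Rightarrow> complex^3 \<Rightarrow> complex^3" where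
  "curl_symbol \<xi> v = \<i> *s ccross \<xi> v"

lemma curl_symbol_nth:
  "curl_symbol \<xi> v $ 1 = \<i> * (of_real (\<xi> $ 2) * v $ 3 - of_real (\<xi> $ 3) * v $ 2)"
  "curl_symbol \<xi> v $ 2 = \<i> * (of_real (\<xi> $ 3) * v $ 1 - of_real (\<xi> $ 1) * v $ 3)"
  "curl_symbol \<xi> v $ 3 = \<i> * (of_real (\<xi> $ 1) * v $ 2 - of_real (\<xi> $ 2) * v $ 1)"
  by (simp_all add: curl_symbol_def ccross_def)

lemma curl_symbol_scaleR: "curl_symbol \<xi> (c *\<^sub>R v) = c *\<^sub>R curl_symbol \<xi> v"
  by (simp add: vec_eq_iff forall_3 curl_symbol_nth scaleR_conv_of_real[where 'a=complex] algebra_simps)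

lemma curl_symbol_self_adjoint: "curl_symbol \<xi> v \<bullet> w = v \<bullet> curl_symbol \<xi> w"
  by (simp add: inner_vec_def sum_3 curl_symbol_nth inner_complex_def algebra_simps)

lemma curl_symbol_vcnj: "curl_symbol (- \<xi>) (vcnj v) = vcnj (curl_symbol \<xi> v)"
  by (simp add: vec_eq_iff forall_3 curl_symbol_nth algebra_simps)

lemma norm_curl_symbol_le: "norm (curl_symbol \<xi> v) \<le> norm \<xi> * norm v"
proof (rule power2_le_imp_le)
  define a where "a = (\<chi> k. Re (v $ k))"
  define b where "b = (\<chi> k. Im (v $ k))"
  have v: "(norm v)\<^sup>2 = (norm a)\<^sup>2 + (norm b)\<^sup>2"
    by (simp add: norm_vec_power2 a_def b_def cmod_power2 sum.distrib)
  have "(norm (curl_symbol \<xi> v))\<^sup>2 = (norm (cross3 \<xi> a))\<^sup>2 + (norm (cross3 \<xi> b))\<^sup>2"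
    by (simp add: norm_vec_power2 sum_3 curl_symbol_nth norm_mult cmod_power2 cross_components a_def b_def)
       (simp add: power2_eq_square algebra_simps)
  also have "\<dots> \<le> (norm \<xi>)\<^sup>2 * (norm a)\<^sup>2 + (norm \<xi>)\<^sup>2 * (norm b)\<^sup>2"
    by (intro add_mono) (simp_all add: norm_cross)
  finally show "(norm (curl_symbol \<xi> v))\<^sup>2 \<le> (norm \<xi> * norm v)\<^sup>2"
    by (simp add: v power_mult_distrib distrib_left)
qed simp

lemma curl_symbol_measurable:
  assumes h: "h \<in> Lmeas"
  shows "(\<lambda>\<xi>. curl_symbol \<xi> (h \<xi>)) \<in> Lmeas"
proof -
  have hk: "(\<lambda>\<xi>. h \<xi> $ k) \<in> Lmeas" for k
    by (rule borel_measurable_continuous_on[OF _ h]) (intro continuous_intros)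
  have xk: "(\<lambda>\<xi>::real^3. complex_of_real (\<xi> $ k)) \<in> Lmeas" for k
    by (rule measurable_completion) (simp add: borel_measurable_continuous_onI continuous_intros)
  have c: "(\<lambda>\<xi>. curl_symbol \<xi> (h \<xi>) $ k) \<in> Lmeas" for k
    using exhaust_3[of k] by (auto simp: curl_symbol_nth intro!: borel_measurable_times borel_measurable_diff hk xk)
  have "(\<lambda>\<xi>. \<Sum>k\<in>UNIV. axis k (curl_symbol \<xi> (h \<xi>) $ k)) \<in> Lmeas"
    by (intro borel_measurable_sum borel_measurable_continuous_on[OF linear_continuous_on[OF bounded_linear_axis] c])
  then show ?thesis by (simp flip: vec_lambda_eq_sum_axis)
qed

lemma Dinv_curl:
  assumes f: "L2 f"
  shows Dinv_curl_L2: "L2 (Dinv_curl f)"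
    and fourier_Dinv_curl: "AE \<xi> in lebesgue. fourier (Dinv_curl f) \<xi> = inverse (norm \<xi>) *\<^sub>R curl_symbol \<xi> (fourier f \<xi>)"
proof -
  have eq: "(\<i> * of_real (inverse (norm \<xi>))) *s ccross \<xi> v = inverse (norm \<xi>) *\<^sub>R curl_symbol \<xi> v" for \<xi> v
    by (simp add: curl_symbol_def vec_eq_iff scaleR_conv_of_real[where 'a=complex])
  have sym: "inverse (norm (- \<xi>)) *\<^sub>R curl_symbol (- \<xi>) (vcnj v) = vcnj (inverse (norm \<xi>) *\<^sub>R curl_symbol \<xi> v)" for \<xi> v
    by (simp add: curl_symbol_vcnj) (simp add: vec_eq_iff)
  have nm: "(\<lambda>\<xi>::real^3. inverse (norm \<xi>)) \<in> Lmeas"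
    by (rule measurable_completion) measurable
  have le: "norm (inverse (norm \<xi>) *\<^sub>R curl_symbol \<xi> v) \<le> 1 * norm v" for \<xi> v
    using norm_curl_symbol_le[of \<xi> v] by (cases "\<xi> = 0") (auto simp: field_simps)
  have L: "L2 (\<lambda>\<xi>. inverse (norm \<xi>) *\<^sub>R curl_symbol \<xi> (fourier f \<xi>))"
  proof (rule L2_dominated(1)[OF fourier_L2[OF f]])
    show "(\<lambda>\<xi>. inverse (norm \<xi>) *\<^sub>R curl_symbol \<xi> (fourier f \<xi>)) \<in> Lmeas"
      by (rule borel_measurable_scaleR[OF nm curl_symbol_measurable[OF L2_measurable[OF fourier_L2[OF f]]]])
    show "AE \<xi> in lebesgue. norm (inverse (norm \<xi>) *\<^sub>R curl_symbol \<xi> (fourier f \<xi>)) \<le> 1 * norm (fourier f \<xi>)"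
      by (rule AE_I2) (rule le)
  qed simp
  show "L2 (Dinv_curl f)" "AE \<xi> in lebesgue. fourier (Dinv_curl f) \<xi> = inverse (norm \<xi>) *\<^sub>R curl_symbol \<xi> (fourier f \<xi>)"
    unfolding Dinv_curl_def eq using fourier_multiplier[OF f L sym] by auto
qed

section \<open>Helical projections and helicity\<close>

text \<open>The sign \<open>s\<close> is \<open>1\<close> for the projection \<open>helical_plus\<close> and \<open>-1\<close> for
  \<open>helical_minus\<close>, so that the two cases share their proofs.\<close>

definition helical :: "real \<Rightarrow> (real^3 \<Rightarrow> real^3) \<Rightarrow> real^3 \<Rightarrow> real^3" where
  "helical s v x = (1/2) *\<^sub>R (v x + s *\<^sub>R Dinv_curl v x)"

lemma helical_plus_eq: "helical_plus v = helical 1 v"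
  by (rule ext) (simp add: helical_plus_def helical_def)

lemma helical_minus_eq: "helical_minus v = helical (-1) v"
  by (rule ext) (simp add: helical_minus_def helical_def)

definition helical_symbol :: "real \<Rightarrow> real^3 \<Rightarrow> complex^3 \<Rightarrow> complex^3" where
  "helical_symbol s \<xi> v = (1/2) *\<^sub>R (v + s *\<^sub>R (inverse (norm \<xi>) *\<^sub>R curl_symbol \<xi> v))"

lemma norm_helical_symbol_le:
  assumes "\<bar>s\<bar> = 1" shows "norm (helical_symbol s \<xi> v) \<le> norm v"
proof -
  have "norm (inverse (norm \<xi>) *\<^sub>R curl_symbol \<xi> v) \<le> norm v"
    using norm_curl_symbol_le[of \<xi> v] by (cases "\<xi> = 0") (auto simp: field_simps)
  then have "norm (v + s *\<^sub>R (inverse (norm \<xi>) *\<^sub>R curl_symbol \<xi> v)) \<le> norm v + norm v"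
    using assms by (intro norm_triangle_le add_mono) (auto simp: abs_mult)
  then show ?thesis by (simp add: helical_symbol_def)
qed

text \<open>Polarisation \<open>\<bar>(v + w)/2\<bar>\<^sup>2 - \<bar>(v - w)/2\<bar>\<^sup>2 = v \<bullet> w\<close> with
  \<open>w = curl_symbol \<xi> v / norm \<xi>\<close>. At \<open>\<xi> = 0\<close> both sides vanish.\<close>

lemma helical_symbol_norm_diff:
  "norm \<xi> * ((norm (helical_symbol 1 \<xi> v))\<^sup>2 - (norm (helical_symbol (-1) \<xi> v))\<^sup>2) = v \<bullet> curl_symbol \<xi> v"
proof -
  let ?w = "inverse (norm \<xi>) *\<^sub>R curl_symbol \<xi> v"
  have "(norm (helical_symbol 1 \<xi> v))\<^sup>2 - (norm (helical_symbol (-1) \<xi> v))\<^sup>2 = v \<bullet> ?w"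
    unfolding helical_symbol_def power2_norm_eq_inner
    by (simp add: inner_add_left inner_add_right inner_diff_left inner_diff_right inner_commute algebra_simps)
  then show ?thesis
  proof (cases "\<xi> = 0")
    case True
    have "norm (curl_symbol \<xi> v) = 0" using norm_curl_symbol_le[of \<xi> v] True by simp
    then show ?thesis using True by simp
  qed simp
qed

lemma helical_symbol_measurable:
  assumes h: "h \<in> Lmeas"
  shows "(\<lambda>\<xi>. helical_symbol s \<xi> (h \<xi>)) \<in> Lmeas"
proof -
  have nm: "(\<lambda>\<xi>::real^3. inverse (norm \<xi>)) \<in> Lmeas"
    by (rule measurable_completion) measurable
  show ?thesis unfolding helical_symbol_def
    by (intro borel_measurable_scaleR borel_measurable_add h borel_measurable_const nm curl_symbol_measurable[OF h])
qed

lemma helical: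
  assumes v: "L2 v"
  shows helical_L2: "L2 (helical s v)"
    and fourier_helical: "AE \<xi> in lebesgue. fourier (helical s v) \<xi> = helical_symbol s \<xi> (fourier v \<xi>)"
proof -
  note D = Dinv_curl[OF v]
  have L1: "L2 (\<lambda>x. s *\<^sub>R Dinv_curl v x)" by (rule L2_scaleR[OF D(1)])
  have L2': "L2 (\<lambda>x. v x + s *\<^sub>R Dinv_curl v x)" by (rule L2_add[OF v L1])
  show "L2 (helical s v)" unfolding helical_def by (rule L2_scaleR[OF L2'])
  show "AE \<xi> in lebesgue. fourier (helical s v) \<xi> = helical_symbol s \<xi> (fourier v \<xi>)"
    using fourier_scaleR[OF L2', of "1/2"] fourier_add[OF v L1] fourier_scaleR[OF D(1), of s] D(2)
    unfolding helical_def[abs_def] helical_symbol_def by eventually_elim simp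
qed

lemma one_le_weight: "0 \<le> s \<Longrightarrow> 1 \<le> (1 + (norm \<xi>)\<^sup>2) powr (s / 2)"
  by (intro ge_one_powr_ge_zero) auto

lemma sobolev_L2: "sobolev s f \<Longrightarrow> L2 f" by (simp add: sobolev_def)

text \<open>Bounds for multipliers on Sobolev spaces reduce to a pointwise comparison of the symbol with the weight.\<close>

lemma sobolev_dominated:
  assumes f: "sobolev s f" and g: "g \<in> Lmeas" and c: "0 \<le> c"
    and le: "AE \<xi> in lebesgue. norm (g \<xi>) \<le> c * ((1 + (norm \<xi>)\<^sup>2) powr (s / 2) * norm (fourier f \<xi>))"
  shows "L2 g" "L2_norm g \<le> c * sobolev_norm s f"
proof -
  have "AE \<xi> in lebesgue. norm (g \<xi>) \<le> c * norm (sobolev_weight s f \<xi>)"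
    using le by (simp add: sobolev_weight_def)
  then show "L2 g" "L2_norm g \<le> c * sobolev_norm s f"
    unfolding sobolev_norm_def using f L2_dominated[OF _ g _ c] by (auto simp: sobolev_def)
qed

lemma sobolev_mono:
  assumes f: "sobolev s f" and st: "t \<le> s" "0 \<le> t"
  shows "sobolev t f" "sobolev_norm t f \<le> sobolev_norm s f"
proof -
  have m: "sobolev_weight t f \<in> Lmeas"
  proof -
    have "(\<lambda>\<xi>::real^3. (1 + (norm \<xi>)\<^sup>2) powr (t/2)) \<in> Lmeas"
      by (rule measurable_completion) measurable
    then show ?thesis unfolding sobolev_weight_def
      using L2_measurable[OF fourier_L2[OF sobolev_L2[OF f]]] by (rule borel_measurable_scaleR)
  qed
  have le: "AE \<xi> in lebesgue. norm (sobolev_weight t f \<xi>) \<le> 1 * ((1 + (norm \<xi>)\<^sup>2) powr (s / 2) * norm (fourier f \<xi>))"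
    using st by (auto simp: sobolev_weight_def intro!: AE_I2 mult_right_mono powr_mono)
  show "sobolev t f" "sobolev_norm t f \<le> sobolev_norm s f"
    using sobolev_dominated[OF f m _ le] f by (auto simp: sobolev_def sobolev_norm_def)
qed

lemma norm_le_weight1: "norm \<xi> \<le> (1 + (norm (\<xi>::'a::real_normed_vector))\<^sup>2) powr (1 / 2)"
proof -
  have "norm \<xi> = sqrt ((norm \<xi>)\<^sup>2)" by simp
  also have "\<dots> \<le> sqrt (1 + (norm \<xi>)\<^sup>2)" by (rule real_sqrt_le_mono) simp
  finally show ?thesis by (simp add: powr_half_sqrt)
qed

lemma norm_powr_half_le_weight1: "norm \<xi> powr (1 / 2) \<le> (1 + (norm (\<xi>::'a::real_normed_vector))\<^sup>2) powr (1 / 2)"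
proof (rule powr_mono2)
  show "norm \<xi> \<le> 1 + (norm \<xi>)\<^sup>2"
  proof (cases "norm \<xi> \<le> 1")
    case True
    have "0 \<le> (norm \<xi>)\<^sup>2" by simp
    with True show ?thesis by linarith
  next
    case False
    then have "norm \<xi> * 1 \<le> norm \<xi> * norm \<xi>" by (intro mult_left_mono) auto
    then show ?thesis by (simp add: power2_eq_square)
  qed
qed auto

lemma weight2: "(1 + (norm \<xi>)\<^sup>2) powr (2 / 2) = 1 + (norm \<xi>)\<^sup>2"
  by (simp add: add_nonneg_pos)

lemma norm_component_symbol: "norm ((\<i> * of_real (\<xi> $ j)) *s (v :: complex^'n::finite)) = \<bar>\<xi> $ j\<bar> * norm v"
proof -
  have "(norm ((\<i> * of_real (\<xi> $ j)) *s v))\<^sup>2 = (\<bar>\<xi> $ j\<bar> * norm v)\<^sup>2"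
    by (simp add: norm_vec_power2 norm_mult power_mult_distrib sum_distrib_left)
  then show ?thesis by (simp add: power2_eq_iff_nonneg)
qed

lemma component_symbol_measurable:
  assumes h: "h \<in> Lmeas"
  shows "(\<lambda>\<xi>. (\<i> * of_real (\<xi> $ j)) *s (h \<xi> :: complex^'n::finite)) \<in> borel_measurable (lebesgue :: (real^3) measure)"
proof -
  have hk: "(\<lambda>\<xi>. h \<xi> $ k) \<in> Lmeas" for k
    by (rule borel_measurable_continuous_on[OF _ h]) (intro continuous_intros)
  have xk: "(\<lambda>\<xi>::real^3. \<i> * of_real (\<xi> $ k)) \<in> Lmeas" for k
    by (rule measurable_completion) (simp add: borel_measurable_continuous_onI continuous_intros)
  have c: "(\<lambda>\<xi>. ((\<i> * of_real (\<xi> $ j)) *s h \<xi>) $ k) \<in> Lmeas" for k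
    using borel_measurable_times[OF xk hk] by simp
  have "(\<lambda>\<xi>. \<Sum>k\<in>UNIV. axis k (((\<i> * of_real (\<xi> $ j)) *s h \<xi>) $ k)) \<in> Lmeas"
    by (intro borel_measurable_sum borel_measurable_continuous_on[OF linear_continuous_on[OF bounded_linear_axis] c])
  then show ?thesis unfolding vec_lambda_eq_sum_axis[symmetric] vec_nth_inverse .
qed

lemma sobolev1_component_symbol:
  fixes f :: "real^3 \<Rightarrow> real^'n::finite"
  assumes f: "sobolev 1 f"
  shows "L2 (\<lambda>\<xi>. (\<i> * of_real (\<xi> $ j)) *s fourier f \<xi>)"
    "L2_norm (\<lambda>\<xi>. (\<i> * of_real (\<xi> $ j)) *s fourier f \<xi>) \<le> sobolev_norm 1 f"
proof -
  have m: "(\<lambda>\<xi>. (\<i> * of_real (\<xi> $ j)) *s fourier f \<xi>) \<in> Lmeas"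
    by (rule component_symbol_measurable[OF L2_measurable[OF fourier_L2[OF sobolev_L2[OF f]]]])
  have "\<bar>\<xi> $ j\<bar> \<le> (1 + (norm \<xi>)\<^sup>2) powr (1 / 2)" for \<xi> :: "real^3"
    using component_le_norm_cart[of \<xi> j] norm_le_weight1[of \<xi>] by simp
  then have le: "AE \<xi> in lebesgue. norm ((\<i> * of_real (\<xi> $ j)) *s fourier f \<xi>) \<le> 1 * ((1 + (norm \<xi>)\<^sup>2) powr (1 / 2) * norm (fourier f \<xi>))"
    by (auto simp: norm_component_symbol intro!: AE_I2 mult_right_mono)
  show "L2 (\<lambda>\<xi>. (\<i> * of_real (\<xi> $ j)) *s fourier f \<xi>)"
    "L2_norm (\<lambda>\<xi>. (\<i> * of_real (\<xi> $ j)) *s fourier f \<xi>) \<le> sobolev_norm 1 f"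
    using sobolev_dominated[OF f m _ le] by auto
qed

lemma sobolev1_partial_x:
  fixes f :: "real^3 \<Rightarrow> real^'n::finite"
  assumes f: "sobolev 1 f"
  shows "L2 (partial_x j f)" "L2_norm (partial_x j f) \<le> sobolev_norm 1 f"
    "AE \<xi> in lebesgue. fourier (partial_x j f) \<xi> = (\<i> * of_real (\<xi> $ j)) *s fourier f \<xi>"
proof -
  note p = partial_x[OF sobolev_L2[OF f] sobolev1_component_symbol(1)[OF f, of j]]
  show "L2 (partial_x j f)" by (rule p)
  show "AE \<xi> in lebesgue. fourier (partial_x j f) \<xi> = (\<i> * of_real (\<xi> $ j)) *s fourier f \<xi>" by (rule p)
  have "L2_norm (partial_x j f) = L2_norm (fourier (partial_x j f))" by (rule fourier_L2_norm[OF p(1), symmetric])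
  also have "\<dots> = L2_norm (\<lambda>\<xi>. (\<i> * of_real (\<xi> $ j)) *s fourier f \<xi>)"
    by (rule L2_norm_cong_AE[OF L2_measurable[OF fourier_L2[OF p(1)]] p(2)])
  finally show "L2_norm (partial_x j f) \<le> sobolev_norm 1 f" using sobolev1_component_symbol(2)[OF f, of j] by simp
qed

lemma L2_weighted_integrable:
  assumes "L2 (\<lambda>\<xi>. w \<xi> *\<^sub>R h \<xi>)"
  shows "integrable lebesgue (\<lambda>\<xi>. (w \<xi>)\<^sup>2 * (norm (h \<xi>))\<^sup>2)"
    "(L2_norm (\<lambda>\<xi>. w \<xi> *\<^sub>R h \<xi>))\<^sup>2 = (LINT \<xi>|lebesgue. (w \<xi>)\<^sup>2 * (norm (h \<xi>))\<^sup>2)"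
  using assms by (auto simp: L2_def L2_norm_sq power_mult_distrib)

lemma half_derivative_helical:
  assumes v: "sobolev 1 v" and s: "\<bar>s\<bar> = 1"
  shows "integrable lebesgue (\<lambda>\<xi>. norm \<xi> * (norm (helical_symbol s \<xi> (fourier v \<xi>)))\<^sup>2)"
    "(L2_norm (Dpow (1/2) (helical s v)))\<^sup>2 = (LINT \<xi>|lebesgue. norm \<xi> * (norm (helical_symbol s \<xi> (fourier v \<xi>)))\<^sup>2)"
proof -
  note h = helical[OF sobolev_L2[OF v], of s]
  let ?g = "\<lambda>\<xi>. (norm \<xi> powr (1/2)) *\<^sub>R helical_symbol s \<xi> (fourier v \<xi>)"
  have wm: "(\<lambda>\<xi>::real^3. norm \<xi> powr (1/2)) \<in> Lmeas"
    by (rule measurable_completion) measurable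
  have gm: "?g \<in> Lmeas"
    by (rule borel_measurable_scaleR[OF wm helical_symbol_measurable[OF L2_measurable[OF fourier_L2[OF sobolev_L2[OF v]]]]])
  have gL: "L2 ?g"
  proof (rule sobolev_dominated(1)[OF v gm, of 1])
    show "AE \<xi> in lebesgue. norm (?g \<xi>) \<le> 1 * ((1 + (norm \<xi>)\<^sup>2) powr (1 / 2) * norm (fourier v \<xi>))"
      using norm_powr_half_le_weight1 norm_helical_symbol_le[OF s]
      by (intro AE_I2) (auto intro!: mult_mono)
  qed simp
  have eq: "AE \<xi> in lebesgue. ?g \<xi> = (norm \<xi> powr (1/2)) *\<^sub>R fourier (helical s v) \<xi>"
    using h(2) by eventually_elim simp
  have "L2_norm (Dpow (1/2) (helical s v)) = L2_norm (\<lambda>\<xi>. (norm \<xi> powr (1/2)) *\<^sub>R fourier (helical s v) \<xi>)"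
    by (rule Dpow[OF h(1) L2_cong_AE[OF gL eq]])
  also have "\<dots> = L2_norm ?g" by (rule L2_norm_cong_AE[OF gm eq, symmetric])
  finally have n: "L2_norm (Dpow (1/2) (helical s v)) = L2_norm ?g" .
  have sq: "(norm \<xi> powr (1/2))\<^sup>2 = norm \<xi>" for \<xi> :: "real^3"
    by (simp add: powr_half_sqrt)
  show "integrable lebesgue (\<lambda>\<xi>. norm \<xi> * (norm (helical_symbol s \<xi> (fourier v \<xi>)))\<^sup>2)"
    "(L2_norm (Dpow (1/2) (helical s v)))\<^sup>2 = (LINT \<xi>|lebesgue. norm \<xi> * (norm (helical_symbol s \<xi> (fourier v \<xi>)))\<^sup>2)"
    unfolding n using L2_weighted_integrable[OF gL] unfolding sq by auto
qed

text \<open>The square of the \<open>L\<^sup>2\<close> norm of \<open>D\<^sup>1\<^sup>/\<^sup>2 \<nabla> u\<^sub>s\<close>, with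
  \<open>u\<^sub>s\<close> the helical projection of \<open>v\<close>, on the Fourier side.\<close>

abbreviation helical_dissipation :: "real \<Rightarrow> (real^3 \<Rightarrow> real^3) \<Rightarrow> real" where
  "helical_dissipation s v \<equiv> (LINT \<xi>|lebesgue. (norm \<xi>) ^ 3 * (norm (helical_symbol s \<xi> (fourier v \<xi>)))\<^sup>2)"

lemma half_derivative_gradient_helical:
  assumes v: "sobolev 2 v" and s: "\<bar>s\<bar> = 1"
  shows "integrable lebesgue (\<lambda>\<xi>. (norm \<xi>) ^ 3 * (norm (helical_symbol s \<xi> (fourier v \<xi>)))\<^sup>2)"
    "(\<Sum>j\<in>UNIV. (L2_norm (Dpow (1/2) (partial_x j (helical s v))))\<^sup>2)
      = helical_dissipation s v"
    "helical_dissipation s v \<le> (sobolev_norm 2 v)\<^sup>2"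
proof -
  note vL = sobolev_L2[OF v]
  note h = helical[OF vL, of s]
  have hm: "(\<lambda>\<xi>. helical_symbol s \<xi> (fourier v \<xi>)) \<in> Lmeas"
    by (rule helical_symbol_measurable[OF L2_measurable[OF fourier_L2[OF vL]]])
  let ?a = "\<lambda>j \<xi>. (\<i> * of_real (\<xi> $ j)) *s helical_symbol s \<xi> (fourier v \<xi>)"
  let ?g = "\<lambda>j \<xi>. (norm \<xi> powr (1/2)) *\<^sub>R ?a j \<xi>"
  have wm: "(\<lambda>\<xi>::real^3. norm \<xi> powr r) \<in> Lmeas" for r
    by (rule measurable_completion) measurable
  have am: "?a j \<in> Lmeas" for j by (rule component_symbol_measurable[OF hm])
  have gm: "?g j \<in> Lmeas" for j by (rule borel_measurable_scaleR[OF wm am])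
  have le1: "norm \<xi> \<le> 1 + (norm \<xi>)\<^sup>2" for \<xi> :: "real^3"
    using sum_squares_bound[of 1 "norm \<xi>"] norm_ge_zero[of \<xi>] unfolding power2_eq_square by linarith
  have le32: "norm \<xi> powr (1/2) * norm \<xi> \<le> 1 + (norm \<xi>)\<^sup>2" for \<xi> :: "real^3"
  proof (cases "norm \<xi> \<le> 1")
    case True
    then have "norm \<xi> powr (1/2) * norm \<xi> \<le> 1 * 1" by (intro mult_mono powr_le1) auto
    also have "\<dots> \<le> 1 + (norm \<xi>)\<^sup>2" by simp
    finally show ?thesis .
  next
    case False
    then have "norm \<xi> powr (1/2) \<le> norm \<xi> powr 1" by (intro powr_mono) auto
    then have "norm \<xi> powr (1/2) * norm \<xi> \<le> norm \<xi> * norm \<xi>" by (intro mult_right_mono) auto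
    then show ?thesis by (simp add: power2_eq_square)
  qed
  have aL: "L2 (?a j)" for j
  proof (rule sobolev_dominated(1)[OF v am, of 1])
    have "norm (?a j \<xi>) \<le> norm \<xi> * norm (fourier v \<xi>)" for \<xi>
      unfolding norm_component_symbol
      by (intro mult_mono norm_helical_symbol_le[OF s] component_le_norm_cart) auto
    then show "AE \<xi> in lebesgue. norm (?a j \<xi>) \<le> 1 * ((1 + (norm \<xi>)\<^sup>2) powr (2 / 2) * norm (fourier v \<xi>))"
      unfolding weight2 using order_trans[OF _ mult_right_mono[OF le1 norm_ge_zero]] by (auto intro!: AE_I2)
  qed simp
  have gL: "L2 (?g j)" for j
  proof (rule sobolev_dominated(1)[OF v gm, of 1])
    have "norm (?g j \<xi>) \<le> (norm \<xi> powr (1/2) * norm \<xi>) * norm (fourier v \<xi>)" for \<xi>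
      unfolding norm_component_symbol norm_scaleR mult.assoc
      by (intro mult_mono norm_helical_symbol_le[OF s] component_le_norm_cart) auto
    also have "\<dots> \<xi> \<le> (1 + (norm \<xi>)\<^sup>2) * norm (fourier v \<xi>)" for \<xi>
      by (intro mult_right_mono le32) auto
    finally show "AE \<xi> in lebesgue. norm (?g j \<xi>) \<le> 1 * ((1 + (norm \<xi>)\<^sup>2) powr (2 / 2) * norm (fourier v \<xi>))"
      unfolding weight2 by (auto intro!: AE_I2)
  qed simp
  have eqa: "AE \<xi> in lebesgue. ?a j \<xi> = (\<i> * of_real (\<xi> $ j)) *s fourier (helical s v) \<xi>" for j
    using h(2) by eventually_elim simp
  note p = partial_x[OF h(1) L2_cong_AE[OF aL eqa]]
  have eqg: "AE \<xi> in lebesgue. ?g j \<xi> = (norm \<xi> powr (1/2)) *\<^sub>R fourier (partial_x j (helical s v)) \<xi>" for j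
    using p(2)[of j] eqa[of j] by eventually_elim simp
  have n: "L2_norm (Dpow (1/2) (partial_x j (helical s v))) = L2_norm (?g j)" for j
    using Dpow[OF p(1) L2_cong_AE[OF gL eqg], of j] L2_norm_cong_AE[OF gm eqg, of j] by simp
  have gsq: "(norm (?g j \<xi>))\<^sup>2 = norm \<xi> * (\<xi> $ j)\<^sup>2 * (norm (helical_symbol s \<xi> (fourier v \<xi>)))\<^sup>2" for j \<xi>
    by (simp add: norm_component_symbol power_mult_distrib powr_half_sqrt)
  have sumsq: "(\<Sum>j\<in>UNIV. (norm (?g j \<xi>))\<^sup>2) = (norm \<xi>) ^ 3 * (norm (helical_symbol s \<xi> (fourier v \<xi>)))\<^sup>2" for \<xi>
  proof -
    have "(\<Sum>j\<in>UNIV. (norm (?g j \<xi>))\<^sup>2) = norm \<xi> * (\<Sum>j\<in>UNIV. (\<xi> $ j)\<^sup>2) * (norm (helical_symbol s \<xi> (fourier v \<xi>)))\<^sup>2"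
      unfolding gsq by (simp add: sum_distrib_left sum_distrib_right)
    also have "(\<Sum>j\<in>UNIV. (\<xi> $ j)\<^sup>2) = (norm \<xi>)\<^sup>2" using norm_vec_power2[of \<xi>] by simp
    finally show ?thesis by (simp add: power2_eq_square power3_eq_cube)
  qed
  have gi: "integrable lebesgue (\<lambda>\<xi>. (norm (?g j \<xi>))\<^sup>2)" for j by (rule L2_integrable_norm_sq[OF gL])
  show int: "integrable lebesgue (\<lambda>\<xi>. (norm \<xi>) ^ 3 * (norm (helical_symbol s \<xi> (fourier v \<xi>)))\<^sup>2)"
    unfolding sumsq[symmetric] by (rule Bochner_Integration.integrable_sum) (rule gi)
  show "(\<Sum>j\<in>UNIV. (L2_norm (Dpow (1/2) (partial_x j (helical s v))))\<^sup>2)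
      = helical_dissipation s v"
    unfolding sumsq[symmetric] n L2_norm_sq by (rule Bochner_Integration.integral_sum[symmetric]) (rule gi)
  have "helical_dissipation s v \<le> (LINT \<xi>|lebesgue. (norm (sobolev_weight 2 v \<xi>))\<^sup>2)"
  proof (rule integral_mono[OF int])
    show "integrable lebesgue (\<lambda>\<xi>. (norm (sobolev_weight 2 v \<xi>))\<^sup>2)" using v by (simp add: sobolev_def L2_def)
    fix \<xi> :: "real^3"
    have "(norm \<xi>) ^ 3 = (norm \<xi> powr (1/2) * norm \<xi>)\<^sup>2"
      by (simp add: power_mult_distrib powr_half_sqrt power2_eq_square power3_eq_cube)
    also have "\<dots> \<le> (1 + (norm \<xi>)\<^sup>2)\<^sup>2" by (intro power_mono le32) auto
    finally have "(norm \<xi>) ^ 3 * (norm (helical_symbol s \<xi> (fourier v \<xi>)))\<^sup>2 \<le> (1 + (norm \<xi>)\<^sup>2)\<^sup>2 * (norm (fourier v \<xi>))\<^sup>2"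
      by (intro mult_mono power_mono norm_helical_symbol_le[OF s]) auto
    then show "(norm \<xi>) ^ 3 * (norm (helical_symbol s \<xi> (fourier v \<xi>)))\<^sup>2 \<le> (norm (sobolev_weight 2 v \<xi>))\<^sup>2"
      unfolding sobolev_weight_def weight2 by (simp add: power_mult_distrib)
  qed
  then show "helical_dissipation s v \<le> (sobolev_norm 2 v)\<^sup>2"
    by (simp add: sobolev_norm_def L2_norm_sq)
qed

definition helicity :: "(real^3 \<Rightarrow> real^3) \<Rightarrow> real" where
  "helicity v = (LINT \<xi>|lebesgue. fourier v \<xi> \<bullet> curl_symbol \<xi> (fourier v \<xi>))"

definition helicity_dissipation :: "(real^3 \<Rightarrow> real^3) \<Rightarrow> real" where
  "helicity_dissipation v = (LINT \<xi>|lebesgue. (norm \<xi>)\<^sup>2 * (fourier v \<xi> \<bullet> curl_symbol \<xi> (fourier v \<xi>)))"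

lemma half_norm_diff_eq_helicity:
  assumes v: "sobolev 1 v"
  shows "(L2_norm (Dpow (1/2) (helical 1 v)))\<^sup>2 - (L2_norm (Dpow (1/2) (helical (-1) v)))\<^sup>2 = helicity v"
proof -
  note h = half_derivative_helical[OF v]
  have "(L2_norm (Dpow (1/2) (helical 1 v)))\<^sup>2 - (L2_norm (Dpow (1/2) (helical (-1) v)))\<^sup>2
    = (LINT \<xi>|lebesgue. norm \<xi> * (norm (helical_symbol 1 \<xi> (fourier v \<xi>)))\<^sup>2 - norm \<xi> * (norm (helical_symbol (-1) \<xi> (fourier v \<xi>)))\<^sup>2)"
    using h(1)[of 1] h(1)[of "-1"] h(2)[of 1] h(2)[of "-1"] by simp
  then show ?thesis
    unfolding helicity_def right_diff_distrib[symmetric] helical_symbol_norm_diff .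
qed

lemma dissipation_diff_eq:
  assumes v: "sobolev 2 v"
  shows "helical_dissipation 1 v
      - helical_dissipation (-1) v = helicity_dissipation v"
proof -
  note h = half_derivative_gradient_helical[OF v]
  have "(norm \<xi>) ^ 3 * (norm (helical_symbol 1 \<xi> w))\<^sup>2 - (norm \<xi>) ^ 3 * (norm (helical_symbol (-1) \<xi> w))\<^sup>2
     = (norm \<xi>)\<^sup>2 * (w \<bullet> curl_symbol \<xi> w)" for \<xi> w
    unfolding helical_symbol_norm_diff[symmetric]
    by (simp add: power2_eq_square power3_eq_cube algebra_simps)
  then show ?thesis
    using h(1)[of 1] h(1)[of "-1"] unfolding helicity_dissipation_def by (simp flip: Bochner_Integration.integral_diff)
qed

section \<open>Difference quotients and the Sobolev embedding\<close>

lemma L2_lim_fourierI: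
  fixes f :: "real^3 \<Rightarrow> real^'n::finite"
  assumes s: "\<And>n. L2 (s n)" and f: "L2 f" and lim: "L2_lim (\<lambda>n. fourier (s n)) (fourier f)"
  shows "L2_lim s f"
proof -
  have "L2_norm (\<lambda>x. s n x - f x) = L2_norm (\<lambda>\<xi>. fourier (s n) \<xi> - fourier f \<xi>)" for n
    using fourier_L2_norm[OF L2_diff[OF s f], of n]
      L2_norm_cong_AE[OF L2_measurable[OF fourier_L2[OF L2_diff[OF s f]]] fourier_diff[OF s f], of n] by simp
  then show ?thesis using s f lim by (simp add: L2_lim_def)
qed

definition diff_quotient :: "real \<Rightarrow> 3 \<Rightarrow> (real^3 \<Rightarrow> 'b) \<Rightarrow> real^3 \<Rightarrow> 'b::real_vector" where
  "diff_quotient h j f x = (1 / h) *\<^sub>R (f (h *\<^sub>R axis j 1 + x) - f x)"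

lemma L2_diff_quotient: "L2 f \<Longrightarrow> L2 (diff_quotient h j f)"
  using L2_isometry[of 1 f "h *\<^sub>R axis j 1"]
  unfolding diff_quotient_def by (intro L2_scaleR L2_diff) auto

lemma norm_cis_minus_1_le: "norm (cis t - 1) \<le> \<bar>t\<bar>"
proof -
  have c: "cos t = 1 - 2 * (sin (t/2))\<^sup>2" using cos_double_sin[of "t/2"] by simp
  have "(norm (cis t - 1))\<^sup>2 = (cos t - 1)\<^sup>2 + (sin t)\<^sup>2" by (simp add: cmod_power2)
  also have "\<dots> = 2 - 2 * cos t" unfolding sin_squared_eq by (simp add: power2_eq_square algebra_simps)
  also have "\<dots> = (2 * \<bar>sin (t/2)\<bar>)\<^sup>2" unfolding c by (simp add: power_mult_distrib)
  also have "\<dots> \<le> (2 * \<bar>t/2\<bar>)\<^sup>2" using abs_sin_x_le_abs_x[of "t/2"] by (intro power_mono) auto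
  finally have "(norm (cis t - 1))\<^sup>2 \<le> \<bar>t\<bar>\<^sup>2" by simp
  then show ?thesis by (rule power2_le_imp_le) simp
qed

lemma cis_difference_quotient_tendsto:
  assumes h: "\<And>n. h n \<noteq> 0" "h \<longlonglongrightarrow> 0"
  shows "(\<lambda>n. (1 / h n) *\<^sub>R (cis (h n * t) - 1)) \<longlonglongrightarrow> \<i> * complex_of_real t"
proof -
  let ?A = "\<i> * complex_of_real t"
  have "((\<lambda>z. exp (z * ?A)) has_field_derivative ?A) (at 0)"
    by (auto intro!: derivative_eq_intros)
  then have "((\<lambda>z. (exp (z * ?A) - 1) / z) \<longlongrightarrow> ?A) (at 0)"
    by (simp add: DERIV_def)
  moreover have "filterlim (\<lambda>n. complex_of_real (h n)) (at 0) sequentially"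
    using h tendsto_of_real[OF h(2), where 'a=complex] by (auto simp: filterlim_at)
  ultimately have "(\<lambda>n. (exp (complex_of_real (h n) * ?A) - 1) / complex_of_real (h n)) \<longlonglongrightarrow> ?A"
    by (rule filterlim_compose)
  then show ?thesis
    by (simp add: cis_conv_exp scaleR_conv_of_real mult_ac)
qed

text \<open>On the Fourier side the quotient multiplies by \<open>(cis (h \<xi>\<^sub>j) - 1) / h\<close>, which converges to
  \<open>\<i> \<xi>\<^sub>j\<close> and is dominated by \<open>\<bar>\<xi>\<^sub>j\<bar>\<close>.\<close>

lemma diff_quotient_L2_lim:
  fixes f :: "real^3 \<Rightarrow> real^'n::finite"
  assumes f: "L2 f" and d: "L2 (\<lambda>\<xi>. (\<i> * of_real (\<xi> $ j)) *s fourier f \<xi>)"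
    and h: "\<And>n. h n \<noteq> 0" "h \<longlonglongrightarrow> 0"
  shows "L2_lim (\<lambda>n. diff_quotient (h n) j f) (partial_x j f)"
proof (rule L2_lim_fourierI)
  note p = partial_x[OF f d]
  show dL: "L2 (diff_quotient (h n) j f)" for n by (rule L2_diff_quotient[OF f])
  show "L2 (partial_x j f)" by (rule p)
  let ?S = "\<lambda>n \<xi>. ((1 / h n) *\<^sub>R (cis (h n * \<xi> $ j) - 1)) *s fourier f \<xi>"
  have FS: "AE \<xi> in lebesgue. fourier (diff_quotient (h n) j f) \<xi> = ?S n \<xi>" for n
  proof -
    have tL: "L2 (\<lambda>x. f (h n *\<^sub>R axis j 1 + x))" using L2_isometry[of 1 f "h n *\<^sub>R axis j 1"] f by simp
    have ax: "(h n *\<^sub>R axis j 1) \<bullet> \<xi> = h n * \<xi> $ j" for \<xi> :: "real^3" by (simp add: inner_axis')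
    show ?thesis
      using fourier_scaleR[OF L2_diff[OF tL f], of "1 / h n"] fourier_diff[OF tL f] fourier_translate[OF f, of "h n *\<^sub>R axis j 1"]
      unfolding diff_quotient_def[abs_def]
    proof eventually_elim
      case (elim \<xi>)
      show ?case unfolding elim ax by (simp add: vec_eq_iff scaleR_conv_of_real[where 'a=complex] algebra_simps)
    qed
  qed
  have "L2_lim ?S (\<lambda>\<xi>. (\<i> * of_real (\<xi> $ j)) *s fourier f \<xi>)"
  proof (rule L2_lim_dominated[OF _ _ d])
    show "?S n \<in> Lmeas" for n
      using borel_measurable_AE[OF L2_measurable[OF fourier_L2[OF dL]] FS] .
    show "(\<lambda>\<xi>. (\<i> * of_real (\<xi> $ j)) *s fourier f \<xi>) \<in> Lmeas"
      by (rule L2_measurable[OF d])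
    show "AE \<xi> in lebesgue. (\<lambda>n. ?S n \<xi>) \<longlonglongrightarrow> (\<i> * of_real (\<xi> $ j)) *s fourier f \<xi>"
    proof (rule AE_I2)
      fix \<xi> :: "real^3"
      show "(\<lambda>n. ?S n \<xi>) \<longlonglongrightarrow> (\<i> * of_real (\<xi> $ j)) *s fourier f \<xi>"
        by (rule vec_tendstoI, unfold vector_smult_component, rule tendsto_mult[OF cis_difference_quotient_tendsto[OF h] tendsto_const])
    qed
    show "AE \<xi> in lebesgue. norm (?S n \<xi>) \<le> norm ((\<i> * of_real (\<xi> $ j)) *s fourier f \<xi>)" for n
    proof (rule AE_I2)
      fix \<xi> :: "real^3"
      have "\<bar>1 / h n\<bar> * norm (cis (h n * \<xi> $ j) - 1) \<le> \<bar>1 / h n\<bar> * \<bar>h n * \<xi> $ j\<bar>"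
        by (intro mult_left_mono norm_cis_minus_1_le) auto
      also have "\<dots> = \<bar>\<xi> $ j\<bar>" using h(1)[of n] by (simp add: abs_mult)
      finally have le: "norm ((1 / h n) *\<^sub>R (cis (h n * \<xi> $ j) - 1)) \<le> norm (\<i> * of_real (\<xi> $ j))" by (simp add: norm_mult)
      have "(norm (?S n \<xi>))\<^sup>2 \<le> (norm ((\<i> * of_real (\<xi> $ j)) *s fourier f \<xi>))\<^sup>2"
        unfolding norm_vec_power2 vector_smult_component norm_mult[of _ "fourier f \<xi> $ _"] power_mult_distrib
        by (intro sum_mono mult_right_mono power_mono le) auto
      then show "norm (?S n \<xi>) \<le> norm ((\<i> * of_real (\<xi> $ j)) *s fourier f \<xi>)"
        by (rule power2_le_imp_le) simp
    qed
  qed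
  then show "L2_lim (\<lambda>n. fourier (diff_quotient (h n) j f)) (fourier (partial_x j f))"
  proof (rule L2_lim_cong_AE)
    show "AE \<xi> in lebesgue. ?S n \<xi> = fourier (diff_quotient (h n) j f) \<xi>" for n
      using FS[of n] by eventually_elim simp
    show "AE \<xi> in lebesgue. (\<i> * of_real (\<xi> $ j)) *s fourier f \<xi> = fourier (partial_x j f) \<xi>"
      using p(2) by eventually_elim simp
  qed
qed

text \<open>The exponent is \<open>-2/3\<close> because the product over three coordinates then dominates \<open>(1 +
  \<bar>\<xi>\<bar>\<^sup>2)\<^sup>-\<^sup>2\<close>.\<close>

lemma powr_tail_integrable:
  "integrable lborel (\<lambda>t::real. (1 + t\<^sup>2) powr (- 2 / 3))"
proof -
  let ?g = "\<lambda>t::real. (1 + \<bar>t\<bar>) powr (- 4 / 3)"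
  have half: "(\<integral>\<^sup>+t. ennreal (?g t) * indicator {0..} t \<partial>lborel) < \<infinity>"
  proof -
    have "(\<integral>\<^sup>+t. ennreal ((1 + t) powr (- 4 / 3)) * indicator {0..} t \<partial>lborel) = ennreal (0 - (- 3 * (1 + 0) powr (- 1 / 3)))"
    proof (rule nn_integral_FTC_atLeast)
      show "(\<lambda>t::real. (1 + t) powr (- 4 / 3)) \<in> borel_measurable borel" by measurable
      show "((\<lambda>t. - 3 * (1 + t) powr (- 1 / 3)) has_real_derivative (1 + x) powr (- 4 / 3)) (at x)" if "0 \<le> x" for x :: real
        using that by (auto intro!: derivative_eq_intros simp: powr_diff field_simps)
      show "((\<lambda>t::real. - 3 * (1 + t) powr (- 1 / 3)) \<longlongrightarrow> 0) at_top"
        by real_asymp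
    qed auto
    moreover have "(\<integral>\<^sup>+t. ennreal (?g t) * indicator {0..} t \<partial>lborel) = (\<integral>\<^sup>+t. ennreal ((1 + t) powr (- 4 / 3)) * indicator {0..} t \<partial>lborel)"
      by (intro nn_integral_cong) (auto simp: indicator_def)
    ultimately show ?thesis by simp
  qed
  have half2: "(\<integral>\<^sup>+t. ennreal (?g t) * indicator {..0} t \<partial>lborel) = (\<integral>\<^sup>+t. ennreal (?g t) * indicator {0..} t \<partial>lborel)"
  proof -
    have "(\<integral>\<^sup>+t. ennreal (?g t) * indicator {..0} t \<partial>lborel) = (\<integral>\<^sup>+t. ennreal (?g t) * indicator {..0} t \<partial>(distr lborel borel uminus))"
      by (simp add: lborel_distr_uminus)
    also have "\<dots> = (\<integral>\<^sup>+t. ennreal (?g (- t)) * indicator {..0} (- t) \<partial>lborel)"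
      by (rule nn_integral_distr) measurable
    also have "\<dots> = (\<integral>\<^sup>+t. ennreal (?g t) * indicator {0..} t \<partial>lborel)"
      by (intro nn_integral_cong) (auto simp: indicator_def)
    finally show ?thesis .
  qed
  have "(\<integral>\<^sup>+t. ennreal (?g t) \<partial>lborel) \<le> (\<integral>\<^sup>+t. ennreal (?g t) * indicator {0..} t + ennreal (?g t) * indicator {..0} t \<partial>lborel)"
    by (intro nn_integral_mono) (auto simp: indicator_def)
  also have "\<dots> = (\<integral>\<^sup>+t. ennreal (?g t) * indicator {0..} t \<partial>lborel) + (\<integral>\<^sup>+t. ennreal (?g t) * indicator {..0} t \<partial>lborel)"
    by (rule nn_integral_add) measurable
  also have "\<dots> < \<infinity>" using half half2 by simp
  finally have gi: "integrable lborel ?g"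
    by (intro integrableI_nonneg) auto
  show ?thesis
  proof (rule Bochner_Integration.integrable_bound)
    show "integrable lborel (\<lambda>t. 2 powr (2 / 3) * ?g t)" using gi by simp
    show "AE t in lborel. norm ((1 + t\<^sup>2) powr (- 2 / 3)) \<le> norm (2 powr (2 / 3) * ?g t)"
    proof (rule AE_I2)
      fix t :: real
      have "(1 + \<bar>t\<bar>)\<^sup>2 / 2 \<le> 1 + t\<^sup>2"
        using sum_squares_bound[of 1 "\<bar>t\<bar>"] by (simp add: power2_eq_square algebra_simps)
      then have "(1 + t\<^sup>2) powr (- 2 / 3) \<le> ((1 + \<bar>t\<bar>)\<^sup>2 / 2) powr (- 2 / 3)"
        by (intro powr_mono2') auto
      also have "\<dots> = 2 powr (2 / 3) * ?g t"
      proof -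
        have "(1 + \<bar>t\<bar>)\<^sup>2 = (1 + \<bar>t\<bar>) powr 2" by simp
        then have "((1 + \<bar>t\<bar>)\<^sup>2 / 2) powr (- 2 / 3) = ((1 + \<bar>t\<bar>) powr 2) powr (- 2 / 3) / 2 powr (- 2 / 3)"
          by (simp only: powr_divide powr_ge_zero zero_le_numeral)
        also have "((1 + \<bar>t\<bar>) powr 2) powr (- 2 / 3) = ?g t" by (simp only: powr_powr) simp
        finally show ?thesis by (simp add: powr_minus_divide)
      qed
      finally show "norm ((1 + t\<^sup>2) powr (- 2 / 3)) \<le> norm (2 powr (2 / 3) * ?g t)" by simp
    qed
  qed measurable
qed

lemma inverse_weight_L2: "L2 (\<lambda>\<xi>::real^3. 1 / (1 + (norm \<xi>)\<^sup>2))"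
proof -
  have i: "integrable lborel (\<lambda>x::real^3. \<Prod>b\<in>Basis. complex_of_real ((1 + (x \<bullet> b)\<^sup>2) powr (- 2 / 3)))"
  proof (rule lborel_integrable_prod_Basis)
    show "integrable lborel (\<lambda>t. complex_of_real ((1 + t\<^sup>2) powr (- 2 / 3)))"
      using powr_tail_integrable by (simp only: complex_of_real_integrable_eq)
  qed
  have m: "(\<lambda>\<xi>::real^3. (norm (1 / (1 + (norm \<xi>)\<^sup>2)))\<^sup>2) \<in> borel_measurable lborel" by measurable
  have "integrable lborel (\<lambda>\<xi>::real^3. (norm (1 / (1 + (norm \<xi>)\<^sup>2)))\<^sup>2)"
  proof (rule Bochner_Integration.integrable_bound[OF i m])
    show "AE \<xi> in lborel. norm ((norm (1 / (1 + (norm (\<xi>::real^3))\<^sup>2)))\<^sup>2) \<le> norm (\<Prod>b\<in>Basis. complex_of_real ((1 + (\<xi> \<bullet> b)\<^sup>2) powr (- 2 / 3)))"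
    proof (rule AE_I2)
      fix \<xi> :: "real^3"
      let ?w = "1 + (norm \<xi>)\<^sup>2"
      have w: "?w > 0" by (simp add: add_pos_nonneg)
      have "(norm (1 / ?w))\<^sup>2 = (?w powr (- 2 / 3)) ^ 3"
      proof -
        have "(?w powr (- 2 / 3)) ^ 3 = ?w powr (- 2)" using w by (simp add: powr_power)
        also have "\<dots> = 1 / ?w\<^sup>2" using w by (simp add: powr_minus_divide)
        finally show ?thesis by (simp add: power_divide)
      qed
      also have "\<dots> = (\<Prod>b\<in>(Basis::(real^3) set). ?w powr (- 2 / 3))" by simp
      also have "\<dots> \<le> (\<Prod>b\<in>Basis. (1 + (\<xi> \<bullet> b)\<^sup>2) powr (- 2 / 3))"
      proof (rule prod_mono)
        fix b :: "real^3" assume b: "b \<in> Basis"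
        have "(\<xi> \<bullet> b)\<^sup>2 \<le> (norm \<xi>)\<^sup>2" using Basis_le_norm[OF b, of \<xi>] by (metis abs_le_square_iff abs_norm_cancel)
        then have "?w powr (- 2 / 3) \<le> (1 + (\<xi> \<bullet> b)\<^sup>2) powr (- 2 / 3)"
          by (intro powr_mono2') (auto simp: add_pos_nonneg)
        then show "0 \<le> ?w powr (- 2 / 3) \<and> ?w powr (- 2 / 3) \<le> (1 + (\<xi> \<bullet> b)\<^sup>2) powr (- 2 / 3)" by simp
      qed
      also have "\<dots> = norm (\<Prod>b\<in>Basis. complex_of_real ((1 + (\<xi> \<bullet> b)\<^sup>2) powr (- 2 / 3)))"
        by (simp add: prod_norm[symmetric])
      finally show "norm ((norm (1 / ?w))\<^sup>2) \<le> norm (\<Prod>b\<in>Basis. complex_of_real ((1 + (\<xi> \<bullet> b)\<^sup>2) powr (- 2 / 3)))"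
        by simp
    qed
  qed
  then show ?thesis
    unfolding L2_def using m by (simp add: integrable_completion measurable_completion)
qed

text \<open>The factor \<open>3\<close> bounds the Euclidean norm of a vector by three times a bound for its components.\<close>

definition sobolev_const :: real where
  "sobolev_const = 3 * (ft_const * L2_norm (\<lambda>\<xi>::real^3. 1 / (1 + (norm \<xi>)\<^sup>2)))"

lemma sobolev_const_nonneg: "0 \<le> sobolev_const"
  using ft_const_pos by (simp add: sobolev_const_def)

lemma sobolev2_fourier_integrable:
  fixes v :: "real^3 \<Rightarrow> real^3"
  assumes v: "sobolev 2 v"
  shows "integrable lebesgue (\<lambda>\<xi>. fourier v \<xi> $ k)"
    "(LINT \<xi>|lebesgue. norm (fourier v \<xi> $ k)) \<le> L2_norm (\<lambda>\<xi>::real^3. 1 / (1 + (norm \<xi>)\<^sup>2)) * sobolev_norm 2 v"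
proof -
  have w: "L2 (sobolev_weight 2 v)" using v by (simp add: sobolev_def)
  let ?p = "\<lambda>\<xi>::real^3. norm (1 / (1 + (norm \<xi>)\<^sup>2)) * norm (sobolev_weight 2 v \<xi>)"
  have pi: "integrable lebesgue ?p" by (rule L2_mult_integrable[OF inverse_weight_L2 w])
  have le: "norm (fourier v \<xi> $ k) \<le> ?p \<xi>" for \<xi>
  proof -
    have "0 < 1 + (norm \<xi>)\<^sup>2" by (simp add: add_pos_nonneg)
    then have "?p \<xi> = norm (fourier v \<xi>)" unfolding sobolev_weight_def weight2 by simp
    then show ?thesis using Finite_Cartesian_Product.norm_nth_le[of "fourier v \<xi>" k] by simp
  qed
  have m: "(\<lambda>\<xi>. fourier v \<xi> $ k) \<in> Lmeas"
    by (rule L2_measurable[OF L2_nth[OF fourier_L2[OF sobolev_L2[OF v]]]])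
  show i: "integrable lebesgue (\<lambda>\<xi>. fourier v \<xi> $ k)"
    by (rule Bochner_Integration.integrable_bound[OF pi m]) (use le in auto)
  have "(LINT \<xi>|lebesgue. norm (fourier v \<xi> $ k)) \<le> (LINT \<xi>|lebesgue. ?p \<xi>)"
    by (rule integral_mono[OF integrable_norm[OF i] pi le])
  also have "\<dots> \<le> L2_norm (\<lambda>\<xi>::real^3. 1 / (1 + (norm \<xi>)\<^sup>2)) * L2_norm (sobolev_weight 2 v)"
    by (rule L2_Cauchy_Schwarz[OF inverse_weight_L2 w])
  finally show "(LINT \<xi>|lebesgue. norm (fourier v \<xi> $ k)) \<le> L2_norm (\<lambda>\<xi>::real^3. 1 / (1 + (norm \<xi>)\<^sup>2)) * sobolev_norm 2 v"
    by (simp add: sobolev_norm_def)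
qed

text \<open>The transform of an \<open>H\<^sup>2\<close> field is the product of the \<open>L\<^sup>2\<close> functions \<open>1 /
  (1 + \<bar>\<xi>\<bar>\<^sup>2)\<close> and \<open>sobolev_weight 2 v\<close>, hence integrable, and inversion represents the
  field as a Fourier integral.\<close>

lemma sobolev2_continuous_representative:
  fixes v :: "real^3 \<Rightarrow> real^3"
  assumes v: "sobolev 2 v"
  obtains U where "continuous_on UNIV U" "AE x in lebesgue. v x = U x"
    "\<And>x. norm (U x) \<le> sobolev_const * sobolev_norm 2 v"
proof
  let ?F = "\<lambda>(k::3) \<xi>. fourier v \<xi> $ k"
  define U :: "real^3 \<Rightarrow> real^3" where "U x = (\<chi> k. Re (ft (?F k) (- x)))" for x
  note F = sobolev2_fourier_integrable[OF v]
  show "continuous_on UNIV U"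
    unfolding U_def
    by (intro continuous_on_vec_lambda continuous_on_Re continuous_on_compose2[OF ft_continuous[OF F(1)]] continuous_intros) auto
  have "AE x in lebesgue. v x $ k = U x $ k" for k
    using is_ft_inverse_formula[OF is_ft_fourier[OF sobolev_L2[OF v]] F(1), of k]
  proof eventually_elim
    case (elim x)
    then have "Re (complex_of_real (v x $ k)) = Re (ft (?F k) (- x))" by simp
    then show ?case by (simp add: U_def)
  qed
  then show "AE x in lebesgue. v x = U x" by (simp add: AE_vec_eq_iff)
  fix x
  have "\<bar>U x $ k\<bar> \<le> ft_const * (L2_norm (\<lambda>\<xi>::real^3. 1 / (1 + (norm \<xi>)\<^sup>2)) * sobolev_norm 2 v)" for k
  proof -
    have "\<bar>U x $ k\<bar> \<le> norm (ft (?F k) (- x))" by (simp add: U_def abs_Re_le_cmod)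
    also have "\<dots> \<le> ft_const * (LINT \<xi>|lebesgue. norm (?F k \<xi>))" by (rule ft_bound[OF F(1)])
    also have "\<dots> \<le> ft_const * (L2_norm (\<lambda>\<xi>::real^3. 1 / (1 + (norm \<xi>)\<^sup>2)) * sobolev_norm 2 v)"
      using ft_const_pos by (intro mult_left_mono F(2)) auto
    finally show ?thesis .
  qed
  then have "(\<Sum>k\<in>UNIV. \<bar>U x $ k\<bar>) \<le> (\<Sum>k\<in>(UNIV::3 set). ft_const * (L2_norm (\<lambda>\<xi>::real^3. 1 / (1 + (norm \<xi>)\<^sup>2)) * sobolev_norm 2 v))"
    by (intro sum_mono)
  then show "norm (U x) \<le> sobolev_const * sobolev_norm 2 v"
    using norm_le_l1_cart[of "U x"] by (simp add: sobolev_const_def)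
qed

lemma L2_lim_bounded_inner:
  fixes s t :: "nat \<Rightarrow> 'a::euclidean_space \<Rightarrow> 'b::euclidean_space"
  assumes s: "\<And>n. s n \<in> Lmeas" "\<And>n x. norm (s n x) \<le> M"
    and lim: "\<And>x. (\<lambda>n. s n x) \<longlonglongrightarrow> f x" and f: "f \<in> Lmeas" and t: "L2_lim t g"
  shows "L2_lim (\<lambda>n x. s n x \<bullet> t n x) (\<lambda>x. f x \<bullet> g x)"
proof -
  have M: "0 \<le> M" using s(2)[of 0 undefined] norm_ge_zero order_trans by blast
  have L: "L2 (t n)" "L2 g" for n using t by (auto simp: L2_lim_def)
  have fb: "norm (f x) \<le> M" for x
    by (rule LIMSEQ_le_const2[OF tendsto_norm[OF lim]]) (use s in auto)
  have bd: "L2 (\<lambda>x. a x \<bullet> b x)" "L2_norm (\<lambda>x. a x \<bullet> b x) \<le> M * L2_norm b"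
    if "a \<in> Lmeas" "\<And>x. norm (a x) \<le> M" "L2 b" for a b :: "'a \<Rightarrow> 'b"
  proof -
    have m: "(\<lambda>x. a x \<bullet> b x) \<in> Lmeas" using that by (auto simp: L2_def)
    have "norm (a x \<bullet> b x) \<le> M * norm (b x)" for x
      using Cauchy_Schwarz_ineq2[of "a x" "b x"] mult_right_mono[OF that(2)[of x] norm_ge_zero[of "b x"]] by simp
    then show "L2 (\<lambda>x. a x \<bullet> b x)" "L2_norm (\<lambda>x. a x \<bullet> b x) \<le> M * L2_norm b"
      using L2_dominated[OF that(3) m _ M] by auto
  qed
  have "L2_lim (\<lambda>n x. s n x \<bullet> (t n x - g x)) (\<lambda>x. 0)"
  proof -
    have "(\<lambda>n. L2_norm (\<lambda>x. s n x \<bullet> (t n x - g x) - 0)) \<longlonglongrightarrow> 0"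
    proof (rule Lim_null_comparison)
      show "\<forall>\<^sub>F n in sequentially. norm (L2_norm (\<lambda>x. s n x \<bullet> (t n x - g x) - 0)) \<le> M * L2_norm (\<lambda>x. t n x - g x)"
        using bd(2)[OF s L2_diff[OF L]] by simp
      show "(\<lambda>n. M * L2_norm (\<lambda>x. t n x - g x)) \<longlonglongrightarrow> 0"
        using t by (auto simp: L2_lim_def intro: tendsto_mult_right_zero)
    qed
    then show ?thesis using bd(1)[OF s L2_diff[OF L]] by (simp add: L2_lim_def)
  qed
  moreover have "L2_lim (\<lambda>n x. s n x \<bullet> g x) (\<lambda>x. f x \<bullet> g x)"
  proof (rule L2_lim_dominated)
    show "L2 (\<lambda>x. M *\<^sub>R g x)" by (rule L2_scaleR[OF L(2)])
    show "AE x in lebesgue. norm (s n x \<bullet> g x) \<le> norm (M *\<^sub>R g x)" for n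
    proof (rule AE_I2)
      fix x
      show "norm (s n x \<bullet> g x) \<le> norm (M *\<^sub>R g x)"
        using Cauchy_Schwarz_ineq2[of "s n x" "g x"] mult_right_mono[OF s(2)[of n x] norm_ge_zero[of "g x"]] M by simp
    qed
    show "AE x in lebesgue. (\<lambda>n. s n x \<bullet> g x) \<longlonglongrightarrow> f x \<bullet> g x"
      by (intro AE_I2 tendsto_intros lim)
  qed (use s f L in \<open>auto simp: L2_def\<close>)
  ultimately show ?thesis using L2_lim_add by (fastforce simp: inner_diff_right)
qed

text \<open>Translation invariance of the integral gives an exact summation by parts.\<close>

lemma integral_diff_quotient_by_parts:
  fixes f g :: "real^3 \<Rightarrow> real"
  assumes f: "L2 f" and g: "L2 g"
  shows "(LINT x|lebesgue. f x * diff_quotient h j g x) = - (LINT x|lebesgue. diff_quotient (- h) j f x * g x)"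
proof -
  let ?a = "h *\<^sub>R axis j (1::real) :: real^3"
  have tr: "L2 (\<lambda>x. k (b + x))" if "L2 k" for k :: "real^3 \<Rightarrow> real" and b using L2_isometry[of 1 k b] that by simp
  have m: "integrable lebesgue (\<lambda>x. a x * b x)" if "L2 a" "L2 b" for a b :: "real^3 \<Rightarrow> real"
    using L2_inner_integrable[OF that] by simp
  have "(LINT x|lebesgue. f x * g (?a + x)) = (LINT x|lebesgue. f (- ?a + (?a + 1 *\<^sub>R x)) * g (?a + 1 *\<^sub>R x))" by simp
  also have "\<dots> = (LINT x|lebesgue. f (- ?a + x) * g x)"
    by (rule integral_isometry[where c=1 and a="?a" and f="\<lambda>x. f (- ?a + x) * g x"])
       (simp, rule borel_measurable_integrable[OF m[OF tr[OF f] g]])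
  finally have *: "(LINT x|lebesgue. f x * g (?a + x)) = (LINT x|lebesgue. f (- ?a + x) * g x)" .
  have "(LINT x|lebesgue. f x * diff_quotient h j g x) = (LINT x|lebesgue. (1 / h) * (f x * g (?a + x) - f x * g x))"
    by (rule Bochner_Integration.integral_cong) (auto simp: diff_quotient_def algebra_simps)
  also have "\<dots> = (1 / h) * ((LINT x|lebesgue. f x * g (?a + x)) - (LINT x|lebesgue. f x * g x))"
    by (simp only: integral_mult_right_zero Bochner_Integration.integral_diff[OF m[OF f tr[OF g]] m[OF f g]])
  also have "\<dots> = (1 / h) * ((LINT x|lebesgue. f (- ?a + x) * g x) - (LINT x|lebesgue. f x * g x))"
    by (simp only: *)
  also have "\<dots> = (LINT x|lebesgue. (1 / h) * (f (- ?a + x) * g x - f x * g x))"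
    by (simp only: integral_mult_right_zero Bochner_Integration.integral_diff[OF m[OF tr[OF f] g] m[OF f g]])
  also have "\<dots> = (LINT x|lebesgue. - (diff_quotient (- h) j f x * g x))"
    by (rule Bochner_Integration.integral_cong) (auto simp: diff_quotient_def algebra_simps)
  finally show ?thesis by simp
qed

section \<open>Orthogonality of the nonlinear term and the curl\<close>

definition curl_field :: "(real^3 \<Rightarrow> real^3) \<Rightarrow> real^3 \<Rightarrow> real^3" where
  "curl_field v x = vector
     [partial_x 2 v x $ 3 - partial_x 3 v x $ 2,
      partial_x 3 v x $ 1 - partial_x 1 v x $ 3,
      partial_x 1 v x $ 2 - partial_x 2 v x $ 1]"

lemma curl_field_nth:
  "curl_field v x $ 1 = partial_x 2 v x $ 3 - partial_x 3 v x $ 2"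
  "curl_field v x $ 2 = partial_x 3 v x $ 1 - partial_x 1 v x $ 3"
  "curl_field v x $ 3 = partial_x 1 v x $ 2 - partial_x 2 v x $ 1"
  by (simp_all add: curl_field_def)

lemma is_ft_partial_x:
  fixes v :: "real^3 \<Rightarrow> real^'n::finite"
  assumes "L2 v" "L2 (\<lambda>\<xi>. (\<i> * of_real (\<xi> $ j)) *s fourier v \<xi>)"
  shows "is_ft (cpx k (partial_x j v)) (\<lambda>\<xi>. \<i> * of_real (\<xi> $ j) * fourier v \<xi> $ k)"
proof (rule is_ft_cong_AE[OF is_ft_fourier[OF partial_x_L2[OF assms]]])
  show "AE \<xi> in lebesgue. fourier (partial_x j v) \<xi> $ k = \<i> * of_real (\<xi> $ j) * fourier v \<xi> $ k"
    using fourier_partial_x[OF assms] by eventually_elim simp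
qed simp

lemma curl_field:
  assumes v: "sobolev 1 v"
  shows curl_field_L2: "L2 (curl_field v)"
    and fourier_curl_field: "AE \<xi> in lebesgue. fourier (curl_field v) \<xi> = curl_symbol \<xi> (fourier v \<xi>)"
proof -
  have pL: "L2 (\<lambda>x. partial_x j v x $ k)" for j k by (rule L2_nth[OF sobolev1_partial_x(1)[OF v]])
  have "L2 (\<lambda>x. curl_field v x $ k)" for k
    using exhaust_3[of k] L2_diff[OF pL pL] by (auto simp: curl_field_nth)
  from L2_vec_lambda[of "\<lambda>k x. curl_field v x $ k", OF this] show c: "L2 (curl_field v)" by simp
  note ip = is_ft_partial_x[OF sobolev_L2[OF v] sobolev1_component_symbol(1)[OF v]]
  have "is_ft (cpx k (curl_field v)) (\<lambda>\<xi>. curl_symbol \<xi> (fourier v \<xi>) $ k)" for k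
    using exhaust_3[of k] is_ft_diff[OF ip ip]
    by (auto simp: curl_field_nth curl_symbol_nth right_diff_distrib mult.assoc)
  then show "AE \<xi> in lebesgue. fourier (curl_field v) \<xi> = curl_symbol \<xi> (fourier v \<xi>)"
    by (intro fourier_eqI c)
qed

text \<open>The pointwise form of \<open>u \<cdot> \<nabla>u = \<omega> \<times> u + \<nabla>\<bar>u\<bar>\<^sup>2/2\<close> after
  taking the inner product with \<open>\<omega>\<close>.\<close>

lemma advection_inner_curl_field:
  "advection v x \<bullet> curl_field v x = (\<Sum>k\<in>UNIV. curl_field v x $ k * (v x \<bullet> partial_x k v x))"
  by (simp add: advection_def inner_vec_def sum_3 curl_field_nth algebra_simps)

lemma L2_norm_sum_le:
  assumes "\<And>i. i \<in> I \<Longrightarrow> L2 (f i)"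
  shows "L2_norm (\<lambda>x. \<Sum>i\<in>I. f i x) \<le> (\<Sum>i\<in>I. L2_norm (f i))"
  using assms
proof (induction I rule: infinite_finite_induct)
  case (insert i I)
  have "L2_norm (\<lambda>x. \<Sum>j\<in>insert i I. f j x) = L2_norm (\<lambda>x. f i x + (\<Sum>j\<in>I. f j x))"
    using insert by simp
  also have "\<dots> \<le> L2_norm (f i) + L2_norm (\<lambda>x. \<Sum>j\<in>I. f j x)"
    by (rule L2_norm_triangle) (use insert in \<open>auto intro: L2_sum\<close>)
  finally show ?case using insert by fastforce
qed auto

lemma L2_norm_function:
  assumes "L2 f" shows "L2 (\<lambda>x. norm (f x))" "L2_norm (\<lambda>x. norm (f x)) = L2_norm f"
  using assms by (auto simp: L2_def L2_norm_def)

lemma advection_L2: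
  assumes v: "sobolev 2 v"
  shows "L2 (advection v)" "L2_norm (advection v) \<le> 3 * sobolev_const * (sobolev_norm 2 v)\<^sup>2"
proof -
  have v1: "sobolev 1 v" and n1: "sobolev_norm 1 v \<le> sobolev_norm 2 v" using sobolev_mono[OF v, of 1] by auto
  note p = sobolev1_partial_x[OF v1]
  note vL = sobolev_L2[OF v]
  obtain U where U: "AE x in lebesgue. v x = U x" "\<And>x. norm (U x) \<le> sobolev_const * sobolev_norm 2 v"
    by (rule sobolev2_continuous_representative[OF v]) blast
  let ?M = "sobolev_const * sobolev_norm 2 v"
  have M: "0 \<le> ?M" using sobolev_const_nonneg by (simp add: sobolev_norm_def)
  let ?g = "\<lambda>x. \<Sum>j\<in>UNIV. norm (partial_x j v x)"
  have gL: "L2 ?g" by (intro L2_sum L2_norm_function p)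
  have gn: "L2_norm ?g \<le> 3 * sobolev_norm 2 v"
  proof -
    have "L2_norm ?g \<le> (\<Sum>j\<in>UNIV. L2_norm (\<lambda>x. norm (partial_x j v x)))"
      by (rule L2_norm_sum_le) (intro L2_norm_function p)
    also have "\<dots> \<le> (\<Sum>j\<in>(UNIV::3 set). sobolev_norm 2 v)"
      using p(2) n1 by (intro sum_mono) (auto simp: L2_norm_function[OF p(1)] intro: order_trans)
    finally show ?thesis by simp
  qed
  have am: "advection v \<in> Lmeas"
    unfolding advection_def
    by (intro borel_measurable_sum borel_measurable_scaleR L2_measurable[OF L2_nth[OF vL]] L2_measurable[OF p(1)])
  have le: "AE x in lebesgue. norm (advection v x) \<le> ?M * norm (?g x)"
    using U(1)
  proof eventually_elim
    case (elim x)
    have "norm (advection v x) \<le> (\<Sum>j\<in>UNIV. \<bar>v x $ j\<bar> * norm (partial_x j v x))"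
      unfolding advection_def by (rule order_trans[OF norm_sum]) simp
    also have "\<dots> \<le> (\<Sum>j\<in>UNIV. ?M * norm (partial_x j v x))"
    proof (intro sum_mono mult_right_mono)
      show "\<bar>v x $ j\<bar> \<le> ?M" for j using component_le_norm_cart[of "v x" j] U(2)[of x] elim by simp
    qed simp
    also have "\<dots> = ?M * norm (?g x)" by (simp add: sum_distrib_left sum_nonneg)
    finally show ?case .
  qed
  show "L2 (advection v)" by (rule L2_dominated(1)[OF gL am le M])
  have "L2_norm (advection v) \<le> ?M * L2_norm ?g" by (rule L2_dominated(2)[OF gL am le M])
  also have "\<dots> \<le> ?M * (3 * sobolev_norm 2 v)" by (rule mult_left_mono[OF gn M])
  finally show "L2_norm (advection v) \<le> 3 * sobolev_const * (sobolev_norm 2 v)\<^sup>2"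
    by (simp add: power2_eq_square mult_ac)
qed

lemma curl_field_derivative_symbol_L2:
  assumes v: "sobolev 2 v"
  shows "L2 (\<lambda>\<xi>. (\<i> * of_real (\<xi> $ j)) *s fourier (curl_field v) \<xi>)"
proof -
  have v1: "sobolev 1 v" using sobolev_mono[OF v, of 1] by auto
  note c = curl_field[OF v1]
  have m: "(\<lambda>\<xi>. (\<i> * of_real (\<xi> $ j)) *s fourier (curl_field v) \<xi>) \<in> Lmeas"
    by (rule component_symbol_measurable[OF L2_measurable[OF fourier_L2[OF c(1)]]])
  show ?thesis
  proof (rule sobolev_dominated(1)[OF v m, of 1])
    show "AE \<xi> in lebesgue. norm ((\<i> * of_real (\<xi> $ j)) *s fourier (curl_field v) \<xi>) \<le> 1 * ((1 + (norm \<xi>)\<^sup>2) powr (2 / 2) * norm (fourier v \<xi>))"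
      using c(2)
    proof eventually_elim
      case (elim \<xi>)
      have "norm ((\<i> * of_real (\<xi> $ j)) *s fourier (curl_field v) \<xi>) \<le> norm \<xi> * (norm \<xi> * norm (fourier v \<xi>))"
        unfolding norm_component_symbol elim
        by (intro mult_mono norm_curl_symbol_le component_le_norm_cart) auto
      also have "\<dots> = (norm \<xi>)\<^sup>2 * norm (fourier v \<xi>)" by (simp add: power2_eq_square)
      also have "\<dots> \<le> (1 + (norm \<xi>)\<^sup>2) * norm (fourier v \<xi>)" by (intro mult_right_mono) auto
      finally show ?case unfolding weight2 by simp
    qed
  qed simp
qed

lemma curl_field_divergence_free:
  assumes v: "sobolev 2 v"
  shows "AE x in lebesgue. (\<Sum>k\<in>UNIV. partial_x k (curl_field v) x $ k) = 0"
proof -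
  have v1: "sobolev 1 v" using sobolev_mono[OF v, of 1] by auto
  note c = curl_field[OF v1]
  have A: "is_ft (\<lambda>x. \<Sum>k\<in>UNIV. cpx k (partial_x k (curl_field v)) x)
      (\<lambda>\<xi>. \<Sum>k\<in>UNIV. \<i> * of_real (\<xi> $ k) * fourier (curl_field v) \<xi> $ k)"
    by (intro is_ft_sum is_ft_partial_x c curl_field_derivative_symbol_L2 v)
  have B: "AE \<xi> in lebesgue. (\<Sum>k\<in>UNIV. \<i> * of_real (\<xi> $ k) * fourier (curl_field v) \<xi> $ k) = 0"
    using c(2) by eventually_elim (simp add: sum_3 curl_symbol_nth algebra_simps)
  have "is_ft (\<lambda>x. \<Sum>k\<in>UNIV. cpx k (partial_x k (curl_field v)) x) (\<lambda>\<xi>. 0)"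
    by (rule is_ft_cong_AE[OF A AE_I2[OF refl] B])
  then have "AE x in lebesgue. (\<Sum>k\<in>UNIV. cpx k (partial_x k (curl_field v)) x) = 0"
    using is_ft_inj[OF _ is_ft_zero] by simp
  then show ?thesis by eventually_elim (simp flip: of_real_sum)
qed

text \<open>By \<open>advection_inner_curl_field\<close> the integrand is \<open>\<omega> \<cdot> \<nabla>\<phi>\<close> with
  \<open>\<phi> = \<bar>v\<bar>\<^sup>2/2\<close>, and \<open>\<omega>\<close> is divergence-free. The integration by parts is
  done with difference quotients, since \<open>\<phi>\<close> is only the product of two \<open>H\<^sup>2\<close> functions: the
  quotient of \<open>\<phi>\<close> is that of \<open>v\<close> times the mean of two translates of \<open>v\<close>, which are
  bounded and converge everywhere for the continuous representative \<open>U\<close>.\<close>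

lemma integral_advection_inner_curl_field:
  assumes v: "sobolev 2 v"
  shows "(LINT x|lebesgue. advection v x \<bullet> curl_field v x) = 0"
proof -
  have v1: "sobolev 1 v" using sobolev_mono[OF v, of 1] by auto
  note vL = sobolev_L2[OF v]
  note c = curl_field[OF v1]
  let ?\<omega> = "curl_field v"
  obtain U where Uc: "continuous_on UNIV U" and vU: "AE x in lebesgue. v x = U x"
    and Ub: "\<And>x. norm (U x) \<le> sobolev_const * sobolev_norm 2 v"
    by (rule sobolev2_continuous_representative[OF v]) blast
  let ?M = "sobolev_const * sobolev_norm 2 v"
  have UL: "L2 U" by (rule L2_cong_AE[OF vL vU])
  have fU: "fourier v = fourier U" by (rule fourier_cong_AE[OF vL vU])
  have pU: "partial_x k v = partial_x k U" for k by (simp add: partial_x_def fourier_multiplier_cong_AE[OF vL vU])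
  have pL: "L2 (partial_x k U)" for k using sobolev1_partial_x(1)[OF v1] by (simp add: pU)
  have Um: "U \<in> Lmeas" by (rule L2_measurable[OF UL])
  define \<phi> where "\<phi> x = (1/2) * (U x \<bullet> U x)" for x
  have inner_L2: "L2 (\<lambda>x. a x \<bullet> b x)" if "a \<in> Lmeas" "\<And>x. norm (a x) \<le> ?M" "L2 b" for a b :: "real^3 \<Rightarrow> real^3"
    using L2_lim_bounded_inner[OF that(1,2) tendsto_const that(1) L2_lim_const[OF that(3)]] by (simp add: L2_lim_def)
  have \<phi>L: "L2 \<phi>" unfolding \<phi>_def using L2_scaleR[OF inner_L2[OF Um Ub UL], of "1/2"] by simp
  define h where "h n = 1 / real (Suc n)" for n
  have h0: "h n \<noteq> 0" "- h n \<noteq> 0" for n by (auto simp: h_def)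
  have hlim: "h \<longlonglongrightarrow> 0" unfolding h_def by (rule LIMSEQ_Suc[OF lim_1_over_n])
  have hlim': "(\<lambda>n. - h n) \<longlonglongrightarrow> 0" using tendsto_minus[OF hlim] by simp
  have lim1: "L2_lim (\<lambda>n. diff_quotient (h n) k \<phi>) (\<lambda>x. U x \<bullet> partial_x k U x)" for k
  proof -
    let ?s = "\<lambda>n x. (1/2) *\<^sub>R (U (h n *\<^sub>R axis k 1 + x) + U x)"
    have "L2_lim (\<lambda>n x. ?s n x \<bullet> diff_quotient (h n) k U x) (\<lambda>x. U x \<bullet> partial_x k U x)"
    proof (rule L2_lim_bounded_inner)
      have "(\<lambda>x. U (h n *\<^sub>R axis k 1 + 1 *\<^sub>R x)) \<in> Lmeas" for n
        by (rule borel_measurable_isometry[OF _ Um]) simp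
      then show "?s n \<in> Lmeas" for n using Um by simp
      show "norm (?s n x) \<le> ?M" for n x
        using norm_triangle_mono[OF Ub[of "h n *\<^sub>R axis k 1 + x"] Ub[of x]] by simp
      show "(\<lambda>n. ?s n x) \<longlonglongrightarrow> U x" for x
      proof -
        have "(\<lambda>n. h n *\<^sub>R axis k 1 + x) \<longlonglongrightarrow> 0 *\<^sub>R axis k 1 + x" by (intro tendsto_intros hlim)
        then have "(\<lambda>n. U (h n *\<^sub>R axis k 1 + x)) \<longlonglongrightarrow> U x"
          using Uc by (auto simp: continuous_on_eq_continuous_at intro: isCont_tendsto_compose)
        then have "(\<lambda>n. ?s n x) \<longlonglongrightarrow> (1/2) *\<^sub>R (U x + U x)" by (intro tendsto_intros)
        then show ?thesis by (simp flip: scaleR_2)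
      qed
      show "L2_lim (\<lambda>n. diff_quotient (h n) k U) (partial_x k U)"
        by (rule diff_quotient_L2_lim[OF UL _ h0(1) hlim]) (use sobolev1_component_symbol(1)[OF v1] fU in simp)
    qed (rule Um)
    moreover have "?s n x \<bullet> diff_quotient (h n) k U x = diff_quotient (h n) k \<phi> x" for n x
      by (simp add: diff_quotient_def \<phi>_def inner_add_left inner_diff_right inner_commute algebra_simps)
    ultimately show ?thesis by simp
  qed
  have lim2: "L2_lim (\<lambda>n. diff_quotient (- h n) k (\<lambda>x. ?\<omega> x $ k)) (\<lambda>x. partial_x k ?\<omega> x $ k)" for k
  proof -
    have "L2_lim (\<lambda>n. diff_quotient (- h n) k ?\<omega>) (partial_x k ?\<omega>)"
      by (rule diff_quotient_L2_lim[OF c(1) curl_field_derivative_symbol_L2[OF v] h0(2) hlim'])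
    from L2_lim_bounded_linear[OF this bounded_linear_vec_nth[of k]]
    show ?thesis by (simp add: diff_quotient_def[abs_def])
  qed
  have wL: "L2 (\<lambda>x. ?\<omega> x $ k)" for k by (rule L2_nth[OF c(1)])
  have eq: "(LINT x|lebesgue. ?\<omega> x $ k * (U x \<bullet> partial_x k U x)) = - (LINT x|lebesgue. partial_x k ?\<omega> x $ k * \<phi> x)" for k
  proof (rule LIMSEQ_unique)
    show "(\<lambda>n. LINT x|lebesgue. ?\<omega> x $ k * diff_quotient (h n) k \<phi> x) \<longlonglongrightarrow> (LINT x|lebesgue. ?\<omega> x $ k * (U x \<bullet> partial_x k U x))"
      using L2_lim_inner[OF L2_lim_const[OF wL] lim1] by simp
    have "(\<lambda>n. - (LINT x|lebesgue. diff_quotient (- h n) k (\<lambda>x. ?\<omega> x $ k) x * \<phi> x)) \<longlonglongrightarrow> - (LINT x|lebesgue. partial_x k ?\<omega> x $ k * \<phi> x)"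
      using L2_lim_inner[OF lim2 L2_lim_const[OF \<phi>L]] by (intro tendsto_minus) simp
    then show "(\<lambda>n. LINT x|lebesgue. ?\<omega> x $ k * diff_quotient (h n) k \<phi> x) \<longlonglongrightarrow> - (LINT x|lebesgue. partial_x k ?\<omega> x $ k * \<phi> x)"
      unfolding integral_diff_quotient_by_parts[OF wL \<phi>L] .
  qed
  have pw: "L2 (\<lambda>x. partial_x k ?\<omega> x $ k)" for k using lim2[of k] by (simp add: L2_lim_def)
  have iU: "integrable lebesgue (\<lambda>x. ?\<omega> x $ k * (U x \<bullet> partial_x k U x))" for k
    using L2_inner_integrable[OF wL[of k], of "\<lambda>x. U x \<bullet> partial_x k U x"] lim1[of k] by (simp add: L2_lim_def)
  have ip: "integrable lebesgue (\<lambda>x. partial_x k ?\<omega> x $ k * \<phi> x)" for k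
    using L2_inner_integrable[OF pw[of k] \<phi>L] by simp
  have "(LINT x|lebesgue. advection v x \<bullet> ?\<omega> x) = (LINT x|lebesgue. (\<Sum>k\<in>UNIV. ?\<omega> x $ k * (U x \<bullet> partial_x k U x)))"
  proof (rule integral_cong_AE)
    show "(\<lambda>x. advection v x \<bullet> ?\<omega> x) \<in> Lmeas"
      using L2_inner_integrable[OF advection_L2(1)[OF v] c(1)] by auto
    show "(\<lambda>x. (\<Sum>k\<in>UNIV. ?\<omega> x $ k * (U x \<bullet> partial_x k U x))) \<in> Lmeas"
      by (intro borel_measurable_sum borel_measurable_integrable iU)
    show "AE x in lebesgue. advection v x \<bullet> ?\<omega> x = (\<Sum>k\<in>UNIV. ?\<omega> x $ k * (U x \<bullet> partial_x k U x))"
      using vU by eventually_elim (simp add: advection_inner_curl_field pU)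
  qed
  also have "\<dots> = (\<Sum>k\<in>UNIV. (LINT x|lebesgue. ?\<omega> x $ k * (U x \<bullet> partial_x k U x)))"
    by (rule Bochner_Integration.integral_sum) (rule iU)
  also have "\<dots> = - (\<Sum>k\<in>UNIV. (LINT x|lebesgue. partial_x k ?\<omega> x $ k * \<phi> x))"
    by (simp add: eq sum_negf)
  also have "(\<Sum>k\<in>UNIV. (LINT x|lebesgue. partial_x k ?\<omega> x $ k * \<phi> x)) = (LINT x|lebesgue. (\<Sum>k\<in>UNIV. partial_x k ?\<omega> x $ k * \<phi> x))"
    by (rule Bochner_Integration.integral_sum[symmetric]) (rule ip)
  also have "\<dots> = (LINT x|(lebesgue::(real^3) measure). 0)"
  proof (rule integral_cong_AE)
    show "(\<lambda>x. (\<Sum>k\<in>UNIV. partial_x k ?\<omega> x $ k * \<phi> x)) \<in> Lmeas"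
      by (intro borel_measurable_sum borel_measurable_integrable ip)
    show "AE x in lebesgue. (\<Sum>k\<in>UNIV. partial_x k ?\<omega> x $ k * \<phi> x) = 0"
      using curl_field_divergence_free[OF v] by eventually_elim (simp flip: sum_distrib_right)
  qed simp
  finally show ?thesis by simp
qed

section \<open>Smooth functions and a bump function\<close>

definition smooth :: "('a::euclidean_space \<Rightarrow> 'b::euclidean_space) \<Rightarrow> bool" where
  "smooth f \<longleftrightarrow> (\<forall>k. Ck k f)"

text \<open>Smoothness is shown below by exhibiting a class of functions closed under directional derivatives.\<close>

lemma smooth_coinduct:
  assumes P: "P f" and step: "\<And>g. P g \<Longrightarrow> (\<forall>z. g differentiable (at z)) \<and> (\<forall>b\<in>Basis. P (dir_deriv b g))"
  shows "smooth f"
proof -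
  have "\<forall>g. P g \<longrightarrow> Ck k g" for k
  proof (induction k)
    case 0
    show ?case using step by (auto simp: continuous_on_eq_continuous_at intro: differentiable_imp_continuous_within)
  next
    case (Suc k)
    then show ?case using step by simp
  qed
  with P show ?thesis by (simp add: smooth_def)
qed

inductive sums_of :: "(('a::euclidean_space \<Rightarrow> 'b::euclidean_space) \<Rightarrow> bool) \<Rightarrow> ('a \<Rightarrow> 'b) \<Rightarrow> bool" for P where
  single: "P f \<Longrightarrow> sums_of P f"
| add: "sums_of P f \<Longrightarrow> sums_of P g \<Longrightarrow> sums_of P (\<lambda>x. f x + g x)"

lemma smooth_differentiable: "smooth f \<Longrightarrow> f differentiable (at z)"
  unfolding smooth_def using Ck.simps(2)[of 0 f] by metis

lemma smooth_dir_deriv: "smooth f \<Longrightarrow> b \<in> Basis \<Longrightarrow> smooth (dir_deriv b f)"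
  unfolding smooth_def using Ck.simps(2) by metis

lemma smooth_continuous: "smooth f \<Longrightarrow> continuous_on UNIV f"
  unfolding smooth_def using Ck.simps(1) by metis

lemma smoothI:
  assumes "\<And>z. f differentiable (at z)" "\<And>b. b \<in> Basis \<Longrightarrow> smooth (dir_deriv b f)"
  shows "smooth f"
proof (rule smooth_coinduct[where P="\<lambda>g. (\<forall>z. g differentiable (at z)) \<and> (\<forall>b\<in>Basis. smooth (dir_deriv b g))"])
  show "(\<forall>z. f differentiable (at z)) \<and> (\<forall>b\<in>Basis. smooth (dir_deriv b f))" using assms by blast
qed (auto simp: smooth_differentiable smooth_dir_deriv)

lemma dir_deriv_eq: "(f has_derivative f') (at z) \<Longrightarrow> dir_deriv b f z = f' b"
  unfolding dir_deriv_def using frechet_derivative_at by metis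

lemma smooth_has_derivative:
  "smooth f \<Longrightarrow> (f has_derivative frechet_derivative f (at z)) (at z)"
  using smooth_differentiable frechet_derivative_works by blast

lemma smooth_const: "smooth (\<lambda>x. c)"
proof (rule smooth_coinduct[where P="\<lambda>g. \<exists>c. g = (\<lambda>x. c)"])
  fix g :: "'a \<Rightarrow> 'b" assume "\<exists>c. g = (\<lambda>x. c)"
  then obtain c where g: "g = (\<lambda>x. c)" by blast
  have "dir_deriv b g = (\<lambda>x. 0)" for b
    unfolding g by (rule ext) (rule dir_deriv_eq[OF has_derivative_const])
  then show "(\<forall>z. g differentiable (at z)) \<and> (\<forall>b\<in>Basis. \<exists>c. dir_deriv b g = (\<lambda>x. c))"
    using g by auto
qed auto

lemma dir_deriv_add:
  "smooth f \<Longrightarrow> smooth g \<Longrightarrow> dir_deriv b (\<lambda>x. f x + g x) = (\<lambda>x. dir_deriv b f x + dir_deriv b g x)"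
  by (rule ext, rule trans[OF dir_deriv_eq[OF has_derivative_add[OF smooth_has_derivative smooth_has_derivative]]])
     (auto simp: dir_deriv_def)

lemma smooth_add: assumes "smooth f" "smooth g" shows "smooth (\<lambda>x. f x + g x)"
proof (rule smooth_coinduct[where P="\<lambda>h. \<exists>f g. smooth f \<and> smooth g \<and> h = (\<lambda>x. f x + g x)"])
  fix h :: "'a \<Rightarrow> 'b" assume "\<exists>f g. smooth f \<and> smooth g \<and> h = (\<lambda>x. f x + g x)"
  then obtain f g where fg: "smooth f" "smooth g" "h = (\<lambda>x. f x + g x)" by blast
  have "dir_deriv b h = (\<lambda>x. dir_deriv b f x + dir_deriv b g x)" for b
    unfolding fg(3) by (rule dir_deriv_add[OF fg(1,2)])
  moreover have "h differentiable (at z)" for z unfolding fg(3) using fg(1,2) by (intro differentiable_add smooth_differentiable)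
  ultimately show "(\<forall>z. h differentiable (at z)) \<and> (\<forall>b\<in>Basis. \<exists>f g. smooth f \<and> smooth g \<and> dir_deriv b h = (\<lambda>x. f x + g x))"
    using fg smooth_dir_deriv by blast
qed (use assms in blast)

lemma dir_deriv_bounded_linear:
  assumes "bounded_linear A" "smooth f"
  shows "dir_deriv b (\<lambda>x. A (f x)) = (\<lambda>x. A (dir_deriv b f x))"
  by (rule ext, rule trans[OF dir_deriv_eq[OF bounded_linear.has_derivative[OF assms(1) smooth_has_derivative[OF assms(2)]]]])
     (auto simp: dir_deriv_def)

lemma smooth_bounded_linear:
  fixes A :: "'b::euclidean_space \<Rightarrow> 'c::euclidean_space"
  assumes A: "bounded_linear A" and "smooth f" shows "smooth (\<lambda>x. A (f x))"
proof (rule smooth_coinduct[where P="\<lambda>h. \<exists>f. smooth f \<and> h = (\<lambda>x. A (f x))"])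
  fix h :: "'a \<Rightarrow> 'c" assume "\<exists>f. smooth f \<and> h = (\<lambda>x. A (f x))"
  then obtain f where f: "smooth f" "h = (\<lambda>x. A (f x))" by blast
  have "h differentiable (at z)" for z
    unfolding f(2) using bounded_linear.has_derivative[OF A smooth_has_derivative[OF f(1)]] differentiableI by blast
  moreover have "dir_deriv b h = (\<lambda>x. A (dir_deriv b f x))" for b
    unfolding f(2) by (rule dir_deriv_bounded_linear[OF A f(1)])
  ultimately show "(\<forall>z. h differentiable (at z)) \<and> (\<forall>b\<in>Basis. \<exists>f. smooth f \<and> dir_deriv b h = (\<lambda>x. A (f x)))"
    using f smooth_dir_deriv by blast
qed (use assms in blast)

lemma smooth_sum: "(\<And>i. i \<in> I \<Longrightarrow> smooth (f i)) \<Longrightarrow> smooth (\<lambda>x. \<Sum>i\<in>I. f i x)"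
  by (induction I rule: infinite_finite_induct) (auto intro: smooth_add smooth_const)

lemma dir_deriv_sum:
  assumes "finite I" "\<And>i. i \<in> I \<Longrightarrow> smooth (f i)"
  shows "dir_deriv b (\<lambda>x. \<Sum>i\<in>I. f i x) = (\<lambda>x. \<Sum>i\<in>I. dir_deriv b (f i) x)"
  by (rule ext, rule trans[OF dir_deriv_eq[OF has_derivative_sum[OF smooth_has_derivative]]])
     (use assms in \<open>auto simp: dir_deriv_def\<close>)

lemma dir_deriv_scaleR:
  fixes m :: "'a::euclidean_space \<Rightarrow> real" and f :: "'a \<Rightarrow> 'b::euclidean_space"
  assumes "smooth m" "smooth f"
  shows "dir_deriv b (\<lambda>x. m x *\<^sub>R f x) = (\<lambda>x. dir_deriv b m x *\<^sub>R f x + m x *\<^sub>R dir_deriv b f x)"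
  by (rule ext, rule trans[OF dir_deriv_eq[OF has_derivative_scaleR[OF smooth_has_derivative[OF assms(1)] smooth_has_derivative[OF assms(2)]]]])
     (auto simp: dir_deriv_def)

text \<open>By the product rule a derivative is usually a sum of functions of the given kind, not a single one.\<close>

lemma smooth_coinduct_sums:
  assumes P: "P f" and step: "\<And>g. P g \<Longrightarrow> (\<forall>z. g differentiable (at z)) \<and> (\<forall>b\<in>Basis. sums_of P (dir_deriv b g))"
  shows "smooth f"
proof (rule smooth_coinduct[where P="sums_of P"])
  show "sums_of P f" by (rule sums_of.single, rule P)
  fix g assume "sums_of P g"
  then show "(\<forall>z. g differentiable (at z)) \<and> (\<forall>b\<in>Basis. sums_of P (dir_deriv b g))"
  proof induction
    case (single f)
    then show ?case by (rule step)
  next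
    case (add f g)
    have "dir_deriv b (\<lambda>x. f x + g x) = (\<lambda>x. dir_deriv b f x + dir_deriv b g x)" for b
      by (rule ext, rule trans[OF dir_deriv_eq[OF has_derivative_add[OF frechet_derivative_works[THEN iffD1] frechet_derivative_works[THEN iffD1]]]])
         (use add in \<open>auto simp: dir_deriv_def\<close>)
    then show ?case using add by (auto intro: sums_of.add differentiable_add)
  qed
qed

lemma smooth_scaleR:
  fixes m :: "'a::euclidean_space \<Rightarrow> real" and f :: "'a \<Rightarrow> 'b::euclidean_space"
  assumes "smooth m" "smooth f"
  shows "smooth (\<lambda>x. m x *\<^sub>R f x)"
proof -
  let ?P = "\<lambda>g :: 'a \<Rightarrow> 'b. \<exists>m f. smooth m \<and> smooth f \<and> g = (\<lambda>x. m x *\<^sub>R f x)"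
  have single: "sums_of ?P (\<lambda>x. m x *\<^sub>R f x)" if "smooth m" "smooth f" for m f
    by (rule sums_of.single) (use that in blast)
  show ?thesis
  proof (rule smooth_coinduct_sums[where P="?P"])
    fix g assume "?P g"
    then obtain m f where mf: "smooth m" "smooth f" and g: "g = (\<lambda>x. m x *\<^sub>R f x)" by blast
    have "g differentiable (at z)" for z
      unfolding g using has_derivative_scaleR[OF smooth_has_derivative[OF mf(1)] smooth_has_derivative[OF mf(2)]] differentiableI by blast
    moreover have "sums_of ?P (dir_deriv b g)" if "b \<in> Basis" for b
      unfolding g dir_deriv_scaleR[OF mf] by (rule sums_of.add; rule single) (use mf smooth_dir_deriv[OF _ that] in blast)+
    ultimately show "(\<forall>z. g differentiable (at z)) \<and> (\<forall>b\<in>Basis. sums_of ?P (dir_deriv b g))" by blast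
  qed (use assms in blast)
qed

lemma smooth_dilation:
  fixes f :: "'a::euclidean_space \<Rightarrow> 'b::euclidean_space"
  assumes "smooth f"
  shows "smooth (\<lambda>x. f (c *\<^sub>R x + d))" "dir_deriv b (\<lambda>x. f (c *\<^sub>R x + d)) = (\<lambda>x. c *\<^sub>R dir_deriv b f (c *\<^sub>R x + d))"
proof -
  have hd: "((\<lambda>x. f (c *\<^sub>R x + d)) has_derivative (\<lambda>y. frechet_derivative f (at (c *\<^sub>R z + d)) (c *\<^sub>R y))) (at z)"
    if "smooth f" for f :: "'a \<Rightarrow> 'b" and z
    by (rule has_derivative_compose[of "\<lambda>x. c *\<^sub>R x + d" _ z UNIV f, OF _ smooth_has_derivative[OF that]])
       (auto intro!: derivative_eq_intros)
  have dd: "dir_deriv b (\<lambda>x. f (c *\<^sub>R x + d)) = (\<lambda>x. c *\<^sub>R dir_deriv b f (c *\<^sub>R x + d))" if "smooth f" for f :: "'a \<Rightarrow> 'b" and b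
    by (rule ext, rule trans[OF dir_deriv_eq[OF hd[OF that]]])
       (use linear_cmul[OF linear_frechet_derivative[OF smooth_differentiable[OF that]]] in \<open>auto simp: dir_deriv_def\<close>)
  show "dir_deriv b (\<lambda>x. f (c *\<^sub>R x + d)) = (\<lambda>x. c *\<^sub>R dir_deriv b f (c *\<^sub>R x + d))" by (rule dd[OF assms])
  show "smooth (\<lambda>x. f (c *\<^sub>R x + d))"
  proof (rule smooth_coinduct[where P="\<lambda>h. \<exists>f. smooth f \<and> h = (\<lambda>x. f (c *\<^sub>R x + d))"])
    fix h :: "'a \<Rightarrow> 'b" assume "\<exists>f. smooth f \<and> h = (\<lambda>x. f (c *\<^sub>R x + d))"
    then obtain f where f: "smooth f" "h = (\<lambda>x. f (c *\<^sub>R x + d))" by blast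
    have "h differentiable (at z)" for z unfolding f(2) using hd[OF f(1)] differentiableI by blast
    moreover have "\<exists>f. smooth f \<and> dir_deriv b h = (\<lambda>x. f (c *\<^sub>R x + d))" if "b \<in> Basis" for b
    proof (intro exI conjI)
      show "smooth (\<lambda>x. c *\<^sub>R dir_deriv b f x)"
        by (rule smooth_bounded_linear[OF bounded_linear_scaleR_right smooth_dir_deriv[OF f(1) that]])
      show "dir_deriv b h = (\<lambda>x. c *\<^sub>R dir_deriv b f (c *\<^sub>R x + d))" unfolding f(2) by (rule dd[OF f(1)])
    qed
    ultimately show "(\<forall>z. h differentiable (at z)) \<and> (\<forall>b\<in>Basis. \<exists>f. smooth f \<and> dir_deriv b h = (\<lambda>x. f (c *\<^sub>R x + d)))"
      by blast
  qed (use assms in blast)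
qed

text \<open>\<open>p(1/x) exp(-1/x)\<close> for \<open>x > 0\<close>, extended by zero: the derivatives of the standard flat
  function stay in this class.\<close>

definition expm :: "real poly \<Rightarrow> real \<Rightarrow> real" where
  "expm p x = (if x > 0 then poly p (1 / x) * exp (- (1 / x)) else 0)"

lemma poly_times_exp_minus_tendsto_0: "((\<lambda>y::real. poly p y * exp (- y)) \<longlongrightarrow> 0) at_top"
proof -
  have "((\<lambda>y. \<Sum>i\<le>degree p. coeff p i * (y ^ i / exp y)) \<longlongrightarrow> (\<Sum>i\<le>degree p. coeff p i * 0)) at_top"
    by (intro tendsto_intros tendsto_power_div_exp_0)
  moreover have "(\<Sum>i\<le>degree p. coeff p i * (y ^ i / exp y)) = poly p y * exp (- y)" for y :: real
    by (simp add: poly_altdef sum_distrib_right exp_minus divide_inverse mult.assoc)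
  ultimately show ?thesis by simp
qed

lemma expm_has_derivative:
  "(expm p has_field_derivative expm (monom 1 2 * (p - pderiv p)) x) (at x)"
proof -
  consider "x > 0" | "x < 0" | "x = 0" by linarith
  then show ?thesis
  proof cases
    case 1
    have "((\<lambda>x. poly p (1 / x) * exp (- (1 / x))) has_field_derivative
        expm (monom 1 2 * (p - pderiv p)) x) (at x)"
      using 1 by (auto intro!: derivative_eq_intros DERIV_chain2[OF poly_DERIV] simp: expm_def poly_monom field_simps power2_eq_square)
    then show ?thesis
      by (rule has_field_derivative_transform_within_open[where S="{0<..}"]) (use 1 in \<open>auto simp: expm_def\<close>)
  next
    case 2
    have "((\<lambda>x. 0) has_field_derivative expm (monom 1 2 * (p - pderiv p)) x) (at x)"
      using 2 by (simp add: expm_def)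
    then show ?thesis
      by (rule has_field_derivative_transform_within_open[where S="{..<0}"]) (use 2 in \<open>auto simp: expm_def\<close>)
  next
    case 3
    have R: "((\<lambda>h. expm p h / h) \<longlongrightarrow> 0) (at_right 0)"
    proof (rule Lim_transform_eventually)
      show "((\<lambda>h::real. poly (p * [:0, 1:]) (inverse h) * exp (- inverse h)) \<longlongrightarrow> 0) (at_right 0)"
        by (rule filterlim_compose[OF poly_times_exp_minus_tendsto_0 filterlim_inverse_at_top_right])
      show "\<forall>\<^sub>F h in at_right 0. poly (p * [:0, 1:]) (inverse h) * exp (- inverse h) = expm p h / h"
        by (auto simp: eventually_at_right_field expm_def field_simps intro!: exI[of _ 1])
    qed
    have L: "((\<lambda>h. expm p h / h) \<longlongrightarrow> 0) (at_left 0)"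
    proof (rule Lim_transform_eventually)
      show "((\<lambda>h. 0) \<longlongrightarrow> 0) (at_left (0::real))" by simp
      show "\<forall>\<^sub>F h in at_left (0::real). 0 = expm p h / h"
        by (auto simp: eventually_at_left_field expm_def intro!: exI[of _ "-1"])
    qed
    have "((\<lambda>h. expm p h / h) \<longlongrightarrow> 0) (at 0)" using L R by (simp add: filterlim_at_split)
    then show ?thesis using 3 by (simp add: DERIV_def expm_def)
  qed
qed

lemma smooth_inner_const: "smooth (\<lambda>x. c * (x \<bullet> b))"
proof (rule smoothI)
  have hd: "((\<lambda>x. c * (x \<bullet> b)) has_derivative (\<lambda>y. c * (y \<bullet> b))) (at z)" for z
    by (auto intro!: derivative_eq_intros)
  show "(\<lambda>x. c * (x \<bullet> b)) differentiable (at z)" for z using hd differentiableI by blast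
  have "dir_deriv a (\<lambda>x. c * (x \<bullet> b)) = (\<lambda>x. c * (a \<bullet> b))" for a
    by (rule ext) (rule dir_deriv_eq[OF hd])
  then show "smooth (dir_deriv a (\<lambda>x. c * (x \<bullet> b)))" for a by (simp add: smooth_const)
qed

lemma expm_radial_has_derivative:
  fixes z :: "'a::euclidean_space"
  shows "((\<lambda>x. expm p (1 - x \<bullet> x)) has_derivative (\<lambda>y. expm (monom 1 2 * (p - pderiv p)) (1 - z \<bullet> z) * (- 2 * (z \<bullet> y)))) (at z)"
proof -
  have "((\<lambda>x. 1 - x \<bullet> x) has_derivative (\<lambda>y. - 2 * (z \<bullet> y))) (at z)"
    by (auto intro!: derivative_eq_intros simp: inner_commute)
  moreover have "(expm p has_derivative (*) (expm (monom 1 2 * (p - pderiv p)) (1 - z \<bullet> z))) (at (1 - z \<bullet> z))"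
    using expm_has_derivative by (simp add: has_field_derivative_def)
  ultimately show ?thesis
    by (rule has_derivative_compose[where f="\<lambda>x. 1 - x \<bullet> x" and g="expm p"])
qed

lemma dir_deriv_radial:
  assumes "smooth m"
  shows "((\<lambda>x. expm p (1 - x \<bullet> x) *\<^sub>R m x) has_derivative
      (\<lambda>y. expm p (1 - z \<bullet> z) *\<^sub>R frechet_derivative m (at z) y + (expm (monom 1 2 * (p - pderiv p)) (1 - z \<bullet> z) * (- 2 * (z \<bullet> y))) *\<^sub>R m z)) (at z)"
  by (rule has_derivative_scaleR[OF expm_radial_has_derivative smooth_has_derivative[OF assms]])

definition bump :: "'a::euclidean_space \<Rightarrow> real" where
  "bump x = expm 1 (1 - x \<bullet> x)"

lemma smooth_bump: "smooth (bump :: 'a::euclidean_space \<Rightarrow> real)"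
proof -
  let ?P = "\<lambda>g :: 'a \<Rightarrow> real. \<exists>p m. smooth m \<and> g = (\<lambda>x. expm p (1 - x \<bullet> x) *\<^sub>R m x)"
  have single: "sums_of ?P (\<lambda>x. expm p (1 - x \<bullet> x) *\<^sub>R m x)" if "smooth m" for p m
    by (rule sums_of.single) (use that in blast)
  show ?thesis
  proof (rule smooth_coinduct_sums[where P="?P"])
    have "bump = (\<lambda>x::'a. expm 1 (1 - x \<bullet> x) *\<^sub>R (\<lambda>x. 1) x)" by (rule ext) (simp add: bump_def)
    then show "?P bump" by - (rule exI[of _ 1], rule exI[of _ "\<lambda>x. 1"], rule conjI[OF smooth_const])
    fix g :: "'a \<Rightarrow> real" assume "?P g"
    then obtain p m where m: "smooth m" and g: "g = (\<lambda>x. expm p (1 - x \<bullet> x) *\<^sub>R m x)" by blast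
    have d: "g differentiable (at z)" for z unfolding g using dir_deriv_radial[OF m] differentiableI by blast
    have "sums_of ?P (dir_deriv b g)" if b: "b \<in> Basis" for b
    proof -
      let ?q = "monom 1 2 * (p - pderiv p)"
      have eq: "dir_deriv b g = (\<lambda>x. expm p (1 - x \<bullet> x) *\<^sub>R dir_deriv b m x + expm ?q (1 - x \<bullet> x) *\<^sub>R ((- 2 * (x \<bullet> b)) *\<^sub>R m x))"
        unfolding g by (rule ext, rule trans[OF dir_deriv_eq[OF dir_deriv_radial[OF m]]]) (simp add: dir_deriv_def)
      show ?thesis
        unfolding eq by (rule sums_of.add; rule single) (rule smooth_dir_deriv[OF m b], rule smooth_scaleR[OF smooth_inner_const m])
    qed
    with d show "(\<forall>z. g differentiable (at z)) \<and> (\<forall>b\<in>Basis. sums_of ?P (dir_deriv b g))" by blast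
  qed
qed

lemma bump_nonneg: "0 \<le> bump x"
  by (simp add: bump_def expm_def)

lemma bump_eq_0: "norm x \<ge> 1 \<Longrightarrow> bump x = 0"
proof -
  assume "norm x \<ge> 1"
  then have "1 \<le> (norm x)\<^sup>2" by (simp add: one_le_power)
  then show ?thesis by (simp add: bump_def expm_def power2_norm_eq_inner)
qed

lemma bump_0: "bump 0 = exp (-1)"
  by (simp add: bump_def expm_def)

lemma bump_pos: "norm x < 1 \<Longrightarrow> 0 < bump x"
  using abs_square_less_1[of "norm x"] by (simp add: bump_def expm_def power2_norm_eq_inner[symmetric])

text \<open>Symmetry of the second derivatives, which makes the divergence of a curl vanish.\<close>

definition mixed_symmetric :: "('a::euclidean_space \<Rightarrow> 'b::euclidean_space) \<Rightarrow> bool" where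
  "mixed_symmetric f \<longleftrightarrow> (\<forall>a\<in>Basis. \<forall>b\<in>Basis. dir_deriv a (dir_deriv b f) = dir_deriv b (dir_deriv a f))"

lemma mixed_symmetric_bump: "mixed_symmetric bump"
  unfolding mixed_symmetric_def
proof (intro ballI)
  fix a b :: 'a
  define q where "q = monom 1 2 * (1 - pderiv (1::real poly))"
  have 1: "dir_deriv b bump = (\<lambda>x. expm q (1 - x \<bullet> x) *\<^sub>R (- 2 * (x \<bullet> b)))" for b :: 'a
    by (rule ext) (simp add: bump_def[abs_def] dir_deriv_eq[OF expm_radial_has_derivative] q_def)
  have 2: "dir_deriv a (\<lambda>x. - 2 * (x \<bullet> b)) x = - 2 * (a \<bullet> b)" for a b x :: 'a
    by (rule dir_deriv_eq) (auto intro!: derivative_eq_intros)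
  have 3: "dir_deriv a (dir_deriv b bump) x = expm q (1 - x \<bullet> x) * (- 2 * (a \<bullet> b)) + expm (monom 1 2 * (q - pderiv q)) (1 - x \<bullet> x) * (- 2 * (x \<bullet> a)) * (- 2 * (x \<bullet> b))" for a b x :: 'a
    unfolding 1 by (rule trans[OF dir_deriv_eq[OF dir_deriv_radial[OF smooth_inner_const]]])
      (use 2 in \<open>simp add: dir_deriv_def\<close>)
  show "dir_deriv a (dir_deriv b bump) = dir_deriv b (dir_deriv a (bump :: 'a \<Rightarrow> real))"
    by (rule ext) (simp add: 3 inner_commute[of a b])
qed

lemma mixed_symmetric_dilation:
  assumes f: "smooth f" and sym: "mixed_symmetric f"
  shows "mixed_symmetric (\<lambda>x. f (c *\<^sub>R x + d))"
proof -
  have "dir_deriv a (dir_deriv b (\<lambda>x. f (c *\<^sub>R x + d))) = (\<lambda>x. c *\<^sub>R c *\<^sub>R dir_deriv a (dir_deriv b f) (c *\<^sub>R x + d))"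
    if b: "b \<in> Basis" for a b
    unfolding smooth_dilation(2)[OF f]
    by (subst dir_deriv_bounded_linear[OF bounded_linear_scaleR_right smooth_dilation(1)[OF smooth_dir_deriv[OF f b]]])
       (simp add: smooth_dilation(2)[OF smooth_dir_deriv[OF f b]])
  then show ?thesis using sym by (simp add: mixed_symmetric_def)
qed

section \<open>Band-limited fields\<close>

definition band_limited :: "(real^3 \<Rightarrow> complex^'n::finite) \<Rightarrow> bool" where
  "band_limited h \<longleftrightarrow> L2 h \<and> hermitian h \<and> (\<exists>R. \<forall>\<xi>. norm \<xi> > R \<longrightarrow> h \<xi> = 0)"

definition synth1 :: "(real^3 \<Rightarrow> complex) \<Rightarrow> real^3 \<Rightarrow> real" where
  "synth1 g x = Re (LINT \<xi>|lebesgue. cis (x \<bullet> \<xi>) * g \<xi>)"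

text \<open>The inverse Fourier integral of a band-limited transform. For such \<open>h\<close> it is an absolutely convergent
  integral, which gives a representative that can be differentiated classically.\<close>

definition synth :: "(real^3 \<Rightarrow> complex^'n::finite) \<Rightarrow> real^3 \<Rightarrow> real^'n" where
  "synth h x = (\<Sum>k\<in>UNIV. axis k (ft_const * synth1 (\<lambda>\<xi>. h \<xi> $ k) x))"

lemma synth_nth: "synth h x $ k = Re (ft (\<lambda>\<xi>. h \<xi> $ k) (- x))"
  by (simp add: synth_def synth1_def ft_def inner_commute flip: vec_lambda_eq_sum_axis)

lemma compact_support_integrable:
  fixes g :: "'a::euclidean_space \<Rightarrow> 'b::euclidean_space"
  assumes g: "L2 g" and R: "\<And>x. norm x > R \<Longrightarrow> g x = 0"
  shows "integrable lebesgue g"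
proof -
  have "(\<lambda>x. indicator (cball 0 R) x *\<^sub>R g x) = g"
    by (rule ext) (use R in \<open>auto simp: indicator_def not_le\<close>)
  then show ?thesis using L2_truncation_integrable[OF g, of R] by simp
qed

text \<open>The remainder in \<open>cis t = 1 + \<i> t + O(t\<^sup>2)\<close> is uniform on the support of
  \<open>g\<close>.\<close>

lemma synth1_has_derivative:
  assumes g: "integrable lebesgue g" and R: "\<And>\<xi>. norm \<xi> > R \<Longrightarrow> g \<xi> = 0" and R0: "0 \<le> R"
  shows "(synth1 g has_derivative (\<lambda>y. synth1 (\<lambda>\<xi>. \<i> * of_real (y \<bullet> \<xi>) * g \<xi>) x)) (at x)"
proof -
  let ?D = "\<lambda>y. synth1 (\<lambda>\<xi>. \<i> * of_real (y \<bullet> \<xi>) * g \<xi>) x"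
  let ?p = "\<lambda>y \<xi>. cis (x \<bullet> \<xi>) * (\<i> * of_real (y \<bullet> \<xi>) * g \<xi>)"
  let ?r = "\<lambda>y \<xi>. cis ((x + y) \<bullet> \<xi>) * g \<xi> - cis (x \<bullet> \<xi>) * g \<xi> - ?p y \<xi>"
  let ?I = "LINT \<xi>|lebesgue. norm (g \<xi>)"
  have im: "(\<lambda>\<xi>. \<i> * of_real (y \<bullet> \<xi>)) \<in> Lmeas" for y :: "real^3"
    by (rule measurable_completion) measurable
  have gm: "g \<in> Lmeas" using g by auto
  have bd: "norm (\<i> * of_real (y \<bullet> \<xi>) * g \<xi>) \<le> (norm y * R) * norm (g \<xi>)" for y \<xi>
  proof (cases "norm \<xi> > R")
    case False
    have "\<bar>y \<bullet> \<xi>\<bar> \<le> norm y * norm \<xi>" by (rule Cauchy_Schwarz_ineq2)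
    also have "\<dots> \<le> norm y * R" using False by (intro mult_left_mono) auto
    finally show ?thesis by (simp add: norm_mult mult_right_mono)
  qed (simp add: R)
  have gi: "integrable lebesgue (\<lambda>\<xi>. \<i> * of_real (y \<bullet> \<xi>) * g \<xi>)" for y
  proof (rule Bochner_Integration.integrable_bound)
    show "integrable lebesgue (\<lambda>\<xi>. (norm y * R) * norm (g \<xi>))" using g by simp
    show "(\<lambda>\<xi>. \<i> * of_real (y \<bullet> \<xi>) * g \<xi>) \<in> Lmeas" by (rule borel_measurable_times[OF im gm])
    show "AE \<xi> in lebesgue. norm (\<i> * of_real (y \<bullet> \<xi>) * g \<xi>) \<le> norm ((norm y * R) * norm (g \<xi>))"
      using bd R0 by (intro AE_I2) (simp add: abs_mult)
  qed
  note ci = ft_integrand_integrable(4)[OF gi] and cg = ft_integrand_integrable(4)[OF g]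
  have lin: "bounded_linear ?D"
  proof (rule bounded_linear_intro)
    fix y z :: "real^3" and r :: real
    have "(LINT \<xi>|lebesgue. cis (x \<bullet> \<xi>) * (\<i> * of_real ((y + z) \<bullet> \<xi>) * g \<xi>))
      = (LINT \<xi>|lebesgue. ?p y \<xi> + ?p z \<xi>)"
      by (simp add: inner_add_left algebra_simps)
    also have "\<dots> = (LINT \<xi>|lebesgue. ?p y \<xi>) + (LINT \<xi>|lebesgue. ?p z \<xi>)"
      by (rule Bochner_Integration.integral_add[OF ci ci])
    finally show "?D (y + z) = ?D y + ?D z" by (simp add: synth1_def)
    have "(LINT \<xi>|lebesgue. cis (x \<bullet> \<xi>) * (\<i> * of_real ((r *\<^sub>R y) \<bullet> \<xi>) * g \<xi>))
      = (LINT \<xi>|lebesgue. complex_of_real r * (?p y \<xi>))"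
      by (simp add: mult_ac)
    also have "\<dots> = complex_of_real r * (LINT \<xi>|lebesgue. ?p y \<xi>)"
      by (rule integral_mult_right_zero)
    finally show "?D (r *\<^sub>R y) = r *\<^sub>R ?D y" by (simp add: synth1_def)
    have "\<bar>?D y\<bar> \<le> norm (LINT \<xi>|lebesgue. ?p y \<xi>)"
      unfolding synth1_def by (rule abs_Re_le_cmod)
    also have "\<dots> \<le> (LINT \<xi>|lebesgue. norm (?p y \<xi>))"
      by (rule integral_norm_bound)
    also have "\<dots> \<le> (LINT \<xi>|lebesgue. (norm y * R) * norm (g \<xi>))"
    proof (rule integral_mono)
      show "norm (?p y \<xi>) \<le> (norm y * R) * norm (g \<xi>)" for \<xi>
        using bd[of y \<xi>] by (simp add: norm_mult)
    qed (use integrable_norm[OF ci] g in auto)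
    finally show "norm (?D y) \<le> norm y * (R * ?I)" by (simp add: mult.assoc)
  qed
  have rem: "norm (synth1 g (x + y) - synth1 g x - ?D y) / norm y \<le> norm y * (R\<^sup>2 / 2 * ?I)" for y
  proof (cases "y = 0")
    case False
    have pt: "norm (?r y \<xi>)
        \<le> (norm y * R)\<^sup>2 / 2 * norm (g \<xi>)" for \<xi>
    proof (cases "norm \<xi> > R")
      case False
      have "norm (cis (y \<bullet> \<xi>) - 1 - \<i> * of_real (y \<bullet> \<xi>)) \<le> \<bar>y \<bullet> \<xi>\<bar>\<^sup>2 / 2"
        using iexp_approx1[of "y \<bullet> \<xi>" 1] by (simp add: cis_conv_exp algebra_simps power2_eq_square)
      also have "\<dots> \<le> (norm y * R)\<^sup>2 / 2"
      proof -
        have "\<bar>y \<bullet> \<xi>\<bar> \<le> norm y * norm \<xi>" by (rule Cauchy_Schwarz_ineq2)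
        also have "\<dots> \<le> norm y * R" using False by (intro mult_left_mono) auto
        finally show ?thesis by (intro divide_right_mono power_mono) auto
      qed
      finally have "norm (cis (y \<bullet> \<xi>) - 1 - \<i> * of_real (y \<bullet> \<xi>)) * norm (g \<xi>) \<le> (norm y * R)\<^sup>2 / 2 * norm (g \<xi>)"
        by (rule mult_right_mono) simp
      moreover have "?r y \<xi>
          = cis (x \<bullet> \<xi>) * ((cis (y \<bullet> \<xi>) - 1 - \<i> * of_real (y \<bullet> \<xi>)) * g \<xi>)"
        by (simp add: inner_add_left cis_mult[symmetric] algebra_simps)
      ultimately show ?thesis by (simp add: norm_mult)
    qed (simp add: R)
    have e: "synth1 g (x + y) - synth1 g x - ?D y = Re (LINT \<xi>|lebesgue. ?r y \<xi>)"
      unfolding synth1_def by (simp add: cg ci)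
    have "norm (synth1 g (x + y) - synth1 g x - ?D y) \<le> norm (LINT \<xi>|lebesgue. ?r y \<xi>)"
      unfolding e real_norm_def by (rule abs_Re_le_cmod)
    also have "\<dots> \<le> (LINT \<xi>|lebesgue. norm (?r y \<xi>))"
      by (rule integral_norm_bound)
    also have "\<dots> \<le> (LINT \<xi>|lebesgue. (norm y * R)\<^sup>2 / 2 * norm (g \<xi>))"
    proof (rule integral_mono)
      show "integrable lebesgue (\<lambda>\<xi>. norm (?r y \<xi>))"
        by (intro integrable_norm Bochner_Integration.integrable_diff cg ci)
      show "integrable lebesgue (\<lambda>\<xi>. (norm y * R)\<^sup>2 / 2 * norm (g \<xi>))"
        by (intro integrable_mult_right integrable_norm g)
    qed (rule pt)
    also have "\<dots> = norm y * (norm y * (R\<^sup>2 / 2 * ?I))" by (simp add: power2_eq_square)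
    finally show ?thesis using False by (simp add: pos_divide_le_eq mult.commute)
  qed simp
  have "((\<lambda>y. norm (synth1 g (x + y) - synth1 g x - ?D y) / norm y) \<longlongrightarrow> 0) (at 0)"
  proof (rule Lim_null_comparison)
    show "\<forall>\<^sub>F y in at 0. norm (norm (synth1 g (x + y) - synth1 g x - ?D y) / norm y) \<le> norm y * (R\<^sup>2 / 2 * ?I)"
      using rem by (intro always_eventually allI) simp
    show "((\<lambda>y::real^3. norm y * (R\<^sup>2 / 2 * ?I)) \<longlongrightarrow> 0) (at 0)"
      by (auto intro!: tendsto_eq_intros)
  qed
  then show ?thesis using lin by (simp add: has_derivative_at)
qed

lemma band_limitedD:
  assumes "band_limited h"
  obtains R where "0 \<le> R" "\<And>\<xi>. norm \<xi> > R \<Longrightarrow> h \<xi> = 0"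
proof -
  obtain R where "\<forall>\<xi>. norm \<xi> > R \<longrightarrow> h \<xi> = 0" using assms by (auto simp: band_limited_def)
  then show thesis using that[of "max R 0"] by auto
qed

lemma band_limited_mult:
  fixes A :: "real^3 \<Rightarrow> complex^'n \<Rightarrow> complex^'m::finite"
  assumes h: "band_limited (h :: real^3 \<Rightarrow> complex^'n::finite)"
    and m: "(\<lambda>\<xi>. A \<xi> (h \<xi>)) \<in> Lmeas"
    and b: "\<And>R \<xi> v. 0 \<le> R \<Longrightarrow> norm \<xi> \<le> R \<Longrightarrow> norm (A \<xi> v) \<le> B R * norm v"
    and B: "\<And>R. 0 \<le> R \<Longrightarrow> 0 \<le> B R"
    and sym: "\<And>\<xi> v. A (- \<xi>) (vcnj v) = vcnj (A \<xi> v)"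
  shows "band_limited (\<lambda>\<xi>. A \<xi> (h \<xi>))"
proof -
  obtain R where R: "0 \<le> R" "\<And>\<xi>. norm \<xi> > R \<Longrightarrow> h \<xi> = 0" using band_limitedD[OF h] by blast
  have z: "A \<xi> 0 = 0" for \<xi> using b[of "norm \<xi>" \<xi> 0] by simp
  have "norm (A \<xi> (h \<xi>)) \<le> B R * norm (h \<xi>)" for \<xi>
    by (cases "norm \<xi> \<le> R") (use b R z B in \<open>auto simp: not_le\<close>)
  then have "L2 (\<lambda>\<xi>. A \<xi> (h \<xi>))"
    using h by (intro L2_dominated(1)[OF _ m _ B[OF R(1)], of h]) (simp_all add: band_limited_def)
  moreover have "hermitian (\<lambda>\<xi>. A \<xi> (h \<xi>))"
  proof -
    have "AE \<xi> in lebesgue. h (- \<xi>) = vcnj (h \<xi>)" using h by (simp add: band_limited_def hermitian_def)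
    then show ?thesis unfolding hermitian_def by eventually_elim (simp add: sym)
  qed
  moreover have "\<exists>R. \<forall>\<xi>. norm \<xi> > R \<longrightarrow> A \<xi> (h \<xi>) = 0"
    by (rule exI[of _ R]) (simp add: R z)
  ultimately show ?thesis by (simp add: band_limited_def)
qed

lemma band_limited_derivative:
  assumes h: "band_limited (h :: real^3 \<Rightarrow> complex^'n::finite)"
  shows "band_limited (\<lambda>\<xi>. (\<i> * of_real (\<xi> $ j)) *s h \<xi>)"
proof (rule band_limited_mult[OF h, where B="\<lambda>R. R"])
  show "(\<lambda>\<xi>. (\<i> * of_real (\<xi> $ j)) *s h \<xi>) \<in> Lmeas"
    by (rule component_symbol_measurable) (use h in \<open>auto simp: band_limited_def L2_def\<close>)
  show "norm ((\<i> * of_real (\<xi> $ j)) *s v) \<le> R * norm v" if "norm \<xi> \<le> R" for R and \<xi> :: "real^3" and v :: "complex^'n"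
    unfolding norm_component_symbol using component_le_norm_cart[of \<xi> j] that by (intro mult_right_mono) auto
qed (auto simp: vec_eq_iff)

lemma band_limited_curl:
  assumes h: "band_limited h" shows "band_limited (\<lambda>\<xi>. curl_symbol \<xi> (h \<xi>))"
proof (rule band_limited_mult[OF h, where B="\<lambda>R. R"])
  show "(\<lambda>\<xi>. curl_symbol \<xi> (h \<xi>)) \<in> Lmeas"
    by (rule curl_symbol_measurable) (use h in \<open>auto simp: band_limited_def L2_def\<close>)
  show "norm (curl_symbol \<xi> v) \<le> R * norm v" if "norm \<xi> \<le> R" for R \<xi> v
    using norm_curl_symbol_le[of \<xi> v] mult_right_mono[OF that norm_ge_zero[of v]] by simp
qed (auto simp: curl_symbol_vcnj)

lemma fourier_synth:
  fixes h :: "real^3 \<Rightarrow> complex^'n::finite"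
  assumes h: "band_limited h"
  shows "L2 (synth h)" "AE \<xi> in lebesgue. fourier (synth h) \<xi> = h \<xi>"
proof -
  obtain R where R: "0 \<le> R" "\<And>\<xi>. norm \<xi> > R \<Longrightarrow> h \<xi> = 0" using band_limitedD[OF h] by blast
  have hL: "L2 h" and hh: "hermitian h" using h by (auto simp: band_limited_def)
  obtain g where g: "L2 g" "AE \<xi> in lebesgue. fourier g \<xi> = h \<xi>" by (rule fourier_surj[OF hL hh])
  have "AE x in lebesgue. g x $ k = synth h x $ k" for k
  proof -
    have i: "integrable lebesgue (\<lambda>\<xi>. h \<xi> $ k)"
      by (rule compact_support_integrable[OF L2_nth[OF hL], of R]) (simp add: R)
    have "is_ft (cpx k g) (\<lambda>\<xi>. h \<xi> $ k)"
      by (rule is_ft_cong_AE[OF is_ft_fourier[OF g(1)]]) (use g(2) in \<open>auto elim: eventually_mono\<close>)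
    from is_ft_inverse_formula[OF this i] show ?thesis
      by eventually_elim (metis Re_complex_of_real synth_nth)
  qed
  then have eq: "AE x in lebesgue. g x = synth h x" by (simp add: AE_vec_eq_iff)
  show "L2 (synth h)" by (rule L2_cong_AE[OF g(1) eq])
  show "AE \<xi> in lebesgue. fourier (synth h) \<xi> = h \<xi>" using g(2) fourier_cong_AE[OF g(1) eq] by simp
qed

lemma synth_derivative:
  fixes h :: "real^3 \<Rightarrow> complex^'n::finite"
  assumes h: "band_limited h"
  shows "synth h differentiable (at x)"
    "dir_deriv (axis j 1) (synth h) = synth (\<lambda>\<xi>. (\<i> * of_real (\<xi> $ j)) *s h \<xi>)"
proof -
  obtain R where R: "0 \<le> R" "\<And>\<xi>. norm \<xi> > R \<Longrightarrow> h \<xi> = 0" using band_limitedD[OF h] by blast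
  have hL: "L2 h" using h by (auto simp: band_limited_def)
  have i: "integrable lebesgue (\<lambda>\<xi>. h \<xi> $ k)" for k
    by (rule compact_support_integrable[OF L2_nth[OF hL], of R]) (simp add: R)
  have d1: "(synth1 (\<lambda>\<xi>. h \<xi> $ k) has_derivative (\<lambda>y. synth1 (\<lambda>\<xi>. \<i> * of_real (y \<bullet> \<xi>) * h \<xi> $ k) x)) (at x)" for k x
    by (rule synth1_has_derivative[OF i _ R(1)]) (simp add: R)
  have d: "(synth h has_derivative (\<lambda>y. \<Sum>k\<in>UNIV. axis k (ft_const * synth1 (\<lambda>\<xi>. \<i> * of_real (y \<bullet> \<xi>) * h \<xi> $ k) x))) (at x)" for x
    unfolding synth_def[abs_def]
    by (intro has_derivative_sum bounded_linear.has_derivative[OF bounded_linear_axis] bounded_linear.has_derivative[OF bounded_linear_mult_right] d1)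
  show "synth h differentiable (at x)" using d differentiableI by blast
  show "dir_deriv (axis j 1) (synth h) = synth (\<lambda>\<xi>. (\<i> * of_real (\<xi> $ j)) *s h \<xi>)"
    by (rule ext, rule trans[OF dir_deriv_eq[OF d]]) (simp add: synth_def inner_axis')
qed

lemma Basis_cart3: "b \<in> (Basis :: (real^3) set) \<longleftrightarrow> (\<exists>j. b = axis j 1)"
  by (auto simp: Basis_vec_def)

text \<open>Derivatives of \<open>synth h\<close> are again of this form, so smoothness follows by coinduction.\<close>

lemma smooth_synth:
  fixes h :: "real^3 \<Rightarrow> complex^'n::finite"
  assumes "band_limited h" shows "smooth (synth h)"
proof (rule smooth_coinduct[where P="\<lambda>f. \<exists>h. band_limited h \<and> f = synth h"])
  fix g :: "real^3 \<Rightarrow> real^'n" assume "\<exists>h. band_limited h \<and> g = synth h"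
  then obtain h where h: "band_limited h" "g = synth h" by blast
  show "(\<forall>z. g differentiable (at z)) \<and> (\<forall>b\<in>Basis. \<exists>h. band_limited h \<and> dir_deriv b g = synth h)"
  proof (intro conjI allI ballI)
    show "g differentiable (at z)" for z unfolding h(2) by (rule synth_derivative(1)[OF h(1)])
    fix b :: "real^3" assume "b \<in> Basis"
    then obtain j where j: "b = axis j 1" using Basis_cart3 by blast
    show "\<exists>h. band_limited h \<and> dir_deriv b g = synth h"
      unfolding j h(2) synth_derivative(2)[OF h(1)] using band_limited_derivative[OF h(1)] by blast
  qed
qed (use assms in blast)

lemma mixed_symmetric_synth:
  fixes h :: "real^3 \<Rightarrow> complex^'n::finite"
  assumes h: "band_limited h" shows "mixed_symmetric (synth h)"
proof -
  have "dir_deriv (axis i 1) (dir_deriv (axis j 1) (synth h)) = dir_deriv (axis j 1) (dir_deriv (axis i 1) (synth h))" for i j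
  proof -
    have "(\<lambda>\<xi>. (\<i> * of_real (\<xi> $ i)) *s ((\<i> * of_real (\<xi> $ j)) *s h \<xi>)) = (\<lambda>\<xi>. (\<i> * of_real (\<xi> $ j)) *s ((\<i> * of_real (\<xi> $ i)) *s h \<xi>))"
      by (rule ext) (simp add: vec_eq_iff mult_ac)
    then show ?thesis by (simp add: synth_derivative(2)[OF h] synth_derivative(2)[OF band_limited_derivative[OF h]])
  qed
  then show ?thesis by (auto simp: mixed_symmetric_def Basis_cart3)
qed

lemma mixed_symmetric_scaleR:
  fixes m :: "'a::euclidean_space \<Rightarrow> real" and f :: "'a \<Rightarrow> 'b::euclidean_space"
  assumes "smooth m" "smooth f" "mixed_symmetric m" "mixed_symmetric f"
  shows "mixed_symmetric (\<lambda>x. m x *\<^sub>R f x)"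
  unfolding mixed_symmetric_def
proof (intro ballI)
  fix a b :: 'a assume ab: "a \<in> Basis" "b \<in> Basis"
  have d: "dir_deriv a (dir_deriv b (\<lambda>x. m x *\<^sub>R f x)) = (\<lambda>x. (dir_deriv a (dir_deriv b m) x *\<^sub>R f x + dir_deriv b m x *\<^sub>R dir_deriv a f x)
      + (dir_deriv a m x *\<^sub>R dir_deriv b f x + m x *\<^sub>R dir_deriv a (dir_deriv b f) x))" if "a \<in> Basis" "b \<in> Basis" for a b
    unfolding dir_deriv_scaleR[OF assms(1,2)]
    by (simp add: dir_deriv_add smooth_scaleR smooth_dir_deriv assms that dir_deriv_scaleR)
  show "dir_deriv a (dir_deriv b (\<lambda>x. m x *\<^sub>R f x)) = dir_deriv b (dir_deriv a (\<lambda>x. m x *\<^sub>R f x))"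
    unfolding d[OF ab] d[OF ab(2,1)] using assms(3,4) ab by (simp add: mixed_symmetric_def algebra_simps)
qed

definition cutoff_function :: "('a::euclidean_space \<Rightarrow> real) \<Rightarrow> bool" where
  "cutoff_function m \<longleftrightarrow> smooth m \<and> (\<forall>x. norm x > 1 \<longrightarrow> m x = 0)"

lemma dir_deriv_local_zero:
  assumes "open S" "z \<in> S" "\<And>x. x \<in> S \<Longrightarrow> f x = 0"
  shows "dir_deriv b f z = 0"
proof -
  have "(f has_derivative (\<lambda>y. 0)) (at z)"
    by (rule has_derivative_transform_within_open[OF has_derivative_const[of 0] assms(1,2)]) (simp add: assms(3))
  from dir_deriv_eq[OF this] show ?thesis .
qed

lemma cutoff_dir_deriv:
  assumes m: "cutoff_function (m :: 'a::euclidean_space \<Rightarrow> real)" and b: "b \<in> Basis" shows "cutoff_function (dir_deriv b m)"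
  unfolding cutoff_function_def
proof (intro conjI allI impI)
  show "smooth (dir_deriv b m)" using m b by (simp add: cutoff_function_def smooth_dir_deriv)
  fix x :: 'a assume "norm x > 1"
  then have x: "x \<in> - cball 0 1" by simp
  show "dir_deriv b m x = 0"
    by (rule dir_deriv_local_zero[OF _ x]) (use m in \<open>auto simp: cutoff_function_def open_Compl\<close>)
qed

lemma cutoff_bounded:
  assumes "cutoff_function (m :: 'a::euclidean_space \<Rightarrow> real)" obtains B where "0 \<le> B" "\<And>x. \<bar>m x\<bar> \<le> B"
proof -
  have "compact (m ` cball 0 1)"
    by (rule compact_continuous_image[OF continuous_on_subset[OF smooth_continuous]]) (use assms in \<open>auto simp: cutoff_function_def\<close>)
  then obtain B where B: "\<And>x. norm x \<le> 1 \<Longrightarrow> \<bar>m x\<bar> \<le> B" using compact_imp_bounded by (fastforce simp: bounded_iff)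
  have "\<bar>m x\<bar> \<le> max B 0" for x
    by (cases "norm x \<le> 1") (use B[of x] assms in \<open>auto simp: cutoff_function_def\<close>)
  then show thesis using that[of "max B 0"] by simp
qed

primrec iterated_deriv :: "'a list \<Rightarrow> ('a::euclidean_space \<Rightarrow> 'b::euclidean_space) \<Rightarrow> 'a \<Rightarrow> 'b" where
  "iterated_deriv [] f = f"
| "iterated_deriv (b # bs) f = iterated_deriv bs (dir_deriv b f)"

lemma iterated_deriv_combination:
  assumes "set bs \<subseteq> Basis" "smooth f" "smooth g"
  shows "iterated_deriv bs (\<lambda>x. c *\<^sub>R f x + g x) = (\<lambda>x. c *\<^sub>R iterated_deriv bs f x + iterated_deriv bs g x)"
  using assms
proof (induction bs arbitrary: f g)
  case (Cons b bs)
  have cf: "smooth (\<lambda>x. c *\<^sub>R f x)" by (rule smooth_bounded_linear[OF bounded_linear_scaleR_right Cons(3)])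
  show ?case
    using Cons by (simp add: dir_deriv_add[OF cf Cons(4)] dir_deriv_bounded_linear[OF bounded_linear_scaleR_right Cons(3)] smooth_dir_deriv)
qed simp

text \<open>A cutoff stretched to radius \<open>n + 1\<close>; each derivative of it gains a factor \<open>1 / (n +
  1)\<close>.\<close>

definition dilate :: "nat \<Rightarrow> ('a::euclidean_space \<Rightarrow> real) \<Rightarrow> 'a \<Rightarrow> real" where
  "dilate n m x = m ((1 / real (Suc n)) *\<^sub>R x)"

lemma dilate:
  assumes "smooth m"
  shows "smooth (dilate n m)" "dir_deriv b (dilate n m) = (\<lambda>x. (1 / real (Suc n)) * dilate n (dir_deriv b m) x)"
  using smooth_dilation[OF assms, where c="1 / real (Suc n)" and d=0] by (auto simp: dilate_def[abs_def])

text \<open>In the product rule every term in which a derivative falls on the cutoff carries a factor \<open>1 / (n + 1)\<close>.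
  The induction is over all cutoff functions \<open>m\<close>, not only those with \<open>m 0 = 1\<close>, because it is applied
  to derivatives of cutoffs as well.\<close>

lemma cutoff_iterated_deriv_L2_lim:
  fixes h :: "real^3 \<Rightarrow> complex^'n::finite"
  assumes "set bs \<subseteq> Basis" "cutoff_function m" "band_limited h"
  shows "L2_lim (\<lambda>n. iterated_deriv bs (\<lambda>x. dilate n m x *\<^sub>R synth h x)) (\<lambda>x. m 0 *\<^sub>R iterated_deriv bs (synth h) x)"
  using assms
proof (induction bs arbitrary: m h)
  case Nil
  obtain B where B: "0 \<le> B" "\<And>x. \<bar>m x\<bar> \<le> B" using cutoff_bounded Nil(2) by blast
  have sm: "smooth m" using Nil(2) by (simp add: cutoff_function_def)
  note hs = fourier_synth[OF Nil(3)]
  have dm: "dilate n m \<in> Lmeas" for n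
    using borel_measurable_continuous_onI[OF smooth_continuous[OF dilate(1)[OF sm]]] by (simp add: measurable_completion)
  have "L2_lim (\<lambda>n x. dilate n m x *\<^sub>R synth h x) (\<lambda>x. m 0 *\<^sub>R synth h x)"
  proof (rule L2_lim_dominated)
    show "L2 (\<lambda>x. B *\<^sub>R synth h x)" by (rule L2_scaleR[OF hs(1)])
    show "(\<lambda>x. dilate n m x *\<^sub>R synth h x) \<in> Lmeas" for n
      by (rule borel_measurable_scaleR[OF dm L2_measurable[OF hs(1)]])
    show "(\<lambda>x. m 0 *\<^sub>R synth h x) \<in> Lmeas" by (rule L2_measurable[OF L2_scaleR[OF hs(1)]])
    show "AE x in lebesgue. norm (dilate n m x *\<^sub>R synth h x) \<le> norm (B *\<^sub>R synth h x)" for n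
      using B by (intro AE_I2) (auto simp: dilate_def intro!: mult_right_mono)
    show "AE x in lebesgue. (\<lambda>n. dilate n m x *\<^sub>R synth h x) \<longlonglongrightarrow> m 0 *\<^sub>R synth h x"
    proof (rule AE_I2)
      fix x :: "real^3"
      have "(\<lambda>n. (1 / real (Suc n)) *\<^sub>R x) \<longlonglongrightarrow> 0 *\<^sub>R x" by (intro tendsto_intros LIMSEQ_Suc[OF lim_1_over_n])
      then have "(\<lambda>n. m ((1 / real (Suc n)) *\<^sub>R x)) \<longlonglongrightarrow> m 0"
        using smooth_continuous[OF sm] by (auto simp: continuous_on_eq_continuous_at intro: isCont_tendsto_compose)
      then show "(\<lambda>n. dilate n m x *\<^sub>R synth h x) \<longlonglongrightarrow> m 0 *\<^sub>R synth h x"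
        unfolding dilate_def by (intro tendsto_intros)
    qed
  qed
  then show ?case by simp
next
  case (Cons b bs)
  have b: "b \<in> Basis" and bs: "set bs \<subseteq> Basis" using Cons(2) by auto
  have sm: "smooth m" using Cons(3) by (simp add: cutoff_function_def)
  obtain j where j: "b = axis j 1" using b Basis_cart3 by blast
  let ?h' = "\<lambda>\<xi>. (\<i> * of_real (\<xi> $ j)) *s h \<xi>"
  have h': "band_limited ?h'" by (rule band_limited_derivative[OF Cons(4)])
  have ss: "smooth (synth h)" "smooth (synth ?h')" by (rule smooth_synth, fact)+
  have db: "dir_deriv b (synth h) = synth ?h'" unfolding j by (rule synth_derivative(2)[OF Cons(4)])
  have c': "cutoff_function (dir_deriv b m)" by (rule cutoff_dir_deriv[OF Cons(3) b])
  then have sm': "smooth (dir_deriv b m)" by (simp add: cutoff_function_def)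
  let ?A = "\<lambda>n. iterated_deriv bs (\<lambda>x. dilate n (dir_deriv b m) x *\<^sub>R synth h x)"
  let ?B = "\<lambda>n. iterated_deriv bs (\<lambda>x. dilate n m x *\<^sub>R synth ?h' x)"
  have eq: "iterated_deriv (b # bs) (\<lambda>x. dilate n m x *\<^sub>R synth h x) = (\<lambda>x. (1 / real (Suc n)) *\<^sub>R ?A n x + ?B n x)" for n
  proof -
    have dd: "dir_deriv b (\<lambda>x. dilate n m x *\<^sub>R synth h x)
        = (\<lambda>x. (1 / real (Suc n)) *\<^sub>R (dilate n (dir_deriv b m) x *\<^sub>R synth h x) + dilate n m x *\<^sub>R synth ?h' x)"
      by (simp add: dir_deriv_scaleR[OF dilate(1)[OF sm] ss(1)] dilate(2)[OF sm] db)
    show ?thesis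
      unfolding iterated_deriv.simps(2) dd
      by (rule iterated_deriv_combination[OF bs smooth_scaleR[OF dilate(1)[OF sm'] ss(1)] smooth_scaleR[OF dilate(1)[OF sm] ss(2)]])
  qed
  have lA: "L2_lim ?A (\<lambda>x. dir_deriv b m 0 *\<^sub>R iterated_deriv bs (synth h) x)" by (rule Cons(1)[OF bs c' Cons(4)])
  have lB: "L2_lim ?B (\<lambda>x. m 0 *\<^sub>R iterated_deriv bs (synth ?h') x)" by (rule Cons(1)[OF bs Cons(3) h'])
  have "L2_lim (\<lambda>n x. (1 / real (Suc n)) *\<^sub>R ?A n x) (\<lambda>x. 0)"
  proof -
    have "(\<lambda>n. (1 / real (Suc n)) * L2_norm (?A n)) \<longlonglongrightarrow> 0 * L2_norm (\<lambda>x. dir_deriv b m 0 *\<^sub>R iterated_deriv bs (synth h) x)"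
      by (intro tendsto_mult LIMSEQ_Suc[OF lim_1_over_n] L2_lim_norm[OF lA])
    then have "(\<lambda>n. L2_norm (\<lambda>x. (1 / real (Suc n)) *\<^sub>R ?A n x)) \<longlonglongrightarrow> 0"
      unfolding L2_norm_scaleR by simp
    then show ?thesis using lA by (simp add: L2_lim_def L2_scaleR)
  qed
  from L2_lim_add[OF this lB] show ?case unfolding eq using db by simp
qed

section \<open>Solenoidal test fields\<close>

definition classical_curl :: "(real^3 \<Rightarrow> real^3) \<Rightarrow> real^3 \<Rightarrow> real^3" where
  "classical_curl \<Psi> x = (\<Sum>j\<in>UNIV. cross3 (axis j 1) (dir_deriv (axis j 1) \<Psi> x))"

definition classical_laplace :: "(real^3 \<Rightarrow> 'b::euclidean_space) \<Rightarrow> real^3 \<Rightarrow> 'b" where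
  "classical_laplace \<psi> x = (\<Sum>i\<in>UNIV. dir_deriv (axis i 1) (dir_deriv (axis i 1) \<psi>) x)"

lemma bounded_linear_cross3: "bounded_linear (cross3 a)"
  by (simp add: linear_conv_bounded_linear[symmetric] linear_iff cross_add_right cross_mult_right)

lemma axis_Basis3: "axis j 1 \<in> (Basis :: (real^3) set)"
  using Basis_cart3 by blast

lemma dir_deriv_classical_curl:
  assumes "smooth \<Psi>"
  shows "dir_deriv b (classical_curl \<Psi>) = (\<lambda>x. \<Sum>j\<in>UNIV. cross3 (axis j 1) (dir_deriv b (dir_deriv (axis j 1) \<Psi>) x))"
    and "smooth (classical_curl \<Psi>)"
proof -
  have s: "smooth (dir_deriv (axis j 1) \<Psi>)" for j by (rule smooth_dir_deriv[OF assms axis_Basis3])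
  have s2: "smooth (\<lambda>x. cross3 (axis j 1) (dir_deriv (axis j 1) \<Psi> x))" for j
    by (rule smooth_bounded_linear[OF bounded_linear_cross3 s])
  show "smooth (classical_curl \<Psi>)" unfolding classical_curl_def[abs_def] by (rule smooth_sum) (rule s2)
  show "dir_deriv b (classical_curl \<Psi>) = (\<lambda>x. \<Sum>j\<in>UNIV. cross3 (axis j 1) (dir_deriv b (dir_deriv (axis j 1) \<Psi>) x))"
    unfolding classical_curl_def[abs_def] dir_deriv_sum[OF finite_class.finite_UNIV s2]
    by (simp add: dir_deriv_bounded_linear[OF bounded_linear_cross3 s])
qed

lemma divergence_classical_curl:
  assumes "smooth \<Psi>" "mixed_symmetric \<Psi>"
  shows "(\<Sum>i\<in>UNIV. dir_deriv (axis i 1) (classical_curl \<Psi>) x $ i) = 0"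
proof -
  define D where "D i j = dir_deriv (axis i 1) (dir_deriv (axis j 1) \<Psi>) x" for i j
  have sym: "D i j = D j i" for i j
    using assms(2) axis_Basis3 by (simp add: D_def mixed_symmetric_def)
  have "(\<Sum>i\<in>UNIV. dir_deriv (axis i 1) (classical_curl \<Psi>) x $ i) = (\<Sum>i\<in>UNIV. (\<Sum>j\<in>UNIV. cross3 (axis j 1) (D i j)) $ i)"
    by (simp add: dir_deriv_classical_curl(1)[OF assms(1)] D_def)
  also have "\<dots> = 0"
    using sym[of 1 2] sym[of 1 3] sym[of 2 3] by (simp add: sum_3 cross_components axis_def)
  finally show ?thesis .
qed

lemma classical_laplace_curl:
  assumes "smooth \<Psi>"
  shows "classical_laplace (classical_curl \<Psi>) x
    = (\<Sum>j\<in>UNIV. cross3 (axis j 1) (\<Sum>i\<in>UNIV. iterated_deriv [axis j 1, axis i 1, axis i 1] \<Psi> x))"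
proof -
  have s: "smooth (dir_deriv (axis i 1) (dir_deriv (axis j 1) \<Psi>))" for i j
    by (intro smooth_dir_deriv assms axis_Basis3)
  have s2: "smooth (\<lambda>x. cross3 (axis j 1) (dir_deriv (axis i 1) (dir_deriv (axis j 1) \<Psi>) x))" for i j
    by (rule smooth_bounded_linear[OF bounded_linear_cross3 s])
  have "dir_deriv (axis i 1) (dir_deriv (axis i 1) (classical_curl \<Psi>))
      = (\<lambda>x. \<Sum>j\<in>UNIV. cross3 (axis j 1) (iterated_deriv [axis j 1, axis i 1, axis i 1] \<Psi> x))" for i
    unfolding dir_deriv_classical_curl(1)[OF assms] dir_deriv_sum[OF finite_class.finite_UNIV s2]
    by (simp add: dir_deriv_bounded_linear[OF bounded_linear_cross3 s])
  then have "classical_laplace (classical_curl \<Psi>) x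
      = (\<Sum>i\<in>UNIV. \<Sum>j\<in>UNIV. cross3 (axis j 1) (iterated_deriv [axis j 1, axis i 1, axis i 1] \<Psi> x))"
    by (simp add: classical_laplace_def)
  also have "\<dots> = (\<Sum>j\<in>UNIV. \<Sum>i\<in>UNIV. cross3 (axis j 1) (iterated_deriv [axis j 1, axis i 1, axis i 1] \<Psi> x))"
    by (rule sum.swap)
  also have "\<dots> = (\<Sum>j\<in>UNIV. cross3 (axis j 1) (\<Sum>i\<in>UNIV. iterated_deriv [axis j 1, axis i 1, axis i 1] \<Psi> x))"
    by (simp add: linear_sum[OF bounded_linear.linear[OF bounded_linear_cross3]])
  finally show ?thesis .
qed

lemma fourier_cross_sum:
  fixes w :: "3 \<Rightarrow> real^3 \<Rightarrow> real^3"
  assumes w: "\<And>j. L2 (w j)" and ft: "\<And>j k. is_ft (cpx k (w j)) (\<lambda>\<xi>. \<i> * of_real (\<xi> $ j) * H \<xi> $ k)"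
  shows "L2 (\<lambda>x. \<Sum>j\<in>UNIV. cross3 (axis j 1) (w j x))"
    "AE \<xi> in lebesgue. fourier (\<lambda>x. \<Sum>j\<in>UNIV. cross3 (axis j 1) (w j x)) \<xi> = curl_symbol \<xi> (H \<xi>)"
proof -
  let ?c = "\<lambda>x. \<Sum>j\<in>UNIV. cross3 (axis j 1) (w j x)"
  show L: "L2 ?c" by (intro L2_sum L2_bounded_linear[OF w bounded_linear_cross3])
  have n: "?c x $ 1 = w 2 x $ 3 - w 3 x $ 2" "?c x $ 2 = w 3 x $ 1 - w 1 x $ 3" "?c x $ 3 = w 1 x $ 2 - w 2 x $ 1" for x
    by (simp_all add: sum_3 cross_components axis_def)
  have c: "cpx 1 ?c = (\<lambda>x. cpx 3 (w 2) x - cpx 2 (w 3) x)" "cpx 2 ?c = (\<lambda>x. cpx 1 (w 3) x - cpx 3 (w 1) x)"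
      "cpx 3 ?c = (\<lambda>x. cpx 2 (w 1) x - cpx 1 (w 2) x)"
    by (simp_all only: n of_real_diff)
  have "is_ft (cpx k ?c) (\<lambda>\<xi>. curl_symbol \<xi> (H \<xi>) $ k)" for k
  proof -
    consider "k = 1" | "k = 2" | "k = 3" using exhaust_3 by blast
    then show ?thesis
    proof cases
      case 1 show ?thesis unfolding 1 c curl_symbol_nth right_diff_distrib mult.assoc[symmetric] by (rule is_ft_diff[OF ft ft])
    next
      case 2 show ?thesis unfolding 2 c curl_symbol_nth right_diff_distrib mult.assoc[symmetric] by (rule is_ft_diff[OF ft ft])
    next
      case 3 show ?thesis unfolding 3 c curl_symbol_nth right_diff_distrib mult.assoc[symmetric] by (rule is_ft_diff[OF ft ft])
    qed
  qed
  then show "AE \<xi> in lebesgue. fourier ?c \<xi> = curl_symbol \<xi> (H \<xi>)" by (intro fourier_eqI L)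
qed

lemma is_ft_synth:
  assumes "band_limited (h :: real^3 \<Rightarrow> complex^'n::finite)"
  shows "is_ft (cpx k (synth h)) (\<lambda>\<xi>. h \<xi> $ k)"
  by (rule is_ft_cong_AE[OF is_ft_fourier[OF fourier_synth(1)[OF assms]]])
     (use fourier_synth(2)[OF assms] in \<open>auto elim: eventually_mono\<close>)

lemma band_limited_neg_norm_sq:
  fixes h :: "real^3 \<Rightarrow> complex^'n::finite"
  assumes h: "band_limited h" shows "band_limited (\<lambda>\<xi>. (- (norm \<xi>)\<^sup>2) *\<^sub>R h \<xi>)"
proof (rule band_limited_mult[OF h, where B="\<lambda>R. R\<^sup>2"])
  have "(\<lambda>\<xi>::real^3. - (norm \<xi>)\<^sup>2) \<in> Lmeas" by (rule measurable_completion) measurable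
  then show "(\<lambda>\<xi>. (- (norm \<xi>)\<^sup>2) *\<^sub>R h \<xi>) \<in> Lmeas"
    by (rule borel_measurable_scaleR) (use h in \<open>auto simp: band_limited_def L2_def\<close>)
qed (auto simp: vec_eq_iff intro!: mult_right_mono power_mono)

lemma synth_curl:
  assumes h: "band_limited h"
  shows "AE x in lebesgue. classical_curl (synth h) x = synth (\<lambda>\<xi>. curl_symbol \<xi> (h \<xi>)) x"
    and "AE x in lebesgue. classical_laplace (classical_curl (synth h)) x = synth (\<lambda>\<xi>. (- (norm \<xi>)\<^sup>2) *\<^sub>R curl_symbol \<xi> (h \<xi>)) x"
proof -
  let ?d = "\<lambda>j h \<xi>. (\<i> * of_real (\<xi> $ j)) *s h \<xi> :: complex^3"
  have bd: "band_limited (?d j h)" if "band_limited h" for j h by (rule band_limited_derivative[OF that])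
  have curl: "band_limited (\<lambda>\<xi>. curl_symbol \<xi> (h \<xi>))" by (rule band_limited_curl[OF h])
  have curl2: "band_limited (\<lambda>\<xi>. (- (norm \<xi>)\<^sup>2) *\<^sub>R curl_symbol \<xi> (h \<xi>))" by (rule band_limited_neg_norm_sq[OF curl])
  note sd = synth_derivative(2)
  have w1: "L2 (synth (?d j h))" "is_ft (cpx k (synth (?d j h))) (\<lambda>\<xi>. \<i> * of_real (\<xi> $ j) * h \<xi> $ k)" for j k
    using fourier_synth(1)[OF bd[OF h]] is_ft_synth[OF bd[OF h]] by simp_all
  have c1: "classical_curl (synth h) = (\<lambda>x. \<Sum>j\<in>UNIV. cross3 (axis j 1) (synth (?d j h) x))"
    by (rule ext) (simp add: classical_curl_def sd[OF h])
  show "AE x in lebesgue. classical_curl (synth h) x = synth (\<lambda>\<xi>. curl_symbol \<xi> (h \<xi>)) x"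
    unfolding c1
  proof (rule fourier_inj[OF fourier_cross_sum(1)[OF w1] fourier_synth(1)[OF curl]])
    show "AE \<xi> in lebesgue. fourier (\<lambda>x. \<Sum>j\<in>UNIV. cross3 (axis j 1) (synth (?d j h) x)) \<xi> = fourier (synth (\<lambda>\<xi>. curl_symbol \<xi> (h \<xi>))) \<xi>"
      using fourier_cross_sum(2)[OF w1] fourier_synth(2)[OF curl] by eventually_elim simp
  qed
  let ?w = "\<lambda>j x. \<Sum>i\<in>UNIV. synth (?d i (?d i (?d j h))) x"
  have w2L: "L2 (?w j)" for j by (intro L2_sum fourier_synth(1) bd h)
  have w2: "is_ft (cpx k (?w j)) (\<lambda>\<xi>. \<i> * of_real (\<xi> $ j) * ((- (norm \<xi>)\<^sup>2) *\<^sub>R h \<xi>) $ k)" for j k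
  proof -
    have "is_ft (\<lambda>x. \<Sum>i\<in>UNIV. cpx k (synth (?d i (?d i (?d j h)))) x) (\<lambda>\<xi>. \<Sum>i\<in>UNIV. ?d i (?d i (?d j h)) \<xi> $ k)"
      by (intro is_ft_sum is_ft_synth bd h)
    moreover have "(\<Sum>i\<in>UNIV. ?d i (?d i (?d j h)) \<xi> $ k) = \<i> * of_real (\<xi> $ j) * ((- (norm \<xi>)\<^sup>2) *\<^sub>R h \<xi>) $ k" for \<xi>
    proof -
      have "(\<Sum>i\<in>UNIV. ?d i (?d i (?d j h)) \<xi> $ k) = (\<Sum>i\<in>UNIV. - complex_of_real ((\<xi> $ i)\<^sup>2)) * (\<i> * of_real (\<xi> $ j) * h \<xi> $ k)"
        unfolding sum_distrib_right by (rule sum.cong) (auto simp: power2_eq_square algebra_simps)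
      also have "(\<Sum>i\<in>UNIV. - complex_of_real ((\<xi> $ i)\<^sup>2)) = - complex_of_real ((norm \<xi>)\<^sup>2)"
        by (simp add: norm_vec_power2 sum_negf)
      finally show ?thesis by (simp add: scaleR_conv_of_real[where 'a=complex] mult_ac)
    qed
    ultimately show ?thesis by simp
  qed
  have it: "iterated_deriv [axis j 1, axis i 1, axis i 1] (synth h) = synth (?d i (?d i (?d j h)))" for i j
    by (simp only: iterated_deriv.simps sd[OF h] sd[OF bd[OF h]] sd[OF bd[OF bd[OF h]]])
  have c2: "classical_laplace (classical_curl (synth h)) = (\<lambda>x. \<Sum>j\<in>UNIV. cross3 (axis j 1) (?w j x))"
    by (rule ext) (simp only: classical_laplace_curl[OF smooth_synth[OF h]] it)
  show "AE x in lebesgue. classical_laplace (classical_curl (synth h)) x = synth (\<lambda>\<xi>. (- (norm \<xi>)\<^sup>2) *\<^sub>R curl_symbol \<xi> (h \<xi>)) x"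
    unfolding c2
  proof (rule fourier_inj[OF fourier_cross_sum(1)[OF w2L w2] fourier_synth(1)[OF curl2]])
    show "AE \<xi> in lebesgue. fourier (\<lambda>x. \<Sum>j\<in>UNIV. cross3 (axis j 1) (?w j x)) \<xi> = fourier (synth (\<lambda>\<xi>. (- (norm \<xi>)\<^sup>2) *\<^sub>R curl_symbol \<xi> (h \<xi>))) \<xi>"
      using fourier_cross_sum(2)[OF w2L w2] fourier_synth(2)[OF curl2]
    proof eventually_elim
      case (elim \<xi>)
      show ?case unfolding elim by (rule curl_symbol_scaleR)
    qed
  qed
qed

text \<open>Admissible spatial factors of test functions for which the pressure term of the momentum equation vanishes.\<close>

definition solenoidal_test :: "(real^3 \<Rightarrow> real^3) \<Rightarrow> bool" where
  "solenoidal_test \<psi> \<longleftrightarrow> smooth \<psi> \<and> (\<exists>R. \<forall>x. norm x > R \<longrightarrow> \<psi> x = 0) \<and>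
     (\<forall>x. (\<Sum>i\<in>UNIV. dir_deriv (axis i 1) \<psi> x $ i) = 0)"

text \<open>The curl is taken after cutting off, which keeps the approximations exactly divergence-free; the error terms carry a
  derivative of the cutoff.\<close>

lemma solenoidal_test_approximation:
  assumes h: "band_limited h"
  obtains \<psi> where "\<And>n. solenoidal_test (\<psi> n)" "L2_lim \<psi> (synth (\<lambda>\<xi>. curl_symbol \<xi> (h \<xi>)))"
    "L2_lim (\<lambda>n. classical_laplace (\<psi> n)) (synth (\<lambda>\<xi>. (- (norm \<xi>)\<^sup>2) *\<^sub>R curl_symbol \<xi> (h \<xi>)))"
proof -
  define c where "c = 1 / bump (0 :: real^3)"
  \<comment> \<open>normalised so that the cutoffs converge to \<open>1\<close>\<close>
  define m :: "real^3 \<Rightarrow> real" where "m x = c * bump x" for x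
  have ms: "smooth m"
    using smooth_bounded_linear[OF bounded_linear_mult_right smooth_bump] unfolding m_def[abs_def] .
  have m: "cutoff_function m" using ms by (auto simp: cutoff_function_def m_def bump_eq_0)
  have m0: "m 0 = 1" by (simp add: m_def c_def bump_0)
  have msym: "mixed_symmetric m"
  proof -
    have "dir_deriv a (dir_deriv b m) = (\<lambda>x. c * dir_deriv a (dir_deriv b bump) x)" if "b \<in> Basis" for a b
      unfolding m_def[abs_def]
      by (simp add: dir_deriv_bounded_linear[OF bounded_linear_mult_right] smooth_bump smooth_dir_deriv that)
    then show ?thesis using mixed_symmetric_bump[where 'a="real^3"] by (simp add: mixed_symmetric_def)
  qed
  define \<Psi> where "\<Psi> n x = dilate n m x *\<^sub>R synth h x" for n x
  have ds: "smooth (dilate n m)" for n by (rule dilate(1)[OF ms])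
  have dsym: "mixed_symmetric (dilate n m)" for n
    using mixed_symmetric_dilation[OF ms msym, of "1 / real (Suc n)" 0] by (simp add: dilate_def[abs_def])
  have \<Psi>s: "smooth (\<Psi> n)" for n unfolding \<Psi>_def[abs_def] by (rule smooth_scaleR[OF ds smooth_synth[OF h]])
  have \<Psi>sym: "mixed_symmetric (\<Psi> n)" for n unfolding \<Psi>_def[abs_def]
    by (rule mixed_symmetric_scaleR[OF ds smooth_synth[OF h] dsym mixed_symmetric_synth[OF h]])
  have D: "L2_lim (\<lambda>n. iterated_deriv bs (\<Psi> n)) (iterated_deriv bs (synth h))" if "set bs \<subseteq> Basis" for bs
    using cutoff_iterated_deriv_L2_lim[OF that m h] unfolding m0 \<Psi>_def[abs_def] by simp
  show thesis
  proof (rule that[of "\<lambda>n. classical_curl (\<Psi> n)"])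
    fix n
    have "classical_curl (\<Psi> n) x = 0" if x: "norm x > real (Suc n)" for x
    proof -
      have "dir_deriv b (\<Psi> n) x = 0" for b
      proof (rule dir_deriv_local_zero[of "- cball 0 (real (Suc n))"])
        show "x \<in> - cball 0 (real (Suc n))" using x by simp
        fix y :: "real^3" assume "y \<in> - cball 0 (real (Suc n))"
        then have "norm ((1 / real (Suc n)) *\<^sub>R y) > 1" by (simp add: field_simps)
        then show "\<Psi> n y = 0" using m by (simp add: \<Psi>_def dilate_def cutoff_function_def)
      qed (simp add: open_Compl)
      then show ?thesis by (simp add: classical_curl_def)
    qed
    then show "solenoidal_test (classical_curl (\<Psi> n))"
      unfolding solenoidal_test_def
      using dir_deriv_classical_curl(2)[OF \<Psi>s] divergence_classical_curl[OF \<Psi>s \<Psi>sym] by blast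
  next
    have "L2_lim (\<lambda>n x. \<Sum>j\<in>UNIV. cross3 (axis j 1) (iterated_deriv [axis j 1] (\<Psi> n) x)) (\<lambda>x. \<Sum>j\<in>UNIV. cross3 (axis j 1) (iterated_deriv [axis j 1] (synth h) x))"
      by (intro L2_lim_sum L2_lim_bounded_linear[OF _ bounded_linear_cross3] D) (simp add: axis_Basis3)
    then have "L2_lim (\<lambda>n. classical_curl (\<Psi> n)) (classical_curl (synth h))"
      by (simp add: classical_curl_def[abs_def])
    then show "L2_lim (\<lambda>n. classical_curl (\<Psi> n)) (synth (\<lambda>\<xi>. curl_symbol \<xi> (h \<xi>)))"
      by (rule L2_lim_cong_AE) (use synth_curl(1)[OF h] in auto)
    have "L2_lim (\<lambda>n x. \<Sum>j\<in>UNIV. cross3 (axis j 1) (\<Sum>i\<in>UNIV. iterated_deriv [axis j 1, axis i 1, axis i 1] (\<Psi> n) x))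
        (\<lambda>x. \<Sum>j\<in>UNIV. cross3 (axis j 1) (\<Sum>i\<in>UNIV. iterated_deriv [axis j 1, axis i 1, axis i 1] (synth h) x))"
      by (intro L2_lim_sum L2_lim_bounded_linear[OF _ bounded_linear_cross3] D) (simp add: axis_Basis3)
    then have "L2_lim (\<lambda>n. classical_laplace (classical_curl (\<Psi> n))) (classical_laplace (classical_curl (synth h)))"
      unfolding classical_laplace_curl[OF \<Psi>s, abs_def] classical_laplace_curl[OF smooth_synth[OF h], abs_def] .
    then show "L2_lim (\<lambda>n. classical_laplace (classical_curl (\<Psi> n))) (synth (\<lambda>\<xi>. (- (norm \<xi>)\<^sup>2) *\<^sub>R curl_symbol \<xi> (h \<xi>)))"
      by (rule L2_lim_cong_AE) (use synth_curl(2)[OF h] in auto)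
  qed
qed

definition tensor :: "(real \<Rightarrow> real) \<Rightarrow> (real^3 \<Rightarrow> 'b::euclidean_space) \<Rightarrow> real \<times> (real^3) \<Rightarrow> 'b" where
  "tensor \<theta> \<psi> z = \<theta> (fst z) *\<^sub>R \<psi> (snd z)"

lemma tensor_has_derivative:
  assumes "smooth \<theta>" "smooth \<psi>"
  shows "(tensor \<theta> \<psi> has_derivative (\<lambda>y. \<theta> (fst z) *\<^sub>R frechet_derivative \<psi> (at (snd z)) (snd y)
      + frechet_derivative \<theta> (at (fst z)) (fst y) *\<^sub>R \<psi> (snd z))) (at z)"
  unfolding tensor_def[abs_def]
  by (intro has_derivative_scaleR has_derivative_compose[OF _ smooth_has_derivative[OF assms(1)]] has_derivative_compose[OF _ smooth_has_derivative[OF assms(2)]] derivative_intros)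

lemma frechet_derivative_zero: "smooth f \<Longrightarrow> frechet_derivative f (at z) 0 = 0"
  by (rule linear_0[OF linear_frechet_derivative[OF smooth_differentiable]])

lemma dir_deriv_tensor:
  assumes "smooth \<theta>" "smooth \<psi>"
  shows "dir_deriv (a, 0) (tensor \<theta> \<psi>) = tensor (dir_deriv a \<theta>) \<psi>"
    and "dir_deriv (0, b) (tensor \<theta> \<psi>) = tensor \<theta> (dir_deriv b \<psi>)"
  by (rule ext, rule trans[OF dir_deriv_eq[OF tensor_has_derivative[OF assms]]],
      simp add: tensor_def dir_deriv_def frechet_derivative_zero assms)+

lemma smooth_tensor:
  fixes \<psi> :: "real^3 \<Rightarrow> 'b::euclidean_space"
  assumes "smooth \<theta>" "smooth \<psi>" shows "smooth (tensor \<theta> \<psi>)"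
proof (rule smooth_coinduct[where P="\<lambda>f. \<exists>\<theta> \<psi>. smooth \<theta> \<and> smooth \<psi> \<and> f = tensor \<theta> \<psi>"])
  fix g :: "real \<times> (real^3) \<Rightarrow> 'b" assume "\<exists>\<theta> \<psi>. smooth \<theta> \<and> smooth \<psi> \<and> g = tensor \<theta> \<psi>"
  then obtain \<theta> \<psi> where s: "smooth \<theta>" "smooth \<psi>" and g: "g = tensor \<theta> \<psi>" by blast
  show "(\<forall>z. g differentiable (at z)) \<and> (\<forall>b\<in>Basis. \<exists>\<theta> \<psi>. smooth \<theta> \<and> smooth \<psi> \<and> dir_deriv b g = tensor \<theta> \<psi>)"
  proof (intro conjI allI ballI)
    show "g differentiable (at z)" for z unfolding g using tensor_has_derivative[OF s] differentiableI by blast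
    fix b :: "real \<times> (real^3)" assume "b \<in> Basis"
    then consider a where "a \<in> Basis" "b = (a, 0)" | c where "c \<in> Basis" "b = (0, c)" by (auto simp: Basis_prod_def)
    then show "\<exists>\<theta> \<psi>. smooth \<theta> \<and> smooth \<psi> \<and> dir_deriv b g = tensor \<theta> \<psi>"
    proof cases
      case 1 then show ?thesis unfolding g using dir_deriv_tensor(1)[OF s] s smooth_dir_deriv[OF s(1)] by metis
    next
      case 2 then show ?thesis unfolding g using dir_deriv_tensor(2)[OF s] s smooth_dir_deriv[OF s(2)] by metis
    qed
  qed
qed (use assms in blast)

definition time_test :: "real \<Rightarrow> (real \<Rightarrow> real) \<Rightarrow> bool" where
  "time_test T \<theta> \<longleftrightarrow> smooth \<theta> \<and> (\<exists>a b. 0 < a \<and> b < T \<and> (\<forall>t. t \<notin> {a..b} \<longrightarrow> \<theta> t = 0))"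

lemma test_function_tensor:
  assumes \<theta>: "time_test T \<theta>" and \<psi>: "solenoidal_test \<psi>"
  shows "test_function T (tensor \<theta> \<psi>)"
    "d_t (tensor \<theta> \<psi>) (t, x) = dir_deriv 1 \<theta> t *\<^sub>R \<psi> x"
    "div_x (tensor \<theta> \<psi>) (t, x) = 0"
    "laplace_x (tensor \<theta> \<psi>) (t, x) = \<theta> t *\<^sub>R classical_laplace \<psi> x"
proof -
  have s: "smooth \<theta>" "smooth \<psi>" using assms by (auto simp: time_test_def solenoidal_test_def)
  obtain a b where ab: "0 < a" "b < T" "\<And>t. t \<notin> {a..b} \<Longrightarrow> \<theta> t = 0" using \<theta> by (auto simp: time_test_def)
  obtain R where R: "\<And>x. norm x > R \<Longrightarrow> \<psi> x = 0" using \<psi> by (auto simp: solenoidal_test_def)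
  have "compact ({a..b} \<times> cball (0::real^3) R)" by (intro compact_Times) auto
  moreover have "{a..b} \<times> cball (0::real^3) R \<subseteq> {0<..<T} \<times> UNIV" using ab by auto
  moreover have "\<forall>z. z \<notin> {a..b} \<times> cball 0 R \<longrightarrow> tensor \<theta> \<psi> z = 0"
    using ab(3) R by (auto simp: tensor_def not_le)
  ultimately show "test_function T (tensor \<theta> \<psi>)"
    using smooth_tensor[OF s] unfolding test_function_def smooth_def by blast
  show "d_t (tensor \<theta> \<psi>) (t, x) = dir_deriv 1 \<theta> t *\<^sub>R \<psi> x"
    by (simp add: d_t_def dir_deriv_tensor[OF s] tensor_def)
  have dx: "d_x j (tensor \<theta> \<psi>) = tensor \<theta> (dir_deriv (axis j 1) \<psi>)" for j
    by (simp add: d_x_def dir_deriv_tensor[OF s])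
  have dxx: "d_x j (d_x j (tensor \<theta> \<psi>)) = tensor \<theta> (dir_deriv (axis j 1) (dir_deriv (axis j 1) \<psi>))" for j
    unfolding dx by (simp add: d_x_def dir_deriv_tensor[OF s(1) smooth_dir_deriv[OF s(2) axis_Basis3]])
  have "div_x (tensor \<theta> \<psi>) (t, x) = \<theta> t * (\<Sum>j\<in>UNIV. dir_deriv (axis j 1) \<psi> x $ j)"
    by (simp add: div_x_def dx tensor_def sum_distrib_left)
  then show "div_x (tensor \<theta> \<psi>) (t, x) = 0" using \<psi> by (simp add: solenoidal_test_def)
  show "laplace_x (tensor \<theta> \<psi>) (t, x) = \<theta> t *\<^sub>R classical_laplace \<psi> x"
    by (simp add: laplace_x_def dxx tensor_def classical_laplace_def scaleR_sum_right)
qed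

section \<open>Lower semicontinuity in time and the dissipation\<close>

text \<open>Lower semicontinuity on \<open>{0..<T}\<close>, in terms of superlevel sets.\<close>

definition lsc_on :: "real \<Rightarrow> (real \<Rightarrow> real) \<Rightarrow> bool" where
  "lsc_on T n \<longleftrightarrow> (\<forall>c. \<forall>s\<in>{0..<T}. n s > c \<longrightarrow> (\<exists>e>0. \<forall>t\<in>{0..<T}. \<bar>t - s\<bar> < e \<longrightarrow> n t > c))"

text \<open>A strict superlevel set would be open in \<open>{0..<T}\<close>; it is a null set and therefore empty.\<close>

lemma lsc_on_bound_everywhere:
  assumes lsc: "lsc_on T n" and ae: "AE t in lebesgue. t \<in> {0<..<T} \<longrightarrow> n t \<le> C" and s: "s \<in> {0..<T}"
  shows "n s \<le> C"
proof (rule ccontr)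
  assume "\<not> n s \<le> C"
  then obtain e where e: "e > 0" "\<And>t. t \<in> {0..<T} \<Longrightarrow> \<bar>t - s\<bar> < e \<Longrightarrow> n t > C"
    using lsc s unfolding lsc_on_def by (meson not_le)
  let ?I = "{s<..<min T (s + e)}"
  have "AE t in lebesgue. t \<notin> ?I"
    using ae
  proof eventually_elim
    case (elim t)
    show ?case
    proof
      assume t: "t \<in> ?I"
      then have "n t > C" using s by (intro e(2)) auto
      then show False using elim t s by auto
    qed
  qed
  moreover have "?I \<in> sets lebesgue" by simp
  ultimately have "?I \<in> null_sets lebesgue" by (simp add: AE_iff_null_sets)
  then have "emeasure lebesgue ?I = 0" by auto
  then show False using s e(1) by (auto simp: min_def split: if_splits)
qed

lemma lsc_on_measurable:
  assumes lsc: "lsc_on T n" and nn: "\<And>t. 0 \<le> n t"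
  shows "(\<lambda>t. indicator {0<..<T} t * n t) \<in> Lmeas"
proof (rule borel_measurableI_greater)
  fix y :: real
  show "{t \<in> space lebesgue. y < indicator {0<..<T} t * n t} \<in> sets lebesgue"
  proof (cases "y < 0")
    case True
    then have "{t \<in> space lebesgue. y < indicator {0<..<T} t * n t} = UNIV"
      using nn by (auto simp: indicator_def intro: less_le_trans)
    then show ?thesis by simp
  next
    case False
    have "{t \<in> space lebesgue. y < indicator {0<..<T} t * n t} = {t \<in> {0<..<T}. n t > y}"
      using False by (auto simp: indicator_def split: if_splits)
    moreover have "open {t \<in> {0<..<T}. n t > y}"
      unfolding open_dist
    proof
      fix s assume s: "s \<in> {t \<in> {0<..<T}. n t > y}"
      then have s': "s \<in> {0..<T}" "n s > y" by auto
      obtain e where e: "e > 0" "\<And>t. t \<in> {0..<T} \<Longrightarrow> \<bar>t - s\<bar> < e \<Longrightarrow> n t > y"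
        using lsc[unfolded lsc_on_def, rule_format, OF s'] by blast
      show "\<exists>e>0. \<forall>t. dist t s < e \<longrightarrow> t \<in> {t \<in> {0<..<T}. n t > y}"
      proof (intro exI[of _ "min e (min s (T - s))"] conjI allI impI)
        show "0 < min e (min s (T - s))" using s e by auto
        fix t assume "dist t s < min e (min s (T - s))"
        then have t: "\<bar>t - s\<bar> < e" "t \<in> {0<..<T}" by (auto simp: dist_real_def)
        then show "t \<in> {t \<in> {0<..<T}. n t > y}" using e(2)[of t] by auto
      qed
    qed
    ultimately show ?thesis by simp
  qed
qed

text \<open>Symbols that map band-limited transforms to band-limited transforms and are self-adjoint. The bound \<open>B\<close>
  may depend on the radius of the frequency ball, so unbounded symbols such as that of the curl are included.\<close>

definition good_symbol :: "(real^3 \<Rightarrow> complex^3 \<Rightarrow> complex^3) \<Rightarrow> bool" where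
  "good_symbol M \<longleftrightarrow>
     (\<forall>h. h \<in> Lmeas \<longrightarrow> (\<lambda>\<xi>. M \<xi> (h \<xi>)) \<in> Lmeas) \<and>
     (\<exists>B. \<forall>R\<ge>0. 0 \<le> B R \<and> (\<forall>\<xi> v. norm \<xi> \<le> R \<longrightarrow> norm (M \<xi> v) \<le> B R * norm v)) \<and>
     (\<forall>\<xi> v. M (- \<xi>) (vcnj v) = vcnj (M \<xi> v)) \<and>
     (\<forall>\<xi> v w. M \<xi> v \<bullet> w = v \<bullet> M \<xi> w)"

definition truncation :: "real \<Rightarrow> (real^3 \<Rightarrow> complex^3) \<Rightarrow> real^3 \<Rightarrow> complex^3" where
  "truncation R h \<xi> = indicator (cball 0 R) \<xi> *\<^sub>R h \<xi>"

lemma band_limited_truncation: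
  assumes h: "L2 h" "hermitian h" shows "band_limited (truncation R h)"
proof -
  have "L2 (truncation R h)"
  proof (rule L2_dominated(1)[OF h(1), of _ 1])
    show "truncation R h \<in> Lmeas"
      unfolding truncation_def[abs_def]
      by (rule borel_measurable_scaleR[OF borel_measurable_indicator[OF cball_in_lebesgue] L2_measurable[OF h(1)]])
    show "AE x in lebesgue. norm (truncation R h x) \<le> 1 * norm (h x)" by (intro AE_I2) (simp add: truncation_def indicator_def)
  qed simp
  moreover have "hermitian (truncation R h)"
    using h(2) unfolding hermitian_def
    by eventually_elim (simp add: truncation_def vec_eq_iff indicator_def)
  moreover have "\<exists>R'. \<forall>\<xi>. norm \<xi> > R' \<longrightarrow> truncation R h \<xi> = 0"
    by (rule exI[of _ R]) (simp add: truncation_def)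
  ultimately show ?thesis by (simp add: band_limited_def)
qed

lemma band_limited_good_symbol:
  assumes M: "good_symbol M" and h: "band_limited h" shows "band_limited (\<lambda>\<xi>. M \<xi> (h \<xi>))"
proof -
  obtain B where B: "\<And>R. 0 \<le> R \<Longrightarrow> 0 \<le> B R" "\<And>R \<xi> v. 0 \<le> R \<Longrightarrow> norm \<xi> \<le> R \<Longrightarrow> norm (M \<xi> v) \<le> B R * norm v"
    using M unfolding good_symbol_def by metis
  show ?thesis
  proof (rule band_limited_mult[OF h, where B=B])
    show "(\<lambda>\<xi>. M \<xi> (h \<xi>)) \<in> Lmeas"
      using M h unfolding good_symbol_def band_limited_def L2_def by blast
    show "M (- \<xi>) (vcnj v) = vcnj (M \<xi> v)" for \<xi> v using M unfolding good_symbol_def by blast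
  qed (use B in auto)
qed

abbreviation ip :: "(real^3 \<Rightarrow> real^3) \<Rightarrow> (real^3 \<Rightarrow> real^3) \<Rightarrow> real" where
  "ip f g \<equiv> (LINT x|lebesgue. f x \<bullet> g x)"

lemma weak_continuityD:
  assumes "weakly_continuous_L2 T u"
  shows "t \<in> {0..<T} \<Longrightarrow> L2 (u t)" "L2 g \<Longrightarrow> continuous_on {0..<T} (\<lambda>t. ip (u t) g)"
  using assms by (auto simp: weakly_continuous_L2_def)

text \<open>Write \<open>Q t\<close> for the filtered transform of \<open>u t\<close>. The pairing of \<open>Q t\<close> with
  \<open>Q s\<close> equals the pairing of \<open>u t\<close> with a fixed \<open>L\<^sup>2\<close> field, so it is continuous in
  \<open>t\<close>. By Cauchy--Schwarz it is at most \<open>\<parallel>Q t\<parallel> \<parallel>Q s\<parallel>\<close>, with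
  equality at \<open>t = s\<close>.\<close>

lemma lsc_on_truncated_norm:
  assumes wc: "weakly_continuous_L2 T u" and M: "good_symbol M"
  shows "lsc_on T (\<lambda>t. L2_norm (\<lambda>\<xi>. M \<xi> (truncation R (fourier (u t)) \<xi>)))"
  unfolding lsc_on_def
proof (intro allI ballI impI)
  \<comment> \<open>\<open>?h\<close> below applies the symbol twice, which by self-adjointness gives the pairing of \<open>Q t\<close> with \<open>Q s\<close>\<close>
  define Q where "Q t = (\<lambda>\<xi>. M \<xi> (truncation R (fourier (u t)) \<xi>))" for t
  fix c s assume s: "s \<in> {0..<T}" and c: "L2_norm (\<lambda>\<xi>. M \<xi> (truncation R (fourier (u s)) \<xi>)) > c"
  have trb: "band_limited (truncation R (fourier (u t)))" if "t \<in> {0..<T}" for t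
    using weak_continuityD(1)[OF wc that] by (intro band_limited_truncation fourier_L2 fourier_hermitian)
  have Qb: "band_limited (Q t)" if "t \<in> {0..<T}" for t
    unfolding Q_def by (rule band_limited_good_symbol[OF M trb[OF that]])
  have QL: "L2 (Q t)" if "t \<in> {0..<T}" for t using Qb[OF that] by (simp add: band_limited_def)
  let ?h = "\<lambda>\<xi>. M \<xi> (Q s \<xi>)"
  have hb: "band_limited ?h" by (rule band_limited_good_symbol[OF M Qb[OF s]])
  note hs = fourier_synth[OF hb]
  have sa: "M \<xi> v \<bullet> w = v \<bullet> M \<xi> w" for \<xi> v w using M unfolding good_symbol_def by blast
  have M0: "M \<xi> 0 = 0" for \<xi>
    using sa[of \<xi> 0 "M \<xi> 0"] by simp
  have pair: "ip (u t) (synth ?h) = (LINT \<xi>|lebesgue. Q t \<xi> \<bullet> Q s \<xi>)" if t: "t \<in> {0..<T}" for t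
  proof -
    have uL: "L2 (u t)" by (rule weak_continuityD(1)[OF wc t])
    have "ip (u t) (synth ?h) = (LINT \<xi>|lebesgue. fourier (u t) \<xi> \<bullet> fourier (synth ?h) \<xi>)"
      by (rule fourier_inner[OF uL hs(1)])
    also have "\<dots> = (LINT \<xi>|lebesgue. Q t \<xi> \<bullet> Q s \<xi>)"
    proof (rule integral_cong_AE)
      show "(\<lambda>\<xi>. fourier (u t) \<xi> \<bullet> fourier (synth ?h) \<xi>) \<in> Lmeas"
        by (rule borel_measurable_integrable[OF L2_inner_integrable[OF fourier_L2[OF uL] fourier_L2[OF hs(1)]]])
      show "(\<lambda>\<xi>. Q t \<xi> \<bullet> Q s \<xi>) \<in> Lmeas"
        by (rule borel_measurable_integrable[OF L2_inner_integrable[OF QL[OF t] QL[OF s]]])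
      show "AE \<xi> in lebesgue. fourier (u t) \<xi> \<bullet> fourier (synth ?h) \<xi> = Q t \<xi> \<bullet> Q s \<xi>"
        using hs(2)
      proof eventually_elim
        case (elim \<xi>)
        have "fourier (u t) \<xi> \<bullet> fourier (synth ?h) \<xi> = M \<xi> (fourier (u t) \<xi>) \<bullet> Q s \<xi>" unfolding elim by (rule sa[symmetric])
        also have "\<dots> = Q t \<xi> \<bullet> Q s \<xi>"
          by (cases "\<xi> \<in> cball 0 R") (simp_all add: Q_def truncation_def M0)
        finally show ?case .
      qed
    qed
    finally show ?thesis .
  qed
  define \<phi> where "\<phi> t = (LINT \<xi>|lebesgue. Q t \<xi> \<bullet> Q s \<xi>)" for t
  have cont: "continuous_on {0..<T} \<phi>"
    unfolding \<phi>_def by (rule continuous_on_eq[OF weak_continuityD(2)[OF wc hs(1)] pair])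
  have \<phi>s: "\<phi> s = L2_norm (Q s) * L2_norm (Q s)"
    unfolding \<phi>_def power2_eq_square[symmetric] L2_norm_sq by (simp add: power2_norm_eq_inner)
  have \<phi>le: "\<phi> t \<le> L2_norm (Q t) * L2_norm (Q s)" if "t \<in> {0..<T}" for t
    using L2_inner_bound[OF QL[OF that] QL[OF s]] unfolding \<phi>_def by linarith
  show "\<exists>e>0. \<forall>t\<in>{0..<T}. \<bar>t - s\<bar> < e \<longrightarrow> L2_norm (\<lambda>\<xi>. M \<xi> (truncation R (fourier (u t)) \<xi>)) > c"
  proof (cases "c < 0")
    case True
    then show ?thesis by (intro exI[of _ 1]) (auto intro: less_le_trans)
  next
    case False
    have cq: "L2_norm (Q s) > c" using c by (simp add: Q_def)
    then have pos: "L2_norm (Q s) > 0" using False by linarith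
    have "\<phi> s > c * L2_norm (Q s)" unfolding \<phi>s using cq pos by simp
    then have "\<phi> s - c * L2_norm (Q s) > 0" by simp
    then obtain d where d: "d > 0" "\<And>t. t \<in> {0..<T} \<Longrightarrow> dist t s < d \<Longrightarrow> dist (\<phi> t) (\<phi> s) < \<phi> s - c * L2_norm (Q s)"
      using cont s unfolding continuous_on_iff by meson
    have "L2_norm (Q t) > c" if t: "t \<in> {0..<T}" "\<bar>t - s\<bar> < d" for t
    proof -
      have "dist (\<phi> t) (\<phi> s) < \<phi> s - c * L2_norm (Q s)" using d(2)[of t] t by (simp add: dist_real_def)
      then have "c * L2_norm (Q s) < \<phi> t" unfolding dist_real_def by linarith
      also have "\<dots> \<le> L2_norm (Q t) * L2_norm (Q s)" by (rule \<phi>le[OF t(1)])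
      finally show ?thesis using pos by simp
    qed
    then show ?thesis using d(1) unfolding Q_def by blast
  qed
qed

lemma good_symbol_weight1: "good_symbol (\<lambda>\<xi> v. ((1 + (norm \<xi>)\<^sup>2) powr (1/2)) *\<^sub>R v)"
  unfolding good_symbol_def
proof (intro conjI allI impI)
  fix h :: "real^3 \<Rightarrow> complex^3" assume h: "h \<in> Lmeas"
  have "(\<lambda>\<xi>::real^3. (1 + (norm \<xi>)\<^sup>2) powr (1/2)) \<in> Lmeas" by (rule measurable_completion) measurable
  then show "(\<lambda>\<xi>. ((1 + (norm \<xi>)\<^sup>2) powr (1/2)) *\<^sub>R h \<xi>) \<in> Lmeas" using h by (rule borel_measurable_scaleR)
next
  show "\<exists>B. \<forall>R\<ge>0. 0 \<le> B R \<and> (\<forall>(\<xi>::real^3) v. norm \<xi> \<le> R \<longrightarrow> norm (((1 + (norm \<xi>)\<^sup>2) powr (1/2)) *\<^sub>R (v::complex^3)) \<le> B R * norm v)"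
    by (intro exI[of _ "\<lambda>R. (1 + R\<^sup>2) powr (1/2)"]) (auto intro!: mult_right_mono powr_mono2 power_mono add_nonneg_nonneg)
qed (auto simp: vec_eq_iff)

lemma good_symbol_helical: "\<bar>s\<bar> = 1 \<Longrightarrow> good_symbol (\<lambda>\<xi> v. (norm \<xi> powr (3/2)) *\<^sub>R helical_symbol s \<xi> v)"
  unfolding good_symbol_def
proof (intro conjI allI impI)
  assume s: "\<bar>s\<bar> = 1"
  show "\<exists>B. \<forall>R\<ge>0. 0 \<le> B R \<and> (\<forall>\<xi> v. norm \<xi> \<le> R \<longrightarrow> norm ((norm \<xi> powr (3/2)) *\<^sub>R helical_symbol s \<xi> v) \<le> B R * norm v)"
    by (intro exI[of _ "\<lambda>R. R powr (3/2)"]) (auto intro!: mult_mono powr_mono2 norm_helical_symbol_le[OF s])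
next
  fix h :: "real^3 \<Rightarrow> complex^3" assume h: "h \<in> Lmeas"
  have "(\<lambda>\<xi>::real^3. norm \<xi> powr (3/2)) \<in> Lmeas" by (rule measurable_completion) measurable
  then show "(\<lambda>\<xi>. (norm \<xi> powr (3/2)) *\<^sub>R helical_symbol s \<xi> (h \<xi>)) \<in> Lmeas"
    by (rule borel_measurable_scaleR[OF _ helical_symbol_measurable[OF h]])
next
  fix \<xi> v
  show "norm (- \<xi>) powr (3/2) *\<^sub>R helical_symbol s (- \<xi>) (vcnj v) = vcnj (norm \<xi> powr (3/2) *\<^sub>R helical_symbol s \<xi> v)"
    by (simp add: helical_symbol_def curl_symbol_vcnj) (simp add: vec_eq_iff)
next
  fix \<xi> v w
  show "norm \<xi> powr (3/2) *\<^sub>R helical_symbol s \<xi> v \<bullet> w = v \<bullet> norm \<xi> powr (3/2) *\<^sub>R helical_symbol s \<xi> w"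
    by (simp add: helical_symbol_def inner_add_left inner_add_right curl_symbol_self_adjoint)
qed

text \<open>The bound passes from almost every time to every time for the truncations, by lower semicontinuity, and then to the
  full norm by Fatou.\<close>

lemma sobolev1_everywhere:
  assumes wc: "weakly_continuous_L2 T u" and Linf: "Linf_sobolev T 1 u"
  obtains C where "\<And>t. t \<in> {0..<T} \<Longrightarrow> sobolev 1 (u t) \<and> sobolev_norm 1 (u t) \<le> C"
proof -
  obtain C where C: "AE t in lebesgue_on {0<..<T}. sobolev 1 (u t) \<and> sobolev_norm 1 (u t) \<le> C"
    using Linf by (auto simp: Linf_sobolev_def)
  then have C': "AE t in lebesgue. t \<in> {0<..<T} \<longrightarrow> sobolev 1 (u t) \<and> sobolev_norm 1 (u t) \<le> C"
    by (subst (asm) AE_restrict_space_iff) auto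
  let ?M = "\<lambda>(\<xi>::real^3) (v::complex^3). ((1 + (norm \<xi>)\<^sup>2) powr (1/2)) *\<^sub>R v"
  let ?s = "\<lambda>n t \<xi>. ?M \<xi> (truncation (real n) (fourier (u t)) \<xi>)"
  have sw: "?s n t = (\<lambda>\<xi>. indicator (cball 0 (real n)) \<xi> *\<^sub>R sobolev_weight 1 (u t) \<xi>)" for n t
    by (rule ext) (simp add: truncation_def sobolev_weight_def)
  have bound: "L2_norm (?s n t) \<le> C" if t: "t \<in> {0..<T}" for n t
  proof (rule lsc_on_bound_everywhere[OF lsc_on_truncated_norm[OF wc good_symbol_weight1] _ t])
    show "AE t in lebesgue. t \<in> {0<..<T} \<longrightarrow> L2_norm (?s n t) \<le> C"
      using C'
    proof eventually_elim
      case (elim t)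
      show ?case
      proof
        assume "t \<in> {0<..<T}"
        then have e: "L2 (sobolev_weight 1 (u t))" "sobolev_norm 1 (u t) \<le> C" using elim by (auto simp: sobolev_def)
        have m: "?s n t \<in> Lmeas"
          unfolding sw by (rule borel_measurable_scaleR[OF borel_measurable_indicator[OF cball_in_lebesgue] L2_measurable[OF e(1)]])
        have "L2_norm (?s n t) \<le> 1 * L2_norm (sobolev_weight 1 (u t))"
          by (rule L2_dominated(2)[OF e(1) m], rule AE_I2) (simp_all add: truncation_def sobolev_weight_def indicator_def)
        then show "L2_norm (?s n t) \<le> C" using e(2) by (simp add: sobolev_norm_def)
      qed
    qed
  qed
  show thesis
  proof (rule that)
    fix t assume t: "t \<in> {0..<T}"
    have uL: "L2 (u t)" by (rule weak_continuityD(1)[OF wc t])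
    have tb: "band_limited (?s n t)" for n
      by (intro band_limited_good_symbol[OF good_symbol_weight1] band_limited_truncation fourier_L2 fourier_hermitian uL)
    have w: "sobolev_weight 1 (u t) \<in> Lmeas"
      using good_symbol_weight1 L2_measurable[OF fourier_L2[OF uL]] unfolding good_symbol_def sobolev_weight_def[abs_def] by blast
    have lim: "AE \<xi> in lebesgue. (\<lambda>n. ?s n t \<xi>) \<longlonglongrightarrow> sobolev_weight 1 (u t) \<xi>"
    proof (rule AE_I2)
      fix \<xi> :: "real^3"
      obtain n0 where "norm \<xi> \<le> real n0" using real_arch_simple by blast
      then have "\<forall>\<^sub>F n in sequentially. ?s n t \<xi> = sobolev_weight 1 (u t) \<xi>"
        by (auto simp: eventually_sequentially truncation_def sobolev_weight_def intro!: exI[of _ n0])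
      then show "(\<lambda>n. ?s n t \<xi>) \<longlonglongrightarrow> sobolev_weight 1 (u t) \<xi>" by (rule tendsto_eventually)
    qed
    have sL: "L2 (?s n t)" for n using tb[of n] by (simp add: band_limited_def)
    show "sobolev 1 (u t) \<and> sobolev_norm 1 (u t) \<le> C"
      using L2_Fatou[OF sL bound[OF t] w lim] uL by (simp add: sobolev_def sobolev_norm_def)
  qed
qed

lemma L2_sobolevD:
  assumes "L2_sobolev T 2 u"
  shows "AE t in lebesgue. t \<in> {0<..<T} \<longrightarrow> sobolev 2 (u t)"
    "integrable lebesgue (\<lambda>t. indicator {0<..<T} t * (sobolev_norm 2 (u t))\<^sup>2)"
proof -
  have "AE t in lebesgue_on {0<..<T}. sobolev 2 (u t)" using assms by (simp add: L2_sobolev_def)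
  then show "AE t in lebesgue. t \<in> {0<..<T} \<longrightarrow> sobolev 2 (u t)" by (subst (asm) AE_restrict_space_iff) auto
  have "integrable (lebesgue_on {0<..<T}) (\<lambda>t. (sobolev_norm 2 (u t))\<^sup>2)" using assms by (simp add: L2_sobolev_def)
  then show "integrable lebesgue (\<lambda>t. indicator {0<..<T} t * (sobolev_norm 2 (u t))\<^sup>2)"
    by (subst (asm) integrable_restrict_space) auto
qed

text \<open>As a limit of lower semicontinuous functions of time, the dissipation is measurable; it is dominated by the squared
  \<open>H\<^sup>2\<close> norm.\<close>

lemma helical_dissipation_integrable:
  assumes wc: "weakly_continuous_L2 T u" and H2: "L2_sobolev T 2 u" and s: "\<bar>s\<bar> = 1"
  shows "integrable lebesgue (\<lambda>t. indicator {0<..<T} t * helical_dissipation s (u t))"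
proof (rule Bochner_Integration.integrable_bound[OF L2_sobolevD(2)[OF H2]])
  let ?m = "\<lambda>t. helical_dissipation s (u t)"
  let ?M = "\<lambda>\<xi> v. (norm \<xi> powr (3/2)) *\<^sub>R helical_symbol s \<xi> v"
  let ?q = "\<lambda>n t. L2_norm (\<lambda>\<xi>. ?M \<xi> (truncation (real n) (fourier (u t)) \<xi>))"
  have qm: "(\<lambda>t. indicator {0<..<T} t * ?q n t) \<in> Lmeas" for n
    by (rule lsc_on_measurable[OF lsc_on_truncated_norm[OF wc good_symbol_helical[OF s]] L2_norm_nonneg])
  define G where "G t = lim (\<lambda>n. (indicator {0<..<T} t * ?q n t)\<^sup>2)" for t
  have Gm: "G \<in> Lmeas"
    unfolding G_def by (rule borel_measurable_lim_metric) (intro borel_measurable_power qm)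
  have G: "AE t in lebesgue. G t = indicator {0<..<T} t * ?m t"
    using L2_sobolevD(1)[OF H2]
  proof eventually_elim
    case (elim t)
    show ?case
    proof (cases "t \<in> {0<..<T}")
      case True
      then have v: "sobolev 2 (u t)" using elim by simp
      note h = half_derivative_gradient_helical[OF v s]
      have sq: "(norm (?M \<xi> w))\<^sup>2 = (norm \<xi>) ^ 3 * (norm (helical_symbol s \<xi> w))\<^sup>2" for \<xi> w
      proof -
        have "(norm \<xi> powr (3/2))\<^sup>2 = norm \<xi> ^ 3"
          by (cases "\<xi> = 0") (simp_all add: powr_power)
        then show ?thesis by (simp add: power_mult_distrib)
      qed
      have mm: "(\<lambda>\<xi>. ?M \<xi> (fourier (u t) \<xi>)) \<in> Lmeas"
        using good_symbol_helical[OF s] L2_measurable[OF fourier_L2[OF sobolev_L2[OF v]]] unfolding good_symbol_def by blast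
      have MuL: "L2 (\<lambda>\<xi>. ?M \<xi> (fourier (u t) \<xi>))" unfolding L2_def sq using mm h(1) by simp
      have hz: "helical_symbol s \<xi> 0 = 0" for \<xi> using norm_helical_symbol_le[OF s, of \<xi> 0] by simp
      have tr: "(\<lambda>\<xi>. ?M \<xi> (truncation (real n) (fourier (u t)) \<xi>)) = (\<lambda>\<xi>. indicator (cball 0 (real n)) \<xi> *\<^sub>R ?M \<xi> (fourier (u t) \<xi>))" for n
        by (rule ext) (auto simp: truncation_def indicator_def hz)
      have "(\<lambda>n. ?q n t) \<longlonglongrightarrow> L2_norm (\<lambda>\<xi>. ?M \<xi> (fourier (u t) \<xi>))"
        unfolding tr by (rule L2_lim_norm[OF L2_lim_truncate[OF MuL]])
      then have "(\<lambda>n. (indicator {0<..<T} t * ?q n t)\<^sup>2) \<longlonglongrightarrow> (L2_norm (\<lambda>\<xi>. ?M \<xi> (fourier (u t) \<xi>)))\<^sup>2"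
        using True by (simp add: tendsto_power)
      then have "G t = (L2_norm (\<lambda>\<xi>. ?M \<xi> (fourier (u t) \<xi>)))\<^sup>2" unfolding G_def by (rule limI)
      then show ?thesis using True unfolding L2_norm_sq sq by simp
    next
      case False
      then show ?thesis by (simp add: G_def)
    qed
  qed
  show "(\<lambda>t. indicator {0<..<T} t * ?m t) \<in> Lmeas" by (rule borel_measurable_AE[OF Gm G])
  show "AE t in lebesgue. norm (indicator {0<..<T} t * ?m t) \<le> norm (indicator {0<..<T} t * (sobolev_norm 2 (u t))\<^sup>2)"
    using L2_sobolevD(1)[OF H2]
  proof eventually_elim
    case (elim t)
    have "0 \<le> ?m t" by (rule Bochner_Integration.integral_nonneg) simp
    then show ?case using elim half_derivative_gradient_helical(3)[OF _ s, of "u t"] by (auto simp: indicator_def)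
  qed
qed

section \<open>Measurability in time of the nonlinear term\<close>

lemma spacetime_representative:
  assumes "spacetime_measurable T u"
  obtains w where "w \<in> borel_measurable borel" "AE t in lebesgue. t \<in> {0<..<T} \<longrightarrow> (AE x in lebesgue. u t x = w (t, x))"
proof -
  let ?S = "{0<..<T} \<times> (UNIV :: (real^3) set)"
  have "open ?S" by (rule open_Times) auto
  then have "?S \<in> sets lborel" by (simp add: borel_open)
  then have S: "?S \<in> sets lebesgue" by (rule sets_completionI_sets)
  define f where "f z = (if z \<in> ?S then (case z of (t, x) \<Rightarrow> u t x) else 0)" for z
  have fm: "f \<in> Lmeas"
    unfolding f_def using assms S unfolding spacetime_measurable_def by (intro borel_measurable_if_I)
  obtain w where w: "w \<in> borel_measurable borel" "AE z in lebesgue. f z = w z"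
    by (rule lebesgue_borel_representative[OF fm])
  have "AE z in lborel. f z = w z" using w(2) by (simp add: AE_completion_iff)
  then have "AE z in lborel \<Otimes>\<^sub>M lborel. f z = w z" unfolding lborel_prod .
  then have "AE t in lborel. AE x in lborel. f (t, x) = w (t, x)" by (rule lborel_pair.AE_pair)
  then have "AE t in lebesgue. AE x in lborel. f (t, x) = w (t, x)" by (rule AE_completion)
  then have "AE t in lebesgue. t \<in> {0<..<T} \<longrightarrow> (AE x in lebesgue. u t x = w (t, x))"
  proof eventually_elim
    case (elim t)
    then have "AE x in lebesgue. f (t, x) = w (t, x)" by (rule AE_completion)
    then show ?case by (auto simp: f_def)
  qed
  then show thesis using that w(1) by blast
qed

text \<open>The derivatives in \<open>advection\<close> are chosen for each time separately, so the dependence on time is not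
  visibly measurable. Replace them by difference quotients of a jointly Borel representative of \<open>u\<close>; their spatial
  integrals are Borel functions of time by Fubini, and they converge for almost every time.\<close>

lemma advection_time_measurable:
  assumes sm: "spacetime_measurable T u" and H2: "AE t in lebesgue. t \<in> {0<..<T} \<longrightarrow> sobolev 2 (u t)" and g: "L2 g"
  shows "(\<lambda>t. indicator {0<..<T} t * ip (advection (u t)) g) \<in> Lmeas"
proof -
  obtain w where wm [measurable]: "w \<in> borel_measurable borel"
      and w: "AE t in lebesgue. t \<in> {0<..<T} \<longrightarrow> (AE x in lebesgue. u t x = w (t, x))"
    by (rule spacetime_representative[OF sm])
  obtain g' where gm [measurable]: "g' \<in> borel_measurable borel" and g': "AE x in lebesgue. g x = g' x"
    by (rule lebesgue_borel_representative[OF L2_measurable[OF g]])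
  have g'L: "L2 g'" by (rule L2_cong_AE[OF g g'])
  define h where "h n = 1 / real (Suc n)" for n
  have h0: "h n \<noteq> 0" for n by (simp add: h_def)
  have hlim: "h \<longlonglongrightarrow> 0" unfolding h_def by (rule LIMSEQ_Suc[OF lim_1_over_n])
  define P where "P n t x = (\<Sum>j\<in>UNIV. w (t, x) $ j * (((1 / h n) *\<^sub>R (w (t, h n *\<^sub>R axis j 1 + x) - w (t, x))) \<bullet> g' x))" for n t and x :: "real^3"
  have wj: "(\<lambda>z. w (fst z, c + snd z)) \<in> borel_measurable borel" for c
    by (rule measurable_compose[OF _ wm]) (intro borel_measurable_continuous_onI continuous_intros)
  have wk: "(\<lambda>z. w z $ j) \<in> borel_measurable borel" for j
    by (rule borel_measurable_continuous_on[OF _ wm]) (intro continuous_intros)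
  have gs: "(\<lambda>z::real \<times> (real^3). g' (snd z)) \<in> borel_measurable borel"
    by (rule measurable_compose[OF _ gm]) (intro borel_measurable_continuous_onI continuous_intros)
  have Pm: "(\<lambda>(t, x). P n t x) \<in> borel_measurable (borel \<Otimes>\<^sub>M lborel)" for n
  proof -
    have "(\<lambda>z. P n (fst z) (snd z)) \<in> borel_measurable borel"
      unfolding P_def prod.collapse
      by (intro borel_measurable_sum borel_measurable_times borel_measurable_inner borel_measurable_scaleR borel_measurable_diff borel_measurable_const wj wk wm gs)
    then have "(\<lambda>(t, x). P n t x) \<in> borel_measurable borel" by (simp add: case_prod_beta')
    moreover have "sets (borel \<Otimes>\<^sub>M lborel :: (real \<times> (real^3)) measure) = sets borel"
      using sets_pair_measure_cong[OF refl sets_lborel] borel_prod by metis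
    ultimately show ?thesis by (subst measurable_cong_sets[OF _ refl])
  qed
  define F where "F n t = (LINT x|lborel. P n t x)" for n t
  have Fm [measurable]: "F n \<in> borel_measurable borel" for n
    unfolding F_def by (rule lborel.borel_measurable_lebesgue_integral[OF Pm])
  define G where "G t = lim (\<lambda>n. indicator {0<..<T} t * F n t)" for t
  have Gm: "G \<in> Lmeas"
    unfolding G_def by (rule measurable_completion) measurable
  have "AE t in lebesgue. G t = indicator {0<..<T} t * ip (advection (u t)) g"
    using w H2
  proof eventually_elim
    case (elim t)
    show ?case
    proof (cases "t \<in> {0<..<T}")
      case True
      have v: "sobolev 2 (u t)" and uw: "AE x in lebesgue. u t x = w (t, x)" using elim True by auto
      have v1: "sobolev 1 (u t)" using sobolev_mono[OF v, of 1] by auto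
      note vL = sobolev_L2[OF v]
      obtain U where U: "AE x in lebesgue. u t x = U x" "\<And>x. norm (U x) \<le> sobolev_const * sobolev_norm 2 (u t)"
        by (rule sobolev2_continuous_representative[OF v]) blast
      let ?K = "sobolev_const * sobolev_norm 2 (u t)"
      have K: "0 \<le> ?K" using U(2)[of 0] norm_ge_zero order_trans by blast
      have ug: "L2 (\<lambda>x. u t x $ j *\<^sub>R g x)" for j
      proof (rule L2_dominated(1)[OF g _ _ K])
        show "(\<lambda>x. u t x $ j *\<^sub>R g x) \<in> Lmeas"
          by (rule borel_measurable_scaleR[OF L2_measurable[OF L2_nth[OF vL]] L2_measurable[OF g]])
        show "AE x in lebesgue. norm (u t x $ j *\<^sub>R g x) \<le> ?K * norm (g x)"
          using U(1)
        proof eventually_elim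
          case (elim x)
          have "\<bar>u t x $ j\<bar> \<le> ?K" using component_le_norm_cart[of "u t x" j] U(2)[of x] elim by simp
          then show ?case by (simp add: mult_right_mono)
        qed
      qed
      note dq = diff_quotient_L2_lim[OF vL sobolev1_component_symbol(1)[OF v1] h0 hlim]
      have dL: "L2 (diff_quotient (h n) j (u t))" for n j by (rule L2_diff_quotient[OF vL])
      have "(\<lambda>n. \<Sum>j\<in>UNIV. ip (diff_quotient (h n) j (u t)) (\<lambda>x. u t x $ j *\<^sub>R g x)) \<longlonglongrightarrow> (\<Sum>j\<in>UNIV. ip (partial_x j (u t)) (\<lambda>x. u t x $ j *\<^sub>R g x))"
        by (intro tendsto_sum L2_lim_inner dq L2_lim_const ug)
      moreover have "(\<Sum>j\<in>UNIV. ip (diff_quotient (h n) j (u t)) (\<lambda>x. u t x $ j *\<^sub>R g x)) = F n t" for n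
      proof -
        have i: "integrable lebesgue (\<lambda>x. diff_quotient (h n) j (u t) x \<bullet> (u t x $ j *\<^sub>R g x))" for j
          by (rule L2_inner_integrable[OF dL ug])
        have tr: "AE x in lebesgue. u t (a + x) = w (t, a + x)" for a
          using AE_isometry[of 1, OF _ uw, of a] by simp
        have "(\<Sum>j\<in>UNIV. ip (diff_quotient (h n) j (u t)) (\<lambda>x. u t x $ j *\<^sub>R g x))
            = (LINT x|lebesgue. (\<Sum>j\<in>UNIV. diff_quotient (h n) j (u t) x \<bullet> (u t x $ j *\<^sub>R g x)))"
          by (rule Bochner_Integration.integral_sum[symmetric]) (rule i)
        also have "\<dots> = (LINT x|lebesgue. P n t x)"
        proof (rule integral_cong_AE)
          show m: "(\<lambda>x. (\<Sum>j\<in>UNIV. diff_quotient (h n) j (u t) x \<bullet> (u t x $ j *\<^sub>R g x))) \<in> Lmeas"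
            by (intro borel_measurable_sum borel_measurable_integrable i)
          have "AE x in lebesgue. \<forall>j. u t (h n *\<^sub>R axis j 1 + x) = w (t, h n *\<^sub>R axis j 1 + x)"
            by (intro eventually_all_finite tr)
          with uw g' show e: "AE x in lebesgue. (\<Sum>j\<in>UNIV. diff_quotient (h n) j (u t) x \<bullet> (u t x $ j *\<^sub>R g x)) = P n t x"
            by eventually_elim (simp add: P_def diff_quotient_def)
          show "P n t \<in> Lmeas" by (rule borel_measurable_AE[OF m e])
        qed
        also have "\<dots> = F n t"
          unfolding F_def
        proof (rule integral_completion)
          have "(\<lambda>x. (case (t, x) of (t, x) \<Rightarrow> P n t x)) \<in> borel_measurable lborel"
            by (rule measurable_compose[OF measurable_Pair1' Pm]) simp
          then show "P n t \<in> borel_measurable lborel" by simp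
        qed
        finally show ?thesis .
      qed
      moreover have "(\<Sum>j\<in>UNIV. ip (partial_x j (u t)) (\<lambda>x. u t x $ j *\<^sub>R g x)) = ip (advection (u t)) g"
      proof -
        have i: "integrable lebesgue (\<lambda>x. partial_x j (u t) x \<bullet> (u t x $ j *\<^sub>R g x))" for j
          by (rule L2_inner_integrable[OF sobolev1_partial_x(1)[OF v1] ug])
        have "(\<Sum>j\<in>UNIV. ip (partial_x j (u t)) (\<lambda>x. u t x $ j *\<^sub>R g x)) = (LINT x|lebesgue. (\<Sum>j\<in>UNIV. partial_x j (u t) x \<bullet> (u t x $ j *\<^sub>R g x)))"
          by (rule Bochner_Integration.integral_sum[symmetric]) (rule i)
        then show ?thesis by (simp add: advection_def inner_sum_left)
      qed
      ultimately have "(\<lambda>n. F n t) \<longlonglongrightarrow> ip (advection (u t)) g" by simp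
      then have "G t = ip (advection (u t)) g" unfolding G_def using True by (simp add: limI)
      then show ?thesis using True by simp
    next
      case False
      then show ?thesis by (simp add: G_def)
    qed
  qed
  then show ?thesis by (rule borel_measurable_AE[OF Gm])
qed

section \<open>Weak derivatives in time and Riemann sums\<close>

text \<open>The normalised primitive of the bump function.\<close>

lemma smooth_step_exists:
  obtains J :: "real \<Rightarrow> real" where "smooth J" "\<And>r. r \<le> -1 \<Longrightarrow> J r = 0" "\<And>r. r \<ge> 1 \<Longrightarrow> J r = 1"
    "\<And>r. 0 \<le> J r" "\<And>r. J r \<le> 1" "\<And>r. 0 \<le> dir_deriv 1 J r" "\<And>r. (J has_real_derivative dir_deriv 1 J r) (at r)"
proof -
  have bc: "isCont bump x" for x :: real
    using smooth_continuous[OF smooth_bump] by (auto simp: continuous_on_eq_continuous_at)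
  obtain F :: "real \<Rightarrow> real" where F: "\<And>x. (F has_vector_derivative bump x) (at x)"
    using einterval_antiderivative[of "-\<infinity>" "\<infinity>" "bump :: real \<Rightarrow> real"] bc by auto
  then have Fd: "(F has_real_derivative bump x) (at x)" for x by (simp add: has_real_derivative_iff_has_vector_derivative)
  have mono: "F x \<le> F y" if "x \<le> y" for x y
    by (rule DERIV_nonneg_imp_nondecreasing[OF that]) (use Fd bump_nonneg in blast)
  have lo: "F r = F (-1)" if "r \<le> -1" for r
  proof (cases "r = -1")
    case False
    have "\<exists>z. r < z \<and> z < -1 \<and> F (-1) - F r = (-1 - r) * bump z"
      by (rule MVT2) (use False that Fd in auto)
    then show ?thesis by (auto simp: bump_eq_0)
  qed simp
  have hi: "F r = F 1" if "r \<ge> 1" for r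
  proof (cases "r = 1")
    case False
    have "\<exists>z. 1 < z \<and> z < r \<and> F r - F 1 = (r - 1) * bump z"
      by (rule MVT2) (use False that Fd in auto)
    then show ?thesis by (auto simp: bump_eq_0)
  qed simp
  have "\<exists>z::real. -1 < z \<and> z < 1 \<and> F 1 - F (-1) = (1 - (-1)) * bump z"
    by (rule MVT2) (use Fd in auto)
  then obtain z :: real where "-1 < z" "z < 1" "F 1 - F (-1) = 2 * bump z" by auto
  then have c: "F 1 - F (-1) > 0" using bump_pos[of z] by (simp add: abs_less_iff)
  define c where "c = F 1 - F (-1)"
  define J where "J r = (F r - F (-1)) / c" for r
  have Jd: "(J has_real_derivative bump r / c) (at r)" for r
    unfolding J_def using c by (auto intro!: derivative_eq_intros Fd simp: c_def)
  have Jdd: "dir_deriv 1 J = (\<lambda>r. bump r / c)"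
    by (rule ext) (use dir_deriv_eq[OF Jd[unfolded has_field_derivative_def], of 1] in simp)
  have "smooth (\<lambda>r::real. (1 / c) * bump r)"
    by (rule smooth_bounded_linear[OF bounded_linear_mult_right smooth_bump])
  then have sb: "smooth (\<lambda>r::real. bump r / c)" by simp
  have Js: "smooth J"
  proof (rule smoothI)
    show "J differentiable (at z)" for z
      using Jd[of z] unfolding has_field_derivative_def by (rule differentiableI)
    fix b :: real assume "b \<in> Basis"
    then have "b = 1" by simp
    then show "smooth (dir_deriv b J)" using sb by (simp only: Jdd)
  qed
  have c0: "c > 0" using c by (simp add: c_def)
  show thesis
  proof (rule that[OF Js])
    show "J r = 0" if "r \<le> -1" for r using lo[OF that] by (simp add: J_def)
    show "J r = 1" if "r \<ge> 1" for r using hi[OF that] c0 by (simp add: J_def c_def)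
    show "0 \<le> J r" for r
    proof -
      have "F (-1) \<le> F r"
      proof (cases "r \<le> -1")
        case True show ?thesis by (simp add: lo[OF True])
      next
        case False then show ?thesis by (intro mono) simp
      qed
      then show ?thesis using c0 by (simp add: J_def)
    qed
    show "J r \<le> 1" for r
    proof -
      have "F r \<le> F 1"
      proof (cases "r \<ge> 1")
        case True show ?thesis by (simp add: hi[OF True])
      next
        case False then show ?thesis by (intro mono) simp
      qed
      then have "F r - F (-1) \<le> c" by (simp add: c_def)
      then show ?thesis using c0 by (simp add: J_def)
    qed
    show "0 \<le> dir_deriv 1 J r" for r using c0 bump_nonneg[of r] by (simp add: Jdd)
    show "(J has_real_derivative dir_deriv 1 J r) (at r)" for r using Jd by (simp add: Jdd)
  qed
qed

text \<open>The derivatives of steepening steps at \<open>s\<close> form an approximate identity.\<close>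

lemma approximate_delta:
  fixes f J :: "real \<Rightarrow> real"
  assumes f: "continuous_on {0..<T} f" and s: "0 < s" "s < T"
    and J: "smooth J" "\<And>r. r \<le> -1 \<Longrightarrow> J r = 0" "\<And>r. r \<ge> 1 \<Longrightarrow> J r = 1" "\<And>r. 0 \<le> dir_deriv 1 J r"
      "\<And>r. (J has_real_derivative dir_deriv 1 J r) (at r)"
    and e: "0 < e"
  shows "\<exists>N. \<forall>n\<ge>N. integrable lebesgue (\<lambda>r. indicator {0<..<T} r * ((real (Suc n) * dir_deriv 1 J (real (Suc n) * (r - s))) * f r)) \<and>
    norm ((LINT r|lebesgue. indicator {0<..<T} r * ((real (Suc n) * dir_deriv 1 J (real (Suc n) * (r - s))) * f r)) - f s) < e"
proof -
  obtain d where d: "d > 0" "\<And>r. r \<in> {0..<T} \<Longrightarrow> dist r s < d \<Longrightarrow> dist (f r) (f s) < e / 2"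
    using f s e unfolding continuous_on_iff by (metis atLeastLessThan_iff half_gt_zero less_imp_le)
  define d' where "d' = min d (min s (T - s))"
  have d': "d' > 0" "d' \<le> d" "d' \<le> s" "d' \<le> T - s" using d s by (auto simp: d'_def)
  obtain N where N: "1 / d' < real N" using reals_Archimedean2 by blast
  have Jd0: "dir_deriv 1 J r = 0" if "\<bar>r\<bar> > 1" for r
  proof (cases "r > 1")
    case True
    have "(J has_real_derivative 0) (at r)"
      by (rule has_field_derivative_transform_within_open[of "\<lambda>_. 1" 0 r "{1<..}"]) (use True J(3) in auto)
    then show ?thesis using J(5) DERIV_unique by blast
  next
    case False
    then have r: "r < -1" using that by auto
    have "(J has_real_derivative 0) (at r)"
      by (rule has_field_derivative_transform_within_open[of "\<lambda>_. 0" 0 r "{..<-1}"]) (use r J(2) in auto)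
    then show ?thesis using J(5) DERIV_unique by blast
  qed
  have Jc: "continuous_on UNIV (dir_deriv 1 J)" by (rule smooth_continuous[OF smooth_dir_deriv[OF J(1)]]) simp
  have "integrable lebesgue (\<lambda>r. indicator {0<..<T} r * ((real (Suc n) * dir_deriv 1 J (real (Suc n) * (r - s))) * f r)) \<and>
      norm ((LINT r|lebesgue. indicator {0<..<T} r * ((real (Suc n) * dir_deriv 1 J (real (Suc n) * (r - s))) * f r)) - f s) < e"
    if n: "n \<ge> N" for n
  proof -
    let ?m = "real (Suc n)"
    define k where "k r = ?m * dir_deriv 1 J (?m * (r - s))" for r
    define a where "a = s - 1 / ?m"
    define b where "b = s + 1 / ?m"
    have m: "?m > 0" by simp
    have "1 / d' < ?m" using N n by linarith
    then have md: "1 / ?m < d'" using d'(1) m by (simp add: field_simps)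
    have ab: "0 < a" "a < s" "s < b" "b < T" using md d' by (auto simp: a_def b_def)
    have kc: "continuous_on S k" for S
      unfolding k_def by (intro continuous_intros continuous_on_compose2[OF Jc]) auto
    have k0: "k r = 0" if "r \<notin> {a..b}" for r
    proof -
      have "\<bar>?m * (r - s)\<bar> > 1"
      proof -
        have "\<bar>r - s\<bar> > 1 / ?m" using that by (auto simp: a_def b_def)
        then have "?m * \<bar>r - s\<bar> > 1" using m by (simp only: pos_divide_less_eq mult.commute)
        then show ?thesis by (simp add: abs_mult)
      qed
      then show ?thesis unfolding k_def by (simp add: Jd0)
    qed
    have kn: "0 \<le> k r" for r by (simp add: k_def J(4))
    have hb: "has_bochner_integral lborel (\<lambda>r. k r * indicator {a..b} r) (J (?m * (b - s)) - J (?m * (a - s)))"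
    proof (rule has_bochner_integral_FTC_Icc_real)
      show "a \<le> b" using ab by simp
      show "DERIV (\<lambda>r. J (?m * (r - s))) x :> k x" if "a \<le> x" "x \<le> b" for x
        unfolding k_def by (rule DERIV_chain2[OF J(5), THEN DERIV_cong]) (auto intro!: derivative_eq_intros)
      show "isCont k x" if "a \<le> x" "x \<le> b" for x using kc[of UNIV] by (simp add: continuous_on_eq_continuous_at)
    qed
    have "J (?m * (b - s)) - J (?m * (a - s)) = 1" using m J(2)[of "?m * (a - s)"] J(3)[of "?m * (b - s)"] by (simp add: a_def b_def)
    then have kI: "integrable lborel (\<lambda>r. k r * indicator {a..b} r)" "(LINT r|lborel. k r * indicator {a..b} r) = 1"
      using hb by (auto simp: has_bochner_integral_iff)
    have fab: "continuous_on {a..b} f" by (rule continuous_on_subset[OF f]) (use ab in auto)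
    have kfi: "integrable lborel (\<lambda>r. indicator {a..b} r *\<^sub>R (k r * f r))"
      by (rule borel_integrable_compact) (use kc fab in \<open>auto intro!: continuous_intros\<close>)
    have kfm: "(\<lambda>r. indicator {a..b} r *\<^sub>R (k r * f r)) \<in> borel_measurable lborel" by (rule borel_measurable_integrable[OF kfi])
    have eq: "indicator {0<..<T} r * (k r * f r) = indicator {a..b} r *\<^sub>R (k r * f r)" for r
      using k0[of r] ab by (auto simp: indicator_def)
    let ?X = "\<lambda>r. indicator {a..b} r *\<^sub>R (k r * f r) - f s * (k r * indicator {a..b} r)"
    have "(LINT r|lebesgue. indicator {0<..<T} r * (k r * f r)) = (LINT r|lborel. indicator {a..b} r *\<^sub>R (k r * f r))"
      unfolding eq by (rule integral_completion[OF kfm])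
    moreover have "(LINT r|lborel. ?X r) = (LINT r|lborel. indicator {a..b} r *\<^sub>R (k r * f r)) - f s"
      using Bochner_Integration.integral_diff[OF kfi integrable_mult_right[OF kI(1), of "f s"]] by (simp add: kI(2))
    ultimately have E: "(LINT r|lebesgue. indicator {0<..<T} r * (k r * f r)) - f s = (LINT r|lborel. ?X r)"
      by simp
    have "norm ((LINT r|lebesgue. indicator {0<..<T} r * (k r * f r)) - f s) \<le> (LINT r|lborel. norm (?X r))"
      unfolding E by (rule integral_norm_bound)
    also have "\<dots> \<le> (LINT r|lborel. (e / 2) * (k r * indicator {a..b} r))"
    proof (rule integral_mono)
      show "integrable lborel (\<lambda>r. norm (indicator {a..b} r *\<^sub>R (k r * f r) - f s * (k r * indicator {a..b} r)))"
        using kfi kI(1) by (intro integrable_norm Bochner_Integration.integrable_diff integrable_mult_right)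
      show "integrable lborel (\<lambda>r. (e / 2) * (k r * indicator {a..b} r))" using kI(1) by (rule integrable_mult_right)
      fix r
      show "norm (indicator {a..b} r *\<^sub>R (k r * f r) - f s * (k r * indicator {a..b} r)) \<le> (e / 2) * (k r * indicator {a..b} r)"
      proof (cases "r \<in> {a..b}")
        case True
        then have "dist r s < d" using md d' by (auto simp: dist_real_def a_def b_def)
        moreover have "r \<in> {0..<T}" using True ab by auto
        ultimately have fd: "\<bar>f r - f s\<bar> \<le> e / 2" using d(2)[of r] by (simp add: dist_real_def)
        have "norm (indicator {a..b} r *\<^sub>R (k r * f r) - f s * (k r * indicator {a..b} r)) = k r * \<bar>f r - f s\<bar>"
        proof -
          have "indicator {a..b} r *\<^sub>R (k r * f r) - f s * (k r * indicator {a..b} r) = k r * (f r - f s)"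
            using True by (simp add: algebra_simps)
          then show ?thesis using kn[of r] by (simp add: abs_mult)
        qed
        also have "\<dots> \<le> k r * (e / 2)" by (rule mult_left_mono[OF fd kn])
        finally show ?thesis using True by (simp add: mult.commute)
      qed simp
    qed
    also have "\<dots> = e / 2" by (simp add: kI(2))
    finally have "norm ((LINT r|lebesgue. indicator {0<..<T} r * (k r * f r)) - f s) < e" using e by simp
    moreover have "integrable lebesgue (\<lambda>r. indicator {0<..<T} r * (k r * f r))"
      unfolding eq using kfi by (simp only: integrable_completion[OF kfm])
    ultimately show ?thesis unfolding k_def by blast
  qed
  then show ?thesis by blast
qed

text \<open>Time integrals run over intervals that may contain \<open>0\<close>, while regularity is known in
  \<open>{0<..<T}\<close>.\<close>

lemma AE_indicator_interior:
  fixes f :: "real \<Rightarrow> real"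
  assumes "0 \<le> a" "b \<le> T"
  shows "AE r in lebesgue. indicator {a..<b} r * (indicator {0<..<T} r * f r) = indicator {a..<b} r * f r"
proof -
  have "AE r in lebesgue. r \<noteq> (0::real)" by (rule AE_completion) (rule AE_lborel_singleton)
  then show ?thesis by eventually_elim (use assms in \<open>auto simp: indicator_def\<close>)
qed

lemma interior_indicator_measurable:
  fixes f :: "real \<Rightarrow> real"
  assumes f: "(\<lambda>r. indicator {0<..<T} r * f r) \<in> Lmeas" and ab: "0 \<le> a" "b \<le> T"
  shows "(\<lambda>r. indicator {a..<b} r * f r) \<in> Lmeas"
proof (rule borel_measurable_AE[OF _ AE_indicator_interior[OF ab]])
  have "(indicator {a..<b} :: real \<Rightarrow> real) \<in> Lmeas" by (rule measurable_completion) simp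
  then show "(\<lambda>r. indicator {a..<b} r * (indicator {0<..<T} r * f r)) \<in> Lmeas"
    using f by (rule borel_measurable_times)
qed

lemma interior_indicator_integrable:
  fixes f :: "real \<Rightarrow> real"
  assumes f: "integrable lebesgue (\<lambda>r. indicator {0<..<T} r * f r)" and ab: "0 \<le> a" "b \<le> T"
  shows "integrable lebesgue (\<lambda>r. indicator {a..<b} r * f r)"
proof (rule Bochner_Integration.integrable_bound[OF f])
  show "(\<lambda>r. indicator {a..<b} r * f r) \<in> Lmeas"
    by (rule interior_indicator_measurable[OF _ ab]) (use f in auto)
  show "AE r in lebesgue. norm (indicator {a..<b} r * f r) \<le> norm (indicator {0<..<T} r * f r)"
    using AE_indicator_interior[OF ab, of f] by eventually_elim (auto simp: indicator_def split: if_splits)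
qed

text \<open>Test with \<open>\<theta> n\<close>, the difference of two steep smooth steps at \<open>s\<close> and
  \<open>t\<close>: it converges to the indicator of \<open>[s, t)\<close>, and its derivative to the difference of point masses
  at \<open>s\<close> and \<open>t\<close>. The case \<open>s = 0\<close>, where no test function reaches the boundary, follows by
  continuity.\<close>

lemma du_bois_reymond:
  fixes f g :: "real \<Rightarrow> real"
  assumes f: "continuous_on {0..<T} f" and g: "integrable lebesgue (\<lambda>r. indicator {0<..<T} r * g r)"
    and weak: "\<And>\<theta>. time_test T \<theta> \<Longrightarrow>
      (LINT r|lebesgue. indicator {0<..<T} r * (\<theta> r * g r)) = (LINT r|lebesgue. indicator {0<..<T} r * (dir_deriv 1 \<theta> r * f r))"
    and st: "0 \<le> s" "s \<le> t" "t < T"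
  shows "f t - f s = - (LINT r|lebesgue. indicator {s..<t} r * g r)"
proof -
  obtain J :: "real \<Rightarrow> real" where J: "smooth J" "\<And>r. r \<le> -1 \<Longrightarrow> J r = 0" "\<And>r. r \<ge> 1 \<Longrightarrow> J r = 1"
    "\<And>r. 0 \<le> J r" "\<And>r. J r \<le> 1" "\<And>r. 0 \<le> dir_deriv 1 J r" "\<And>r. (J has_real_derivative dir_deriv 1 J r) (at r)"
    by (rule smooth_step_exists) blast
  have gm: "(\<lambda>r. indicator {0<..<T} r * g r) \<in> Lmeas" using g by auto
  have ind: "(indicator {a..<b} :: real \<Rightarrow> real) \<in> Lmeas" for a b :: real
    by (rule measurable_completion) simp
  have pos: "f t - f s = - (LINT r|lebesgue. indicator {s..<t} r * g r)" if s: "0 < s" "s < t" for s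
  proof -
    have t: "0 < t" "t < T" and sT: "s < T" using s st by auto
    define k where "k n a r = real (Suc n) * dir_deriv 1 J (real (Suc n) * (r - a))" for n and a r :: real
    define \<theta> where "\<theta> n r = J (real (Suc n) * (r - s)) - J (real (Suc n) * (r - t))" for n r
    have Js: "smooth (\<lambda>r. J (real (Suc n) * (r - a)))" "dir_deriv 1 (\<lambda>r. J (real (Suc n) * (r - a))) = k n a" for n a
      using smooth_dilation[OF J(1), where c="real (Suc n)" and d="- real (Suc n) * a"]
      by (simp_all add: k_def[abs_def] algebra_simps)
    have \<theta>s: "smooth (\<theta> n)" for n
      using smooth_add[OF Js(1)[of n s] smooth_bounded_linear[OF bounded_linear_minus[OF bounded_linear_ident] Js(1)[of n t]]] by (simp add: \<theta>_def[abs_def])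
    have \<theta>d: "dir_deriv 1 (\<theta> n) = (\<lambda>r. k n s r - k n t r)" for n
    proof -
      have "\<theta> n = (\<lambda>r. J (real (Suc n) * (r - s)) + - J (real (Suc n) * (r - t)))" by (rule ext) (simp add: \<theta>_def)
      then show ?thesis
        by (simp only: dir_deriv_add[OF Js(1)[of n s] smooth_bounded_linear[OF bounded_linear_minus[OF bounded_linear_ident] Js(1)[of n t]]]
          dir_deriv_bounded_linear[OF bounded_linear_minus[OF bounded_linear_ident] Js(1)[of n t]] Js(2)) simp
    qed
    \<comment> \<open>distance of \<open>[s, t]\<close> to the end points of \<open>(0, T)\<close>: the transition layers of width \<open>1 / (n + 1)\<close> must fit in\<close>
    define d where "d = min s (T - t)"
    have d: "d > 0" "d \<le> s" "d \<le> T - t" using s t by (auto simp: d_def)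
    obtain N0 where N0: "1 / d < real N0" using reals_Archimedean2 by blast
    have tt: "time_test T (\<theta> n)" if n: "n \<ge> N0" for n
    proof -
      let ?m = "real (Suc n)"
      have m: "?m > 0" by simp
      have mm: "?m * (- (1 / ?m)) = -1" "?m * (1 / ?m) = 1" using m by simp_all
      have "1 / d < ?m" using N0 n by linarith
      then have md: "1 / ?m < d" using d(1) m by (simp add: field_simps)
      have "\<theta> n r = 0" if r: "r \<notin> {s - 1 / ?m..t + 1 / ?m}" for r
      proof (cases "r < s - 1 / ?m")
        case True
        then have "?m * (r - s) < ?m * (- (1 / ?m))" by (intro mult_strict_left_mono m) simp
        moreover have "?m * (r - t) \<le> ?m * (r - s)" using s m by (intro mult_left_mono) auto
        ultimately have "?m * (r - s) \<le> -1" "?m * (r - t) \<le> -1" using mm by linarith+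
        then show ?thesis using J(2) by (simp add: \<theta>_def del: of_nat_Suc)
      next
        case False
        then have "r > t + 1 / ?m" using r by auto
        then have "?m * (r - t) > ?m * (1 / ?m)" by (intro mult_strict_left_mono m) simp
        moreover have "?m * (r - t) \<le> ?m * (r - s)" using s m by (intro mult_left_mono) auto
        ultimately have "?m * (r - s) \<ge> 1" "?m * (r - t) \<ge> 1" using mm by linarith+
        then show ?thesis using J(3) by (simp add: \<theta>_def del: of_nat_Suc)
      qed
      moreover have "0 < s - 1 / ?m" "t + 1 / ?m < T" using md d by auto
      ultimately show ?thesis using \<theta>s unfolding time_test_def by blast
    qed
    have delta: "(\<lambda>n. LINT r|lebesgue. indicator {0<..<T} r * (k n a r * f r)) \<longlonglongrightarrow> f a"
        and delta_i: "\<forall>\<^sub>F n in sequentially. integrable lebesgue (\<lambda>r. indicator {0<..<T} r * (k n a r * f r))"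
      if a: "0 < a" "a < T" for a
    proof -
      note ad = approximate_delta[OF f a J(1,2,3,6,7), folded k_def]
      show "(\<lambda>n. LINT r|lebesgue. indicator {0<..<T} r * (k n a r * f r)) \<longlonglongrightarrow> f a"
        by (rule LIMSEQ_I) (use ad in blast)
      show "\<forall>\<^sub>F n in sequentially. integrable lebesgue (\<lambda>r. indicator {0<..<T} r * (k n a r * f r))"
        unfolding eventually_sequentially using ad[of 1] by auto
    qed
    have lim1: "(\<lambda>n. (LINT r|lebesgue. indicator {0<..<T} r * (k n s r * f r)) - (LINT r|lebesgue. indicator {0<..<T} r * (k n t r * f r))) \<longlonglongrightarrow> f s - f t"
      by (intro tendsto_diff delta s t sT)
    have "\<forall>\<^sub>F n in sequentially. (LINT r|lebesgue. indicator {0<..<T} r * (k n s r * f r)) - (LINT r|lebesgue. indicator {0<..<T} r * (k n t r * f r))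
        = (LINT r|lebesgue. indicator {0<..<T} r * (\<theta> n r * g r))"
      using delta_i[OF s(1) sT] delta_i[OF t] eventually_ge_at_top[of N0]
    proof eventually_elim
      case (elim n)
      have "(LINT r|lebesgue. indicator {0<..<T} r * (\<theta> n r * g r)) = (LINT r|lebesgue. indicator {0<..<T} r * (k n s r * f r) - indicator {0<..<T} r * (k n t r * f r))"
        unfolding weak[OF tt[OF elim(3)]] \<theta>d by (simp add: algebra_simps)
      also have "\<dots> = (LINT r|lebesgue. indicator {0<..<T} r * (k n s r * f r)) - (LINT r|lebesgue. indicator {0<..<T} r * (k n t r * f r))"
        by (rule Bochner_Integration.integral_diff[OF elim(1,2)])
      finally show ?case by simp
    qed
    from Lim_transform_eventually[OF lim1 this]
    have lim2: "(\<lambda>n. LINT r|lebesgue. indicator {0<..<T} r * (\<theta> n r * g r)) \<longlonglongrightarrow> f s - f t" .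
    have lim3: "(\<lambda>n. LINT r|lebesgue. indicator {0<..<T} r * (\<theta> n r * g r)) \<longlonglongrightarrow> (LINT r|lebesgue. indicator {s..<t} r * g r)"
    proof (rule integral_dominated_convergence)
      show "integrable lebesgue (\<lambda>r. 2 * norm (indicator {0<..<T} r * g r))" using g by simp
      have \<theta>m: "\<theta> n \<in> Lmeas" for n
        using borel_measurable_continuous_onI[OF smooth_continuous[OF \<theta>s]] by (simp add: measurable_completion)
      show "(\<lambda>r. indicator {0<..<T} r * (\<theta> n r * g r)) \<in> Lmeas" for n
        using borel_measurable_times[OF \<theta>m gm, of n] by (simp add: mult.left_commute)
      have "(\<lambda>r. indicator {s..<t} r * (indicator {0<..<T} r * g r)) \<in> Lmeas"
        by (rule borel_measurable_times[OF ind gm])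
      moreover have "indicator {s..<t} r * (indicator {0<..<T} r * g r) = indicator {s..<t} r * g r" for r
        using s t by (auto simp: indicator_def)
      ultimately show "(\<lambda>r. indicator {s..<t} r * g r) \<in> Lmeas" by simp
      have \<theta>b: "\<bar>\<theta> n r\<bar> \<le> 2" for n r
        using J(4,5)[of "real (Suc n) * (r - s)"] J(4,5)[of "real (Suc n) * (r - t)"] unfolding \<theta>_def by linarith
      show "AE r in lebesgue. norm (indicator {0<..<T} r * (\<theta> n r * g r)) \<le> 2 * norm (indicator {0<..<T} r * g r)" for n
        by (rule AE_I2) (use \<theta>b in \<open>auto simp: indicator_def abs_mult intro!: mult_right_mono\<close>)
      have "AE r in lebesgue. r \<noteq> s \<and> r \<noteq> t"
        by (rule AE_completion) (intro AE_conjI AE_lborel_singleton)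
      then show "AE r in lebesgue. (\<lambda>n. indicator {0<..<T} r * (\<theta> n r * g r)) \<longlonglongrightarrow> indicator {s..<t} r * g r"
      proof eventually_elim
        case (elim r)
        have step: "\<forall>\<^sub>F n in sequentially. J (real (Suc n) * (r - a)) = (if r < a then 0 else 1)" if "r \<noteq> a" for a
        proof -
          obtain N where N: "1 / \<bar>r - a\<bar> < real N" using reals_Archimedean2 by blast
          have "J (real (Suc n) * (r - a)) = (if r < a then 0 else 1)" if n: "n \<ge> N" for n
          proof -
            have "1 / \<bar>r - a\<bar> < real (Suc n)" using N n by linarith
            then have *: "1 < real (Suc n) * \<bar>r - a\<bar>" using \<open>r \<noteq> a\<close> by (simp only: pos_divide_less_eq zero_less_abs_iff right_minus_eq not_False_eq_True)
            show ?thesis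
            proof (cases "r < a")
              case True
              have "real (Suc n) * (r - a) = - (real (Suc n) * \<bar>r - a\<bar>)" using True by (simp add: algebra_simps)
              then show ?thesis using * J(2)[of "real (Suc n) * (r - a)"] True by simp
            next
              case False
              have "real (Suc n) * (r - a) = real (Suc n) * \<bar>r - a\<bar>" using False by simp
              then show ?thesis using * J(3)[of "real (Suc n) * (r - a)"] False by simp
            qed
          qed
          then show ?thesis unfolding eventually_sequentially by blast
        qed
        have "\<forall>\<^sub>F n in sequentially. indicator {0<..<T} r * (\<theta> n r * g r) = indicator {s..<t} r * g r"
          using step[OF conjunct1[OF elim]] step[OF conjunct2[OF elim]]
        proof eventually_elim
          case (elim n)
          then show ?case using s t by (auto simp: \<theta>_def indicator_def split: if_splits)
        qed
        then show ?case by (rule tendsto_eventually)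
      qed
    qed
    show ?thesis using LIMSEQ_unique[OF lim2 lim3] by simp
  qed
  consider "s = t" | "0 < s" "s < t" | "s = 0" "s < t" using st by linarith
  then show ?thesis
  proof cases
    case 1 then show ?thesis by simp
  next
    case 2 then show ?thesis by (rule pos)
  next
    case 3
    \<comment> \<open>the shift by two keeps \<open>a n\<close> strictly below \<open>t\<close>\<close>
    define a where "a n = t / real (Suc (Suc n))" for n
    have t: "0 < t" using 3 by simp
    have a: "0 < a n" "a n < t" for n
    proof -
      have "t * 1 < t * real (Suc (Suc n))" by (rule mult_strict_left_mono) (use t in auto)
      then show "0 < a n" "a n < t" using t by (auto simp: a_def divide_less_eq)
    qed
    have a0: "a \<longlonglongrightarrow> 0"
      unfolding a_def using LIMSEQ_Suc[OF LIMSEQ_Suc[OF lim_const_over_n[of t]]] by simp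
    have "(\<lambda>n. f (a n)) \<longlonglongrightarrow> f 0"
    proof (rule continuous_on_tendsto_compose[OF f a0])
      show "0 \<in> {0..<T}" using st t by auto
      show "\<forall>\<^sub>F n in sequentially. a n \<in> {0..<T}" using a st by (intro always_eventually allI) (auto intro: less_imp_le less_trans)
    qed
    then have l1: "(\<lambda>n. f t - f (a n)) \<longlonglongrightarrow> f t - f 0" by (intro tendsto_intros)
    have eqn: "f t - f (a n) = - (LINT r|lebesgue. indicator {a n..<t} r * g r)" for n by (rule pos[OF a])
    have "(\<lambda>n. LINT r|lebesgue. indicator {a n..<t} r * g r) \<longlonglongrightarrow> (LINT r|lebesgue. indicator {0..<t} r * g r)"
    proof (rule integral_dominated_convergence)
      show "integrable lebesgue (\<lambda>r. norm (indicator {0<..<T} r * g r))" using g by simp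
      show "(\<lambda>r. indicator {a n..<t} r * g r) \<in> Lmeas" for n
        by (rule interior_indicator_measurable[OF gm]) (use a[of n] st in auto)
      show "AE r in lebesgue. norm (indicator {a n..<t} r * g r) \<le> norm (indicator {0<..<T} r * g r)" for n
        by (rule AE_I2) (use a[of n] st in \<open>auto simp: indicator_def\<close>)
      have ae: "AE r in lebesgue. r \<noteq> 0" by (rule AE_completion) (rule AE_lborel_singleton)
      then show "AE r in lebesgue. (\<lambda>n. indicator {a n..<t} r * g r) \<longlonglongrightarrow> indicator {0..<t} r * g r"
      proof eventually_elim
        case (elim r)
        have "\<forall>\<^sub>F n in sequentially. indicator {a n..<t} r * g r = indicator {0..<t} r * g r"
        proof (cases "0 < r")
          case True
          have "\<forall>\<^sub>F n in sequentially. a n < r" using order_tendstoD(2)[OF a0 True] .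
          then show ?thesis by eventually_elim (use True in \<open>auto simp: indicator_def\<close>)
        next
          case False
          have "a n > r" for n using a(1)[of n] False by linarith
          then show ?thesis using elim False by (intro always_eventually allI) (auto simp: indicator_def not_le)
        qed
        then show ?case by (rule tendsto_eventually)
      qed
      show "(\<lambda>r. indicator {0..<t} r * g r) \<in> Lmeas"
        by (rule interior_indicator_measurable[OF gm]) (use st in auto)
    qed
    then have "(\<lambda>n. f t - f (a n)) \<longlonglongrightarrow> - (LINT r|lebesgue. indicator {0..<t} r * g r)"
      unfolding eqn by (rule tendsto_minus)
    from LIMSEQ_unique[OF l1 this] show ?thesis using 3 by simp
  qed
qed

text \<open>Sum \<open>inc\<close> over the uniform partition of \<open>[0, t]\<close>. At a given \<open>r\<close> only the cell
  containing \<open>r\<close> contributes, and by continuity of \<open>k r\<close> its two end points may both be replaced by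
  \<open>r\<close> in the limit.\<close>

lemma riemann_quadratic_increment:
  fixes H :: "real \<Rightarrow> real" and k :: "real \<Rightarrow> real \<Rightarrow> real"
  assumes inc: "\<And>a b. 0 \<le> a \<Longrightarrow> a \<le> b \<Longrightarrow> b < T \<Longrightarrow> H b - H a = (LINT r|lebesgue. indicator {a..<b} r * (k r a + k r b))"
    and meas: "\<And>s. s \<in> {0..<T} \<Longrightarrow> (\<lambda>r. indicator {0<..<T} r * k r s) \<in> Lmeas"
    and cont: "AE r in lebesgue. r \<in> {0<..<T} \<longrightarrow> continuous_on {0..<T} (k r)"
    and bd: "AE r in lebesgue. r \<in> {0<..<T} \<longrightarrow> (\<forall>s\<in>{0..<T}. \<bar>k r s\<bar> \<le> M r)"
    and M: "integrable lebesgue (\<lambda>r. indicator {0<..<T} r * M r)"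
    and t: "t \<in> {0..<T}"
  shows "H t - H 0 = 2 * (LINT r|lebesgue. indicator {0..<t} r * k r r)"
    "(\<lambda>r. indicator {0..<t} r * k r r) \<in> Lmeas"
proof -
  define p where "p n i = real i * t / real (Suc n)" for n i :: nat
  have p0: "p n 0 = 0" "p n (Suc n) = t" for n by (auto simp: p_def)
  have pm: "p n i \<le> p n (Suc i)" for n i unfolding p_def using t by (intro divide_right_mono mult_right_mono) auto
  have p_le: "p n i \<le> t" if "i \<le> Suc n" for n i
  proof -
    have "real i * t \<le> real (Suc n) * t" using t that by (intro mult_right_mono) (auto simp del: of_nat_Suc)
    then show ?thesis by (simp add: p_def divide_le_eq mult.commute del: of_nat_Suc)
  qed
  have pr: "p n i \<in> {0..<T}" if "i \<le> Suc n" for n i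
    using t p_le[OF that] by (auto simp: p_def)
  define S where "S n r = (\<Sum>i<Suc n. indicator {p n i..<p n (Suc i)} r * (k r (p n i) + k r (p n (Suc i))))" for n r
  have ind: "(indicator {a..<b} :: real \<Rightarrow> real) \<in> Lmeas" for a b :: real
    by (rule measurable_completion) simp
  have ae0: "AE r in lebesgue. r \<noteq> (0::real)" by (rule AE_completion) (rule AE_lborel_singleton)
  have bdi: "integrable lebesgue (\<lambda>r. indicator {p n i..<p n (Suc i)} r * (k r (p n i) + k r (p n (Suc i))))" if i: "i < Suc n" for n i
  proof (rule Bochner_Integration.integrable_bound)
    show "integrable lebesgue (\<lambda>r. 2 * (indicator {0<..<T} r * M r))" using M by simp
    have s: "p n i \<in> {0..<T}" "p n (Suc i) \<in> {0..<T}" using pr i by auto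
    have "(\<lambda>r. indicator {0<..<T} r * (k r (p n i) + k r (p n (Suc i)))) \<in> Lmeas"
      unfolding distrib_left by (intro borel_measurable_add meas s)
    then show "(\<lambda>r. indicator {p n i..<p n (Suc i)} r * (k r (p n i) + k r (p n (Suc i)))) \<in> Lmeas"
      by (rule interior_indicator_measurable) (use s in auto)
    show "AE r in lebesgue. norm (indicator {p n i..<p n (Suc i)} r * (k r (p n i) + k r (p n (Suc i)))) \<le> norm (2 * (indicator {0<..<T} r * M r))"
      using ae0 bd
    proof eventually_elim
      case (elim r)
      show ?case
      proof (cases "r \<in> {p n i..<p n (Suc i)}")
        case True
        then have r: "r \<in> {0<..<T}" using s elim(1) by auto
        then have "\<bar>k r (p n i)\<bar> \<le> M r" "\<bar>k r (p n (Suc i))\<bar> \<le> M r" using elim(2) s by auto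
        then have "\<bar>k r (p n i) + k r (p n (Suc i))\<bar> \<le> \<bar>2 * M r\<bar>" by linarith
        then show ?thesis using r True by simp
      qed simp
    qed
  qed
  have SH: "(LINT r|lebesgue. S n r) = H t - H 0" for n
  proof -
    have "(LINT r|lebesgue. S n r) = (\<Sum>i<Suc n. (LINT r|lebesgue. indicator {p n i..<p n (Suc i)} r * (k r (p n i) + k r (p n (Suc i)))))"
      unfolding S_def by (rule Bochner_Integration.integral_sum) (use bdi in auto)
    also have "\<dots> = (\<Sum>i<Suc n. H (p n (Suc i)) - H (p n i))"
    proof (rule sum.cong[OF refl])
      fix i assume "i \<in> {..<Suc n}"
      then show "(LINT r|lebesgue. indicator {p n i..<p n (Suc i)} r * (k r (p n i) + k r (p n (Suc i)))) = H (p n (Suc i)) - H (p n i)"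
        using pr[of i n] pr[of "Suc i" n] pm[of n i] by (intro inc[symmetric]) auto
    qed
    also have "\<dots> = H (p n (Suc n)) - H (p n 0)" by (rule sum_lessThan_telescope)
    finally show ?thesis by (simp add: p0)
  qed
  have point: "\<exists>i<Suc n. S n r = k r (p n i) + k r (p n (Suc i)) \<and> \<bar>p n i - r\<bar> \<le> t / real (Suc n) \<and> \<bar>p n (Suc i) - r\<bar> \<le> t / real (Suc n)"
    if r: "r \<in> {0..<t}" for n r
  proof -
    have t0: "t > 0" using r by auto
    \<comment> \<open>\<open>r\<close> measured in cell lengths; its integer part is the index of the cell\<close>
    define x where "x = r * real (Suc n) / t"
    have x0: "0 \<le> x" using r t0 by (simp add: x_def)
    have xl: "x < real (Suc n)" using r t0 by (simp add: x_def divide_less_eq mult.commute)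
    define i where "i = nat \<lfloor>x\<rfloor>"
    have xi: "real i \<le> x" "x < real i + 1" using x0 by (auto simp: i_def)
    have iN: "i < Suc n" using xi xl by linarith
    have inI: "r \<in> {p n j..<p n (Suc j)} \<longleftrightarrow> real j \<le> x \<and> x < real (Suc j)" for j
      using t0 by (auto simp: p_def x_def field_simps)
    have uniq: "real j \<le> x \<and> x < real (Suc j) \<longleftrightarrow> j = i" for j
    proof
      assume "real j \<le> x \<and> x < real (Suc j)"
      then have "real j < real i + 1" "real i < real j + 1" using xi by auto
      then show "j = i" by linarith
    qed (use xi in auto)
    have "S n r = (\<Sum>j<Suc n. if j = i then k r (p n j) + k r (p n (Suc j)) else 0)"
      unfolding S_def indicator_def inI uniq by (rule sum.cong) auto
    also have "\<dots> = k r (p n i) + k r (p n (Suc i))" using iN by (simp add: sum.delta)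
    finally have 1: "S n r = k r (p n i) + k r (p n (Suc i))" .
    have ri: "p n i \<le> r" "r < p n (Suc i)" using inI[of i] uniq[of i] by auto
    have len: "p n (Suc i) - p n i = t / real (Suc n)"
      unfolding p_def diff_divide_distrib[symmetric] by (simp add: algebra_simps)
    have "\<bar>p n i - r\<bar> \<le> t / real (Suc n)" "\<bar>p n (Suc i) - r\<bar> \<le> t / real (Suc n)" using ri len by linarith+
    with 1 iN show ?thesis by blast
  qed
  have out: "S n r = 0" if r: "r \<notin> {0..<t}" for n r
  proof -
    have "r \<notin> {p n i..<p n (Suc i)}" if "i < Suc n" for i
    proof -
      have "0 \<le> p n i" using pr[of i n] that by simp
      moreover have "p n (Suc i) \<le> t" using p_le that by simp
      ultimately show ?thesis using r by auto
    qed
    then show ?thesis by (simp add: S_def)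
  qed
  have lim: "AE r in lebesgue. (\<lambda>n. S n r) \<longlonglongrightarrow> 2 * (indicator {0..<t} r * k r r)"
    using ae0 cont
  proof eventually_elim
    case (elim r)
    show ?case
    proof (cases "r \<in> {0..<t}")
      case True
      then have rT: "r \<in> {0<..<T}" using t elim(1) by auto
      then have c: "continuous_on {0..<T} (k r)" using elim(2) by blast
      obtain i where i: "\<And>n. i n < Suc n" "\<And>n. S n r = k r (p n (i n)) + k r (p n (Suc (i n)))"
          "\<And>n. \<bar>p n (i n) - r\<bar> \<le> t / real (Suc n)" "\<And>n. \<bar>p n (Suc (i n)) - r\<bar> \<le> t / real (Suc n)"
        using point[OF True] by metis
      have l0: "(\<lambda>n. t / real (Suc n)) \<longlonglongrightarrow> 0" by (rule LIMSEQ_Suc[OF lim_const_over_n])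
      have conv: "q \<longlonglongrightarrow> r" if "\<And>n. \<bar>q n - r\<bar> \<le> t / real (Suc n)" for q :: "nat \<Rightarrow> real"
      proof -
        have "(\<lambda>n. q n - r) \<longlonglongrightarrow> 0" by (rule Lim_null_comparison[OF _ l0]) (use that in simp)
        then show ?thesis by (simp add: LIM_zero_iff)
      qed
      have kq: "(\<lambda>n. k r (q n)) \<longlonglongrightarrow> k r r" if "q \<longlonglongrightarrow> r" "\<And>n. q n \<in> {0..<T}" for q
        by (rule continuous_on_tendsto_compose[OF c that(1)]) (use rT that(2) in auto)
      have "(\<lambda>n. k r (p n (i n)) + k r (p n (Suc (i n)))) \<longlonglongrightarrow> k r r + k r r"
        by (intro tendsto_add kq conv i(3,4) pr) (use i(1) in \<open>auto simp: less_imp_le Suc_le_eq\<close>)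
      then show ?thesis using True by (simp add: i(2))
    next
      case False
      then show ?thesis by (simp add: out)
    qed
  qed
  have Sm: "S n \<in> Lmeas" for n
    unfolding S_def using bdi by (intro borel_measurable_sum borel_measurable_integrable) auto
  define L where "L r = lim (\<lambda>n. S n r)" for r
  have Lm: "L \<in> Lmeas" unfolding L_def by (rule borel_measurable_lim_metric[OF Sm])
  have "AE r in lebesgue. L r = 2 * (indicator {0..<t} r * k r r)" using lim by eventually_elim (simp add: L_def limI)
  then have m2: "(\<lambda>r. 2 * (indicator {0..<t} r * k r r)) \<in> Lmeas" by (rule borel_measurable_AE[OF Lm])
  from borel_measurable_times[OF borel_measurable_const[of "1/2"] this]
  show "(\<lambda>r. indicator {0..<t} r * k r r) \<in> Lmeas" by simp
  have "(\<lambda>n. LINT r|lebesgue. S n r) \<longlonglongrightarrow> (LINT r|lebesgue. 2 * (indicator {0..<t} r * k r r))"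
  proof (rule integral_dominated_convergence[OF m2 Sm _ lim])
    show "integrable lebesgue (\<lambda>r. 2 * (indicator {0<..<T} r * M r))" using M by simp
    show "AE r in lebesgue. norm (S n r) \<le> 2 * (indicator {0<..<T} r * M r)" for n
      using ae0 bd
    proof eventually_elim
      case (elim r)
      show ?case
      proof (cases "r \<in> {0..<t}")
        case True
        then have rT: "r \<in> {0<..<T}" using t elim(1) by auto
        obtain i where i: "i < Suc n" "S n r = k r (p n i) + k r (p n (Suc i))" using point[OF True] by blast
        have "\<bar>k r (p n i)\<bar> \<le> M r" "\<bar>k r (p n (Suc i))\<bar> \<le> M r" using elim(2) rT pr[of i n] pr[of "Suc i" n] i(1) by auto
        then have "\<bar>S n r\<bar> \<le> 2 * M r" unfolding i(2) by linarith
        then show ?thesis using rT by simp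
      next
        case False
        have "0 \<le> indicator {0<..<T} r * M r"
        proof (cases "r \<in> {0<..<T}")
          case True
          have "0 \<in> {0..<T}" using t by auto
          then have "\<bar>k r 0\<bar> \<le> M r" using elim(2) True by blast
          then show ?thesis using True by simp
        qed simp
        then show ?thesis by (simp add: out[OF False])
      qed
    qed
  qed
  then have "(\<lambda>n. H t - H 0) \<longlonglongrightarrow> (LINT r|lebesgue. 2 * (indicator {0..<t} r * k r r))" unfolding SH .
  then have "H t - H 0 = (LINT r|lebesgue. 2 * (indicator {0..<t} r * k r r))" by (simp add: LIMSEQ_const_iff)
  then show "H t - H 0 = 2 * (LINT r|lebesgue. indicator {0..<t} r * k r r)" by simp
qed

section \<open>The momentum equation tested with solenoidal fields\<close>

lemma weak_pairing_measurable:
  assumes wc: "weakly_continuous_L2 T u" and g: "L2 g"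
  shows "(\<lambda>t. indicator {0<..<T} t * ip (u t) g) \<in> Lmeas"
proof -
  have "continuous_on {0<..<T} (\<lambda>t. ip (u t) g)"
    by (rule continuous_on_subset[OF weak_continuityD(2)[OF wc g]]) auto
  then have "(\<lambda>t. indicator {0<..<T} t *\<^sub>R ip (u t) g) \<in> borel_measurable borel"
    by (intro borel_measurable_continuous_on_indicator) auto
  then show ?thesis by (intro measurable_completion) simp
qed

lemma smooth_compact_support_L2:
  fixes \<psi> :: "real^3 \<Rightarrow> 'b::euclidean_space"
  assumes s: "smooth \<psi>" and R: "\<And>x. norm x > R \<Longrightarrow> \<psi> x = 0"
  shows "L2 \<psi>"
proof -
  have c: "continuous_on UNIV \<psi>" by (rule smooth_continuous[OF s])
  have "compact (\<psi> ` cball 0 R)" by (rule compact_continuous_image[OF continuous_on_subset[OF c]]) auto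
  then obtain B where B: "0 < B" "\<And>x. x \<in> cball 0 R \<Longrightarrow> norm (\<psi> x) \<le> B"
    using compact_imp_bounded bounded_pos by (metis image_eqI)
  have iL: "integrable lborel (indicator (cball (0::real^3) R) :: _ \<Rightarrow> real)"
    by (intro integrable_real_indicator) (use emeasure_bounded_finite[OF bounded_cball] in \<open>auto simp: top.not_eq_extremum\<close>)
  have "integrable lebesgue (indicator (cball (0::real^3) R) :: _ \<Rightarrow> real)"
    using iL borel_measurable_integrable[OF iL] by (simp only: integrable_completion)
  moreover have "(norm (indicator (cball (0::real^3) R) x :: real))\<^sup>2 = indicator (cball 0 R) x" for x by (simp add: indicator_def)
  ultimately have I: "L2 (indicator (cball (0::real^3) R) :: _ \<Rightarrow> real)"
    unfolding L2_def using borel_measurable_indicator[OF cball_in_lebesgue] by simp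
  show ?thesis
  proof (rule L2_dominated(1)[OF I, of _ B])
    show "\<psi> \<in> Lmeas"
      by (rule measurable_completion) (simp add: borel_measurable_continuous_onI c)
    show "AE x in lebesgue. norm (\<psi> x) \<le> B * norm (indicator (cball 0 R) x :: real)"
      using B R by (intro AE_I2) (auto simp: indicator_def not_le)
  qed (use B in simp)
qed

lemma solenoidal_test_L2:
  assumes \<psi>: "solenoidal_test \<psi>"
  shows "L2 \<psi>" "L2 (classical_laplace \<psi>)"
proof -
  have s: "smooth \<psi>" using \<psi> by (simp add: solenoidal_test_def)
  obtain R where R: "\<And>x. norm x > R \<Longrightarrow> \<psi> x = 0" using \<psi> by (auto simp: solenoidal_test_def)
  show "L2 \<psi>" by (rule smooth_compact_support_L2[OF s R])
  have S: "open {x :: real^3. norm x > R}" by (intro open_Collect_less continuous_intros)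
  have 1: "dir_deriv b \<psi> x = 0" if "norm x > R" for b x
    by (rule dir_deriv_local_zero[OF S]) (use that R in auto)
  have 2: "dir_deriv b (dir_deriv b \<psi>) x = 0" if "norm x > R" for b x
    by (rule dir_deriv_local_zero[OF S]) (use that 1 in auto)
  show "L2 (classical_laplace \<psi>)"
  proof (rule smooth_compact_support_L2)
    show "smooth (classical_laplace \<psi>)"
      unfolding classical_laplace_def by (intro smooth_sum smooth_dir_deriv s axis_Basis3)
    show "classical_laplace \<psi> x = 0" if "norm x > R" for x using 2[OF that] by (simp add: classical_laplace_def)
  qed
qed

text \<open>The weak time derivative of \<open>\<langle>u, \<psi>\<rangle>\<close> when \<open>v = u\<close> and \<open>l\<close>
  is the Laplacian of \<open>\<psi>\<close>. The two are independent arguments because both converge in \<open>L\<^sup>2\<close>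
  separately when test fields are approximated.\<close>

definition weak_tendency :: "real \<Rightarrow> (real^3 \<Rightarrow> real^3) \<Rightarrow> (real^3 \<Rightarrow> real^3) \<Rightarrow> (real^3 \<Rightarrow> real^3) \<Rightarrow> real" where
  "weak_tendency \<nu> v \<psi> l = \<nu> * ip v l - ip (advection v) \<psi>"

lemma L2_norm_le_sobolev_norm:
  assumes v: "sobolev s v" and s: "0 \<le> s" shows "L2_norm v \<le> sobolev_norm s v"
proof -
  have "L2_norm (fourier v) \<le> 1 * sobolev_norm s v"
    by (rule sobolev_dominated(2)[OF v L2_measurable[OF fourier_L2[OF sobolev_L2[OF v]]]])
       (use mult_right_mono[OF one_le_weight[OF s] norm_ge_zero] in \<open>auto intro!: AE_I2\<close>)
  then show ?thesis by (simp add: fourier_L2_norm[OF sobolev_L2[OF v]])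
qed

text \<open>The right-hand side is a function of time integrable over \<open>(0, T)\<close> for fields in
  \<open>L\<^sup>2(0,T;H\<^sup>2)\<close>.\<close>

lemma weak_tendency_bound:
  assumes v: "sobolev 2 v" and \<psi>: "L2 \<psi>" and l: "L2 l" and \<nu>: "0 \<le> \<nu>"
  shows "\<bar>weak_tendency \<nu> v \<psi> l\<bar> \<le> (\<nu> * L2_norm l + 3 * sobolev_const * L2_norm \<psi>) * (1 + (sobolev_norm 2 v)\<^sup>2)"
proof -
  let ?N = "sobolev_norm 2 v"
  have N: "0 \<le> ?N" by (simp add: sobolev_norm_def)
  have N1: "?N \<le> 1 + ?N\<^sup>2"
  proof -
    \<comment> \<open>bounds the first power by the square, so that one integrable majorant serves both terms\<close>
    have "0 \<le> (?N - 1/2)\<^sup>2" by simp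
    moreover have "(?N - 1/2)\<^sup>2 = ?N\<^sup>2 - ?N + 1/4" by (simp add: power2_eq_square algebra_simps)
    ultimately show ?thesis by linarith
  qed
  have "\<bar>ip v l\<bar> \<le> L2_norm v * L2_norm l" by (rule L2_inner_bound[OF sobolev_L2[OF v] l])
  also have "\<dots> \<le> (1 + ?N\<^sup>2) * L2_norm l" using L2_norm_le_sobolev_norm[OF v] N1 by (intro mult_right_mono) auto
  finally have 1: "\<nu> * \<bar>ip v l\<bar> \<le> \<nu> * ((1 + ?N\<^sup>2) * L2_norm l)" using \<nu> by (rule mult_left_mono)
  have "\<bar>ip (advection v) \<psi>\<bar> \<le> L2_norm (advection v) * L2_norm \<psi>" by (rule L2_inner_bound[OF advection_L2(1)[OF v] \<psi>])
  also have "\<dots> \<le> (3 * sobolev_const * ?N\<^sup>2) * L2_norm \<psi>" by (rule mult_right_mono[OF advection_L2(2)[OF v]]) simp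
  also have "\<dots> \<le> (3 * sobolev_const * (1 + ?N\<^sup>2)) * L2_norm \<psi>"
    using sobolev_const_nonneg by (intro mult_right_mono mult_left_mono) auto
  finally have 2: "\<bar>ip (advection v) \<psi>\<bar> \<le> (3 * sobolev_const * (1 + ?N\<^sup>2)) * L2_norm \<psi>" .
  have "\<bar>weak_tendency \<nu> v \<psi> l\<bar> \<le> \<nu> * \<bar>ip v l\<bar> + \<bar>ip (advection v) \<psi>\<bar>"
    unfolding weak_tendency_def using abs_triangle_ineq4[of "\<nu> * ip v l" "ip (advection v) \<psi>"] \<nu> by (simp add: abs_mult)
  also have "\<dots> \<le> \<nu> * ((1 + ?N\<^sup>2) * L2_norm l) + (3 * sobolev_const * (1 + ?N\<^sup>2)) * L2_norm \<psi>" by (rule add_mono[OF 1 2])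
  finally show ?thesis by (simp add: algebra_simps)
qed

lemma weak_tendency_measurable:
  assumes wc: "weakly_continuous_L2 T u" and H2: "L2_sobolev T 2 u" and \<psi>: "L2 \<psi>" and l: "L2 l"
  shows "(\<lambda>t. indicator {0<..<T} t * weak_tendency \<nu> (u t) \<psi> l) \<in> Lmeas"
proof -
  have sm: "spacetime_measurable T u" using H2 by (simp add: L2_sobolev_def)
  have "(\<lambda>t. \<nu> * (indicator {0<..<T} t * ip (u t) l) - indicator {0<..<T} t * ip (advection (u t)) \<psi>) \<in> Lmeas"
    by (intro borel_measurable_diff borel_measurable_times borel_measurable_const
        weak_pairing_measurable[OF wc l] advection_time_measurable[OF sm L2_sobolevD(1)[OF H2] \<psi>])
  then show ?thesis unfolding weak_tendency_def by (simp add: algebra_simps)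
qed

lemma sobolev_norm_weight_integrable:
  assumes H2: "L2_sobolev T 2 u"
  shows "integrable lebesgue (\<lambda>t. indicator {0<..<T} t * (A * (1 + (sobolev_norm 2 (u t))\<^sup>2)))"
proof -
  have "integrable lborel (indicator {0<..<T} :: real \<Rightarrow> real)" by (intro integrable_real_indicator) (use emeasure_bounded_finite[OF bounded_box[of 0 T]] in \<open>auto simp: box_real\<close>)
  then have "integrable lebesgue (indicator {0<..<T} :: real \<Rightarrow> real)" by (rule integrable_completion[THEN iffD2, rotated]) simp
  then have "integrable lebesgue (\<lambda>t. A * (indicator {0<..<T} t + indicator {0<..<T} t * (sobolev_norm 2 (u t))\<^sup>2))"
    using L2_sobolevD(2)[OF H2] by (intro integrable_mult_right Bochner_Integration.integrable_add)
  then show ?thesis by (simp add: algebra_simps)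
qed

lemma weak_tendency_integrable:
  assumes wc: "weakly_continuous_L2 T u" and H2: "L2_sobolev T 2 u" and \<psi>: "L2 \<psi>" and l: "L2 l" and \<nu>: "0 \<le> \<nu>"
  shows "integrable lebesgue (\<lambda>t. indicator {0<..<T} t * weak_tendency \<nu> (u t) \<psi> l)"
proof (rule Bochner_Integration.integrable_bound[OF sobolev_norm_weight_integrable[OF H2] weak_tendency_measurable[OF wc H2 \<psi> l]])
  show "AE t in lebesgue. norm (indicator {0<..<T} t * weak_tendency \<nu> (u t) \<psi> l)
      \<le> norm (indicator {0<..<T} t * ((\<nu> * L2_norm l + 3 * sobolev_const * L2_norm \<psi>) * (1 + (sobolev_norm 2 (u t))\<^sup>2)))"
    using L2_sobolevD(1)[OF H2]
  proof eventually_elim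
    case (elim t)
    then show ?case using weak_tendency_bound[OF _ \<psi> l \<nu>, of "u t"] by (auto simp: indicator_def intro: order_trans[OF _ abs_ge_self])
  qed
qed

lemma time_weighted_integrable:
  fixes \<theta> g :: "real \<Rightarrow> real"
  assumes c: "continuous_on UNIV \<theta>" and ab: "\<And>t. t \<notin> {a..b} \<Longrightarrow> \<theta> t = 0"
    and g: "integrable lebesgue (\<lambda>t. indicator {0<..<T} t * g t)"
  shows "integrable lebesgue (\<lambda>t. indicator {0<..<T} t * (\<theta> t * g t))"
proof -
  have "compact (\<theta> ` {a..b})" by (rule compact_continuous_image[OF continuous_on_subset[OF c]]) auto
  then obtain B where B: "0 < B" "\<And>x. x \<in> {a..b} \<Longrightarrow> norm (\<theta> x) \<le> B"
    using compact_imp_bounded bounded_pos by (metis image_eqI)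
  have b: "\<bar>\<theta> t\<bar> \<le> B" for t using B ab[of t] by (cases "t \<in> {a..b}") auto
  show ?thesis
  proof (rule Bochner_Integration.integrable_bound)
    show "integrable lebesgue (\<lambda>t. B * (indicator {0<..<T} t * g t))" using g by simp
    have "\<theta> \<in> Lmeas" by (rule measurable_completion) (simp add: borel_measurable_continuous_onI c)
    then have "(\<lambda>t. \<theta> t * (indicator {0<..<T} t * g t)) \<in> Lmeas"
      by (rule borel_measurable_times) (use g in auto)
    then show "(\<lambda>t. indicator {0<..<T} t * (\<theta> t * g t)) \<in> Lmeas" by (simp add: mult.left_commute)
    show "AE t in lebesgue. norm (indicator {0<..<T} t * (\<theta> t * g t)) \<le> norm (B * (indicator {0<..<T} t * g t))"
      using b B(1) by (intro AE_I2) (auto simp: indicator_def abs_mult intro: mult_right_mono)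
  qed
qed

text \<open>Tensor test functions \<open>\<theta>(t) \<psi>(x)\<close> make the momentum equation the weak form of an ordinary
  differential equation for \<open>\<langle>u, \<psi>\<rangle>\<close>.\<close>

lemma momentum_increment:
  assumes wc: "weakly_continuous_L2 T u" and H2: "L2_sobolev T 2 u" and mom: "momentum_equation \<nu> T u p"
    and \<nu>: "0 \<le> \<nu>" and \<psi>: "solenoidal_test \<psi>" and ab: "0 \<le> a" "a \<le> b" "b < T"
  shows "ip (u b) \<psi> - ip (u a) \<psi> = (LINT r|lebesgue. indicator {a..<b} r * weak_tendency \<nu> (u r) \<psi> (classical_laplace \<psi>))"
proof -
  let ?l = "classical_laplace \<psi>" and ?I = "indicator {0<..<T} :: real \<Rightarrow> real"
  note L = solenoidal_test_L2[OF \<psi>]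
  let ?g = "\<lambda>r. - weak_tendency \<nu> (u r) \<psi> ?l"
  \<comment> \<open>the instances with \<open>\<nu> = 0\<close> and with \<open>\<psi> = 0\<close> isolate the two parts of the tendency\<close>
  have adv: "integrable lebesgue (\<lambda>t. ?I t * ip (advection (u t)) \<psi>)"
    using weak_tendency_integrable[OF wc H2 L(1) L2_zero, of 0] by (simp add: weak_tendency_def)
  have pair: "integrable lebesgue (\<lambda>t. ?I t * ip (u t) g)" if "L2 g" for g
    using weak_tendency_integrable[OF wc H2 L2_zero that, of 1] by (simp add: weak_tendency_def)
  have "ip (u b) \<psi> - ip (u a) \<psi> = - (LINT r|lebesgue. indicator {a..<b} r * ?g r)"
  proof (rule du_bois_reymond[OF weak_continuityD(2)[OF wc L(1)] _ _ ab])
    show "integrable lebesgue (\<lambda>r. ?I r * ?g r)" using weak_tendency_integrable[OF wc H2 L \<nu>] by simp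
    fix \<theta> assume \<theta>: "time_test T \<theta>"
    obtain c d where cd: "\<And>t. t \<notin> {c..d} \<Longrightarrow> \<theta> t = 0" using \<theta> by (auto simp: time_test_def)
    have s\<theta>: "smooth \<theta>" using \<theta> by (simp add: time_test_def)
    let ?D = "dir_deriv 1 \<theta>"
    have s\<theta>': "smooth ?D" by (rule smooth_dir_deriv[OF s\<theta>]) simp
    have cd': "?D t = 0" if "t \<notin> {c..d}" for t
      by (rule dir_deriv_local_zero[of "- {c..d}"]) (use that cd in auto)
    note i1 = time_weighted_integrable[OF smooth_continuous[OF s\<theta>'] cd' pair[OF L(1)]]
    note i2 = time_weighted_integrable[OF smooth_continuous[OF s\<theta>] cd adv]
    note i3 = time_weighted_integrable[OF smooth_continuous[OF s\<theta>] cd pair[OF L(2)]]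
    let ?A = "\<lambda>t. - (?I t * (?D t * ip (u t) \<psi>)) + ?I t * (\<theta> t * ip (advection (u t)) \<psi>)"
    let ?B = "\<lambda>t. \<nu> * (?I t * (\<theta> t * ip (u t) ?l))"
    let ?\<phi> = "tensor \<theta> \<psi>"
    note tf = test_function_tensor[OF \<theta> \<psi>]
    have "(LINT t:{0<..<T}|lebesgue. LINT x|lebesgue.
           - (u t x \<bullet> d_t ?\<phi> (t, x)) + advection (u t) x \<bullet> ?\<phi> (t, x) - p t x * div_x ?\<phi> (t, x))
      = (LINT t:{0<..<T}|lebesgue. LINT x|lebesgue. \<nu> * (u t x \<bullet> laplace_x ?\<phi> (t, x)))"
      using mom tf(1) unfolding momentum_equation_def by blast
    moreover have "(LINT t:{0<..<T}|lebesgue. LINT x|lebesgue.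
           - (u t x \<bullet> d_t ?\<phi> (t, x)) + advection (u t) x \<bullet> ?\<phi> (t, x) - p t x * div_x ?\<phi> (t, x)) = (LINT t|lebesgue. ?A t)"
    proof -
      have m: "?A \<in> Lmeas" using i1 i2 by (intro borel_measurable_add borel_measurable_uminus) auto
      have "AE t in lebesgue. ?A t = ?I t *\<^sub>R (LINT x|lebesgue.
           - (u t x \<bullet> d_t ?\<phi> (t, x)) + advection (u t) x \<bullet> ?\<phi> (t, x) - p t x * div_x ?\<phi> (t, x))"
        using L2_sobolevD(1)[OF H2]
      proof eventually_elim
        case (elim t)
        show ?case
        proof (cases "t \<in> {0<..<T}")
          case True
          then have v: "sobolev 2 (u t)" using elim by simp
          note ii = L2_inner_integrable[OF sobolev_L2[OF v] L(1)] L2_inner_integrable[OF advection_L2(1)[OF v] L(1)]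
          have "(LINT x|lebesgue. - (u t x \<bullet> d_t ?\<phi> (t, x)) + advection (u t) x \<bullet> ?\<phi> (t, x) - p t x * div_x ?\<phi> (t, x))
            = (LINT x|lebesgue. - (?D t * (u t x \<bullet> \<psi> x)) + \<theta> t * (advection (u t) x \<bullet> \<psi> x))"
            by (simp add: tf tensor_def)
          also have "\<dots> = - (?D t * ip (u t) \<psi>) + \<theta> t * ip (advection (u t)) \<psi>" using ii by simp
          finally show ?thesis using True by simp
        qed simp
      qed
      then show ?thesis unfolding set_lebesgue_integral_def
        using m borel_measurable_AE[OF m] by (intro integral_cong_AE[symmetric]) (auto elim: AE_mp)
    qed
    moreover have "(LINT t:{0<..<T}|lebesgue. LINT x|lebesgue. \<nu> * (u t x \<bullet> laplace_x ?\<phi> (t, x))) = (LINT t|lebesgue. ?B t)"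
      unfolding set_lebesgue_integral_def by (rule Bochner_Integration.integral_cong) (simp_all add: tf)
    ultimately have "(LINT t|lebesgue. ?A t) = (LINT t|lebesgue. ?B t)" by simp
    moreover have "(LINT t|lebesgue. ?A t) = - (LINT t|lebesgue. ?I t * (?D t * ip (u t) \<psi>)) + (LINT t|lebesgue. ?I t * (\<theta> t * ip (advection (u t)) \<psi>))"
      using i1 i2 by simp
    moreover have "(LINT t|lebesgue. ?I t * (\<theta> t * ?g t)) = (LINT t|lebesgue. ?I t * (\<theta> t * ip (advection (u t)) \<psi>) - ?B t)"
      by (rule Bochner_Integration.integral_cong) (simp_all add: weak_tendency_def algebra_simps)
    moreover have "\<dots> = (LINT t|lebesgue. ?I t * (\<theta> t * ip (advection (u t)) \<psi>)) - (LINT t|lebesgue. ?B t)"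
      using i2 i3 by (intro Bochner_Integration.integral_diff) auto
    ultimately show "(LINT r|lebesgue. ?I r * (\<theta> r * ?g r)) = (LINT r|lebesgue. ?I r * (?D r * ip (u r) \<psi>))" by linarith
  qed
  then show ?thesis by simp
qed

section \<open>The helicity balance\<close>

lemma good_symbol_curl: "good_symbol curl_symbol"
  unfolding good_symbol_def
proof (intro conjI allI impI)
  show "\<exists>B. \<forall>R\<ge>0. 0 \<le> B R \<and> (\<forall>\<xi> v. norm \<xi> \<le> R \<longrightarrow> norm (curl_symbol \<xi> v) \<le> B R * norm v)"
    by (rule exI[of _ "\<lambda>R. R"]) (auto intro: order_trans[OF norm_curl_symbol_le mult_right_mono])
qed (simp_all add: curl_symbol_measurable curl_symbol_vcnj curl_symbol_self_adjoint)

lemma good_symbol_laplace_curl: "good_symbol (\<lambda>\<xi> v. (- (norm \<xi>)\<^sup>2) *\<^sub>R curl_symbol \<xi> v)"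
  unfolding good_symbol_def
proof (intro conjI allI impI)
  have "norm ((- (norm \<xi>)\<^sup>2) *\<^sub>R curl_symbol \<xi> v) \<le> R ^ 3 * norm v" if "norm \<xi> \<le> R" for R :: real and \<xi> v
  proof -
    have "norm ((- (norm \<xi>)\<^sup>2) *\<^sub>R curl_symbol \<xi> v) \<le> (norm \<xi>)\<^sup>2 * (norm \<xi> * norm v)"
      using mult_left_mono[OF norm_curl_symbol_le] by simp
    also have "\<dots> = norm \<xi> ^ 3 * norm v" by (simp add: power2_eq_square power3_eq_cube)
    also have "\<dots> \<le> R ^ 3 * norm v" by (intro mult_right_mono power_mono that) auto
    finally show ?thesis .
  qed
  then show "\<exists>B. \<forall>R\<ge>0. 0 \<le> B R \<and> (\<forall>\<xi> v. norm \<xi> \<le> R \<longrightarrow> norm ((- (norm \<xi>)\<^sup>2) *\<^sub>R curl_symbol \<xi> v) \<le> B R * norm v)"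
    by (intro exI[of _ "\<lambda>R. R ^ 3"]) auto
next
  fix h :: "real^3 \<Rightarrow> complex^3" assume h: "h \<in> Lmeas"
  have "(\<lambda>\<xi>::real^3. - (norm \<xi>)\<^sup>2) \<in> Lmeas" by (rule measurable_completion) measurable
  then show "(\<lambda>\<xi>. (- (norm \<xi>)\<^sup>2) *\<^sub>R curl_symbol \<xi> (h \<xi>)) \<in> Lmeas"
    by (rule borel_measurable_scaleR[OF _ curl_symbol_measurable[OF h]])
next
  show "(- (norm (- \<xi>))\<^sup>2) *\<^sub>R curl_symbol (- \<xi>) (vcnj v) = vcnj ((- (norm \<xi>)\<^sup>2) *\<^sub>R curl_symbol \<xi> v)" for \<xi> v
    by (simp add: curl_symbol_vcnj) (simp add: vec_eq_iff)
qed (simp add: curl_symbol_self_adjoint)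

text \<open>The multiplier \<open>M\<close> preceded by the sharp frequency cutoff at radius \<open>n\<close>, realised by a
  smooth representative.\<close>

definition filtered :: "(real^3 \<Rightarrow> complex^3 \<Rightarrow> complex^3) \<Rightarrow> nat \<Rightarrow> (real^3 \<Rightarrow> real^3) \<Rightarrow> real^3 \<Rightarrow> real^3" where
  "filtered M n v = synth (\<lambda>\<xi>. M \<xi> (truncation (real n) (fourier v) \<xi>))"

lemma filtered:
  assumes M: "good_symbol M" and v: "L2 v"
  shows filtered_L2: "L2 (filtered M n v)"
    and fourier_filtered: "AE \<xi> in lebesgue. fourier (filtered M n v) \<xi> = M \<xi> (truncation (real n) (fourier v) \<xi>)"
  unfolding filtered_def
  using fourier_synth[OF band_limited_good_symbol[OF M band_limited_truncation[OF fourier_L2[OF v] fourier_hermitian[OF v]]]]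
  by auto

lemma good_symbol_0:
  assumes "good_symbol M" shows "M \<xi> 0 = 0"
proof -
  have "M \<xi> 0 \<bullet> M \<xi> 0 = 0 \<bullet> M \<xi> (M \<xi> 0)" using assms unfolding good_symbol_def by blast
  then show ?thesis by simp
qed

lemma filtered_symmetric:
  assumes M: "good_symbol M" and f: "L2 f" and g: "L2 g"
  shows "ip f (filtered M n g) = ip g (filtered M n f)"
proof -
  note Ff = filtered[OF M f, of n] and Fg = filtered[OF M g, of n]
  have sa: "M \<xi> v \<bullet> w = v \<bullet> M \<xi> w" for \<xi> v w using M unfolding good_symbol_def by blast
  have "ip f (filtered M n g) = (LINT \<xi>|lebesgue. fourier f \<xi> \<bullet> fourier (filtered M n g) \<xi>)" by (rule fourier_inner[OF f Fg(1)])
  also have "\<dots> = (LINT \<xi>|lebesgue. fourier g \<xi> \<bullet> fourier (filtered M n f) \<xi>)"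
  proof (rule integral_cong_AE)
    show "AE \<xi> in lebesgue. fourier f \<xi> \<bullet> fourier (filtered M n g) \<xi> = fourier g \<xi> \<bullet> fourier (filtered M n f) \<xi>"
      using Ff(2) Fg(2)
    proof eventually_elim
      case (elim \<xi>)
      have "fourier f \<xi> \<bullet> M \<xi> (fourier g \<xi>) = fourier g \<xi> \<bullet> M \<xi> (fourier f \<xi>)"
        unfolding sa[symmetric, of "fourier f \<xi>"] by (rule inner_commute)
      then show ?case unfolding elim
        by (cases "\<xi> \<in> cball 0 (real n)") (simp_all add: truncation_def good_symbol_0[OF M])
    qed
  qed (intro borel_measurable_integrable L2_inner_integrable fourier_L2 f g Ff(1) Fg(1))+
  also have "\<dots> = ip g (filtered M n f)" by (rule fourier_inner[OF g Ff(1), symmetric])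
  finally show ?thesis .
qed

lemma filtered_bound:
  assumes M: "good_symbol M"
  obtains B where "0 \<le> B" "\<And>v. L2 v \<Longrightarrow> L2_norm (filtered M n v) \<le> B * L2_norm v"
proof -
  obtain B where B: "0 \<le> B" "\<And>\<xi> v. norm \<xi> \<le> real n \<Longrightarrow> norm (M \<xi> v) \<le> B * norm v"
    using M unfolding good_symbol_def by (metis of_nat_0_le_iff)
  show thesis
  proof (rule that[OF B(1)])
    fix v :: "real^3 \<Rightarrow> real^3" assume v: "L2 v"
    note F = filtered[OF M v, of n]
    have "L2_norm (fourier (filtered M n v)) \<le> B * L2_norm (fourier v)"
    proof (rule L2_dominated(2)[OF fourier_L2[OF v] L2_measurable[OF fourier_L2[OF F(1)]] _ B(1)])
      show "AE \<xi> in lebesgue. norm (fourier (filtered M n v) \<xi>) \<le> B * norm (fourier v \<xi>)"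
        using F(2)
      proof eventually_elim
        case (elim \<xi>)
        show ?case unfolding elim using B
          by (cases "\<xi> \<in> cball 0 (real n)") (simp_all add: truncation_def good_symbol_0[OF M])
      qed
    qed
    then show "L2_norm (filtered M n v) \<le> B * L2_norm v" by (simp add: fourier_L2_norm F(1) v)
  qed
qed

abbreviation filtered_curl :: "nat \<Rightarrow> (real^3 \<Rightarrow> real^3) \<Rightarrow> real^3 \<Rightarrow> real^3" where
  "filtered_curl \<equiv> filtered curl_symbol"

abbreviation filtered_laplace_curl :: "nat \<Rightarrow> (real^3 \<Rightarrow> real^3) \<Rightarrow> real^3 \<Rightarrow> real^3" where
  "filtered_laplace_curl \<equiv> filtered (\<lambda>\<xi> v. (- (norm \<xi>)\<^sup>2) *\<^sub>R curl_symbol \<xi> v)"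

text \<open>The passage from compactly supported test fields to filtered curls, by dominated convergence in time.\<close>

lemma momentum_increment_filtered_curl:
  assumes wc: "weakly_continuous_L2 T u" and H2: "L2_sobolev T 2 u" and mom: "momentum_equation \<nu> T u p"
    and \<nu>: "0 \<le> \<nu>" and v: "L2 v" and ab: "0 \<le> a" "a \<le> b" "b < T"
  shows "ip (u b) (filtered_curl n v) - ip (u a) (filtered_curl n v)
    = (LINT r|lebesgue. indicator {a..<b} r * weak_tendency \<nu> (u r) (filtered_curl n v) (filtered_laplace_curl n v))"
proof -
  let ?h = "truncation (real n) (fourier v)" and ?c = "filtered_curl n v" and ?l = "filtered_laplace_curl n v"
  obtain \<psi> where \<psi>: "\<And>m. solenoidal_test (\<psi> m)" "L2_lim \<psi> (synth (\<lambda>\<xi>. curl_symbol \<xi> (?h \<xi>)))"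
    "L2_lim (\<lambda>m. classical_laplace (\<psi> m)) (synth (\<lambda>\<xi>. (- (norm \<xi>)\<^sup>2) *\<^sub>R curl_symbol \<xi> (?h \<xi>)))"
    by (rule solenoidal_test_approximation[OF band_limited_truncation[OF fourier_L2[OF v] fourier_hermitian[OF v]]]) blast
  then have lim: "L2_lim \<psi> ?c" "L2_lim (\<lambda>m. classical_laplace (\<psi> m)) ?l" by (simp_all add: filtered_def)
  have abT: "a \<in> {0..<T}" "b \<in> {0..<T}" "b \<le> T" using ab by auto
  have pair: "(\<lambda>m. ip w (\<psi> m)) \<longlonglongrightarrow> ip w ?c" "(\<lambda>m. ip w (classical_laplace (\<psi> m))) \<longlonglongrightarrow> ip w ?l" if "L2 w" for w
    using L2_lim_inner[OF L2_lim_const[OF that]] lim by blast+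
  let ?t = "\<lambda>m r. weak_tendency \<nu> (u r) (\<psi> m) (classical_laplace (\<psi> m))"
  obtain K where K: "\<And>m. L2_norm (\<psi> m) \<le> K" "\<And>m. L2_norm (classical_laplace (\<psi> m)) \<le> K"
  proof -
    have "Bseq (\<lambda>m. L2_norm (\<psi> m))" "Bseq (\<lambda>m. L2_norm (classical_laplace (\<psi> m)))"
      by (rule convergent_imp_Bseq[OF convergentI[OF L2_lim_norm[OF lim(1)]]], rule convergent_imp_Bseq[OF convergentI[OF L2_lim_norm[OF lim(2)]]])
    then obtain K1 K2 where "\<And>m. L2_norm (\<psi> m) \<le> K1" "\<And>m. L2_norm (classical_laplace (\<psi> m)) \<le> K2"
      unfolding Bseq_def by (metis L2_norm_nonneg abs_of_nonneg real_norm_def)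
    then show thesis by (intro that[of "max K1 K2"]) (auto simp: le_max_iff_disj)
  qed
  let ?A = "\<nu> * K + 3 * sobolev_const * K"
  have L: "L2 (\<psi> m)" "L2 (classical_laplace (\<psi> m))" for m using solenoidal_test_L2[OF \<psi>(1)] by auto
  have cl: "L2 ?c" "L2 ?l" using filtered_L2[OF good_symbol_curl v] filtered_L2[OF good_symbol_laplace_curl v] by auto
  have "(\<lambda>m. LINT r|lebesgue. indicator {a..<b} r * ?t m r) \<longlonglongrightarrow> (LINT r|lebesgue. indicator {a..<b} r * weak_tendency \<nu> (u r) ?c ?l)"
  proof (rule integral_dominated_convergence)
    show "integrable lebesgue (\<lambda>r. indicator {0<..<T} r * (?A * (1 + (sobolev_norm 2 (u r))\<^sup>2)))"
      by (rule sobolev_norm_weight_integrable[OF H2])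
    show "(\<lambda>r. indicator {a..<b} r * ?t m r) \<in> Lmeas" for m
      by (rule interior_indicator_measurable[OF weak_tendency_measurable[OF wc H2 L] ab(1) abT(3)])
    show "(\<lambda>r. indicator {a..<b} r * weak_tendency \<nu> (u r) ?c ?l) \<in> Lmeas"
      by (rule interior_indicator_measurable[OF weak_tendency_measurable[OF wc H2 cl] ab(1) abT(3)])
    show "AE r in lebesgue. (\<lambda>m. indicator {a..<b} r * ?t m r) \<longlonglongrightarrow> indicator {a..<b} r * weak_tendency \<nu> (u r) ?c ?l"
      using L2_sobolevD(1)[OF H2] AE_completion[OF AE_lborel_singleton[of 0]]
    proof eventually_elim
      case (elim r)
      show ?case
      proof (cases "r \<in> {a..<b}")
        case True
        then have w: "sobolev 2 (u r)" using elim ab by auto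
        show ?thesis unfolding weak_tendency_def
          by (intro tendsto_mult tendsto_diff tendsto_const pair sobolev_L2[OF w] advection_L2(1)[OF w])
      qed simp
    qed
    show "AE r in lebesgue. norm (indicator {a..<b} r * ?t m r) \<le> indicator {0<..<T} r * (?A * (1 + (sobolev_norm 2 (u r))\<^sup>2))" for m
      using L2_sobolevD(1)[OF H2] AE_completion[OF AE_lborel_singleton[of 0]]
    proof eventually_elim
      case (elim r)
      have "0 \<le> K" using K(1)[of 0] L2_norm_nonneg[of "\<psi> 0"] by linarith
      then have A: "0 \<le> ?A * (1 + (sobolev_norm 2 (u r))\<^sup>2)" using \<nu> sobolev_const_nonneg by simp
      show ?case
      proof (cases "r \<in> {a..<b}")
        case True
        then have w: "sobolev 2 (u r)" using elim ab by auto
        have "\<bar>?t m r\<bar> \<le> (\<nu> * L2_norm (classical_laplace (\<psi> m)) + 3 * sobolev_const * L2_norm (\<psi> m)) * (1 + (sobolev_norm 2 (u r))\<^sup>2)"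
          by (rule weak_tendency_bound[OF w L \<nu>])
        also have "\<dots> \<le> ?A * (1 + (sobolev_norm 2 (u r))\<^sup>2)"
          using K \<nu> sobolev_const_nonneg by (intro mult_right_mono add_mono mult_left_mono) auto
        finally show ?thesis using True elim ab by (simp add: indicator_def)
      qed (use A in simp)
    qed
  qed
  moreover have "(\<lambda>m. ip (u b) (\<psi> m) - ip (u a) (\<psi> m)) \<longlonglongrightarrow> ip (u b) ?c - ip (u a) ?c"
    by (intro tendsto_diff pair weak_continuityD(1)[OF wc] abT)
  ultimately show ?thesis
    unfolding momentum_increment[OF wc H2 mom \<nu> \<psi>(1) ab, symmetric] by (rule LIMSEQ_unique[rotated])
qed

text \<open>The kernel \<open>k r s\<close> is the tendency at time \<open>r\<close> tested with the filtered curl of the field at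
  time \<open>s\<close>. By symmetry of the filtered operators the argument \<open>s\<close> can be moved to a plain \<open>u
  s\<close>, so weak continuity of \<open>u\<close> makes \<open>k r\<close> continuous.\<close>

lemma filtered_helicity_balance:
  fixes n :: nat
  assumes wc: "weakly_continuous_L2 T u" and H2: "L2_sobolev T 2 u" and mom: "momentum_equation \<nu> T u p"
    and \<nu>: "0 \<le> \<nu>" and C: "\<And>t. t \<in> {0..<T} \<Longrightarrow> L2_norm (u t) \<le> C" and t: "t \<in> {0..<T}"
  defines "k \<equiv> \<lambda>r s. weak_tendency \<nu> (u r) (filtered_curl n (u s)) (filtered_laplace_curl n (u s))"
  shows "ip (u t) (filtered_curl n (u t)) - ip (u 0) (filtered_curl n (u 0)) = 2 * (LINT r|lebesgue. indicator {0..<t} r * k r r)"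
    "(\<lambda>r. indicator {0..<t} r * k r r) \<in> Lmeas"
proof -
  let ?c = "\<lambda>s. filtered_curl n (u s)" and ?l = "\<lambda>s. filtered_laplace_curl n (u s)"
  note wcL = weak_continuityD(1)[OF wc]
  have cL: "L2 (?c s)" "L2 (?l s)" if "s \<in> {0..<T}" for s
    using filtered_L2[OF good_symbol_curl wcL[OF that]] filtered_L2[OF good_symbol_laplace_curl wcL[OF that]] by auto
  obtain B1 where B1: "0 \<le> B1" "\<And>v. L2 v \<Longrightarrow> L2_norm (filtered_curl n v) \<le> B1 * L2_norm v"
    by (rule filtered_bound[OF good_symbol_curl]) blast
  obtain B2 where B2: "0 \<le> B2" "\<And>v. L2 v \<Longrightarrow> L2_norm (filtered_laplace_curl n v) \<le> B2 * L2_norm v"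
    by (rule filtered_bound[OF good_symbol_laplace_curl]) blast
  let ?M = "\<lambda>r. (\<nu> * (B2 * C) + 3 * sobolev_const * (B1 * C)) * (1 + (sobolev_norm 2 (u r))\<^sup>2)"
  \<comment> \<open>by symmetry the mixed terms \<open>\<langle>u(a), C u(b)\<rangle>\<close> and \<open>\<langle>u(b), C u(a)\<rangle>\<close> cancel\<close>
  have inc: "ip (u b) (?c b) - ip (u a) (?c a) = (LINT r|lebesgue. indicator {a..<b} r * (k r a + k r b))"
    if ab: "0 \<le> a" "a \<le> b" "b < T" for a b
  proof -
    have abT: "a \<in> {0..<T}" "b \<in> {0..<T}" "b \<le> T" using ab by auto
    have i: "integrable lebesgue (\<lambda>r. indicator {a..<b} r * k r s)" if "s \<in> {0..<T}" for s
      unfolding k_def by (rule interior_indicator_integrable[OF weak_tendency_integrable[OF wc H2 cL[OF that] \<nu>] ab(1) abT(3)])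
    have "ip (u b) (?c b) - ip (u a) (?c a)
        = (ip (u b) (?c a) - ip (u a) (?c a)) + (ip (u b) (?c b) - ip (u a) (?c b))"
      using filtered_symmetric[OF good_symbol_curl wcL[OF abT(1)] wcL[OF abT(2)], of n] by simp
    also have "\<dots> = (LINT r|lebesgue. indicator {a..<b} r * k r a) + (LINT r|lebesgue. indicator {a..<b} r * k r b)"
      unfolding k_def momentum_increment_filtered_curl[OF wc H2 mom \<nu> wcL[OF abT(1)] ab]
        momentum_increment_filtered_curl[OF wc H2 mom \<nu> wcL[OF abT(2)] ab] ..
    also have "\<dots> = (LINT r|lebesgue. indicator {a..<b} r * k r a + indicator {a..<b} r * k r b)"
      by (rule Bochner_Integration.integral_add[OF i i, symmetric]) (use abT in auto)
    finally show ?thesis by (simp add: distrib_left)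
  qed
  have meas: "(\<lambda>r. indicator {0<..<T} r * k r s) \<in> Lmeas" if "s \<in> {0..<T}" for s
    unfolding k_def by (rule weak_tendency_measurable[OF wc H2 cL[OF that]])
  have cont: "AE r in lebesgue. r \<in> {0<..<T} \<longrightarrow> continuous_on {0..<T} (k r)"
    using L2_sobolevD(1)[OF H2]
  proof (eventually_elim, intro impI)
    fix r assume "r \<in> {0<..<T} \<longrightarrow> sobolev 2 (u r)" "r \<in> {0<..<T}"
    then have w: "sobolev 2 (u r)" by blast
    note a = advection_L2(1)[OF w] and wL = sobolev_L2[OF w]
    have "continuous_on {0..<T} (\<lambda>s. \<nu> * ip (u s) (filtered_laplace_curl n (u r)) - ip (u s) (filtered_curl n (advection (u r))))"
      by (intro continuous_intros weak_continuityD(2)[OF wc] filtered_L2 good_symbol_curl good_symbol_laplace_curl a wL)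
    moreover have "\<nu> * ip (u s) (filtered_laplace_curl n (u r)) - ip (u s) (filtered_curl n (advection (u r))) = k r s"
      if s: "s \<in> {0..<T}" for s
      unfolding k_def weak_tendency_def filtered_symmetric[OF good_symbol_curl a wcL[OF s]]
        filtered_symmetric[OF good_symbol_laplace_curl wL wcL[OF s]] ..
    ultimately show "continuous_on {0..<T} (k r)" by (rule continuous_on_eq)
  qed
  have bd: "AE r in lebesgue. r \<in> {0<..<T} \<longrightarrow> (\<forall>s\<in>{0..<T}. \<bar>k r s\<bar> \<le> ?M r)"
    using L2_sobolevD(1)[OF H2]
  proof (eventually_elim, intro impI ballI)
    fix r s assume "r \<in> {0<..<T} \<longrightarrow> sobolev 2 (u r)" "r \<in> {0<..<T}" and s: "s \<in> {0..<T}"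
    then have w: "sobolev 2 (u r)" by blast
    have "\<bar>k r s\<bar> \<le> (\<nu> * L2_norm (?l s) + 3 * sobolev_const * L2_norm (?c s)) * (1 + (sobolev_norm 2 (u r))\<^sup>2)"
      unfolding k_def by (rule weak_tendency_bound[OF w cL[OF s] \<nu>])
    also have "\<dots> \<le> ?M r"
      using order_trans[OF B1(2)[OF wcL[OF s]] mult_left_mono[OF C[OF s] B1(1)]]
        order_trans[OF B2(2)[OF wcL[OF s]] mult_left_mono[OF C[OF s] B2(1)]] \<nu> sobolev_const_nonneg
      by (intro mult_right_mono add_mono mult_left_mono) auto
    finally show "\<bar>k r s\<bar> \<le> ?M r" .
  qed
  note R = riemann_quadratic_increment[where H="\<lambda>t. ip (u t) (?c t)" and k=k and T=T and M="?M", OF inc meas cont bd sobolev_norm_weight_integrable[OF H2] t]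
  show "ip (u t) (?c t) - ip (u 0) (?c 0) = 2 * (LINT r|lebesgue. indicator {0..<t} r * k r r)" by (rule R(1))
  show "(\<lambda>r. indicator {0..<t} r * k r r) \<in> Lmeas" by (rule R(2))
qed

lemma filtered_curl_limit:
  assumes v: "sobolev 1 v"
  shows "L2_lim (\<lambda>n. fourier (filtered_curl n v)) (fourier (curl_field v))"
    "L2_lim (\<lambda>n. filtered_curl n v) (curl_field v)"
    "L2_norm (filtered_curl n v) \<le> sobolev_norm 1 v"
proof -
  have vL: "L2 v" by (rule sobolev_L2[OF v])
  note F = filtered[OF good_symbol_curl vL] and c = curl_field[OF v]
  have cs: "L2 (\<lambda>\<xi>. curl_symbol \<xi> (fourier v \<xi>))" by (rule L2_cong_AE[OF fourier_L2[OF c(1)] c(2)])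
  show 1: "L2_lim (\<lambda>n. fourier (filtered_curl n v)) (fourier (curl_field v))"
  proof (rule L2_lim_cong_AE[OF L2_lim_truncate[OF cs]])
    show "AE \<xi> in lebesgue. indicator (cball 0 (real m)) \<xi> *\<^sub>R curl_symbol \<xi> (fourier v \<xi>) = fourier (filtered_curl m v) \<xi>" for m
      using F(2)[of m] by eventually_elim (simp add: truncation_def curl_symbol_scaleR)
    show "AE \<xi> in lebesgue. curl_symbol \<xi> (fourier v \<xi>) = fourier (curl_field v) \<xi>" using c(2) by eventually_elim simp
  qed
  show "L2_lim (\<lambda>n. filtered_curl n v) (curl_field v)" by (rule L2_lim_fourierI[OF F(1) c(1) 1])
  have "L2_norm (fourier (filtered_curl n v)) \<le> 1 * sobolev_norm 1 v"
  proof (rule sobolev_dominated(2)[OF v L2_measurable[OF fourier_L2[OF F(1)]]])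
    show "AE \<xi> in lebesgue. norm (fourier (filtered_curl n v) \<xi>) \<le> 1 * ((1 + (norm \<xi>)\<^sup>2) powr (1 / 2) * norm (fourier v \<xi>))"
      using F(2)[of n]
    proof eventually_elim
      case (elim \<xi>)
      have "norm (curl_symbol \<xi> (truncation (real n) (fourier v) \<xi>)) \<le> norm \<xi> * norm (fourier v \<xi>)"
        by (rule order_trans[OF norm_curl_symbol_le]) (auto simp: truncation_def indicator_def)
      also have "\<dots> \<le> (1 + (norm \<xi>)\<^sup>2) powr (1 / 2) * norm (fourier v \<xi>)" by (rule mult_right_mono[OF norm_le_weight1]) simp
      finally show ?case unfolding elim by simp
    qed
  qed simp
  then show "L2_norm (filtered_curl n v) \<le> sobolev_norm 1 v" by (simp add: fourier_L2_norm[OF F(1)])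
qed

lemma filtered_helicity_limit:
  assumes v: "sobolev 1 v"
  shows "(\<lambda>n. ip v (filtered_curl n v)) \<longlonglongrightarrow> helicity v"
proof -
  have vL: "L2 v" by (rule sobolev_L2[OF v])
  note c = curl_field[OF v]
  have "ip v (curl_field v) = (LINT \<xi>|lebesgue. fourier v \<xi> \<bullet> fourier (curl_field v) \<xi>)" by (rule fourier_inner[OF vL c(1)])
  also have "\<dots> = helicity v"
    unfolding helicity_def
  proof (rule integral_cong_AE)
    show "AE \<xi> in lebesgue. fourier v \<xi> \<bullet> fourier (curl_field v) \<xi> = fourier v \<xi> \<bullet> curl_symbol \<xi> (fourier v \<xi>)"
      using c(2) by eventually_elim simp
    show "(\<lambda>\<xi>. fourier v \<xi> \<bullet> curl_symbol \<xi> (fourier v \<xi>)) \<in> Lmeas"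
      by (intro borel_measurable_inner curl_symbol_measurable L2_measurable fourier_L2 vL)
  qed (intro borel_measurable_inner L2_measurable fourier_L2 vL c(1))
  finally show ?thesis using L2_lim_inner[OF L2_lim_const[OF vL] filtered_curl_limit(2)[OF v]] by simp
qed

text \<open>For a field in \<open>H\<^sup>2\<close> the symbol \<open>-\<bar>\<xi>\<bar>\<^sup>2 curl_symbol \<xi>\<close>, of
  order three, is too strong for \<open>L\<^sup>2\<close>; the two factors are therefore distributed over both arguments of the
  pairing.\<close>

lemma filtered_dissipation_limit:
  assumes v: "sobolev 2 v"
  shows "(\<lambda>n. ip v (filtered_laplace_curl n v)) \<longlonglongrightarrow> - helicity_dissipation v"
    "\<bar>ip v (filtered_laplace_curl n v)\<bar> \<le> (sobolev_norm 2 v)\<^sup>2"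
proof -
  have vL: "L2 v" by (rule sobolev_L2[OF v])
  have v1: "sobolev 1 v" "sobolev_norm 1 v \<le> sobolev_norm 2 v" using sobolev_mono[OF v, of 1] by auto
  note c = curl_field[OF v1(1)] and F = filtered[OF good_symbol_laplace_curl vL] and G = filtered[OF good_symbol_curl vL]
  \<comment> \<open>two of the three orders fall on \<open>v\<close>, where \<open>H\<^sup>2\<close> suffices; the remaining curl needs \<open>H\<^sup>1\<close>\<close>
  let ?w = "\<lambda>\<xi>. (- (norm \<xi>)\<^sup>2) *\<^sub>R fourier v \<xi>"
  have wm: "?w \<in> Lmeas"
  proof (rule borel_measurable_scaleR[OF _ L2_measurable[OF fourier_L2[OF vL]]])
    show "(\<lambda>\<xi>::real^3. - (norm \<xi>)\<^sup>2) \<in> Lmeas" by (rule measurable_completion) measurable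
  qed
  have wle: "AE \<xi> in lebesgue. norm (?w \<xi>) \<le> 1 * ((1 + (norm \<xi>)\<^sup>2) powr (2 / 2) * norm (fourier v \<xi>))"
    unfolding weight2 by (auto intro!: AE_I2 mult_right_mono)
  have w: "L2 ?w" "L2_norm ?w \<le> 1 * sobolev_norm 2 v" using sobolev_dominated[OF v wm _ wle] by auto
  have eq: "ip v (filtered_laplace_curl m v) = (LINT \<xi>|lebesgue. ?w \<xi> \<bullet> fourier (filtered_curl m v) \<xi>)" for m
  proof -
    have "ip v (filtered_laplace_curl m v) = (LINT \<xi>|lebesgue. fourier v \<xi> \<bullet> fourier (filtered_laplace_curl m v) \<xi>)"
      by (rule fourier_inner[OF vL F(1)])
    also have "\<dots> = (LINT \<xi>|lebesgue. ?w \<xi> \<bullet> fourier (filtered_curl m v) \<xi>)"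
    proof (rule integral_cong_AE)
      show "AE \<xi> in lebesgue. fourier v \<xi> \<bullet> fourier (filtered_laplace_curl m v) \<xi> = ?w \<xi> \<bullet> fourier (filtered_curl m v) \<xi>"
        using F(2)[of m] G(2)[of m] by eventually_elim simp
    qed (intro borel_measurable_inner L2_measurable fourier_L2 vL F(1) G(1) w(1))+
    finally show ?thesis .
  qed
  have "(\<lambda>n. ip v (filtered_laplace_curl n v)) \<longlonglongrightarrow> (LINT \<xi>|lebesgue. ?w \<xi> \<bullet> fourier (curl_field v) \<xi>)"
    unfolding eq by (rule L2_lim_inner[OF L2_lim_const[OF w(1)] filtered_curl_limit(1)[OF v1(1)]])
  also have "(LINT \<xi>|lebesgue. ?w \<xi> \<bullet> fourier (curl_field v) \<xi>) = (LINT \<xi>|lebesgue. - ((norm \<xi>)\<^sup>2 * (fourier v \<xi> \<bullet> curl_symbol \<xi> (fourier v \<xi>))))"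
  proof (rule integral_cong_AE)
    show "AE \<xi> in lebesgue. ?w \<xi> \<bullet> fourier (curl_field v) \<xi> = - ((norm \<xi>)\<^sup>2 * (fourier v \<xi> \<bullet> curl_symbol \<xi> (fourier v \<xi>)))"
      using c(2) by eventually_elim simp
    have "(\<lambda>\<xi>. ?w \<xi> \<bullet> curl_symbol \<xi> (fourier v \<xi>)) \<in> Lmeas"
      by (intro borel_measurable_inner wm curl_symbol_measurable L2_measurable fourier_L2 vL)
    then show "(\<lambda>\<xi>. - ((norm \<xi>)\<^sup>2 * (fourier v \<xi> \<bullet> curl_symbol \<xi> (fourier v \<xi>)))) \<in> Lmeas" by simp
  qed (intro borel_measurable_inner wm L2_measurable fourier_L2 c(1))
  finally show "(\<lambda>n. ip v (filtered_laplace_curl n v)) \<longlonglongrightarrow> - helicity_dissipation v" by (simp add: helicity_dissipation_def)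
  have "\<bar>ip v (filtered_laplace_curl n v)\<bar> \<le> L2_norm ?w * L2_norm (fourier (filtered_curl n v))"
    unfolding eq by (rule L2_inner_bound[OF w(1) fourier_L2[OF G(1)]])
  also have "\<dots> \<le> sobolev_norm 2 v * sobolev_norm 2 v"
    using w(2) filtered_curl_limit(3)[OF v1(1), of n] v1(2) by (intro mult_mono) (auto simp: fourier_L2_norm[OF G(1)] sobolev_norm_def)
  finally show "\<bar>ip v (filtered_laplace_curl n v)\<bar> \<le> (sobolev_norm 2 v)\<^sup>2" by (simp add: power2_eq_square)
qed

lemma helicity_dissipation_integrable:
  assumes wc: "weakly_continuous_L2 T u" and H2: "L2_sobolev T 2 u"
  shows "integrable lebesgue (\<lambda>t. indicator {0<..<T} t * helicity_dissipation (u t))"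
proof -
  let ?m = "\<lambda>s t. helical_dissipation s (u t)"
  have i: "integrable lebesgue (\<lambda>t. indicator {0<..<T} t * ?m 1 t - indicator {0<..<T} t * ?m (-1) t)"
    by (intro Bochner_Integration.integrable_diff helical_dissipation_integrable[OF wc H2]) auto
  have ae: "AE t in lebesgue. indicator {0<..<T} t * ?m 1 t - indicator {0<..<T} t * ?m (-1) t = indicator {0<..<T} t * helicity_dissipation (u t)"
    using L2_sobolevD(1)[OF H2] by eventually_elim (auto simp: dissipation_diff_eq[symmetric] indicator_def)
  show ?thesis
    by (rule integrable_cong_AE_imp[OF i borel_measurable_AE[OF borel_measurable_integrable[OF i] ae]])
       (use ae in eventually_elim, simp)
qed

text \<open>Let the frequency cutoff of the filtered balance tend to infinity. The tendency along the diagonal converges to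
  \<open>- \<nu>\<close> times the helicity dissipation, since the nonlinear term is orthogonal to the curl. The
  \<open>H\<^sup>1\<close> bound \<open>C\<close> enters through the norm of the filtered curl.\<close>

lemma helicity_balance:
  assumes wc: "weakly_continuous_L2 T u" and H2: "L2_sobolev T 2 u" and mom: "momentum_equation \<nu> T u p"
    and \<nu>: "0 \<le> \<nu>" and H1: "\<And>t. t \<in> {0..<T} \<Longrightarrow> sobolev 1 (u t) \<and> sobolev_norm 1 (u t) \<le> C" and t: "t \<in> {0..<T}"
  shows "helicity (u t) - helicity (u 0) = - 2 * \<nu> * (LINT r|lebesgue. indicator {0..<t} r * helicity_dissipation (u r))"
proof -
  have C: "L2_norm (u s) \<le> C" if "s \<in> {0..<T}" for s
    using L2_norm_le_sobolev_norm[of 1 "u s"] H1[OF that] by auto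
  have C0: "0 \<le> C" using C[OF t] L2_norm_nonneg[of "u t"] by linarith
  have z: "0 \<in> {0..<T}" "t \<le> T" using t by auto
  let ?k = "\<lambda>n r. weak_tendency \<nu> (u r) (filtered_curl n (u r)) (filtered_laplace_curl n (u r))"
  note fb = filtered_helicity_balance[OF wc H2 mom \<nu> C t]
  let ?A = "\<nu> + 3 * sobolev_const * C"
  have "(\<lambda>n. LINT r|lebesgue. indicator {0..<t} r * ?k n r) \<longlonglongrightarrow> (LINT r|lebesgue. indicator {0..<t} r * (- \<nu> * helicity_dissipation (u r)))"
  proof (rule integral_dominated_convergence)
    show "integrable lebesgue (\<lambda>r. ?A * (indicator {0<..<T} r * (sobolev_norm 2 (u r))\<^sup>2))"
      using L2_sobolevD(2)[OF H2] by simp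
    show "(\<lambda>r. indicator {0..<t} r * ?k n r) \<in> Lmeas" for n by (rule fb(2))
    have "(\<lambda>r. - \<nu> * (indicator {0<..<T} r * helicity_dissipation (u r))) \<in> Lmeas"
      by (rule borel_measurable_times[OF borel_measurable_const borel_measurable_integrable[OF helicity_dissipation_integrable[OF wc H2]]])
    then show "(\<lambda>r. indicator {0..<t} r * (- \<nu> * helicity_dissipation (u r))) \<in> Lmeas"
      by (intro interior_indicator_measurable[OF _ _ z(2)]) (simp_all add: mult.left_commute)
    show "AE r in lebesgue. (\<lambda>n. indicator {0..<t} r * ?k n r) \<longlonglongrightarrow> indicator {0..<t} r * (- \<nu> * helicity_dissipation (u r))"
      using L2_sobolevD(1)[OF H2] AE_completion[OF AE_lborel_singleton[of 0]]
    proof eventually_elim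
      case (elim r)
      show ?case
      proof (cases "r \<in> {0..<t}")
        case True
        then have w: "sobolev 2 (u r)" using elim t by auto
        have w1: "sobolev 1 (u r)" by (rule sobolev_mono(1)[OF w]) auto
        have "(\<lambda>n. ip (advection (u r)) (filtered_curl n (u r))) \<longlonglongrightarrow> ip (advection (u r)) (curl_field (u r))"
          by (rule L2_lim_inner[OF L2_lim_const[OF advection_L2(1)[OF w]] filtered_curl_limit(2)[OF w1]])
        then have "(\<lambda>n. ip (advection (u r)) (filtered_curl n (u r))) \<longlonglongrightarrow> 0"
          by (simp add: integral_advection_inner_curl_field[OF w])
        then have "(\<lambda>n. ?k n r) \<longlonglongrightarrow> \<nu> * (- helicity_dissipation (u r)) - 0"
          unfolding weak_tendency_def by (intro tendsto_intros filtered_dissipation_limit(1)[OF w])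
        then show ?thesis by (intro tendsto_mult tendsto_const) simp
      qed simp
    qed
    show "AE r in lebesgue. norm (indicator {0..<t} r * ?k n r) \<le> ?A * (indicator {0<..<T} r * (sobolev_norm 2 (u r))\<^sup>2)" for n
      using L2_sobolevD(1)[OF H2] AE_completion[OF AE_lborel_singleton[of 0]]
    proof eventually_elim
      case (elim r)
      let ?N = "(sobolev_norm 2 (u r))\<^sup>2"
      show ?case
      proof (cases "r \<in> {0..<t}")
        case True
        then have w: "sobolev 2 (u r)" and r: "r \<in> {0<..<T}" using elim t by auto
        have w1: "sobolev 1 (u r)" "sobolev_norm 1 (u r) \<le> C" using H1[of r] r by auto
        have fc: "L2_norm (filtered_curl n (u r)) \<le> C" using filtered_curl_limit(3)[OF w1(1), of n] w1(2) by linarith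
        have "\<bar>ip (advection (u r)) (filtered_curl n (u r))\<bar> \<le> L2_norm (advection (u r)) * L2_norm (filtered_curl n (u r))"
          by (rule L2_inner_bound[OF advection_L2(1)[OF w] filtered_L2[OF good_symbol_curl sobolev_L2[OF w]]])
        also have "\<dots> \<le> (3 * sobolev_const * ?N) * C"
          using advection_L2(2)[OF w] fc sobolev_const_nonneg by (intro mult_mono) auto
        finally have 1: "\<bar>ip (advection (u r)) (filtered_curl n (u r))\<bar> \<le> (3 * sobolev_const * ?N) * C" .
        have "\<bar>\<nu> * ip (u r) (filtered_laplace_curl n (u r))\<bar> \<le> \<nu> * ?N"
          unfolding abs_mult using mult_left_mono[OF filtered_dissipation_limit(2)[OF w, of n] \<nu>] \<nu> by simp
        then have "\<bar>?k n r\<bar> \<le> \<nu> * ?N + (3 * sobolev_const * ?N) * C" unfolding weak_tendency_def using 1 by linarith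
        also have "\<dots> = ?A * ?N" by (simp add: algebra_simps)
        finally show ?thesis using True r by (simp add: indicator_def)
      qed (use \<nu> sobolev_const_nonneg C0 in simp)
    qed
  qed
  then have "(\<lambda>n. 2 * (LINT r|lebesgue. indicator {0..<t} r * ?k n r)) \<longlonglongrightarrow> 2 * (LINT r|lebesgue. indicator {0..<t} r * (- \<nu> * helicity_dissipation (u r)))"
    by (rule tendsto_mult_left)
  moreover have "(\<lambda>n. ip (u t) (filtered_curl n (u t)) - ip (u 0) (filtered_curl n (u 0))) \<longlonglongrightarrow> helicity (u t) - helicity (u 0)"
    using H1[OF t] H1[OF z(1)] by (intro tendsto_diff filtered_helicity_limit) auto
  moreover have "ip (u t) (filtered_curl n (u t)) - ip (u 0) (filtered_curl n (u 0)) = 2 * (LINT r|lebesgue. indicator {0..<t} r * ?k n r)" for n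
    by (rule fb(1))
  ultimately have "helicity (u t) - helicity (u 0) = 2 * (LINT r|lebesgue. indicator {0..<t} r * (- \<nu> * helicity_dissipation (u r)))"
    using LIMSEQ_unique by simp
  also have "\<dots> = 2 * (LINT r|lebesgue. - \<nu> * (indicator {0..<t} r * helicity_dissipation (u r)))"
    by (simp add: mult.left_commute)
  finally show ?thesis by simp
qed

lemma E_c_helical:
  assumes wc: "weakly_continuous_L2 T u" and H2: "L2_sobolev T 2 u" and s: "\<bar>s\<bar> = 1" and t: "t \<in> {0..<T}"
  shows "E_c \<nu> (\<lambda>r. helical s (u r)) t = 1/2 * (L2_norm (Dpow (1/2) (helical s (u t))))\<^sup>2
    + \<nu> * (LINT r|lebesgue. indicator {0..<t} r * helical_dissipation s (u r))"
proof -
  let ?m = "\<lambda>r. helical_dissipation s (u r)"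
  let ?g = "\<lambda>r. (\<Sum>j\<in>UNIV. (L2_norm (Dpow (1/2) (partial_x j (helical s (u r)))))\<^sup>2)"
  have "integrable lebesgue (\<lambda>r. indicator {0..<t} r * ?m r)"
    by (rule interior_indicator_integrable[OF helical_dissipation_integrable[OF wc H2 s]]) (use t in auto)
  then have m: "(\<lambda>r. indicator {0..<t} r * ?m r) \<in> Lmeas" by auto
  have ae: "AE r in lebesgue. indicator {0..<t} r * ?m r = indicator {0..t} r *\<^sub>R ?g r"
    using L2_sobolevD(1)[OF H2] AE_completion[OF AE_lborel_singleton[of 0]] AE_completion[OF AE_lborel_singleton[of t]]
  proof eventually_elim
    case (elim r)
    show ?case
    proof (cases "r \<in> {0..<t}")
      case True
      then have "sobolev 2 (u r)" using elim t by auto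
      then show ?thesis using True half_derivative_gradient_helical(2)[OF _ s, of "u r"] by simp
    qed (use elim in \<open>auto simp: indicator_def\<close>)
  qed
  have "(LINT r|lebesgue. indicator {0..<t} r * ?m r) = (LINT r|lebesgue. indicator {0..t} r *\<^sub>R ?g r)"
    by (rule integral_cong_AE[OF m borel_measurable_AE[OF m ae] ae])
  then show ?thesis by (simp add: E_c_def set_lebesgue_integral_def)
qed

theorem theorem1p1:
  fixes \<nu> T :: real
    and u :: "real \<Rightarrow> real^3 \<Rightarrow> real^3"
    and p :: "real \<Rightarrow> real^3 \<Rightarrow> real"
    and u0 :: "real^3 \<Rightarrow> real^3"
  assumes "\<nu> > 0" and "T > 0"
    and "Linf_sobolev T 1 u" and "L2_sobolev T 2 u"
    and "navier_stokes_solution \<nu> T u p u0"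
  shows "\<forall>t\<in>{0..<T}.
    E_c \<nu> (\<lambda>s. helical_plus (u s)) t =
    E_c \<nu> (\<lambda>s. helical_minus (u s)) t +
      1/2 * ((Hdot_half_norm (helical_plus u0))\<^sup>2 - (Hdot_half_norm (helical_minus u0))\<^sup>2)"
proof
  fix t assume t: "t \<in> {0..<T}"
  have wc: "weakly_continuous_L2 T u" and mom: "momentum_equation \<nu> T u p" and init: "AE x in lebesgue. u 0 x = u0 x"
    using assms(5) by (auto simp: navier_stokes_solution_def)
  note H2 = assms(4)
  have z: "0 \<in> {0..<T}" using t by auto
  have \<nu>: "0 \<le> \<nu>" using assms(1) by simp
  obtain C where H1: "\<And>t. t \<in> {0..<T} \<Longrightarrow> sobolev 1 (u t) \<and> sobolev_norm 1 (u t) \<le> C"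
    by (rule sobolev1_everywhere[OF wc assms(3)]) blast
  let ?m = "\<lambda>s r. helical_dissipation s (u r)"
  let ?d = "LINT r|lebesgue. indicator {0..<t} r * helicity_dissipation (u r)"
  have i: "integrable lebesgue (\<lambda>r. indicator {0..<t} r * ?m s r)" if "\<bar>s\<bar> = 1" for s
    by (rule interior_indicator_integrable[OF helical_dissipation_integrable[OF wc H2 that]]) (use t in auto)
  have "(LINT r|lebesgue. indicator {0..<t} r * ?m 1 r) - (LINT r|lebesgue. indicator {0..<t} r * ?m (-1) r)
      = (LINT r|lebesgue. indicator {0..<t} r * ?m 1 r - indicator {0..<t} r * ?m (-1) r)"
    by (rule Bochner_Integration.integral_diff[symmetric]) (intro i; simp)+
  also have "\<dots> = ?d"
  proof (rule integral_cong_AE)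
    show "(\<lambda>r. indicator {0..<t} r * ?m 1 r - indicator {0..<t} r * ?m (-1) r) \<in> Lmeas"
      by (intro borel_measurable_integrable Bochner_Integration.integrable_diff i) auto
    show "(\<lambda>r. indicator {0..<t} r * helicity_dissipation (u r)) \<in> Lmeas"
      by (rule interior_indicator_measurable[OF borel_measurable_integrable[OF helicity_dissipation_integrable[OF wc H2]]]) (use t in auto)
    show "AE r in lebesgue. indicator {0..<t} r * ?m 1 r - indicator {0..<t} r * ?m (-1) r = indicator {0..<t} r * helicity_dissipation (u r)"
      using L2_sobolevD(1)[OF H2] AE_completion[OF AE_lborel_singleton[of 0]]
    proof eventually_elim
      case (elim r)
      show ?case
      proof (cases "r \<in> {0..<t}")
        case True
        then have "sobolev 2 (u r)" using elim t by auto
        then show ?thesis using True dissipation_diff_eq[of "u r"] by simp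
      qed simp
    qed
  qed
  finally have diss: "(LINT r|lebesgue. indicator {0..<t} r * ?m 1 r) = (LINT r|lebesgue. indicator {0..<t} r * ?m (-1) r) + ?d" by linarith
  have c0: "Hdot_half_norm (helical s u0) = L2_norm (Dpow (1/2) (helical s (u 0)))" for s
  proof -
    have L: "L2 (u 0)" by (rule weak_continuityD(1)[OF wc z])
    have Du: "Dinv_curl (u 0) = Dinv_curl u0" unfolding Dinv_curl_def by (rule fourier_multiplier_cong_AE[OF L init])
    have "AE x in lebesgue. helical s (u 0) x = helical s u0 x"
      using init by eventually_elim (simp add: helical_def Du)
    then have "Dpow (1/2) (helical s (u 0)) = Dpow (1/2) (helical s u0)"
      unfolding Dpow_def by (rule fourier_multiplier_cong_AE[OF helical_L2[OF L]])
    then show ?thesis by (simp add: Hdot_half_norm_def)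
  qed
  have h: "(L2_norm (Dpow (1/2) (helical 1 (u r))))\<^sup>2 = (L2_norm (Dpow (1/2) (helical (-1) (u r))))\<^sup>2 + helicity (u r)"
    if "r \<in> {0..<T}" for r
    using half_norm_diff_eq_helicity[of "u r"] H1[OF that] by simp
  have abs_m: "\<bar>-1 :: real\<bar> = 1" by simp
  have bal: "helicity (u t) = helicity (u 0) - 2 * (\<nu> * ?d)"
    using helicity_balance[OF wc H2 mom \<nu> H1 t] by simp
  show "E_c \<nu> (\<lambda>s. helical_plus (u s)) t = E_c \<nu> (\<lambda>s. helical_minus (u s)) t +
      1/2 * ((Hdot_half_norm (helical_plus u0))\<^sup>2 - (Hdot_half_norm (helical_minus u0))\<^sup>2)"
    unfolding helical_plus_eq helical_minus_eq c0 E_c_helical[OF wc H2 abs_one t] E_c_helical[OF wc H2 abs_m t]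
      h[OF t] h[OF z] diss bal
    by (simp add: algebra_simps)
qed

end
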